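(* Let assumptions (A1)--(A4) hold and let $p\ge2$. There exist two constants $\delta_0>0$ and $C>0$ such that for all $y_0\in Y$ with $\|y_0\|_Y\le\delta_0$, the closed-loop system $$\frac{d}{dt}y=Ay+(Ny+B)\mathbf{u}_p(y),\qquad y(0)=y_0,$$ admits a unique solution $S(\mathbf{u}_p,y_0)\in W_\infty$ satisfying $\|S(\mathbf{u}_p,y_0)\|_{W_\infty}\le C\|y_0\|_Y$. Moreover, the mapping $y_0\mapsto S(\mathbf{u}_p,y_0)$, from the closed ball $\{y_0\in Y:\|y_0\|_Y\le\delta_0\}$ to $W_\infty$, is Lipschitz continuous.
   Context: Setting. $V\subset Y\subset V^*$ is a Gelfand triple of real Hilbert spaces with $V$ densely and compactly embedded in $Y$; $\langle\cdot,\cdot\rangle$ is the inner product of $Y$. $a\colon V\times V\to\mathbb{R}$ is a bounded bilinear form such that (A1): there are $\nu>0$, $\lambda\in\mathbb{R}$ with $a(v,v)\ge\nu\|v\|_V^2-\lambda\|v\|_Y^2$ for all $v\in V$. $A$ is the closed operator in $Y$ with $\mathcal{D}(A)=\{v\in V: w\mapsto a(v,w)\text{ is }Y\text{-continuous}\}$, $\langle Av,w\rangle=-a(v,w)$; its extension in $\mathcal{L}(V,V^* )$ is also denoted $A$. $B\in Y$, $\alpha>0$. (A2): $N\in\mathcal{L}(V,Y)\cap\mathcal{L}(\mathcal{D}(A),V)$ and $N^*\in\mathcal{L}(V,Y)$ ($\mathcal{D}(A)$ with graph norm; hence $N$ extends to $\mathcal{L}(Y,V^* )$). (A3): with $A_0=A-\lambda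 I$ if $\lambda>0$ and $A_0=A$ otherwise, $[\mathcal{D}(-A_0),Y]_{1/2}=[\mathcal{D}(-A_0^* ),Y]_{1/2}=V$ (real interpolation with indices $2,\tfrac12$). (A4): there is $F\in\mathcal{L}(Y,\mathbb{R})$ such that the semigroup $e^{(A+BF)t}$ is exponentially stable on $Y$. Multilinear forms. $B$ is identified with the operator $\mathbb{R}\to Y$, $B^*z=\langle B,z\rangle$. $\Pi\in\mathcal{L}(Y)$ is the unique nonnegative self-adjoint stabilizing solution of the Riccati equation $\langle Az_1,\Pi z_2\rangle+\langle\Pi z_1,Az_2\rangle+\langle z_1,z_2\rangle-\frac1\alpha(B^*\Pi z_1)(B^*\Pi z_2)=0$ for all $z_1,z_2\in\mathcal{D}(A)$; $A_\Pi=A-\frac1\alpha BB^*\Pi$ with domain $\mathcal{D}(A)$ generates an exponentially stable semigroup. $\mathrm{Sym}_{i,j}(\mathcal{T})(z_1,\dots,z_{i+j})=\binom{i+j}{i}^{-1}\sum_{\sigma\in S_{i,j}}\mathcal{T}(z_{\sigma(1)},\dots,z_{\sigma(i+j)})$, where $S_{i,j}$ is the set of permutations $\sigma$ of $\{1,\dots,i+j\}$ with $\sigma(1)<\dots<\sigma(i)$ and $\sigma(i+1)<\dots<\sigma(i+j)$; $(\mathcal{T}_1\otimes\mathcal{T}_2)(y_1,\dots,y_{k+\ell})=\mathcal{T}_1(y_1,\dots,y_k)\mathcal{T}_2(y_{k+1},\dots,y_{k+\ell})$; $y^{\otimes k}=(y,\dots,y)\in Y^k$. $(\mathcal{T}_k)_{k\ge2}$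 is the unique sequence of bounded symmetric multilinear forms $\mathcal{T}_k\colon Y^k\to\mathbb{R}$ with $\mathcal{T}_2(z_1,z_2)=\langle z_1,\Pi z_2\rangle$ and, for $k\ge3$ and $z_1,\dots,z_k\in\mathcal{D}(A)$, $\sum_{i=1}^k\mathcal{T}_k(z_1,\dots,z_{i-1},A_\Pi z_i,z_{i+1},\dots,z_k)=\frac1{2\alpha}\mathcal{R}_k(z_1,\dots,z_k)$, where $\mathcal{R}_k=2k(k-1)\mathrm{Sym}_{1,k-1}(\mathcal{C}_1\otimes\mathcal{G}_{k-1})+\sum_{i=2}^{k-2}\binom ki\mathrm{Sym}_{i,k-i}\big((\mathcal{C}_i+i\mathcal{G}_i)\otimes(\mathcal{C}_{k-i}+(k-i)\mathcal{G}_{k-i})\big)$, $\mathcal{C}_i(z_1,\dots,z_i)=\mathcal{T}_{i+1}(B,z_1,\dots,z_i)$, $\mathcal{G}_i(z_1,\dots,z_i)=\frac1i\sum_{j=1}^i\mathcal{T}_i(z_1,\dots,z_{j-1},Nz_j,z_{j+1},\dots,z_i)$. Feedback. $\mathcal{V}_p(y)=\sum_{k=2}^p\frac1{k!}\mathcal{T}_k(y^{\otimes k})$, and for $y\in V$, $\mathbf{u}_p(y)=-\frac1\alpha D\mathcal{V}_p(y)(Ny+B)=-\frac1\alpha\sum_{k=2}^p\frac1{(k-1)!}\mathcal{T}_k(Ny+B,y^{\otimes k-1})$. $W_\infty=\{y\in L^2(0,\infty;V):\frac{d}{dt}y\in L^2(0,\infty;V^* )\}$, with its natural norm. *)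

theory Defs
  imports "HOL-Analysis.Analysis"
begin

section \<open>Gelfand triple and operators\<close>

text \<open>
  The embedding of V into Y is a map j between two Hilbert space types, and the topological dual
  of V is the type of bounded linear functionals on V with the operator norm.
\<close>

definition gelfand_triple ::
  "('v::{real_inner,complete_space} \<Rightarrow>\<^sub>L 'y::{real_inner,complete_space}) \<Rightarrow> bool" where
  "gelfand_triple j \<longleftrightarrow>
     inj (blinfun_apply j) \<and>
     closure (range (blinfun_apply j)) = UNIV \<and>
     compact (closure (blinfun_apply j ` cball 0 1))"

definition to_dual :: "('v::real_inner \<Rightarrow>\<^sub>L 'y::real_inner) \<Rightarrow> 'y \<Rightarrow> ('v \<Rightarrow>\<^sub>L real)" where
  "to_dual j y = blinfun_inner_right y o\<^sub>L j"

definition op_dom ::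
  "('v::real_inner \<Rightarrow>\<^sub>L 'y::real_inner) \<Rightarrow> ('v \<Rightarrow> 'v \<Rightarrow> real) \<Rightarrow> 'v set" where
  "op_dom j a = {v. \<exists>M. \<forall>w. \<bar>a v w\<bar> \<le> M * norm (j w)}"

definition op_A ::
  "('v::real_inner \<Rightarrow>\<^sub>L 'y::real_inner) \<Rightarrow> ('v \<Rightarrow> 'v \<Rightarrow> real) \<Rightarrow> 'v \<Rightarrow> 'y" where
  "op_A j a v = (THE f. \<forall>w. f \<bullet> j w = - a v w)"

definition op_A_ext :: "('v::real_inner \<Rightarrow> 'v \<Rightarrow> real) \<Rightarrow> 'v \<Rightarrow> ('v \<Rightarrow>\<^sub>L real)" where
  "op_A_ext a v = Blinfun (\<lambda>w. - a v w)"

text \<open>Unbounded operators in Y are represented by their graphs.\<close>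

definition graph_on ::
  "('v::real_inner \<Rightarrow>\<^sub>L 'y::real_inner) \<Rightarrow> 'v set \<Rightarrow> ('v \<Rightarrow> 'y) \<Rightarrow> ('y \<times> 'y) set" where
  "graph_on j D f = {(j v, f v) | v. v \<in> D}"

definition adjoint_graph :: "('y::real_inner \<times> 'y) set \<Rightarrow> ('y \<times> 'y) set" where
  "adjoint_graph G = {(y, w). \<forall>(x, z)\<in>G. z \<bullet> y = x \<bullet> w}"

definition graph_norm :: "('y::real_inner \<times> 'y) set \<Rightarrow> 'y \<Rightarrow> real" where
  "graph_norm G x = norm (x, THE z. (x, z) \<in> G)"


section \<open>Semigroups\<close>

definition C0_semigroup :: "(real \<Rightarrow> ('y::real_normed_vector \<Rightarrow>\<^sub>L 'y)) \<Rightarrow> bool" where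
  "C0_semigroup S \<longleftrightarrow>
     S 0 = id_blinfun \<and>
     (\<forall>s\<ge>0. \<forall>t\<ge>0. S (s + t) = S s o\<^sub>L S t) \<and>
     (\<forall>x. ((\<lambda>t. S t x) \<longlongrightarrow> x) (at_right 0))"

definition generator_graph :: "(real \<Rightarrow> ('y::real_normed_vector \<Rightarrow>\<^sub>L 'y)) \<Rightarrow> ('y \<times> 'y) set" where
  "generator_graph S = {(x, z). ((\<lambda>h. (S h x - x) /\<^sub>R h) \<longlongrightarrow> z) (at_right 0)}"

definition exp_stable :: "(real \<Rightarrow> ('y::real_normed_vector \<Rightarrow>\<^sub>L 'y)) \<Rightarrow> bool" where
  "exp_stable S \<longleftrightarrow> (\<exists>M \<omega>. \<omega> > 0 \<and> (\<forall>t\<ge>0. norm (S t) \<le> M * exp (- \<omega> * t)))"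

definition generates_exp_stable_semigroup :: "('y::real_normed_vector \<times> 'y) set \<Rightarrow> bool" where
  "generates_exp_stable_semigroup G \<longleftrightarrow>
     (\<exists>S. C0_semigroup S \<and> generator_graph S = G \<and> exp_stable S)"


section \<open>Real interpolation\<close>

text \<open>
  The K-method for a couple of normed spaces, given as subspaces X and Z of a common vector space
  with norms nX and nZ; the second interpolation index is 2.
\<close>

definition K_functional ::
  "'y::real_vector set \<Rightarrow> ('y \<Rightarrow> real) \<Rightarrow> 'y set \<Rightarrow> ('y \<Rightarrow> real) \<Rightarrow> real \<Rightarrow> 'y \<Rightarrow> real" where
  "K_functional X nX Z nZ t x = Inf {nX u + t * nZ w | u w. u \<in> X \<and> w \<in> Z \<and> x = u + w}"

definition interp_energy ::
  "'y::real_vector set \<Rightarrow> ('y \<Rightarrow> real) \<Rightarrow> 'y set \<Rightarrow> ('y \<Rightarrow> real) \<Rightarrow> real \<Rightarrow> 'y \<Rightarrow> ennreal" where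
  "interp_energy X nX Z nZ \<theta> x =
     (\<integral>\<^sup>+ t\<in>{0<..}. ennreal ((t powr (- \<theta>) * K_functional X nX Z nZ t x)\<^sup>2 / t) \<partial>lborel)"

definition interp_space ::
  "'y::real_vector set \<Rightarrow> ('y \<Rightarrow> real) \<Rightarrow> 'y set \<Rightarrow> ('y \<Rightarrow> real) \<Rightarrow> real \<Rightarrow> 'y set" where
  "interp_space X nX Z nZ \<theta> =
     {x. (\<exists>u\<in>X. \<exists>w\<in>Z. x = u + w) \<and> interp_energy X nX Z nZ \<theta> x < \<infinity>}"

definition interp_norm ::
  "'y::real_vector set \<Rightarrow> ('y \<Rightarrow> real) \<Rightarrow> 'y set \<Rightarrow> ('y \<Rightarrow> real) \<Rightarrow> real \<Rightarrow> 'y \<Rightarrow> real" where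
  "interp_norm X nX Z nZ \<theta> x = sqrt (enn2real (interp_energy X nX Z nZ \<theta> x))"

text \<open>Equality of the interpolation space with V is understood up to equivalence of norms.\<close>

definition interp_half_dom_eq ::
  "('v::real_inner \<Rightarrow>\<^sub>L 'y::real_inner) \<Rightarrow> ('y \<times> 'y) set \<Rightarrow> bool" where
  "interp_half_dom_eq j G \<longleftrightarrow>
     interp_space (Domain G) (graph_norm G) UNIV norm (1/2) = range (blinfun_apply j) \<and>
     (\<exists>c>0. \<exists>C. \<forall>v.
        c * norm v \<le> interp_norm (Domain G) (graph_norm G) UNIV norm (1/2) (j v) \<and>
        interp_norm (Domain G) (graph_norm G) UNIV norm (1/2) (j v) \<le> C * norm v)"


section \<open>Standing assumptions\<close>

definition assumption_A1 ::
  "('v::real_inner \<Rightarrow>\<^sub>L 'y::real_inner) \<Rightarrow> ('v \<Rightarrow> 'v \<Rightarrow> real) \<Rightarrow> real \<Rightarrow> real \<Rightarrow> bool" where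
  "assumption_A1 j a \<nu> lam \<longleftrightarrow>
     \<nu> > 0 \<and> (\<forall>v. a v v \<ge> \<nu> * (norm v)\<^sup>2 - lam * (norm (j v))\<^sup>2)"

definition assumption_A2 ::
  "('v::real_inner \<Rightarrow>\<^sub>L 'y::real_inner) \<Rightarrow> ('v \<Rightarrow> 'v \<Rightarrow> real) \<Rightarrow> ('v \<Rightarrow>\<^sub>L 'y) \<Rightarrow> bool" where
  "assumption_A2 j a N \<longleftrightarrow>
     (\<exists>M. \<forall>v\<in>op_dom j a. \<exists>w. j w = N v \<and> norm w \<le> M * norm (j v, op_A j a v)) \<and>
     (\<exists>N' :: 'v \<Rightarrow>\<^sub>L 'y. \<forall>v w. N v \<bullet> j w = j v \<bullet> N' w)"

definition minus_A0_graph ::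
  "('v::real_inner \<Rightarrow>\<^sub>L 'y::real_inner) \<Rightarrow> ('v \<Rightarrow> 'v \<Rightarrow> real) \<Rightarrow> real \<Rightarrow> ('y \<times> 'y) set" where
  "minus_A0_graph j a lam =
     graph_on j (op_dom j a)
       (\<lambda>v. - (if lam > 0 then op_A j a v - lam *\<^sub>R j v else op_A j a v))"

definition assumption_A3 ::
  "('v::real_inner \<Rightarrow>\<^sub>L 'y::real_inner) \<Rightarrow> ('v \<Rightarrow> 'v \<Rightarrow> real) \<Rightarrow> real \<Rightarrow> bool" where
  "assumption_A3 j a lam \<longleftrightarrow>
     interp_half_dom_eq j (minus_A0_graph j a lam) \<and>
     interp_half_dom_eq j (adjoint_graph (minus_A0_graph j a lam))"

definition assumption_A4 ::
  "('v::real_inner \<Rightarrow>\<^sub>L 'y::real_inner) \<Rightarrow> ('v \<Rightarrow> 'v \<Rightarrow> real) \<Rightarrow> 'y \<Rightarrow> bool" where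
  "assumption_A4 j a B \<longleftrightarrow>
     (\<exists>F :: 'y \<Rightarrow>\<^sub>L real.
        generates_exp_stable_semigroup
          (graph_on j (op_dom j a) (\<lambda>v. op_A j a v + F (j v) *\<^sub>R B)))"


section \<open>Riccati equation\<close>

definition op_A_Pi ::
  "('v::real_inner \<Rightarrow>\<^sub>L 'y::real_inner) \<Rightarrow> ('v \<Rightarrow> 'v \<Rightarrow> real) \<Rightarrow> 'y \<Rightarrow> real \<Rightarrow> ('y \<Rightarrow>\<^sub>L 'y) \<Rightarrow> 'v \<Rightarrow> 'y" where
  "op_A_Pi j a B \<alpha> P v = op_A j a v - ((1/\<alpha>) * (B \<bullet> P (j v))) *\<^sub>R B"

definition stabilizing_riccati_solution ::
  "('v::real_inner \<Rightarrow>\<^sub>L 'y::real_inner) \<Rightarrow> ('v \<Rightarrow> 'v \<Rightarrow> real) \<Rightarrow> 'y \<Rightarrow> real \<Rightarrow> ('y \<Rightarrow>\<^sub>L 'y) \<Rightarrow> bool" where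
  "stabilizing_riccati_solution j a B \<alpha> P \<longleftrightarrow>
     (\<forall>x y. P x \<bullet> y = x \<bullet> P y) \<and>
     (\<forall>x. 0 \<le> x \<bullet> P x) \<and>
     (\<forall>z1\<in>op_dom j a. \<forall>z2\<in>op_dom j a.
        op_A j a z1 \<bullet> P (j z2) + P (j z1) \<bullet> op_A j a z2 + j z1 \<bullet> j z2
          - (1/\<alpha>) * (B \<bullet> P (j z1)) * (B \<bullet> P (j z2)) = 0) \<and>
     generates_exp_stable_semigroup (graph_on j (op_dom j a) (op_A_Pi j a B \<alpha> P))"


section \<open>Multilinear forms\<close>

text \<open>
  A form of order k is a function on lists, of which only the values at lists of length k matter.
  List positions, and hence the permuted indices, start at 0.
\<close>

definition bounded_multilinear_form :: "nat \<Rightarrow> ('y::real_normed_vector list \<Rightarrow> real) \<Rightarrow> bool" where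
  "bounded_multilinear_form k T \<longleftrightarrow>
     (\<forall>zs i. length zs = k \<longrightarrow> i < k \<longrightarrow> linear (\<lambda>x. T (zs[i := x]))) \<and>
     (\<exists>M. \<forall>zs. length zs = k \<longrightarrow> \<bar>T zs\<bar> \<le> M * prod_list (map norm zs))"

definition symmetric_form :: "nat \<Rightarrow> ('y list \<Rightarrow> real) \<Rightarrow> bool" where
  "symmetric_form k T \<longleftrightarrow>
     (\<forall>zs \<sigma>. length zs = k \<longrightarrow> \<sigma> permutes {..<k} \<longrightarrow> T (permute_list \<sigma> zs) = T zs)"

definition shuffle_perms :: "nat \<Rightarrow> nat \<Rightarrow> (nat \<Rightarrow> nat) set" where
  "shuffle_perms i j =
     {\<sigma>. \<sigma> permutes {..<i+j} \<and> strict_mono_on {..<i} \<sigma> \<and> strict_mono_on {i..<i+j} \<sigma>}"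

definition Sym :: "nat \<Rightarrow> nat \<Rightarrow> ('x list \<Rightarrow> real) \<Rightarrow> 'x list \<Rightarrow> real" where
  "Sym i j T zs =
     (1 / real ((i + j) choose i)) * (\<Sum>\<sigma>\<in>shuffle_perms i j. T (permute_list \<sigma> zs))"

text \<open>Here k is the order of the first factor.\<close>

definition tensor :: "nat \<Rightarrow> ('x list \<Rightarrow> real) \<Rightarrow> ('x list \<Rightarrow> real) \<Rightarrow> 'x list \<Rightarrow> real" where
  "tensor k T1 T2 zs = T1 (take k zs) * T2 (drop k zs)"

text \<open>
  The forms below involve N, which is defined on V, so their arguments are lists of elements of V.
\<close>

definition form_C ::
  "('v::real_inner \<Rightarrow>\<^sub>L 'y::real_inner) \<Rightarrow> 'y \<Rightarrow> (nat \<Rightarrow> 'y list \<Rightarrow> real) \<Rightarrow> nat \<Rightarrow> 'v list \<Rightarrow> real" where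
  "form_C j B T i zs = T (i + 1) (B # map j zs)"

definition form_G ::
  "('v::real_inner \<Rightarrow>\<^sub>L 'y::real_inner) \<Rightarrow> ('v \<Rightarrow>\<^sub>L 'y) \<Rightarrow> (nat \<Rightarrow> 'y list \<Rightarrow> real) \<Rightarrow> nat \<Rightarrow> 'v list \<Rightarrow> real" where
  "form_G j N T i zs = (1 / real i) * (\<Sum>l<i. T i ((map j zs)[l := N (zs ! l)]))"

definition form_R ::
  "('v::real_inner \<Rightarrow>\<^sub>L 'y::real_inner) \<Rightarrow> ('v \<Rightarrow>\<^sub>L 'y) \<Rightarrow> 'y \<Rightarrow> (nat \<Rightarrow> 'y list \<Rightarrow> real) \<Rightarrow> nat \<Rightarrow> 'v list \<Rightarrow> real" where
  "form_R j N B T k zs =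
     2 * real k * real (k - 1) *
       Sym 1 (k - 1) (tensor 1 (form_C j B T 1) (form_G j N T (k - 1))) zs
     + (\<Sum>i\<in>{2..k-2}. real (k choose i) *
          Sym i (k - i)
            (tensor i (\<lambda>xs. form_C j B T i xs + real i * form_G j N T i xs)
                      (\<lambda>xs. form_C j B T (k - i) xs + real (k - i) * form_G j N T (k - i) xs)) zs)"

definition value_expansion_forms ::
  "('v::real_inner \<Rightarrow>\<^sub>L 'y::real_inner) \<Rightarrow> ('v \<Rightarrow> 'v \<Rightarrow> real) \<Rightarrow> ('v \<Rightarrow>\<^sub>L 'y) \<Rightarrow> 'y \<Rightarrow> real \<Rightarrow>
     ('y \<Rightarrow>\<^sub>L 'y) \<Rightarrow> (nat \<Rightarrow> 'y list \<Rightarrow> real) \<Rightarrow> bool" where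
  "value_expansion_forms j a N B \<alpha> P T \<longleftrightarrow>
     (\<forall>k\<ge>2. bounded_multilinear_form k (T k) \<and> symmetric_form k (T k)) \<and>
     (\<forall>z1 z2. T 2 [z1, z2] = z1 \<bullet> P z2) \<and>
     (\<forall>k\<ge>3. \<forall>zs. length zs = k \<longrightarrow> set zs \<subseteq> op_dom j a \<longrightarrow>
        (\<Sum>i<k. T k ((map j zs)[i := op_A_Pi j a B \<alpha> P (zs ! i)])) =
          (1 / (2 * \<alpha>)) * form_R j N B T k zs)"


section \<open>Feedback law\<close>

definition value_poly :: "(nat \<Rightarrow> 'y list \<Rightarrow> real) \<Rightarrow> nat \<Rightarrow> 'y \<Rightarrow> real" where
  "value_poly T p y = (\<Sum>k=2..p. (1 / fact k) * T k (replicate k y))"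

definition feedback ::
  "('v::real_inner \<Rightarrow>\<^sub>L 'y::real_inner) \<Rightarrow> ('v \<Rightarrow>\<^sub>L 'y) \<Rightarrow> 'y \<Rightarrow> real \<Rightarrow> (nat \<Rightarrow> 'y list \<Rightarrow> real) \<Rightarrow>
     nat \<Rightarrow> 'v \<Rightarrow> real" where
  "feedback j N B \<alpha> T p v =
     - (1/\<alpha>) * frechet_derivative (value_poly T p) (at (j v)) (N v + B)"


section \<open>The space of trajectories and the closed-loop system\<close>

abbreviation half_line :: "real measure" where
  "half_line \<equiv> lebesgue_on {0<..}"

text \<open>Bochner (strong) measurability; no separability of the target type is required.\<close>

definition strongly_measurable :: "'t measure \<Rightarrow> ('t \<Rightarrow> 'x::topological_space) \<Rightarrow> bool" where
  "strongly_measurable M f \<longleftrightarrow>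
     (\<exists>s. (\<forall>n::nat. simple_function M (s n)) \<and> (AE t in M. (\<lambda>n. s n t) \<longlonglongrightarrow> f t))"

definition in_L2 :: "(real \<Rightarrow> 'x::real_normed_vector) \<Rightarrow> bool" where
  "in_L2 f \<longleftrightarrow> strongly_measurable half_line f \<and> integrable half_line (\<lambda>t. (norm (f t))\<^sup>2)"

definition L2_norm :: "(real \<Rightarrow> 'x::real_normed_vector) \<Rightarrow> real" where
  "L2_norm f = sqrt (LINT t|half_line. (norm (f t))\<^sup>2)"

definition test_function :: "(real \<Rightarrow> real) \<Rightarrow> bool" where
  "test_function \<phi> \<longleftrightarrow>
     (\<forall>n x. (deriv ^^ n) \<phi> field_differentiable at x) \<and>
     (\<exists>a b. 0 < a \<and> a < b \<and> (\<forall>x. x \<notin> {a..b} \<longrightarrow> \<phi> x = 0))"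

text \<open>
  The distributional derivative on the open half line, with values in the dual of V. The identity
  between Bochner integrals in the dual of V is written out by evaluating both sides at each w.
\<close>

definition has_weak_derivative ::
  "('v::real_inner \<Rightarrow>\<^sub>L 'y::real_inner) \<Rightarrow> (real \<Rightarrow> 'v) \<Rightarrow> (real \<Rightarrow> ('v \<Rightarrow>\<^sub>L real)) \<Rightarrow> bool" where
  "has_weak_derivative j y g \<longleftrightarrow>
     (\<forall>\<phi> w. test_function \<phi> \<longrightarrow>
        (LINT t|half_line. deriv \<phi> t * to_dual j (j (y t)) w) =
        - (LINT t|half_line. \<phi> t * g t w))"

definition in_W_inf :: "('v::real_inner \<Rightarrow>\<^sub>L 'y::real_inner) \<Rightarrow> (real \<Rightarrow> 'v) \<Rightarrow> bool" where
  "in_W_inf j y \<longleftrightarrow> in_L2 y \<and> (\<exists>g. in_L2 g \<and> has_weak_derivative j y g)"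

text \<open>The weak derivative is determined up to a null set, so the choice is immaterial below.\<close>

definition weak_derivative ::
  "('v::real_inner \<Rightarrow>\<^sub>L 'y::real_inner) \<Rightarrow> (real \<Rightarrow> 'v) \<Rightarrow> real \<Rightarrow> ('v \<Rightarrow>\<^sub>L real)" where
  "weak_derivative j y = (SOME g. in_L2 g \<and> has_weak_derivative j y g)"

definition W_inf_norm :: "('v::real_inner \<Rightarrow>\<^sub>L 'y::real_inner) \<Rightarrow> (real \<Rightarrow> 'v) \<Rightarrow> real" where
  "W_inf_norm j y = sqrt ((L2_norm y)\<^sup>2 + (L2_norm (weak_derivative j y))\<^sup>2)"

text \<open>
  Trajectories are representatives of equivalence classes modulo null sets, so the initial value
  is that of the representative that is continuous on the closed half line with values in Y.
\<close>

definition has_initial_value ::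
  "('v::real_inner \<Rightarrow>\<^sub>L 'y::real_inner) \<Rightarrow> (real \<Rightarrow> 'v) \<Rightarrow> 'y \<Rightarrow> bool" where
  "has_initial_value j y y0 \<longleftrightarrow>
     (\<exists>c. continuous_on {0..} c \<and> (AE t in half_line. c t = j (y t)) \<and> c 0 = y0)"

definition closed_loop_solution ::
  "('v::real_inner \<Rightarrow>\<^sub>L 'y::real_inner) \<Rightarrow> ('v \<Rightarrow> 'v \<Rightarrow> real) \<Rightarrow> ('v \<Rightarrow>\<^sub>L 'y) \<Rightarrow> 'y \<Rightarrow>
     ('v \<Rightarrow> real) \<Rightarrow> 'y \<Rightarrow> (real \<Rightarrow> 'v) \<Rightarrow> bool" where
  "closed_loop_solution j a N B u y0 y \<longleftrightarrow>
     in_W_inf j y \<and>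
     (AE t in half_line.
        weak_derivative j y t = op_A_ext a (y t) + to_dual j (u (y t) *\<^sub>R (N (y t) + B))) \<and>
     has_initial_value j y y0"

end

theory Submission
  imports Defs
begin

text \<open>
  With the form b of the negative of A_Pi, the closed-loop system reads y' = A_Pi y + F(y), where F
  collects the terms of degree at least two. The Riccati equation makes the quadratic form of Pi a
  Lyapunov function; together with the coercivity of a it bounds weak solutions of the linear
  problem in L2(V) and in the supremum norm of Y by the initial value and the L1(Y) norm of the
  forcing. For step function forcing, solutions are found from the exponentially stable semigroup,
  and the general case follows by density. Since F is quadratic in the V norm, it maps L2(V) to
  L1(Y) with a small Lipschitz constant on small balls, and the contraction principle applies. The
  adjoint of N shows that F is linear in the V norm when measured in the dual of V, which bounds
  the derivative. Uniqueness follows from the energy identity and Gronwall's inequality.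
\<close>

section \<open>Strong measurability and square integrability\<close>

text \<open>The obstacle is the product of the control with N y. Both factors are of order the V
  norm, so for y in L2(V) the product is merely integrable in time with values in Y. The estimate in
  the dual of V is square integrable but carries no small factor: it yields the derivative, not a
  contraction. Hence the linear theory must accept forcing in L1(Y) and return exactly the two norms
  in which F is a contraction near 0, the supremum norm of Y and the L2 norm of V. The form b is
  coercive only up to a multiple of the Y norm, so the energy inequality alone allows growth in T;
  the time integral supplied by the Lyapunov inequality removes this and makes all bounds global in
  time. That inequality holds only where A_Pi u lies in Y, so it cannot be tested with a weak
  solution and is applied to resolvents of it. Uniqueness is asserted among all solutions in W_inf,
  large ones included, and therefore does not follow from the contraction.\<close>

lemma complete_measure_half_line: "complete_measure half_line"
proof
  fix A B :: "real set"
  assume "B \<subseteq> A" "A \<in> null_sets half_line"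
  then have "A \<subseteq> {0<..}" "A \<in> null_sets lebesgue"
    by (auto simp: null_sets_restrict_space)
  then have "B \<in> null_sets lebesgue"
    using \<open>B \<subseteq> A\<close> completion.complete2 by blast
  then show "B \<in> sets half_line"
    using \<open>B \<subseteq> A\<close> \<open>A \<subseteq> {0<..}\<close> by (auto simp: sets_restrict_space_iff)
qed

text \<open>Strong measurability sees functions only up to null sets, so measurability of real
  functions must survive changes on null sets. Completeness of \<open>half_line\<close> provides
  this.\<close>

lemma half_line_measurable_AE_eq:
  fixes f g :: "real \<Rightarrow> real"
  assumes f: "f \<in> borel_measurable half_line" and ae: "AE t in half_line. f t = g t"
  shows "g \<in> borel_measurable half_line"
  unfolding borel_measurable_iff_less
proof
  fix a
  have "{t \<in> space half_line. f t < a} \<in> sets half_line"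
    using f by measurable
  then show "{t \<in> space half_line. g t < a} \<in> sets half_line"
    using complete_measure.in_sets_AE[OF complete_measure_half_line] ae
    by (rule_tac complete_measure.in_sets_AE[OF complete_measure_half_line, where A = "{t \<in> space half_line. f t < a}"])
       (auto elim!: eventually_mono)
qed

lemma half_line_measurable_AE_limit:
  fixes f :: "nat \<Rightarrow> real \<Rightarrow> real"
  assumes f: "\<And>n. f n \<in> borel_measurable half_line"
    and lim: "AE t in half_line. (\<lambda>n. f n t) \<longlonglongrightarrow> g t"
  shows "g \<in> borel_measurable half_line"
proof (rule half_line_measurable_AE_eq)
  show "(\<lambda>t. lim (\<lambda>n. f n t)) \<in> borel_measurable half_line"
    using f by (rule borel_measurable_lim_metric)
  show "AE t in half_line. lim (\<lambda>n. f n t) = g t"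
    using lim by eventually_elim (rule limI)
qed

lemma strongly_measurable_compose:
  fixes g :: "'x::t2_space \<Rightarrow> 'z::topological_space"
  assumes "strongly_measurable M f" and g: "continuous_on UNIV g"
  shows "strongly_measurable M (\<lambda>t. g (f t))"
proof -
  obtain s where s: "\<And>n::nat. simple_function M (s n)" "AE t in M. (\<lambda>n. s n t) \<longlonglongrightarrow> f t"
    using assms(1) by (auto simp: strongly_measurable_def)
  have "AE t in M. (\<lambda>n. g (s n t)) \<longlonglongrightarrow> g (f t)"
    using s(2)
  proof eventually_elim
    case (elim t)
    then show ?case using g
      by (intro isCont_tendsto_compose[of _ g]) (auto simp: continuous_on_eq_continuous_at)
  qed
  then show ?thesis
    unfolding strongly_measurable_def using s(1)
    by (intro exI[of _ "\<lambda>n t. g (s n t)"]) (auto intro: simple_function_compose1)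
qed

lemma strongly_measurable_Pair:
  assumes "strongly_measurable M f" and "strongly_measurable M g"
  shows "strongly_measurable M (\<lambda>t. (f t, g t))"
proof -
  obtain s where s: "\<And>n::nat. simple_function M (s n)" "AE t in M. (\<lambda>n. s n t) \<longlonglongrightarrow> f t"
    using assms(1) by (auto simp: strongly_measurable_def)
  obtain r where r: "\<And>n::nat. simple_function M (r n)" "AE t in M. (\<lambda>n. r n t) \<longlonglongrightarrow> g t"
    using assms(2) by (auto simp: strongly_measurable_def)
  have "AE t in M. (\<lambda>n. (s n t, r n t)) \<longlonglongrightarrow> (f t, g t)"
    using s(2) r(2) by eventually_elim (rule tendsto_Pair)
  then show ?thesis
    unfolding strongly_measurable_def using s(1) r(1) 
    by (intro exI[of _ "\<lambda>n t. (s n t, r n t)"]) auto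
qed

lemma strongly_measurable_compose2:
  fixes h :: "'x::t2_space \<Rightarrow> 'y::t2_space \<Rightarrow> 'z::topological_space"
  assumes "strongly_measurable M f" and "strongly_measurable M g"
    and "continuous_on UNIV (\<lambda>x. h (fst x) (snd x))"
  shows "strongly_measurable M (\<lambda>t. h (f t) (g t))"
  using strongly_measurable_compose[OF strongly_measurable_Pair[OF assms(1,2)] assms(3)] by simp

lemma strongly_measurable_add:
  fixes f g :: "'t \<Rightarrow> 'x::real_normed_vector"
  shows "strongly_measurable M f \<Longrightarrow> strongly_measurable M g \<Longrightarrow> strongly_measurable M (\<lambda>t. f t + g t)"
  by (rule strongly_measurable_compose2[where h = "(+)"]) (auto intro!: continuous_intros)

lemma strongly_measurable_diff:
  fixes f g :: "'t \<Rightarrow> 'x::real_normed_vector"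
  shows "strongly_measurable M f \<Longrightarrow> strongly_measurable M g \<Longrightarrow> strongly_measurable M (\<lambda>t. f t - g t)"
  by (rule strongly_measurable_compose2[where h = "(-)"]) (auto intro!: continuous_intros)

lemma strongly_measurable_scaleR:
  fixes f :: "'t \<Rightarrow> 'x::real_normed_vector"
  shows "strongly_measurable M r \<Longrightarrow> strongly_measurable M f \<Longrightarrow> strongly_measurable M (\<lambda>t. r t *\<^sub>R f t)"
  by (rule strongly_measurable_compose2[where h = "scaleR"]) (auto intro!: continuous_intros)

lemma strongly_measurable_const [simp]: "strongly_measurable M (\<lambda>_. x)"
  unfolding strongly_measurable_def by (rule exI[of _ "\<lambda>_ _. x"]) auto

lemma strongly_measurable_real:
  fixes f :: "real \<Rightarrow> real"
  assumes "strongly_measurable half_line f"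
  shows "f \<in> borel_measurable half_line"
proof -
  obtain s where s: "\<And>n::nat. simple_function half_line (s n)" "AE t in half_line. (\<lambda>n. s n t) \<longlonglongrightarrow> f t"
    using assms by (auto simp: strongly_measurable_def)
  then show ?thesis
    using half_line_measurable_AE_limit[OF borel_measurable_simple_function] by blast
qed

lemma strongly_measurable_of_real_measurable:
  fixes f :: "'t \<Rightarrow> real"
  assumes "f \<in> borel_measurable M"
  shows "strongly_measurable M f"
proof -
  obtain s where "\<And>i. simple_function M (s i)" "\<And>x. x \<in> space M \<Longrightarrow> (\<lambda>i. s i x) \<longlonglongrightarrow> f x"
    using borel_measurable_implies_sequence_metric[OF assms, of 0] by blast
  then show ?thesis
    unfolding strongly_measurable_def by (intro exI[of _ s]) (auto intro!: AE_I2)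
qed

lemma strongly_measurable_norm:
  fixes f :: "real \<Rightarrow> 'x::real_normed_vector"
  shows "strongly_measurable half_line f \<Longrightarrow> (\<lambda>t. norm (f t)) \<in> borel_measurable half_line"
  by (intro strongly_measurable_real strongly_measurable_compose[where g = norm] continuous_intros)

lemma strongly_measurable_dist:
  fixes f :: "real \<Rightarrow> 'x::metric_space"
  shows "strongly_measurable half_line f \<Longrightarrow> (\<lambda>t. dist (f t) x) \<in> borel_measurable half_line"
  by (intro strongly_measurable_real strongly_measurable_compose[where g = "\<lambda>y. dist y x"] continuous_intros)

text \<open>The finitely many values of each approximating simple function together form the
  countable set. With the converse below this is a metric version of Pettis' theorem: an essentially
  separable range plus measurable distance functions.\<close>

lemma strongly_measurable_essentially_separable:
  assumes "strongly_measurable half_line f"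
  shows "\<exists>D. countable D \<and> (AE t in half_line. f t \<in> closure D)"
proof -
  obtain s where s: "\<And>n::nat. simple_function half_line (s n)" "AE t in half_line. (\<lambda>n. s n t) \<longlonglongrightarrow> f t"
    using assms by (auto simp: strongly_measurable_def)
  define D where "D = (\<Union>n. s n ` {0<..})"
  have "countable D"
    unfolding D_def using simple_functionD(1)[OF s(1)] by (simp add: countable_finite)
  moreover have "AE t in half_line. t \<in> {0<..}" by (rule AE_I2) auto
  with s(2) have "AE t in half_line. f t \<in> closure D"
  proof eventually_elim
    case (elim t)
    then have "\<forall>n. s n t \<in> D" by (auto simp: D_def)
    then have "\<And>n. s n t \<in> closure D" using closure_subset[of D] by blast
    then show ?case using elim(1) by (rule closed_sequentially[OF closed_closure])
  qed
  ultimately show ?thesis by blast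
qed

text \<open>
  The approximating simple functions take the nearest among the first n points of D.
\<close>

lemma strongly_measurableI_separable:
  fixes f :: "real \<Rightarrow> 'x::metric_space"
  assumes D: "countable D" "AE t in half_line. f t \<in> closure D"
    and meas: "\<And>x. x \<in> D \<Longrightarrow> (\<lambda>t. dist (f t) x) \<in> borel_measurable half_line"
  shows "strongly_measurable half_line f"
proof (cases "D = {}")
  case True
  \<comment> \<open>The closure of the empty set is empty, so the hypothesis makes almost every t
    contradictory and any constant sequence serves.\<close>
  then have "AE t in half_line. (\<lambda>n. undefined) \<longlonglongrightarrow> f t" using D(2) by auto
  then show ?thesis unfolding strongly_measurable_def
    by (intro exI[of _ "\<lambda>_ _. undefined"]) auto
next
  case False
  define d where "d = from_nat_into D"
  have dD: "\<And>i. d i \<in> D" and rd: "range d = D"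
    using False D(1) by (auto simp: d_def from_nat_into range_from_nat_into)
  have [measurable]: "\<And>i. (\<lambda>t. dist (f t) (d i)) \<in> borel_measurable half_line"
    using meas dD by auto
  \<comment> \<open>Taking the least index among the nearest points breaks ties measurably in
    t.\<close>
  define I where "I n t = (LEAST i. i \<le> n \<and> (\<forall>k\<in>{..n}. dist (f t) (d i) \<le> dist (f t) (d k)))" for n t
  have I: "I n t \<le> n \<and> (\<forall>k\<in>{..n}. dist (f t) (d (I n t)) \<le> dist (f t) (d k))" for n t
  proof -
    have "Min ((\<lambda>i. dist (f t) (d i)) ` {..n}) \<in> (\<lambda>i. dist (f t) (d i)) ` {..n}"
      by (rule Min_in) auto
    then obtain i where i: "i \<le> n" "dist (f t) (d i) = Min ((\<lambda>i. dist (f t) (d i)) ` {..n})" by (smt (verit) imageE atMost_iff)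
    then have "\<forall>k\<in>{..n}. dist (f t) (d i) \<le> dist (f t) (d k)" by auto
    then show ?thesis unfolding I_def using i(1) 
      by (intro LeastI[of "\<lambda>i. i \<le> n \<and> (\<forall>k\<in>{..n}. dist (f t) (d i) \<le> dist (f t) (d k))" i]) auto
  qed
  have "simple_function half_line (I n)" for n
    unfolding simple_function_eq_measurable
  proof
    have "I n ` space half_line \<subseteq> {..n}" using I by auto
    then show "finite (I n ` space half_line)" by (rule finite_subset) auto
    show "I n \<in> measurable half_line (count_space UNIV)"
      unfolding I_def by measurable
  qed
  then have "simple_function half_line (\<lambda>t. d (I n t))" for n
    by (rule simple_function_compose1)
  moreover have "AE t in half_line. (\<lambda>n. d (I n t)) \<longlonglongrightarrow> f t"
    using D(2)
  proof eventually_elim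
    case (elim t)
    show ?case
    proof (rule metric_LIMSEQ_I)
      fix e :: real assume "e > 0"
      then obtain y where "y \<in> D" "dist y (f t) < e" using elim by (auto simp: closure_approachable)
      then obtain k where k: "dist (d k) (f t) < e" using rd by auto
      have "dist (d (I n t)) (f t) < e" if "n \<ge> k" for n
        using I[of n t] that k by (force simp: dist_commute)
      then show "\<exists>no. \<forall>n\<ge>no. dist (d (I n t)) (f t) < e" by blast
    qed
  qed
  ultimately show ?thesis unfolding strongly_measurable_def by (intro exI[of _ "\<lambda>n t. d (I n t)"]) auto
qed

text \<open>The separability criterion avoids a diagonal choice among the simple functions
  approximating the single \<open>f n\<close>: countable sets are united, and distances to a fixed
  point pass to the limit as real functions.\<close>

lemma strongly_measurable_AE_limit:
  fixes f :: "nat \<Rightarrow> real \<Rightarrow> 'x::metric_space"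
  assumes f: "\<And>n. strongly_measurable half_line (f n)"
    and lim: "AE t in half_line. (\<lambda>n. f n t) \<longlonglongrightarrow> g t"
  shows "strongly_measurable half_line g"
proof -
  obtain D where D: "\<And>n. countable (D n)" "\<And>n. AE t in half_line. f n t \<in> closure (D n)"
    using strongly_measurable_essentially_separable[OF f] by metis
  show ?thesis
  proof (rule strongly_measurableI_separable)
    show "countable (\<Union>n. D n)" using D(1) by auto
    have "AE t in half_line. \<forall>n. f n t \<in> closure (D n)" using D(2) by (simp add: AE_all_countable)
    with lim show "AE t in half_line. g t \<in> closure (\<Union>n. D n)"
    proof eventually_elim
      case (elim t)
      have "f n t \<in> closure (\<Union>n. D n)" for n
        using elim(2) closure_mono[of "D n" "\<Union>n. D n"] by auto
      then show ?case using elim(1) by (rule closed_sequentially[OF closed_closure])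
    qed
    fix x
    have "AE t in half_line. (\<lambda>n. dist (f n t) x) \<longlonglongrightarrow> dist (g t) x"
      using lim by eventually_elim (intro tendsto_intros)
    then show "(\<lambda>t. dist (g t) x) \<in> borel_measurable half_line"
      by (rule half_line_measurable_AE_limit[OF strongly_measurable_dist[OF f]])
  qed
qed

lemma strongly_measurable_AE_eq:
  assumes "strongly_measurable M f" "AE t in M. f t = g t"
  shows "strongly_measurable M g"
proof -
  obtain s where s: "\<And>n::nat. simple_function M (s n)" "AE t in M. (\<lambda>n. s n t) \<longlonglongrightarrow> f t"
    using assms by (auto simp: strongly_measurable_def)
  have "AE t in M. (\<lambda>n. s n t) \<longlonglongrightarrow> g t" using s(2) assms(2) by eventually_elim auto
  then show ?thesis using s(1) by (auto simp: strongly_measurable_def)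
qed

text \<open>The values at positive rational times are countable and, by continuity, dense in the
  range.\<close>

lemma strongly_measurable_continuous:
  fixes f :: "real \<Rightarrow> 'x::metric_space"
  assumes c: "continuous_on {0..} f"
  shows "strongly_measurable half_line f"
proof (rule strongly_measurableI_separable)
  have c': "continuous_on {0<..} f" using c by (rule continuous_on_subset) auto
  let ?D = "f ` (\<rat> \<inter> {0<..})"
  show "countable ?D" by (auto simp: countable_rat intro: countable_subset)
  have "f t \<in> closure ?D" if "t > 0" for t
  proof -
    have "\<exists>q. q \<in> \<rat> \<and> t < q \<and> q < t + 1 / real (Suc n)" for n
      using Rats_dense_in_real[of t "t + 1 / real (Suc n)"] by auto
    then obtain q where q: "\<And>n. q n \<in> \<rat>" "\<And>n. t < q n" "\<And>n. q n < t + 1 / real (Suc n)"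
      by metis
    have "q \<longlonglongrightarrow> t"
    proof (rule tendsto_sandwich[OF _ _ tendsto_const])
      show "(\<lambda>n. t + 1 / real (Suc n)) \<longlonglongrightarrow> t" 
        using tendsto_add[OF tendsto_const LIMSEQ_inverse_real_of_nat, of t] by (simp add: inverse_eq_divide)
    qed (use q in \<open>auto intro!: eventuallyI less_imp_le\<close>)
    moreover have "q n > 0" for n using q(2)[of n] that by simp
    ultimately have "(\<lambda>n. f (q n)) \<longlonglongrightarrow> f t"
      using c' that by (intro continuous_on_tendsto_compose[OF c']) auto
    moreover have "f (q n) \<in> closure ?D" for n
      using q \<open>\<And>n. q n > 0\<close> closure_subset[of ?D] by blast
    ultimately show ?thesis by (rule closed_sequentially[OF closed_closure, rotated])
  qed
  then show "AE t in half_line. f t \<in> closure ?D" by (intro AE_I2) auto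
  fix x
  have "continuous_on {0<..} (\<lambda>t. dist (f t) x)" by (intro continuous_intros c')
  then show "(\<lambda>t. dist (f t) x) \<in> borel_measurable half_line"
    by (intro continuous_imp_measurable_on_sets_lebesgue) auto
qed

section \<open>Square integrable functions: norm inequalities and completeness\<close>

lemma integrable_power2_add:
  fixes f g :: "'t \<Rightarrow> real"
  assumes [measurable]: "f \<in> borel_measurable M" "g \<in> borel_measurable M"
    and "integrable M (\<lambda>t. (f t)\<^sup>2)" "integrable M (\<lambda>t. (g t)\<^sup>2)"
  shows "integrable M (\<lambda>t. (f t + g t)\<^sup>2)"
proof (rule Bochner_Integration.integrable_bound)
  show "integrable M (\<lambda>t. 2 * (f t)\<^sup>2 + 2 * (g t)\<^sup>2)" using assms by auto
  have "(f t + g t)\<^sup>2 \<le> 2 * (f t)\<^sup>2 + 2 * (g t)\<^sup>2" for t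
    using zero_le_power2[of "f t - g t"] by (simp add: power2_eq_square algebra_simps)
  then show "AE t in M. norm ((f t + g t)\<^sup>2) \<le> norm (2 * (f t)\<^sup>2 + 2 * (g t)\<^sup>2)" by (intro AE_I2) auto
qed simp

lemma integrable_mult_of_power2:
  fixes f g :: "'t \<Rightarrow> real"
  assumes [measurable]: "f \<in> borel_measurable M" "g \<in> borel_measurable M"
    and "integrable M (\<lambda>t. (f t)\<^sup>2)" "integrable M (\<lambda>t. (g t)\<^sup>2)"
  shows "integrable M (\<lambda>t. f t * g t)"
proof (rule Bochner_Integration.integrable_bound)
  show "integrable M (\<lambda>t. (f t)\<^sup>2 + (g t)\<^sup>2)" using assms by auto
  have "\<bar>f t * g t\<bar> \<le> (f t)\<^sup>2 + (g t)\<^sup>2" for t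
    using sum_squares_bound[of "\<bar>f t\<bar>" "\<bar>g t\<bar>"] mult_nonneg_nonneg[of "\<bar>f t\<bar>" "\<bar>g t\<bar>"]
    by (simp add: abs_mult del: mult_nonneg_nonneg)
  then show "AE t in M. norm (f t * g t) \<le> norm ((f t)\<^sup>2 + (g t)\<^sup>2)" by (intro AE_I2) auto
qed simp

text \<open>The polynomial s |-> A + 2 s B + s^2 C is the integral of (f + s g)^2, hence
  nonnegative; its discriminant gives the claim. A vanishing leading coefficient is treated
  separately.\<close>

lemma Cauchy_Schwarz_integral:
  fixes f g :: "'t \<Rightarrow> real"
  assumes meas: "f \<in> borel_measurable M" "g \<in> borel_measurable M"
    and sq: "integrable M (\<lambda>t. (f t)\<^sup>2)" "integrable M (\<lambda>t. (g t)\<^sup>2)"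
  shows "\<bar>LINT t|M. f t * g t\<bar> \<le> sqrt (LINT t|M. (f t)\<^sup>2) * sqrt (LINT t|M. (g t)\<^sup>2)"
proof -
  define A where "A = (LINT t|M. (f t)\<^sup>2)"
  define B where "B = (LINT t|M. f t * g t)"
  define C where "C = (LINT t|M. (g t)\<^sup>2)"
  have fg: "integrable M (\<lambda>t. f t * g t)" using integrable_mult_of_power2 assms by blast
  have pos: "0 \<le> A + 2 * s * B + s\<^sup>2 * C" for s
  proof -
    have "A + 2 * s * B + s\<^sup>2 * C = (LINT t|M. (f t)\<^sup>2 + 2 * s * (f t * g t) + s\<^sup>2 * (g t)\<^sup>2)"
      unfolding A_def B_def C_def using fg sq by simp
    also have "\<dots> = (LINT t|M. (f t + s * g t)\<^sup>2)"
      by (rule Bochner_Integration.integral_cong) (auto simp: power2_eq_square algebra_simps)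
    finally show ?thesis by simp
  qed
  have AC: "A \<ge> 0" "C \<ge> 0" unfolding A_def C_def by auto
  have "B\<^sup>2 \<le> A * C"
  proof (cases "C = 0")
    case True
    have "B = 0"
    proof (rule ccontr)
      assume "B \<noteq> 0"
      \<comment> \<open>For C = 0 the polynomial is affine in s; this s gives it the value
        -1.\<close>
      then show False using pos[of "- (A + 1) / (2 * B)"] True by (simp add: field_simps)
    qed
    then show ?thesis using AC by simp
  next
    case False
    have "0 \<le> C * (A + 2 * (- B / C) * B + (- B / C)\<^sup>2 * C)"
      using pos[of "- B / C"] AC by (intro mult_nonneg_nonneg)
    also have "\<dots> = A * C - B\<^sup>2" using False by (simp add: field_simps power2_eq_square)
    finally show ?thesis by simp
  qed
  then have "\<bar>B\<bar> \<le> sqrt (A * C)" using real_le_rsqrt[of "\<bar>B\<bar>"] by simp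
  then show ?thesis by (simp add: A_def B_def C_def real_sqrt_mult)
qed

lemma in_L2_meas:
  "in_L2 f \<Longrightarrow> strongly_measurable half_line f"
  "in_L2 f \<Longrightarrow> (\<lambda>t. norm (f t)) \<in> borel_measurable half_line"
  "in_L2 f \<Longrightarrow> integrable half_line (\<lambda>t. (norm (f t))\<^sup>2)"
  by (auto simp: in_L2_def strongly_measurable_norm)

lemma L2_norm_power2: "(L2_norm f)\<^sup>2 = (LINT t|half_line. (norm (f t))\<^sup>2)"
  unfolding L2_norm_def by simp

lemma L2_norm_nonneg [simp]: "0 \<le> L2_norm f"
  unfolding L2_norm_def by simp

lemma L2_norm_mono:
  assumes g: "integrable half_line (\<lambda>t. (norm (g t))\<^sup>2)" and f: "strongly_measurable half_line f"
    and le: "AE t in half_line. norm (f t) \<le> norm (g t)"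
  shows "in_L2 f" "L2_norm f \<le> L2_norm g"
proof -
  have le': "AE t in half_line. (norm (f t))\<^sup>2 \<le> (norm (g t))\<^sup>2"
    using le by eventually_elim (auto intro: power_mono)
  have [measurable]: "(\<lambda>t. norm (f t)) \<in> borel_measurable half_line"
    using f by (rule strongly_measurable_norm)
  have "integrable half_line (\<lambda>t. (norm (f t))\<^sup>2)"
  proof (rule Bochner_Integration.integrable_bound[OF g])
    show "AE t in half_line. norm ((norm (f t))\<^sup>2) \<le> norm ((norm (g t))\<^sup>2)" using le' by simp
  qed simp
  then show "in_L2 f" "L2_norm f \<le> L2_norm g"
    using f le' g unfolding in_L2_def L2_norm_def
    by (auto intro!: integral_mono_AE)
qed

lemma L2_norm_cong_AE:
  assumes "in_L2 f" "AE t in half_line. f t = g t"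
  shows "in_L2 g" "L2_norm g = L2_norm f"
proof -
  have g: "strongly_measurable half_line g"
    using assms strongly_measurable_AE_eq in_L2_meas by blast
  have ae: "AE t in half_line. norm (g t) \<le> norm (f t)" "AE t in half_line. norm (f t) \<le> norm (g t)"
    using assms(2) by (auto elim: eventually_mono)
  show *: "in_L2 g" using L2_norm_mono(1)[OF in_L2_meas(3)[OF assms(1)] g ae(1)] .
  show "L2_norm g = L2_norm f"
    using L2_norm_mono(2)[OF in_L2_meas(3)[OF assms(1)] g ae(1)]
      L2_norm_mono(2)[OF in_L2_meas(3)[OF *] in_L2_meas(1)[OF assms(1)] ae(2)] by simp
qed

lemma L2_norm_triangle_real:
  fixes f g :: "real \<Rightarrow> real"
  assumes meas: "f \<in> borel_measurable half_line" "g \<in> borel_measurable half_line"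
    and sq: "integrable half_line (\<lambda>t. (f t)\<^sup>2)" "integrable half_line (\<lambda>t. (g t)\<^sup>2)"
  shows "L2_norm (\<lambda>t. f t + g t) \<le> L2_norm f + L2_norm g"
proof -
  have fg: "integrable half_line (\<lambda>t. f t * g t)" using integrable_mult_of_power2 assms by blast
  have "(LINT t|half_line. (f t + g t)\<^sup>2) = (LINT t|half_line. (f t)\<^sup>2 + 2 * (f t * g t) + (g t)\<^sup>2)"
    by (rule Bochner_Integration.integral_cong) (auto simp: power2_eq_square algebra_simps)
  also have "\<dots> = (L2_norm f)\<^sup>2 + 2 * (LINT t|half_line. f t * g t) + (L2_norm g)\<^sup>2"
    using fg sq by (simp add: L2_norm_power2)
  also have "\<dots> \<le> (L2_norm f)\<^sup>2 + 2 * (L2_norm f * L2_norm g) + (L2_norm g)\<^sup>2"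
    using Cauchy_Schwarz_integral[OF meas sq] by (simp add: L2_norm_def)
  also have "\<dots> = (L2_norm f + L2_norm g)\<^sup>2" by (simp add: power2_sum)
  finally show ?thesis unfolding L2_norm_def[of "\<lambda>t. f t + g t"]
    by (intro real_le_lsqrt) auto
qed

lemma in_L2_add:
  assumes f: "in_L2 f" and g: "in_L2 g"
  shows "in_L2 (\<lambda>t. f t + g t)" "L2_norm (\<lambda>t. f t + g t) \<le> L2_norm f + L2_norm g"
proof -
  let ?h = "\<lambda>t. norm (f t) + norm (g t)"
  have h: "integrable half_line (\<lambda>t. (norm (?h t))\<^sup>2)"
    using integrable_power2_add[OF in_L2_meas(2)[OF f] in_L2_meas(2)[OF g]] 
      in_L2_meas(3)[OF f] in_L2_meas(3)[OF g] by simp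
  have m: "strongly_measurable half_line (\<lambda>t. f t + g t)"
    using f g by (intro strongly_measurable_add in_L2_meas)
  have ae: "AE t in half_line. norm (f t + g t) \<le> norm (?h t)"
    by (intro AE_I2) (auto intro: norm_triangle_ineq)
  note * = L2_norm_mono[OF h m ae]
  show "in_L2 (\<lambda>t. f t + g t)" by (fact *(1))
  have "L2_norm ?h \<le> L2_norm f + L2_norm g"
    using L2_norm_triangle_real[OF in_L2_meas(2)[OF f] in_L2_meas(2)[OF g]] in_L2_meas(3)[OF f] in_L2_meas(3)[OF g]
    by (simp add: L2_norm_def)
  then show "L2_norm (\<lambda>t. f t + g t) \<le> L2_norm f + L2_norm g" using *(2) by simp
qed

lemma in_L2_linear:
  assumes "bounded_linear h" and f: "in_L2 f" and K: "\<And>x. norm (h x) \<le> K * norm x" "K \<ge> 0"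
  shows "in_L2 (\<lambda>t. h (f t))" "L2_norm (\<lambda>t. h (f t)) \<le> K * L2_norm f"
proof -
  have m: "strongly_measurable half_line (\<lambda>t. h (f t))"
    using assms by (intro strongly_measurable_compose[where g = h] in_L2_meas linear_continuous_on)
  have i: "integrable half_line (\<lambda>t. (norm (K * norm (f t)))\<^sup>2)"
    using in_L2_meas(3)[OF f] by (simp add: power_mult_distrib)
  have ae: "AE t in half_line. norm (h (f t)) \<le> norm (K * norm (f t))"
    using K by (intro AE_I2) (auto intro: order_trans)
  note * = L2_norm_mono[OF i m ae]
  show "in_L2 (\<lambda>t. h (f t))" by (fact *(1))
  have "L2_norm (\<lambda>t. K * norm (f t)) = K * L2_norm f"
    using K by (simp add: L2_norm_def power_mult_distrib real_sqrt_mult)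
  then show "L2_norm (\<lambda>t. h (f t)) \<le> K * L2_norm f" using *(2) by simp
qed

lemma L2_norm_minus_commute: "L2_norm (\<lambda>t. f t - g t) = L2_norm (\<lambda>t. g t - f t)"
  by (simp add: L2_norm_def norm_minus_commute)

lemma L2_norm_norm: "L2_norm (\<lambda>t. norm (f t)) = L2_norm f"
  by (simp add: L2_norm_def)

lemma in_L2_diff:
  assumes f: "in_L2 f" and g: "in_L2 g"
  shows "in_L2 (\<lambda>t. f t - g t)" "L2_norm (\<lambda>t. f t - g t) \<le> L2_norm f + L2_norm g"
proof -
  have g': "in_L2 (\<lambda>t. - g t)" "L2_norm (\<lambda>t. - g t) \<le> 1 * L2_norm g"
    using in_L2_linear[of uminus g 1] g bounded_linear_minus[OF bounded_linear_ident] by auto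
  show "in_L2 (\<lambda>t. f t - g t)" "L2_norm (\<lambda>t. f t - g t) \<le> L2_norm f + L2_norm g"
    using in_L2_add[OF f g'(1)] g'(2) by auto
qed

lemma L2_norm_triangle_diff:
  assumes "in_L2 f" "in_L2 g" "in_L2 h"
  shows "L2_norm (\<lambda>t. f t - h t) \<le> L2_norm (\<lambda>t. f t - g t) + L2_norm (\<lambda>t. g t - h t)"
  using in_L2_add(2)[OF in_L2_diff(1)[OF assms(1,2)] in_L2_diff(1)[OF assms(2,3)]] by simp

lemma in_L2_zero [simp]: "in_L2 (\<lambda>_. 0)" "L2_norm (\<lambda>_. 0) = 0"
  by (simp_all add: in_L2_def L2_norm_def)

text \<open>Riesz-Fischer for sequences with geometric increments. Besides the norm limit it
  delivers almost everywhere convergence, which later identifies the limit in V with the uniform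
  limit in Y.\<close>

lemma L2_complete:
  fixes y :: "nat \<Rightarrow> real \<Rightarrow> 'x::{real_normed_vector,complete_space}"
  assumes y: "\<And>k. in_L2 (y k)" and C: "\<And>k. L2_norm (\<lambda>t. y (Suc k) t - y k t) \<le> C * (1/2)^k"
  shows "\<exists>x. in_L2 x \<and> (AE t in half_line. (\<lambda>k. y k t) \<longlonglongrightarrow> x t) \<and>
    (\<forall>k. L2_norm (\<lambda>t. x t - y k t) \<le> 2 * C * (1/2)^k)"
proof -
  define h where "h k t = norm (y (Suc k) t - y k t)" for k t
  have dL2: "in_L2 (\<lambda>t. y k t - y m t)" for k m using in_L2_diff y by blast
  have hm[measurable]: "h k \<in> borel_measurable half_line" for k
    unfolding h_def using in_L2_meas(2)[OF dL2] .
  have C0: "C \<ge> 0" using order_trans[OF L2_norm_nonneg C[of 0]] by simp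
  \<comment> \<open>The squared increments decay like 4^-k, which leaves room for the weight 2^k.
    The weighted sum is then finite almost everywhere, and since \<open>h k t\<close> is at most
    2^-k plus the weighted square, the increments themselves are summable.\<close>
  have hi: "(\<integral>\<^sup>+t. ennreal (2^k * (h k t)\<^sup>2) \<partial>half_line) \<le> ennreal (C\<^sup>2 * (1/2)^k)" for k
  proof -
    have "(LINT t|half_line. (h k t)\<^sup>2) \<le> (C * (1/2)^k)\<^sup>2"
      using power_mono[OF C[of k], of 2] unfolding L2_norm_power2 h_def by simp
    then have "2^k * (LINT t|half_line. (h k t)\<^sup>2) \<le> 2^k * (C * (1/2)^k)\<^sup>2"
      by (intro mult_left_mono) auto
    also have "\<dots> = C\<^sup>2 * (1/2)^k"
      by (simp add: power_mult_distrib power_divide power2_eq_square)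
    finally show ?thesis
      using in_L2_meas(3)[OF dL2, of "Suc k" k]
      by (subst nn_integral_eq_integral) (auto simp: h_def intro!: ennreal_leI)
  qed
  have "(\<integral>\<^sup>+t. (\<Sum>k. ennreal (2^k * (h k t)\<^sup>2)) \<partial>half_line) = (\<Sum>k. \<integral>\<^sup>+t. ennreal (2^k * (h k t)\<^sup>2) \<partial>half_line)"
    by (rule nn_integral_suminf) simp
  also have "\<dots> \<le> (\<Sum>k. ennreal (C\<^sup>2 * (1/2)^k))" by (intro suminf_le hi) auto
  also have "\<dots> = ennreal (\<Sum>k. C\<^sup>2 * (1/2)^k)"
    by (intro suminf_ennreal2 summable_mult summable_geometric) auto
  also have "\<dots> < \<infinity>" by simp
  finally have "AE t in half_line. (\<Sum>k. ennreal (2^k * (h k t)\<^sup>2)) \<noteq> \<infinity>"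
    by (intro nn_integral_noteq_infinite) auto
  then have conv: "AE t in half_line. convergent (\<lambda>k. y k t)"
  proof eventually_elim
    case (elim t)
    have "summable (\<lambda>k. 2^k * (h k t)\<^sup>2)"
      using elim by (intro summable_suminf_not_top) auto
    then have s: "summable (\<lambda>k. (1/2)^k + 2^k * (h k t)\<^sup>2)"
      by (intro summable_add summable_geometric) auto
    have le: "h k t \<le> (1/2)^k + 2^k * (h k t)\<^sup>2" for k
    proof -
      have "0 \<le> (1 - 2^k * h k t)\<^sup>2" by simp
      then have "2 * (2^k * h k t) \<le> 1 + (2^k * h k t)\<^sup>2" by (simp add: power2_eq_square algebra_simps)
      then have "2^k * h k t \<le> 1 + (2^k * h k t)\<^sup>2" using mult_nonneg_nonneg[of "2^k" "h k t"] 
        by (simp add: h_def del: mult_nonneg_nonneg)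
      then have "(1/2)^k * (2^k * h k t) \<le> (1/2)^k * (1 + (2^k * h k t)\<^sup>2)" by (intro mult_left_mono) auto
      then show ?thesis by (simp add: power_divide field_simps power2_eq_square)
    qed
    have hs: "summable (\<lambda>k. h k t)"
      by (rule summable_comparison_test'[OF s, of 0]) (use le in \<open>auto simp: h_def\<close>)
    have tel: "norm (y n t - y m t) \<le> (\<Sum>k=m..<n. h k t)" if "m \<le> n" for m n
      using that
    proof (induction n rule: dec_induct)
      case (step n)
      have "norm (y (Suc n) t - y m t) \<le> norm (y n t - y m t) + h n t"
        unfolding h_def by (metis add.commute diff_add_cancel add_diff_eq norm_triangle_ineq)
      then show ?case using step by simp
    qed auto
    have "Cauchy (\<lambda>k. y k t)"
    proof (rule CauchyI')
      fix e :: real assume "0 < e"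
      then obtain N0 where N0: "\<And>m n. m \<ge> N0 \<Longrightarrow> norm (\<Sum>k=m..<n. h k t) < e"
        using hs unfolding summable_Cauchy by blast
      have "dist (y m t) (y n t) < e" if "m \<ge> N0" "n > m" for m n
        using tel[of m n] N0[of m n] that by (simp add: dist_norm norm_minus_commute)
      then show "\<exists>M. \<forall>m\<ge>M. \<forall>n>m. dist (y m t) (y n t) < e" by blast
    qed
    then show ?case by (simp add: Cauchy_convergent_iff)
  qed
  define x where "x t = lim (\<lambda>k. y k t)" for t
  have lim: "AE t in half_line. (\<lambda>k. y k t) \<longlonglongrightarrow> x t"
    using conv by eventually_elim (simp add: x_def convergent_LIMSEQ_iff)
  have xm: "strongly_measurable half_line x"
    using lim y by (intro strongly_measurable_AE_limit[of y x]) (auto simp: in_L2_def)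
  \<comment> \<open>The exact partial geometric sum is kept because the plain bound
    \<open>2 * C * (1/2)^m\<close> would not be inductive in n.\<close>
  have tel: "L2_norm (\<lambda>t. y n t - y m t) \<le> 2 * C * (1/2)^m - 2 * C * (1/2)^n" if "m \<le> n" for m n
    using that
  proof (induction n rule: dec_induct)
    case (step n)
    have "L2_norm (\<lambda>t. y (Suc n) t - y m t) \<le> L2_norm (\<lambda>t. y (Suc n) t - y n t) + L2_norm (\<lambda>t. y n t - y m t)"
      by (rule L2_norm_triangle_diff) (fact y)+
    also have "\<dots> \<le> C * (1/2)^n + (2 * C * (1/2)^m - 2 * C * (1/2)^n)"
      using C[of n] step by simp
    also have "\<dots> = 2 * C * (1/2)^m - 2 * C * (1/2)^Suc n" by simp
    finally show ?case .
  qed simp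
  \<comment> \<open>Fatou's lemma carries the telescoped bound over from y n - y m to the almost
    everywhere limit x - y m.\<close>
  have fatou: "(\<integral>\<^sup>+t. ennreal ((norm (x t - y m t))\<^sup>2) \<partial>half_line) \<le> ennreal ((2 * C * (1/2)^m)\<^sup>2)" for m
  proof -
    have "AE t in half_line. ennreal ((norm (x t - y m t))\<^sup>2) \<le> liminf (\<lambda>n. ennreal ((norm (y n t - y m t))\<^sup>2))"
      using lim
    proof eventually_elim
      case (elim t)
      have "(\<lambda>n. ennreal ((norm (y n t - y m t))\<^sup>2)) \<longlonglongrightarrow> ennreal ((norm (x t - y m t))\<^sup>2)"
        by (intro tendsto_ennrealI tendsto_intros elim)
      from lim_imp_Liminf[OF _ this] show ?case by simp
    qed
    then have "(\<integral>\<^sup>+t. ennreal ((norm (x t - y m t))\<^sup>2) \<partial>half_line)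
        \<le> (\<integral>\<^sup>+t. liminf (\<lambda>n. ennreal ((norm (y n t - y m t))\<^sup>2)) \<partial>half_line)"
      by (rule nn_integral_mono_AE)
    also have "\<dots> \<le> liminf (\<lambda>n. \<integral>\<^sup>+t. ennreal ((norm (y n t - y m t))\<^sup>2) \<partial>half_line)"
      using in_L2_meas(2)[OF dL2] by (intro nn_integral_liminf) (auto)
    also have "\<dots> \<le> limsup (\<lambda>n. \<integral>\<^sup>+t. ennreal ((norm (y n t - y m t))\<^sup>2) \<partial>half_line)"
      by (rule Liminf_le_Limsup) simp
    also have "\<dots> \<le> ennreal ((2 * C * (1/2)^m)\<^sup>2)"
    proof (rule Limsup_bounded)
      show "\<forall>\<^sub>F n in sequentially. (\<integral>\<^sup>+t. ennreal ((norm (y n t - y m t))\<^sup>2) \<partial>half_line) \<le> ennreal ((2 * C * (1/2)^m)\<^sup>2)"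
      proof (rule eventually_sequentiallyI[of m])
        fix n assume "m \<le> n"
        then have "L2_norm (\<lambda>t. y n t - y m t) \<le> 2 * C * (1/2)^m" using tel[of m n]
          mult_nonneg_nonneg[OF C0, of "(1/2)^n"] by simp
        then have "(L2_norm (\<lambda>t. y n t - y m t))\<^sup>2 \<le> (2 * C * (1/2)^m)\<^sup>2" by (intro power_mono) auto
        then show "(\<integral>\<^sup>+t. ennreal ((norm (y n t - y m t))\<^sup>2) \<partial>half_line) \<le> ennreal ((2 * C * (1/2)^m)\<^sup>2)"
          using in_L2_meas(3)[OF dL2, of n m]
          by (subst nn_integral_eq_integral) (auto simp: L2_norm_power2 intro!: ennreal_leI)
      qed
    qed
    finally show ?thesis .
  qed
  have dm: "strongly_measurable half_line (\<lambda>t. x t - y m t)" for m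
    using xm y in_L2_meas by (intro strongly_measurable_diff) auto
  have dint: "integrable half_line (\<lambda>t. (norm (x t - y m t))\<^sup>2)" for m
  proof (rule integrableI_nn_integral_finite[OF _ _ , of _ _ "enn2real (\<integral>\<^sup>+t. ennreal ((norm (x t - y m t))\<^sup>2) \<partial>half_line)"])
    have [measurable]: "(\<lambda>t. norm (x t - y m t)) \<in> borel_measurable half_line"
      using dm strongly_measurable_norm by blast
    show "(\<lambda>t. (norm (x t - y m t))\<^sup>2) \<in> borel_measurable half_line" by simp
    have "(\<integral>\<^sup>+t. ennreal ((norm (x t - y m t))\<^sup>2) \<partial>half_line) < top"
      using fatou[of m] by (simp add: order_le_less_trans ennreal_less_top)
    then show "(\<integral>\<^sup>+t. ennreal ((norm (x t - y m t))\<^sup>2) \<partial>half_line) 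
        = ennreal (enn2real (\<integral>\<^sup>+t. ennreal ((norm (x t - y m t))\<^sup>2) \<partial>half_line))" by simp
  qed auto
  have dL: "in_L2 (\<lambda>t. x t - y m t)" for m using dm dint by (simp add: in_L2_def)
  have "L2_norm (\<lambda>t. x t - y m t) \<le> 2 * C * (1/2)^m" for m
  proof -
    have "(LINT t|half_line. (norm (x t - y m t))\<^sup>2) \<le> (2 * C * (1/2)^m)\<^sup>2"
      using fatou[of m] dint[of m] by (subst (asm) nn_integral_eq_integral) (auto simp: ennreal_le_iff)
    then show ?thesis unfolding L2_norm_def using C0 by (intro real_le_lsqrt) auto
  qed
  moreover have "in_L2 x" using in_L2_add(1)[OF dL[of 0] y[of 0]] by simp
  ultimately show ?thesis using lim by blast
qed

section \<open>Representation theorems in Hilbert space\<close>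

text \<open>
  Riesz representation of a functional that is bounded with respect to the pulled back norm;
  the range of j need not be closed.
\<close>

lemma riesz_pullback:
  fixes j :: "'v::real_vector \<Rightarrow> 'y::{real_inner,complete_space}" and \<phi> :: "'v \<Rightarrow> real"
  assumes j: "linear j" and \<phi>: "linear \<phi>" and M: "\<And>w. \<bar>\<phi> w\<bar> \<le> M * norm (j w)"
  shows "\<exists>f. \<forall>w. f \<bullet> j w = \<phi> w"
proof -
  interpret j: linear j by fact
  interpret f: linear \<phi> by fact
  \<comment> \<open>For a representer f, \<open>E w\<close> equals |j w - f|^2 - |f|^2. A minimiser
    may fail to exist, but the images under j of a minimising sequence converge to f in Y.\<close>
  define E where "E w = (norm (j w))\<^sup>2 - 2 * \<phi> w" for w
  have E_ge: "E w \<ge> - M\<^sup>2" for w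
  proof -
    have "0 \<le> (norm (j w) - M)\<^sup>2" by simp
    then show ?thesis using M[of w] unfolding E_def 
      by (simp add: power2_eq_square algebra_simps)
  qed
  define m where "m = (INF w. E w)"
  have bdd: "bdd_below (range E)" using E_ge by (intro bdd_belowI[of _ "- M\<^sup>2"]) auto
  have mE: "m \<le> E w" for w unfolding m_def using bdd by (intro cINF_lower) auto
  have "\<exists>w. E w < m + e" if "e > 0" for e
    using cINF_less_iff[OF _ bdd, of "m + e"] that by (auto simp: m_def)
  then have "\<exists>w. E w < m + 1 / real (Suc n)" for n by (meson of_nat_0_less_iff zero_less_Suc zero_less_divide_1_iff)
  then obtain w where w: "\<And>n. E (w n) < m + 1 / real (Suc n)" by metis
  \<comment> \<open>Parallelogram law: E at the midpoint of x and y is at least m.\<close>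
  have mid: "(norm (j x - j y))\<^sup>2 \<le> 2 * (E x - m) + 2 * (E y - m)" for x y
  proof -
    have "m \<le> E ((1/2) *\<^sub>R (x + y))" by (rule mE)
    then show ?thesis
      unfolding E_def by (simp add: j.scaleR f.scaleR j.add f.add power2_norm_eq_inner 
          inner_simps inner_commute algebra_simps)
  qed
  have "Cauchy (\<lambda>n. j (w n))"
  proof (rule CauchyI)
    fix e :: real assume e: "e > 0"
    obtain n0 where n0: "4 / e\<^sup>2 < real n0" using reals_Archimedean2 by blast
    have "norm (j (w k) - j (w n)) < e" if "k \<ge> n0" "n \<ge> n0" for k n
    proof -
      have n0pos: "real n0 > 0" using n0 e by (smt (verit) divide_pos_pos zero_less_power)
      have b: "E (w k) - m < 1 / real n0" if "k \<ge> n0" for k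
      proof -
        have "1 / real (Suc k) \<le> 1 / real n0" using n0pos that by (intro divide_left_mono) auto
        then show ?thesis using w[of k] by simp
      qed
      have "(norm (j (w k) - j (w n)))\<^sup>2 < 4 / real n0"
        using mid[of "w k" "w n"] b[OF that(1)] b[OF that(2)] by simp
      also have "\<dots> < e\<^sup>2" using n0 n0pos e by (simp add: field_simps)
      finally show ?thesis using e by (meson less_imp_le power_less_imp_less_base)
    qed
    then show "\<exists>M. \<forall>m\<ge>M. \<forall>n\<ge>M. norm (j (w m) - j (w n)) < e" by blast
  qed
  then obtain f where f: "(\<lambda>n. j (w n)) \<longlonglongrightarrow> f" by (auto simp: Cauchy_convergent_iff convergent_def)
  have Elim: "(\<lambda>n. E (w n)) \<longlonglongrightarrow> m"
  proof (rule tendsto_sandwich[OF _ _ tendsto_const])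
    show "(\<lambda>n. m + 1 / real (Suc n)) \<longlonglongrightarrow> m" 
      using tendsto_add[OF tendsto_const LIMSEQ_inverse_real_of_nat, of m] by (simp add: inverse_eq_divide)
  qed (use w mE in \<open>auto intro!: eventuallyI less_imp_le\<close>)
  \<comment> \<open>First variation: \<open>E (w n + s *\<^sub>R v)\<close> is at least m for every
    n, and n tends to infinity.\<close>
  have var: "0 \<le> 2 * s * (f \<bullet> j v - \<phi> v) + s\<^sup>2 * (norm (j v))\<^sup>2" for s v
  proof -
    have "(\<lambda>n. E (w n) + 2 * s * (j (w n) \<bullet> j v - \<phi> v) + s\<^sup>2 * (norm (j v))\<^sup>2) \<longlonglongrightarrow> 
        m + 2 * s * (f \<bullet> j v - \<phi> v) + s\<^sup>2 * (norm (j v))\<^sup>2"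
      by (intro tendsto_intros Elim f)
    moreover have "E (w n) + 2 * s * (j (w n) \<bullet> j v - \<phi> v) + s\<^sup>2 * (norm (j v))\<^sup>2 = E (w n + s *\<^sub>R v)" for n
      unfolding E_def j.scaleR f.scaleR j.add f.add power2_norm_eq_inner
      by (simp add: inner_simps inner_commute algebra_simps power2_eq_square)
    ultimately have "m \<le> m + 2 * s * (f \<bullet> j v - \<phi> v) + s\<^sup>2 * (norm (j v))\<^sup>2"
      using mE by (intro LIMSEQ_le_const[of _ _ m]) auto
    then show ?thesis by simp
  qed
  have "f \<bullet> j v = \<phi> v" for v
  proof (rule ccontr)
    define d where "d = f \<bullet> j v - \<phi> v"
    define q where "q = (norm (j v))\<^sup>2"
    assume "f \<bullet> j v \<noteq> \<phi> v"
    then have d: "d \<noteq> 0" by (simp add: d_def)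
    have q: "q \<ge> 0" by (simp add: q_def)
    \<comment> \<open>This value of s makes the variation negative if d is nonzero; q + 1 instead of
      q keeps the denominator positive when j v = 0.\<close>
    have "0 \<le> 2 * (- d / (q + 1)) * d + (- d / (q + 1))\<^sup>2 * q"
      using var[of "- d / (q + 1)" v] by (simp add: d_def q_def)
    also have "\<dots> = - (d\<^sup>2 * (q + 2)) / (q + 1)\<^sup>2"
      using q by (simp add: divide_simps power2_eq_square) (simp add: algebra_simps)
    also have "\<dots> < 0" using d q by (intro divide_neg_pos) auto
    finally show False by simp
  qed
  then show ?thesis by blast
qed

text \<open>Since b need not be symmetric there is no energy to minimise. With R v the Riesz
  representer of \<open>b v\<close>, the map v |-> v - rho (R v - g) is a contraction for small rho,
  and its fixed point solves R v = g.\<close>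

lemma lax_milgram_functional:
  fixes b :: "'v::{real_inner,complete_space} \<Rightarrow> 'v \<Rightarrow> real"
  assumes b: "bounded_bilinear b" and \<kappa>: "\<kappa> > 0" "\<And>v. \<kappa> * (norm v)\<^sup>2 \<le> b v v"
    and \<phi>: "bounded_linear \<phi>"
  shows "\<exists>v. \<forall>w. b v w = \<phi> w"
proof -
  interpret b: bounded_bilinear b by fact
  have riesz: "\<exists>f. \<forall>w. f \<bullet> w = \<psi> w" if \<psi>: "bounded_linear \<psi>" for \<psi> :: "'v \<Rightarrow> real"
  proof -
    obtain K where K: "\<And>x. norm (\<psi> x) \<le> norm x * K" using bounded_linear.bounded[OF \<psi>] by blast
    then show ?thesis using riesz_pullback[of "\<lambda>x. x" \<psi> K] bounded_linear.linear[OF \<psi>] bounded_linear.linear[OF bounded_linear_ident]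
      by (auto simp: mult.commute)
  qed
  obtain g where g: "\<And>w. g \<bullet> w = \<phi> w" using riesz[OF \<phi>] by blast
  have "\<forall>v. \<exists>r. \<forall>w. r \<bullet> w = b v w" using riesz b.bounded_linear_right by blast
  then obtain R where R: "\<And>v w. R v \<bullet> w = b v w" by metis
  obtain K where K: "K > 0" "\<And>x y. norm (b x y) \<le> norm x * norm y * K" using b.pos_bounded by blast
  have Radd: "R (x - y) = R x - R y" for x y
  proof -
    have "(R (x - y) - (R x - R y)) \<bullet> w = 0" for w by (simp add: inner_simps R b.diff_left)
    then show ?thesis by (metis inner_eq_zero_iff eq_iff_diff_eq_0)
  qed
  have Rb: "norm (R x) \<le> K * norm x" for x
  proof -
    have "norm (R x) * norm (R x) = b x (R x)" by (simp add: R[symmetric] norm_eq_sqrt_inner)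
    also have "\<dots> \<le> norm x * norm (R x) * K" using K(2)[of x "R x"] by auto
    finally have "norm (R x) * norm (R x) \<le> (K * norm x) * norm (R x)" by (simp add: algebra_simps)
    then show ?thesis by (cases "R x = 0") (use K in auto)
  qed
  \<comment> \<open>With this rho the squared contraction factor 1 - 2 rho kappa + rho^2 K^2 is at
    most 1 - rho kappa. The summand kappa^2 in the denominator keeps q nonnegative without comparing
    kappa with K.\<close>
  define \<rho> where "\<rho> = \<kappa> / (K\<^sup>2 + \<kappa>\<^sup>2)"
  define T where "T v = v - \<rho> *\<^sub>R (R v - g)" for v
  define q where "q = 1 - \<kappa>\<^sup>2 / (K\<^sup>2 + \<kappa>\<^sup>2)"
  have den: "K\<^sup>2 + \<kappa>\<^sup>2 > 0" using K by (simp add: add_pos_nonneg)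
  have q: "0 \<le> q" "q < 1" using den \<kappa> by (auto simp: q_def)
  have \<rho>: "\<rho> > 0" using den \<kappa> by (simp add: \<rho>_def)
  have contr: "(norm (T x - T y))\<^sup>2 \<le> q * (norm (x - y))\<^sup>2" for x y
  proof -
    define d where "d = x - y"
    have eq: "T x - T y = d - \<rho> *\<^sub>R R d" by (simp add: T_def d_def Radd algebra_simps)
    have "(norm (T x - T y))\<^sup>2 = (norm d)\<^sup>2 - 2 * \<rho> * b d d + \<rho>\<^sup>2 * (norm (R d))\<^sup>2"
      unfolding eq power2_norm_eq_inner
      by (simp add: inner_simps R inner_commute[of d "R d"] algebra_simps power2_eq_square)
    also have "\<dots> \<le> (norm d)\<^sup>2 - 2 * \<rho> * (\<kappa> * (norm d)\<^sup>2) + \<rho>\<^sup>2 * (K * norm d)\<^sup>2"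
      using \<kappa>(2)[of d] \<rho> Rb[of d] by (intro add_mono diff_mono mult_left_mono power_mono) auto
    also have "\<dots> = (1 - 2 * \<rho> * \<kappa> + \<rho>\<^sup>2 * K\<^sup>2) * (norm d)\<^sup>2" by (simp add: algebra_simps power_mult_distrib)
    also have "\<dots> \<le> q * (norm d)\<^sup>2"
    proof (rule mult_right_mono)
      have "\<rho>\<^sup>2 * K\<^sup>2 \<le> \<rho>\<^sup>2 * (K\<^sup>2 + \<kappa>\<^sup>2)" by (intro mult_left_mono) auto
      also have "\<dots> = \<rho> * \<kappa>" using den by (simp add: \<rho>_def power2_eq_square)
      finally have "1 - 2 * \<rho> * \<kappa> + \<rho>\<^sup>2 * K\<^sup>2 \<le> 1 - \<rho> * \<kappa>" by linarith
      then show "1 - 2 * \<rho> * \<kappa> + \<rho>\<^sup>2 * K\<^sup>2 \<le> q" by (simp add: q_def \<rho>_def power2_eq_square)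
    qed simp
    finally show ?thesis by (simp add: d_def)
  qed
  have "dist (T x) (T y) \<le> sqrt q * dist x y" for x y
    using real_sqrt_le_mono[OF contr[of x y]] by (simp add: dist_norm real_sqrt_mult)
  then have "\<exists>!v\<in>UNIV. T v = v"
    using q by (intro Banach_fix[of UNIV "sqrt q"]) (auto simp: complete_UNIV)
  then obtain v where "T v = v" by blast
  then have "R v = g" using \<rho> by (simp add: T_def)
  then show ?thesis using R g by metis
qed

lemma lax_milgram_operator:
  fixes b :: "'v::{real_inner,complete_space} \<Rightarrow> 'v \<Rightarrow> real" and j :: "'v \<Rightarrow>\<^sub>L 'y::real_inner"
  assumes b: "bounded_bilinear b" and \<kappa>: "\<kappa> > 0" "\<And>v. \<kappa> * (norm v)\<^sup>2 \<le> b v v"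
  shows "\<exists>J :: 'y \<Rightarrow>\<^sub>L 'v. \<forall>y w. b (J y) w = y \<bullet> j w"
proof -
  interpret b: bounded_bilinear b by fact
  have "\<exists>v. \<forall>w. b v w = y \<bullet> j w" for y
    by (rule lax_milgram_functional[OF b \<kappa>]) (intro bounded_linear_intros)+
  then obtain J where J: "\<And>y w. b (J y) w = y \<bullet> j w" by metis
  have uniq: "x = y" if "\<And>w. b x w = b y w" for x y
    using \<kappa>(2)[of "x - y"] \<kappa>(1) that by (simp add: b.diff_left mult_le_0_iff)
  have "bounded_linear J"
  proof (rule bounded_linear_intro)
    show "J (x + y) = J x + J y" for x y
      by (rule uniq) (simp add: J b.add_left inner_simps)
    show "J (r *\<^sub>R x) = r *\<^sub>R J x" for r x
      by (rule uniq) (simp add: J b.scaleR_left inner_simps)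
    show "norm (J x) \<le> norm x * (norm j / \<kappa>)" for x
    proof -
      have "\<kappa> * (norm (J x))\<^sup>2 \<le> x \<bullet> j (J x)" using \<kappa>(2)[of "J x"] by (simp add: J)
      also have "\<dots> \<le> norm x * norm (j (J x))" by (rule norm_cauchy_schwarz)
      also have "\<dots> \<le> norm x * (norm j * norm (J x))" by (intro mult_left_mono norm_blinfun) auto
      finally have "(\<kappa> * norm (J x)) * norm (J x) \<le> (norm x * norm j) * norm (J x)"
        by (simp add: power2_eq_square algebra_simps)
      then have "\<kappa> * norm (J x) \<le> norm x * norm j \<or> J x = 0" by (auto simp: mult_le_cancel_right)
      then show ?thesis using \<kappa> by (auto simp: field_simps)
    qed
  qed
  then show ?thesis using J by (intro exI[of _ "Blinfun J"]) (simp add: bounded_linear_Blinfun_apply)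
qed

lemma bounded_bilinear_inner_pullback:
  fixes j :: "'v::real_normed_vector \<Rightarrow>\<^sub>L 'y::real_inner" and k :: "'w::real_normed_vector \<Rightarrow>\<^sub>L 'y"
  shows "bounded_bilinear (\<lambda>v w. j v \<bullet> k w)"
  using bounded_bilinear.comp[OF bounded_bilinear_inner blinfun.bounded_linear_right blinfun.bounded_linear_right] .

lemma bounded_bilinear_scale:
  fixes b :: "'a::real_normed_vector \<Rightarrow> 'b::real_normed_vector \<Rightarrow> real"
  assumes "bounded_bilinear b"
  shows "bounded_bilinear (\<lambda>v w. r * b v w)"
proof -
  interpret bounded_bilinear b by fact
  obtain K where K: "\<And>x y. norm (b x y) \<le> norm x * norm y * K" using bounded by blast
  have "norm (r * b x y) \<le> norm x * norm y * (\<bar>r\<bar> * K)" for x y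
    using mult_left_mono[OF K[of x y], of "\<bar>r\<bar>"] by (simp add: abs_mult algebra_simps)
  then show ?thesis
    by (intro bounded_bilinear.intro exI[of _ "\<bar>r\<bar> * K"]) (auto simp: add_left add_right scaleR_left scaleR_right distrib_left)
qed

lemma bounded_bilinear_add:
  fixes b c :: "'a::real_normed_vector \<Rightarrow> 'b::real_normed_vector \<Rightarrow> real"
  assumes "bounded_bilinear b" "bounded_bilinear c"
  shows "bounded_bilinear (\<lambda>v w. b v w + c v w)"
proof -
  interpret b: bounded_bilinear b by fact
  interpret c: bounded_bilinear c by fact
  obtain K where K: "\<And>x y. norm (b x y) \<le> norm x * norm y * K" using b.bounded by blast
  obtain L where L: "\<And>x y. norm (c x y) \<le> norm x * norm y * L" using c.bounded by blast
  have "norm (b x y + c x y) \<le> norm x * norm y * (K + L)" for x y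
    using norm_triangle_ineq[of "b x y" "c x y"] K[of x y] L[of x y] by (simp add: algebra_simps)
  then show ?thesis
    by (intro bounded_bilinear.intro exI[of _ "K + L"]) (auto simp: b.add_left b.add_right b.scaleR_left b.scaleR_right
     c.add_left c.add_right c.scaleR_left c.scaleR_right distrib_left)
qed

text \<open>
  The operators R n smooth Y into V and are self-adjoint. Strong convergence in V follows since
  the norms of R n (j v) increase with n, which makes this sequence Cauchy, and j is injective.
\<close>

lemma smoothing_operators:
  fixes j :: "'v::{real_inner,complete_space} \<Rightarrow>\<^sub>L 'y::real_inner"
  assumes inj: "inj (blinfun_apply j)" and dense: "closure (range (blinfun_apply j)) = UNIV"
  shows "\<exists>R :: nat \<Rightarrow> 'y \<Rightarrow>\<^sub>L 'v.
    (\<forall>n x y. x \<bullet> j (R n y) = y \<bullet> j (R n x)) \<and>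
    (\<forall>n v. norm (R n (j v)) \<le> norm v) \<and> (\<forall>n y. norm (j (R n y)) \<le> norm y) \<and>
    (\<forall>v. (\<lambda>n. R n (j v)) \<longlonglongrightarrow> v) \<and> (\<forall>y. (\<lambda>n. j (R n y)) \<longlonglongrightarrow> y)"
proof -
  define \<epsilon> where "\<epsilon> n = 1 / real (Suc n)" for n
  have \<epsilon>: "\<epsilon> n > 0" for n by (simp add: \<epsilon>_def)
  \<comment> \<open>\<open>R n y\<close> is the Tikhonov regularisation of the inverse of j: it
    minimises eps n |v|^2 + |j v - y|^2 over v. The symmetry of this form makes j R n
    self-adjoint.\<close>
  have "\<exists>J :: 'y \<Rightarrow>\<^sub>L 'v. \<forall>y w. \<epsilon> n * (J y \<bullet> w) + j (J y) \<bullet> j w = y \<bullet> j w" for n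
    using lax_milgram_operator[where j = j, OF bounded_bilinear_add[OF bounded_bilinear_scale[OF bounded_bilinear_inner] bounded_bilinear_inner_pullback], of "\<epsilon> n" "\<epsilon> n" j j] \<epsilon>[of n]
    by (simp add: power2_norm_eq_inner)
  then obtain R :: "nat \<Rightarrow> 'y \<Rightarrow>\<^sub>L 'v" where R: "\<And>n y w. \<epsilon> n * (R n y \<bullet> w) + j (R n y) \<bullet> j w = y \<bullet> j w"
    by metis
  have sym: "x \<bullet> j (R n y) = y \<bullet> j (R n x)" for n x y
    using R[of n x "R n y"] R[of n y "R n x"] by (simp add: inner_commute)
  have Rj: "norm (R n (j v)) \<le> norm v" for n v
  proof -
    define r where "r = R n (j v)"
    have "\<epsilon> n * (r \<bullet> (r - v)) + (norm (j (r - v)))\<^sup>2 = 0"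
      using R[of n "j v" "r - v"] by (simp add: r_def power2_norm_eq_inner blinfun.diff_right inner_simps inner_commute)
    then have "\<epsilon> n * (r \<bullet> (r - v)) \<le> 0" by (smt (verit) zero_le_power2)
    then have "r \<bullet> r \<le> r \<bullet> v" using \<epsilon>[of n] by (simp add: mult_le_0_iff inner_simps)
    also have "\<dots> \<le> norm r * norm v" by (rule norm_cauchy_schwarz)
    finally have "norm r * norm r \<le> norm v * norm r" by (simp add: norm_eq_sqrt_inner algebra_simps flip: power2_eq_square)
    then show ?thesis unfolding r_def[symmetric] by (cases "r = 0") auto
  qed
  have jR: "norm (j (R n y)) \<le> norm y" for n y
  proof -
    have "norm (j (R n y)) * norm (j (R n y)) \<le> y \<bullet> j (R n y)"
      using R[of n y "R n y"] \<epsilon>[of n] mult_nonneg_nonneg[of "\<epsilon> n" "R n y \<bullet> R n y"] 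
      by (simp add: power2_norm_eq_inner[symmetric] power2_eq_square[symmetric] del: mult_nonneg_nonneg)
    also have "\<dots> \<le> norm y * norm (j (R n y))" by (rule norm_cauchy_schwarz)
    finally show ?thesis by (cases "j (R n y) = 0") auto
  qed
  \<comment> \<open>Testing the difference of the equations for n and m with d shows that R m (j v)
    and d have nonnegative inner product. Expanding the square of R n (j v) = R m (j v) + d then
    gives both monotonicity of the norms and the Cauchy estimate.\<close>
  have step: "(norm (R n (j v) - R m (j v)))\<^sup>2 \<le> (norm (R n (j v)))\<^sup>2 - (norm (R m (j v)))\<^sup>2" if "m \<le> n" for m n v
  proof (cases "m = n")
    case False
    define d where "d = R n (j v) - R m (j v)"
    have lt: "\<epsilon> n < \<epsilon> m" using that False by (simp add: \<epsilon>_def frac_less2)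
    have "\<epsilon> n * (R n (j v) \<bullet> d) - \<epsilon> m * (R m (j v) \<bullet> d) + j d \<bullet> j d = 0"
      using R[of n "j v" d] R[of m "j v" d] by (simp add: d_def blinfun.diff_right inner_simps)
    then have eq: "\<epsilon> n * (d \<bullet> d) + j d \<bullet> j d = (\<epsilon> m - \<epsilon> n) * (R m (j v) \<bullet> d)"
      by (simp add: d_def inner_simps algebra_simps)
    have "0 \<le> (\<epsilon> m - \<epsilon> n) * (R m (j v) \<bullet> d)" unfolding eq[symmetric] using \<epsilon>[of n] by simp
    then have "0 \<le> R m (j v) \<bullet> d" using lt by (simp add: zero_le_mult_iff)
    then show ?thesis unfolding d_def power2_norm_eq_inner by (simp add: inner_simps inner_commute)
  qed simp
  have jlim: "(\<lambda>n. j (R n (j v))) \<longlonglongrightarrow> j v" for v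
  proof -
    have "(norm (j (R n (j v)) - j v))\<^sup>2 \<le> \<epsilon> n * (2 * (norm v)\<^sup>2)" for n
    proof -
      define r where "r = R n (j v)"
      have "(norm (j (r - v)))\<^sup>2 = \<epsilon> n * (r \<bullet> (v - r))"
        using R[of n "j v" "r - v"] by (simp add: r_def power2_norm_eq_inner blinfun.diff_right inner_simps inner_commute algebra_simps)
      also have "\<dots> \<le> \<epsilon> n * (norm r * norm (v - r))"
        using \<epsilon>[of n] by (intro mult_left_mono norm_cauchy_schwarz) auto
      also have "\<dots> \<le> \<epsilon> n * (norm v * (2 * norm v))"
        using \<epsilon>[of n] Rj[of n v] norm_triangle_ineq4[of v r] unfolding r_def by (intro mult_left_mono mult_mono) auto
      finally show ?thesis by (simp add: r_def blinfun.diff_right power2_eq_square)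
    qed
    then have le: "\<forall>n. norm ((norm (j (R n (j v)) - j v))\<^sup>2) \<le> \<epsilon> n * (2 * (norm v)\<^sup>2)"
      by simp
    have lim: "(\<lambda>n. \<epsilon> n * (2 * (norm v)\<^sup>2)) \<longlonglongrightarrow> 0"
      unfolding \<epsilon>_def using LIMSEQ_inverse_real_of_nat by (intro tendsto_mult_left_zero) (simp add: inverse_eq_divide)
    have "(\<lambda>n. (norm (j (R n (j v)) - j v))\<^sup>2) \<longlonglongrightarrow> 0"
      by (rule Lim_null_comparison[OF always_eventually[OF le] lim])
    from tendsto_real_sqrt[OF this] have "(\<lambda>n. norm (j (R n (j v)) - j v)) \<longlonglongrightarrow> 0"
      by simp
    then show ?thesis using tendsto_norm_zero_iff LIM_zero_cancel by blast
  qed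
  have vlim: "(\<lambda>n. R n (j v)) \<longlonglongrightarrow> v" for v
  proof -
    have "incseq (\<lambda>n. (norm (R n (j v)))\<^sup>2)"
      using step by (intro incseq_SucI) (smt (verit) le_SucI order_refl zero_le_power2)
    moreover have "(norm (R n (j v)))\<^sup>2 \<le> (norm v)\<^sup>2" for n using Rj by (intro power_mono) auto
    ultimately obtain L where L: "(\<lambda>n. (norm (R n (j v)))\<^sup>2) \<longlonglongrightarrow> L" using incseq_convergent by metis
    have "Cauchy (\<lambda>n. R n (j v))"
    proof (rule CauchyI')
      fix e :: real assume e: "e > 0"
      have "Cauchy (\<lambda>n. (norm (R n (j v)))\<^sup>2)" using L by (rule LIMSEQ_imp_Cauchy)
      from CauchyD[OF this, of "e\<^sup>2"] obtain n0 where 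
        n0: "\<And>m n. m \<ge> n0 \<Longrightarrow> n \<ge> n0 \<Longrightarrow> \<bar>(norm (R m (j v)))\<^sup>2 - (norm (R n (j v)))\<^sup>2\<bar> < e\<^sup>2"
        using e by auto
      have "dist (R m (j v)) (R n (j v)) < e" if "m \<ge> n0" "n > m" for m n
      proof -
        have "(norm (R n (j v) - R m (j v)))\<^sup>2 < e\<^sup>2" using step[of m n v] n0[of n m] that by simp
        then show ?thesis using e by (metis dist_norm norm_minus_commute less_imp_le power_less_imp_less_base)
      qed
      then show "\<exists>M. \<forall>m\<ge>M. \<forall>n>m. dist (R m (j v)) (R n (j v)) < e" by blast
    qed
    then obtain l where l: "(\<lambda>n. R n (j v)) \<longlonglongrightarrow> l" by (auto simp: Cauchy_convergent_iff convergent_def)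
    then have "(\<lambda>n. j (R n (j v))) \<longlonglongrightarrow> j l" by (intro tendsto_intros)
    then have "j l = j v" using jlim LIMSEQ_unique by blast
    then show ?thesis using l inj by (simp add: inj_eq)
  qed
  have ylim: "(\<lambda>n. j (R n y)) \<longlonglongrightarrow> y" for y
  proof (rule metric_LIMSEQ_I)
    fix e :: real assume e: "e > 0"
    have "y \<in> closure (range (blinfun_apply j))" using dense by simp
    then have "\<exists>x\<in>range (blinfun_apply j). dist x y < e / 3"
      using divide_pos_pos[OF e zero_less_numeral] unfolding closure_approachable by blast
    then obtain v where v: "norm (j v - y) < e / 3" by (auto simp: dist_norm)
    obtain n0 where n0: "\<And>n. n \<ge> n0 \<Longrightarrow> norm (j (R n (j v)) - j v) < e / 3"
      using LIMSEQ_D[OF jlim, of "e / 3"] e by auto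
    have "dist (j (R n y)) y < e" if "n \<ge> n0" for n
    proof -
      have "j (R n y) - y = j (R n (y - j v)) + (j (R n (j v)) - j v) + (j v - y)"
        by (simp add: blinfun.diff_right)
      moreover have "norm (a + b + d) \<le> norm a + norm b + norm d" for a b d :: 'y
        by (rule order_trans[OF norm_triangle_ineq add_right_mono[OF norm_triangle_ineq]])
      from this[of "j (R n (y - j v))" "j (R n (j v)) - j v" "j v - y"]
      have "norm (j (R n y) - y) \<le> norm (j (R n (y - j v))) + norm (j (R n (j v)) - j v) + norm (j v - y)"
        unfolding calculation .
      then show ?thesis using jR[of n "y - j v"] n0[OF that] v by (simp add: dist_norm norm_minus_commute)
    qed
    then show "\<exists>no. \<forall>n\<ge>no. dist (j (R n y)) y < e" by blast
  qed
  show ?thesis by (rule exI[of _ R]) (use sym Rj jR vlim ylim in blast)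
qed

lemma abs_blinfun_le: "\<bar>blinfun_apply g v\<bar> \<le> norm g * norm v"
  using norm_blinfun[of g v] by simp

lemma strongly_measurable_blinfun_apply:
  fixes g :: "'t \<Rightarrow> 'a::real_normed_vector \<Rightarrow>\<^sub>L 'b::real_normed_vector"
  assumes "strongly_measurable M g" "strongly_measurable M v"
  shows "strongly_measurable M (\<lambda>t. g t (v t))"
  by (rule strongly_measurable_compose2[OF assms, where h = blinfun_apply]) (intro continuous_intros)

section \<open>Locally integrable functions on the half line\<close>

text \<open>Integrability reaches down to time 0, unlike local integrability on the open half line,
  so that primitives can start at the initial time.\<close>

definition locint :: "(real \<Rightarrow> real) \<Rightarrow> bool" where
  "locint f \<longleftrightarrow> (\<forall>T. set_integrable half_line {0<..T} f)"

text \<open>Half-open intervals split without overlap; for t at most s the integral is 0.\<close>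

definition ig :: "(real \<Rightarrow> real) \<Rightarrow> real \<Rightarrow> real \<Rightarrow> real" where
  "ig f s t = (LINT r:{s<..t}|half_line. f r)"

lemma half_line_Ioc_sets [measurable, simp]: "0 \<le> s \<Longrightarrow> {s<..t} \<in> sets half_line"
  by (auto simp: sets_restrict_space_iff)

lemma AE_half_line_pos: "AE t in half_line. t > 0"
  by (intro AE_I2) auto

lemma locint_set_integrable: "locint f \<Longrightarrow> 0 \<le> s \<Longrightarrow> set_integrable half_line {s<..t} f"
  unfolding locint_def by (rule set_integrable_subset[of _ "{0<..t}"]) auto

lemma locint_measurable:
  assumes "locint f" shows "f \<in> borel_measurable half_line"
proof -
  have "(\<lambda>t. indicator {0<..real n} t *\<^sub>R f t) \<in> borel_measurable half_line" for n
    using assms unfolding locint_def set_integrable_def by (intro borel_measurable_integrable) auto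
  moreover have "AE t in half_line. (\<lambda>n. indicator {0<..real n} t *\<^sub>R f t) \<longlonglongrightarrow> f t"
  proof (rule AE_I2)
    fix t assume "t \<in> space half_line"
    then have t: "t > 0" by simp
    obtain N where N: "t \<le> real N" using real_arch_simple by blast
    have "\<forall>\<^sub>F n in sequentially. indicator {0<..real n} t *\<^sub>R f t = f t"
      using t N by (intro eventually_sequentiallyI[of N]) auto
    then show "(\<lambda>n. indicator {0<..real n} t *\<^sub>R f t) \<longlonglongrightarrow> f t" by (rule tendsto_eventually)
  qed
  ultimately show ?thesis by (rule half_line_measurable_AE_limit)
qed

lemma locint_bound:
  assumes f: "locint f" and g: "g \<in> borel_measurable half_line"
    and le: "AE t in half_line. \<bar>g t\<bar> \<le> f t"
  shows "locint g"
  unfolding locint_def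
proof
  fix T
  show "set_integrable half_line {0<..T} g"
    unfolding set_integrable_def
  proof (rule Bochner_Integration.integrable_bound)
    show "integrable half_line (\<lambda>t. indicator {0<..T} t *\<^sub>R f t)"
      using f by (auto simp: locint_def set_integrable_def)
    show "(\<lambda>t. indicator {0<..T} t *\<^sub>R g t) \<in> borel_measurable half_line"
      using g by simp
    show "AE t in half_line. norm (indicator {0<..T} t *\<^sub>R g t) \<le> norm (indicator {0<..T} t *\<^sub>R f t)"
      using le by eventually_elim (auto simp: indicator_def)
  qed
qed

lemma integrable_imp_locint: "integrable half_line f \<Longrightarrow> locint f"
  unfolding locint_def set_integrable_def by (intro allI integrable_mult_indicator) auto

lemma locint_add: "locint f \<Longrightarrow> locint g \<Longrightarrow> locint (\<lambda>t. f t + g t)"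
  by (auto simp: locint_def)

lemma locint_diff: "locint f \<Longrightarrow> locint g \<Longrightarrow> locint (\<lambda>t. f t - g t)"
  by (auto simp: locint_def)

lemma locint_mult: "locint f \<Longrightarrow> locint (\<lambda>t. a * f t)"
  by (auto simp: locint_def)

lemma locint_uminus: "locint f \<Longrightarrow> locint (\<lambda>t. - f t)"
  using locint_mult[of f "-1"] by simp

lemma locint_abs: "locint f \<Longrightarrow> locint (\<lambda>t. \<bar>f t\<bar>)"
  by (auto simp: locint_def intro: set_integrable_abs)

lemma emeasure_half_line_Ioc: "0 \<le> s \<Longrightarrow> s \<le> t \<Longrightarrow> emeasure half_line {s<..t} = ennreal (t - s)"
  by (subst emeasure_restrict_space) auto

lemma locint_const [simp]: "locint (\<lambda>_. a)"
  unfolding locint_def set_integrable_def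
proof
  fix T :: real
  show "integrable half_line (\<lambda>x. indicator {0<..T} x *\<^sub>R a)"
  proof (cases "0 \<le> T")
    case True
    then show ?thesis using emeasure_half_line_Ioc[of 0 T]
      by (intro integrable_scaleR_left integrable_real_indicator) auto
  next
    case False
    then have "{0<..T} = {}" by auto
    then show ?thesis by simp
  qed
qed

lemma locint_mult_bounded:
  assumes f: "locint f" and g: "g \<in> borel_measurable half_line"
    and B: "\<And>T. \<exists>K. \<forall>t. 0 < t \<longrightarrow> t \<le> T \<longrightarrow> \<bar>g t\<bar> \<le> K"
  shows "locint (\<lambda>t. f t * g t)"
  unfolding locint_def
proof
  fix T
  obtain K where K: "\<And>t. 0 < t \<Longrightarrow> t \<le> T \<Longrightarrow> \<bar>g t\<bar> \<le> K" using B by blast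
  show "set_integrable half_line {0<..T} (\<lambda>t. f t * g t)"
    unfolding set_integrable_def
  proof (rule Bochner_Integration.integrable_bound)
    show "integrable half_line (\<lambda>t. indicator {0<..T} t *\<^sub>R (K * f t))"
      using locint_mult[OF f, of K] by (auto simp: locint_def set_integrable_def)
    show "(\<lambda>t. indicator {0<..T} t *\<^sub>R (f t * g t)) \<in> borel_measurable half_line"
      using g locint_measurable[OF f] by simp
    have "\<bar>f t * g t\<bar> \<le> \<bar>K * f t\<bar>" if "0 < t" "t \<le> T" for t
    proof -
      have "\<bar>g t\<bar> * \<bar>f t\<bar> \<le> \<bar>K\<bar> * \<bar>f t\<bar>" using K[OF that] by (intro mult_right_mono) auto
      then show ?thesis by (simp add: abs_mult mult.commute)
    qed
    then show "AE t in half_line. norm (indicator {0<..T} t *\<^sub>R (f t * g t)) \<le> norm (indicator {0<..T} t *\<^sub>R (K * f t))"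
      by (intro AE_I2) (auto simp: indicator_def)
  qed
qed

lemma continuous_half_line_bounded:
  fixes c :: "real \<Rightarrow> 'x::real_normed_vector"
  assumes "continuous_on {0..} c"
  shows "\<exists>K. \<forall>t. 0 \<le> t \<longrightarrow> t \<le> T \<longrightarrow> norm (c t) \<le> K"
proof -
  have "continuous_on {0..T} c" using assms by (rule continuous_on_subset) auto
  then have "bounded (c ` {0..T})" by (intro compact_imp_bounded compact_continuous_image) auto
  then obtain K where "\<forall>x\<in>c ` {0..T}. norm x \<le> K" unfolding bounded_iff by blast
  then show ?thesis by (intro exI[of _ K]) auto
qed

lemma locint_continuous:
  assumes "continuous_on {0..} f"
  shows "locint f"
proof -
  have "f \<in> borel_measurable half_line" 
    using strongly_measurable_real[OF strongly_measurable_continuous[OF assms]] .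
  moreover have "\<exists>K. \<forall>t. 0 < t \<longrightarrow> t \<le> T \<longrightarrow> \<bar>f t\<bar> \<le> K" for T
    using continuous_half_line_bounded[OF assms, of T] by auto (meson less_imp_le)
  ultimately have "locint (\<lambda>t. 1 * f t)" by (intro locint_mult_bounded) auto
  then show ?thesis by simp
qed

lemma locint_mult_continuous:
  assumes f: "locint f" and g: "continuous_on {0..} g"
  shows "locint (\<lambda>t. f t * g t)"
proof (rule locint_mult_bounded[OF f])
  show "g \<in> borel_measurable half_line" 
    using strongly_measurable_real[OF strongly_measurable_continuous[OF g]] .
  show "\<exists>K. \<forall>t. 0 < t \<longrightarrow> t \<le> T \<longrightarrow> \<bar>g t\<bar> \<le> K" for T
    using continuous_half_line_bounded[OF g, of T] by auto (meson less_imp_le)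
qed

lemma locint_of_power2:
  assumes f: "f \<in> borel_measurable half_line" "integrable half_line (\<lambda>t. (f t)\<^sup>2)"
  shows "locint f"
proof (rule locint_bound[OF _ f(1)])
  show "locint (\<lambda>t. 1 + (f t)\<^sup>2)" by (intro locint_add locint_const integrable_imp_locint f)
  have "\<bar>f t\<bar> \<le> 1 + (f t)\<^sup>2" for t
    using zero_le_power2[of "\<bar>f t\<bar> - 1"] by (simp add: power2_eq_square algebra_simps) 
  then show "AE t in half_line. \<bar>f t\<bar> \<le> 1 + (f t)\<^sup>2" by simp
qed

lemma locint_norm_L2: "in_L2 f \<Longrightarrow> locint (\<lambda>t. norm (f t))"
  by (intro locint_of_power2 in_L2_meas)

lemma ig_add: "locint f \<Longrightarrow> locint g \<Longrightarrow> 0 \<le> s \<Longrightarrow> ig (\<lambda>t. f t + g t) s t = ig f s t + ig g s t"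
  unfolding ig_def by (intro set_integral_add locint_set_integrable)

lemma ig_diff: "locint f \<Longrightarrow> locint g \<Longrightarrow> 0 \<le> s \<Longrightarrow> ig (\<lambda>t. f t - g t) s t = ig f s t - ig g s t"
  unfolding ig_def by (intro set_integral_diff locint_set_integrable)

lemma ig_mult: "ig (\<lambda>t. a * f t) s t = a * ig f s t"
  unfolding ig_def by simp

lemma ig_uminus: "ig (\<lambda>t. - f t) s t = - ig f s t"
  using ig_mult[of "-1" f s t] by simp

lemma ig_cong_AE: "AE r in half_line. s < r \<longrightarrow> r \<le> t \<longrightarrow> f r = g r \<Longrightarrow> f \<in> borel_measurable half_line \<Longrightarrow>
    g \<in> borel_measurable half_line \<Longrightarrow> 0 \<le> s \<Longrightarrow> ig f s t = ig g s t"
  unfolding ig_def set_lebesgue_integral_def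
  by (rule integral_cong_AE) (auto elim!: eventually_mono split: split_indicator)

lemma ig_cong: "(\<And>r. s < r \<Longrightarrow> r \<le> t \<Longrightarrow> f r = g r) \<Longrightarrow> ig f s t = ig g s t"
  unfolding ig_def set_lebesgue_integral_def
  by (rule Bochner_Integration.integral_cong) (auto simp: indicator_def)

lemma ig_mono_AE: 
  assumes "locint f" "locint g" "0 \<le> s" "AE r in half_line. s < r \<longrightarrow> r \<le> t \<longrightarrow> f r \<le> g r"
  shows "ig f s t \<le> ig g s t"
  unfolding ig_def set_lebesgue_integral_def
proof (rule integral_mono_AE)
  show "AE x in half_line. indicator {s<..t} x *\<^sub>R f x \<le> indicator {s<..t} x *\<^sub>R g x"
    using assms(4) by eventually_elim (auto simp: indicator_def)
qed (use locint_set_integrable assms in \<open>auto simp: set_integrable_def\<close>)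

lemma ig_mono: 
  assumes "locint f" "locint g" "0 \<le> s" "\<And>r. s < r \<Longrightarrow> r \<le> t \<Longrightarrow> f r \<le> g r"
  shows "ig f s t \<le> ig g s t"
  using assms by (intro ig_mono_AE AE_I2) auto

lemma ig_nonneg: "(\<And>r. s < r \<Longrightarrow> r \<le> t \<Longrightarrow> 0 \<le> f r) \<Longrightarrow> 0 \<le> ig f s t"
  unfolding ig_def set_lebesgue_integral_def
  by (intro Bochner_Integration.integral_nonneg) (auto simp: indicator_def)

lemma ig_abs_le:
  assumes "locint f" "0 \<le> s" shows "\<bar>ig f s t\<bar> \<le> ig (\<lambda>r. \<bar>f r\<bar>) s t"
proof -
  have "ig f s t \<le> ig (\<lambda>r. \<bar>f r\<bar>) s t" using assms by (intro ig_mono locint_abs) auto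
  moreover have "ig (\<lambda>r. - f r) s t \<le> ig (\<lambda>r. \<bar>f r\<bar>) s t" using assms by (intro ig_mono locint_abs locint_uminus) auto
  ultimately show ?thesis by (simp add: ig_uminus)
qed

lemma ig_split:
  assumes "locint f" "0 \<le> s" "s \<le> t" "t \<le> u" shows "ig f s u = ig f s t + ig f t u"
proof -
  have "{s<..u} = {s<..t} \<union> {t<..u}" using assms by auto
  then show ?thesis unfolding ig_def using assms
    by (simp add: set_integral_Un locint_set_integrable)
qed

lemma ig_const:
  assumes "0 \<le> s" "s \<le> t" shows "ig (\<lambda>_. a) s t = a * (t - s)"
proof -
  have "ig (\<lambda>_. a) s t = (LINT r|half_line. indicator {s<..t} r * a)"
    by (simp add: ig_def set_lebesgue_integral_def)
  also have "\<dots> = measure half_line ({s<..t} \<inter> space half_line) * a"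
    by (simp only: integral_mult_left_zero Bochner_Integration.integral_indicator)
  also have "{s<..t} \<inter> space half_line = {s<..t}" using assms by auto
  finally show ?thesis using emeasure_half_line_Ioc[OF assms] assms by (simp add: measure_def)
qed

lemma ig_self [simp]: "ig f s s = 0"
  by (simp add: ig_def set_lebesgue_integral_def)

lemma ig_le_integral:
  assumes "integrable half_line f" "\<And>r. r > 0 \<Longrightarrow> 0 \<le> f r" "0 \<le> s"
  shows "ig f s t \<le> (LINT r|half_line. f r)"
  unfolding ig_def set_lebesgue_integral_def
proof (rule integral_mono)
  show "integrable half_line (\<lambda>x. indicator {s<..t} x *\<^sub>R f x)"
    using locint_set_integrable[OF integrable_imp_locint[OF assms(1)] assms(3), of t] by (simp add: set_integrable_def)
qed (use assms in \<open>auto simp: indicator_def\<close>)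

lemma ig_tendsto_integral:
  assumes f: "integrable half_line f"
  shows "(\<lambda>n. ig f 0 (real n)) \<longlonglongrightarrow> (LINT r|half_line. f r)"
  unfolding ig_def set_lebesgue_integral_def
proof (rule integral_dominated_convergence[where w = "\<lambda>t. \<bar>f t\<bar>"])
  show "AE t in half_line. (\<lambda>n. indicator {0<..real n} t *\<^sub>R f t) \<longlonglongrightarrow> f t"
  proof (rule AE_I2)
    fix t assume "t \<in> space half_line"
    then have t: "t > 0" by simp
    obtain N where N: "t \<le> real N" using real_arch_simple by blast
    have "\<forall>\<^sub>F n in sequentially. indicator {0<..real n} t *\<^sub>R f t = f t"
      using t N by (intro eventually_sequentiallyI[of N]) auto
    then show "(\<lambda>n. indicator {0<..real n} t *\<^sub>R f t) \<longlonglongrightarrow> f t" by (rule tendsto_eventually)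
  qed
qed (use f in \<open>auto split: split_indicator\<close>)

lemma ig_dominated_convergence:
  assumes "f \<in> borel_measurable half_line" "\<And>n. F n \<in> borel_measurable half_line" "locint w" "0 \<le> s"
    and "AE r in half_line. (\<lambda>n. F n r) \<longlonglongrightarrow> f r"
    and "\<And>n. AE r in half_line. s < r \<longrightarrow> r \<le> t \<longrightarrow> \<bar>F n r\<bar> \<le> w r"
  shows "(\<lambda>n. ig (F n) s t) \<longlonglongrightarrow> ig f s t"
  unfolding ig_def set_lebesgue_integral_def
proof (rule integral_dominated_convergence[where w = "\<lambda>r. indicator {s<..t} r *\<^sub>R w r"])
  show "integrable half_line (\<lambda>r. indicator {s<..t} r *\<^sub>R w r)"
    using locint_set_integrable[OF assms(3,4), of t] by (simp add: set_integrable_def)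
  show "AE r in half_line. (\<lambda>n. indicator {s<..t} r *\<^sub>R F n r) \<longlonglongrightarrow> indicator {s<..t} r *\<^sub>R f r"
    using assms(5) by eventually_elim (intro tendsto_intros)
  show "AE r in half_line. norm (indicator {s<..t} r *\<^sub>R F n r) \<le> indicator {s<..t} r *\<^sub>R w r" for n
    using assms(6)[of n] by eventually_elim (auto simp: indicator_def)
qed (use assms in auto)

text \<open>Summing over a partition finer than delta bounds the total error by epsilon times a
  fixed integral, for every epsilon. This is how product and chain rules are obtained for functions
  that are only primitives of integrable functions: it suffices to compare increments on short
  intervals.\<close>

lemma increments_imp_integral:
  assumes K: "locint K" and \<rho>: "locint \<rho>" and T: "0 \<le> T"
    and inc: "\<And>\<epsilon>. \<epsilon> > 0 \<Longrightarrow> \<exists>\<delta>>0. \<forall>s t. 0 \<le> s \<longrightarrow> s \<le> t \<longrightarrow> t \<le> T \<longrightarrow> t - s < \<delta> \<longrightarrow>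
      \<bar>F t - F s - ig K s t\<bar> \<le> \<epsilon> * ig \<rho> s t"
  shows "F T - F 0 = ig K 0 T"
proof -
  define D where "D = \<bar>F T - F 0 - ig K 0 T\<bar>"
  have D: "D \<le> \<epsilon> * ig \<rho> 0 T" if \<epsilon>: "\<epsilon> > 0" for \<epsilon>
  proof -
    obtain \<delta> where \<delta>: "\<delta> > 0" and le: "\<And>s t. 0 \<le> s \<Longrightarrow> s \<le> t \<Longrightarrow> t \<le> T \<Longrightarrow> t - s < \<delta> \<Longrightarrow>
      \<bar>F t - F s - ig K s t\<bar> \<le> \<epsilon> * ig \<rho> s t" using inc[OF \<epsilon>] by blast
    obtain n where n: "T / \<delta> < real n" using reals_Archimedean2 by blast
    then have n0: "real n > 0" using T \<delta> by (smt (verit) divide_nonneg_pos)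
    define p where "p i = T * real i / real n" for i
    have p: "0 \<le> p i" "p i \<le> p (Suc i)" "p (Suc i) - p i < \<delta>" for i
    proof -
      show "0 \<le> p i" "p i \<le> p (Suc i)" unfolding p_def using T n0 by (auto intro!: divide_right_mono mult_left_mono)
      have "p (Suc i) - p i = T / real n" unfolding p_def by (simp add: field_simps diff_divide_distrib[symmetric])
      also have "\<dots> < \<delta>" using n n0 \<delta> by (simp add: field_simps)
      finally show "p (Suc i) - p i < \<delta>" .
    qed
    have "\<bar>F (p i) - F 0 - ig K 0 (p i)\<bar> \<le> \<epsilon> * ig \<rho> 0 (p i)" if "i \<le> n" for i
      using that
    proof (induction i)
      case 0 then show ?case by (simp add: p_def)
    next
      case (Suc i)
      have "p (Suc i) \<le> T * real n / real n" unfolding p_def using Suc.prems n0 T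
        by (intro divide_right_mono mult_left_mono) auto
      then have "p (Suc i) \<le> T" using n0 by simp
      then have "\<bar>F (p (Suc i)) - F (p i) - ig K (p i) (p (Suc i))\<bar> \<le> \<epsilon> * ig \<rho> (p i) (p (Suc i))"
        using p by (intro le) auto
      moreover have "ig K 0 (p (Suc i)) = ig K 0 (p i) + ig K (p i) (p (Suc i))"
        "ig \<rho> 0 (p (Suc i)) = ig \<rho> 0 (p i) + ig \<rho> (p i) (p (Suc i))"
        using p by (auto intro!: ig_split K \<rho>)
      ultimately show ?case using Suc by (simp add: distrib_left)
    qed
    from this[of n] show ?thesis using n0 by (simp add: p_def D_def)
  qed
  have "D \<le> 0"
  proof (rule ccontr)
    assume "\<not> D \<le> 0"
    then have D0: "D > 0" by simp
    define I where "I = ig \<rho> 0 T"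
    have "I > 0" using D[of 1] D0 by (simp add: I_def)
    \<comment> \<open>The choice epsilon = D / (2 I) turns the bound into D at most D / 2.\<close>
    then have "D \<le> D / (2 * I) * I" using D[of "D / (2 * I)"] D0 by (simp add: I_def)
    then show False using \<open>I > 0\<close> D0 by simp
  qed
  then show ?thesis by (simp add: D_def)
qed

section \<open>Energy identities\<close>

text \<open>Because Q maps Y into V, the functional g s may be applied to Q (c s) although c is only
  continuous in Y. Between s and t the increment of the quadratic form is that of c tested with Q (c
  t) + Q (c s), and Q (c r) varies little on short intervals.\<close>

lemma quadratic_form_identity:
  fixes j :: "'v::real_inner \<Rightarrow>\<^sub>L 'y::real_inner" and Q :: "'y \<Rightarrow>\<^sub>L 'v" and g :: "real \<Rightarrow> 'v \<Rightarrow>\<^sub>L real"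
  assumes c: "continuous_on {0..} c" and g: "strongly_measurable half_line g" "locint (\<lambda>t. norm (g t))"
    and weak: "\<And>w t. 0 \<le> t \<Longrightarrow> c t \<bullet> j w = c 0 \<bullet> j w + ig (\<lambda>s. g s w) 0 t"
    and sym: "\<And>x y. x \<bullet> j (Q y) = y \<bullet> j (Q x)" and T: "0 \<le> T"
  shows "c T \<bullet> j (Q (c T)) - c 0 \<bullet> j (Q (c 0)) = ig (\<lambda>s. 2 * g s (Q (c s))) 0 T"
proof (rule increments_imp_integral[OF _ g(2) T])
  have meas: "(\<lambda>s. g s (v s)) \<in> borel_measurable half_line" if "strongly_measurable half_line v" for v
    using strongly_measurable_real[OF strongly_measurable_blinfun_apply[OF g(1) that]] .
  have lw: "locint (\<lambda>s. g s w)" for w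
  proof (rule locint_bound)
    show "locint (\<lambda>t. norm w * norm (g t))" by (intro locint_mult g)
    show "AE t in half_line. \<bar>g t w\<bar> \<le> norm w * norm (g t)"
      using norm_blinfun[of "g _" w] by (intro AE_I2) (simp add: mult.commute)
  qed (rule meas, simp)
  have Qc: "continuous_on {0..} (\<lambda>s. Q (c s))" by (intro continuous_intros c)
  have lQ: "locint (\<lambda>s. g s (Q (c s)))"
  proof (rule locint_bound)
    show "locint (\<lambda>t. norm (g t) * norm (Q (c t)))" 
      by (intro locint_mult_continuous g continuous_intros c)
    show "AE t in half_line. \<bar>g t (Q (c t))\<bar> \<le> norm (g t) * norm (Q (c t))"
      by (intro AE_I2 abs_blinfun_le)
  qed (rule meas, rule strongly_measurable_continuous[OF Qc])
  show l2: "locint (\<lambda>s. 2 * g s (Q (c s)))" by (intro locint_mult lQ)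
  fix \<epsilon> :: real assume \<epsilon>: "\<epsilon> > 0"
  have "uniformly_continuous_on {0..T} (\<lambda>s. Q (c s))"
    by (intro compact_uniformly_continuous continuous_on_subset[OF Qc]) auto
  then obtain \<delta> where \<delta>: "\<delta> > 0" 
    and uc: "\<And>s t. s \<in> {0..T} \<Longrightarrow> t \<in> {0..T} \<Longrightarrow> dist s t < \<delta> \<Longrightarrow> dist (Q (c s)) (Q (c t)) < \<epsilon> / 2"
    using \<epsilon> unfolding uniformly_continuous_on_def by (metis half_gt_zero)
  have "\<bar>c t \<bullet> j (Q (c t)) - c s \<bullet> j (Q (c s)) - ig (\<lambda>s. 2 * g s (Q (c s))) s t\<bar> \<le> \<epsilon> * ig (\<lambda>t. norm (g t)) s t"
    if st: "0 \<le> s" "s \<le> t" "t \<le> T" "t - s < \<delta>" for s t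
  proof -
    \<comment> \<open>Difference of two squares, valid by the symmetry of j Q.\<close>
    let ?w = "Q (c t) + Q (c s)"
    have "c t \<bullet> j (Q (c t)) - c s \<bullet> j (Q (c s)) = c t \<bullet> j ?w - c s \<bullet> j ?w"
      using sym[of "c t" "c s"] by (simp add: blinfun.add_right inner_simps)
    also have "\<dots> = ig (\<lambda>r. g r ?w) s t"
      using weak[of t ?w] weak[of s ?w] ig_split[OF lw, of 0 s t ?w] st by simp
    finally have "c t \<bullet> j (Q (c t)) - c s \<bullet> j (Q (c s)) - ig (\<lambda>s. 2 * g s (Q (c s))) s t
        = ig (\<lambda>r. g r ?w - 2 * g r (Q (c r))) s t"
      using ig_diff[OF lw l2] st by simp
    moreover have "\<bar>ig (\<lambda>r. g r ?w - 2 * g r (Q (c r))) s t\<bar> \<le> ig (\<lambda>r. \<bar>g r ?w - 2 * g r (Q (c r))\<bar>) s t"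
      using st by (intro ig_abs_le locint_diff lw l2)
    moreover have "\<dots> \<le> ig (\<lambda>r. \<epsilon> * norm (g r)) s t"
    proof (rule ig_mono)
      fix r assume r: "s < r" "r \<le> t"
      have "g r ?w - 2 * g r (Q (c r)) = g r ((Q (c t) - Q (c r)) + (Q (c s) - Q (c r)))"
        by (simp add: blinfun.add_right blinfun.diff_right)
      also have "\<bar>\<dots>\<bar> \<le> norm (g r) * norm ((Q (c t) - Q (c r)) + (Q (c s) - Q (c r)))"
        by (rule abs_blinfun_le)
      also have "\<dots> \<le> norm (g r) * \<epsilon>"
      proof (rule mult_left_mono)
        have "dist (Q (c t)) (Q (c r)) < \<epsilon> / 2" "dist (Q (c s)) (Q (c r)) < \<epsilon> / 2"
          using st r uc[of t r] uc[of s r] by (simp_all add: dist_real_def)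
        then show "norm ((Q (c t) - Q (c r)) + (Q (c s) - Q (c r))) \<le> \<epsilon>"
          using norm_triangle_ineq[of "Q (c t) - Q (c r)" "Q (c s) - Q (c r)"] by (simp add: dist_norm)
      qed simp
      finally show "\<bar>g r ?w - 2 * g r (Q (c r))\<bar> \<le> \<epsilon> * norm (g r)" by (simp add: mult.commute)
    qed (use st in \<open>auto intro!: locint_mult locint_abs locint_diff lw l2 lQ g\<close>)
    ultimately show ?thesis by (simp add: ig_mult)
  qed
  then show "\<exists>\<delta>>0. \<forall>s t. 0 \<le> s \<longrightarrow> s \<le> t \<longrightarrow> t \<le> T \<longrightarrow> t - s < \<delta> \<longrightarrow>
      \<bar>c t \<bullet> j (Q (c t)) - c s \<bullet> j (Q (c s)) - ig (\<lambda>s. 2 * g s (Q (c s))) s t\<bar> \<le> \<epsilon> * ig (\<lambda>t. norm (g t)) s t"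
    using \<delta> by blast
qed

text \<open>The quadratic identity is applied to the smoothing operators, and dominated convergence
  removes them. The majorant must hold for all v with norms at most those of y t in V and c t in Y,
  because R n (c t) is such a v. Asking for both norms lets one statement cover forcing in Y and
  derivatives in the dual of V.\<close>

lemma energy_identity:
  fixes j :: "'v::{real_inner,complete_space} \<Rightarrow>\<^sub>L 'y::real_inner" and g :: "real \<Rightarrow> 'v \<Rightarrow>\<^sub>L real"
  assumes inj: "inj (blinfun_apply j)" and dense: "closure (range (blinfun_apply j)) = UNIV"
    and c: "continuous_on {0..} c" and g: "strongly_measurable half_line g" "locint (\<lambda>t. norm (g t))"
    and weak: "\<And>w t. 0 \<le> t \<Longrightarrow> c t \<bullet> j w = c 0 \<bullet> j w + ig (\<lambda>s. g s w) 0 t"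
    and y: "strongly_measurable half_line y" "AE t in half_line. c t = j (y t)"
    and \<rho>: "locint \<rho>" and g_le: "AE t in half_line. \<forall>v. norm v \<le> norm (y t) \<longrightarrow> norm (j v) \<le> norm (c t) \<longrightarrow> \<bar>g t v\<bar> \<le> \<rho> t"
    and T: "0 \<le> T"
  shows "(norm (c T))\<^sup>2 - (norm (c 0))\<^sup>2 = ig (\<lambda>s. 2 * g s (y s)) 0 T"
proof -
  obtain R :: "nat \<Rightarrow> 'y \<Rightarrow>\<^sub>L 'v" where R: "\<And>n x y. x \<bullet> j (R n y) = y \<bullet> j (R n x)"
    "\<And>n v. norm (R n (j v)) \<le> norm v" "\<And>n y. norm (j (R n y)) \<le> norm y" "\<And>v. (\<lambda>n. R n (j v)) \<longlonglongrightarrow> v" "\<And>y. (\<lambda>n. j (R n y)) \<longlonglongrightarrow> y"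
    using smoothing_operators[OF inj dense] by blast
  have meas: "(\<lambda>s. 2 * g s (v s)) \<in> borel_measurable half_line" if "strongly_measurable half_line v" for v
    using strongly_measurable_real[OF strongly_measurable_blinfun_apply[OF g(1) that]] by simp
  have id: "c T \<bullet> j (R n (c T)) - c 0 \<bullet> j (R n (c 0)) = ig (\<lambda>s. 2 * g s (R n (c s))) 0 T" for n
    by (rule quadratic_form_identity[OF c g weak R(1) T])
  have "(\<lambda>n. ig (\<lambda>s. 2 * g s (R n (c s))) 0 T) \<longlonglongrightarrow> ig (\<lambda>s. 2 * g s (y s)) 0 T"
  proof (rule ig_dominated_convergence)
    show "(\<lambda>s. 2 * g s (y s)) \<in> borel_measurable half_line" by (rule meas[OF y(1)])
    show "(\<lambda>s. 2 * g s (R n (c s))) \<in> borel_measurable half_line" for n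
      by (intro meas strongly_measurable_continuous continuous_intros c)
    show "locint (\<lambda>t. 2 * \<rho> t)" by (intro locint_mult \<rho>)
    show "AE r in half_line. (\<lambda>n. 2 * g r (R n (c r))) \<longlonglongrightarrow> 2 * g r (y r)"
      using y(2) by eventually_elim (auto intro!: tendsto_intros R)
    show "AE r in half_line. 0 < r \<longrightarrow> r \<le> T \<longrightarrow> \<bar>2 * g r (R n (c r))\<bar> \<le> 2 * \<rho> r" for n
      using y(2) g_le
    proof eventually_elim
      case (elim r)
      then have "\<bar>g r (R n (c r))\<bar> \<le> \<rho> r" using R(2,3) by metis
      then show ?case by (simp add: abs_mult)
    qed
  qed simp
  moreover have "(\<lambda>n. c T \<bullet> j (R n (c T)) - c 0 \<bullet> j (R n (c 0))) \<longlonglongrightarrow> c T \<bullet> c T - c 0 \<bullet> c 0"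
    by (intro tendsto_intros R)
  ultimately show ?thesis unfolding id using LIMSEQ_unique by (fastforce simp: power2_norm_eq_inner)
qed

text \<open>Dynkin's argument for the intersection-stable generator of initial intervals treats
  Borel sets; the null set case passes to the completed measure. It serves both for vanishing
  integrals and for solvability with indicator forcing.\<close>

lemma half_line_set_induct [consumes 2, case_names empty interval compl union null]:
  fixes P :: "real set \<Rightarrow> bool"
  assumes A: "A \<in> sets half_line" "A \<subseteq> {0<..T}"
    and empty: "P {}" and interval: "\<And>a. 0 \<le> a \<Longrightarrow> P {0<..a}"
    and compl: "\<And>A. P A \<Longrightarrow> A \<in> sets half_line \<Longrightarrow> A \<subseteq> {0<..T} \<Longrightarrow> P ({0<..T} - A)"
    and union: "\<And>A :: nat \<Rightarrow> real set. (\<And>i. P (A i)) \<Longrightarrow> (\<And>i. A i \<in> sets half_line) \<Longrightarrow> 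
      (\<And>i. A i \<subseteq> {0<..T}) \<Longrightarrow> disjoint_family A \<Longrightarrow> P (\<Union>i. A i)"
    and null: "\<And>A B. P A \<Longrightarrow> A \<in> sets half_line \<Longrightarrow> AE t in half_line. t \<in> A \<longleftrightarrow> t \<in> B \<Longrightarrow> 
      B \<in> sets half_line \<Longrightarrow> B \<subseteq> {0<..T} \<Longrightarrow> P B"
  shows "P A"
proof -
  have borel_half: "B \<inter> {0<..T} \<in> sets half_line" if "B \<in> sets borel" for B
    using that by (auto simp: sets_restrict_space_iff)
  have *: "P (B \<inter> {0<..T})" if "B \<in> sets borel" for B
  proof -
    have "Int_stable (range (\<lambda>a::real. {..a}))"
      by (auto simp: Int_stable_def)
    moreover have "range (\<lambda>a::real. {..a}) \<subseteq> Pow UNIV" by auto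
    moreover have "B \<in> sigma_sets UNIV (range (\<lambda>a::real. {..a}))"
      using that by (simp add: borel_eq_atMost)
    ultimately show ?thesis
    proof (induction rule: sigma_sets_induct_disjoint)
      case (basic A)
      then obtain a where a: "A = {..a}" by auto
      show ?case
      proof (cases "0 \<le> min a T")
        case True
        moreover have "A \<inter> {0<..T} = {0<..min a T}" using a by auto
        ultimately show ?thesis using interval by metis
      next
        case False
        then have "A \<inter> {0<..T} = {}" using a by auto
        then show ?thesis using empty by simp
      qed
    next
      case (compl A)
      have "A \<in> sets borel" using compl(1) by (simp add: borel_eq_atMost)
      then have "P ({0<..T} - (A \<inter> {0<..T}))"
        using compl(2) borel_half by (intro assms(5)) auto
      moreover have "{0<..T} - (A \<inter> {0<..T}) = (UNIV - A) \<inter> {0<..T}" by auto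
      ultimately show ?case by simp
    next
      case (union A)
      have "P (\<Union>i. A i \<inter> {0<..T})"
      proof (rule assms(6))
        fix i
        have "A i \<in> sets borel" using union(2) by (simp add: borel_eq_atMost subset_eq)
        then show "A i \<inter> {0<..T} \<in> sets half_line" by (rule borel_half)
      qed (use union in \<open>auto simp: disjoint_family_on_def\<close>)
      moreover have "(\<Union>i. A i \<inter> {0<..T}) = (\<Union>i. A i) \<inter> {0<..T}" by auto
      ultimately show ?case by simp
    qed (use empty in simp)
  qed
  have "A \<in> sets (completion lborel)" using A by (auto simp: sets_restrict_space_iff)
  then obtain S N N' where S: "A = S \<union> N" "N \<subseteq> N'" "N' \<in> null_sets lborel" "S \<in> sets lborel"
    by (rule sets_completionE)
  have Sb: "S \<in> sets borel" using S(4) by simp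
  show ?thesis
  proof (rule null)
    show "P (S \<inter> {0<..T})" "S \<inter> {0<..T} \<in> sets half_line" using *[OF Sb] borel_half[OF Sb] by auto
    have "N' \<in> null_sets lebesgue" using S(3) by (simp add: null_sets_completionI)
    then have "AE t in lebesgue. t \<notin> N'" by (rule AE_not_in)
    then have "AE t in half_line. t \<notin> N'" by (subst AE_restrict_space_iff) auto
    then show "AE t in half_line. (t \<in> S \<inter> {0<..T}) = (t \<in> A)"
      by eventually_elim (use S A in auto)
  qed (use A in auto)
qed

text \<open>Vanishing of the integrals over initial intervals spreads to all measurable subsets of a
  bounded interval, in particular to the sets where f is positive or negative.\<close>

lemma ig_zero_imp_AE_zero:
  assumes f: "locint f" and z: "\<And>t. 0 \<le> t \<Longrightarrow> ig f 0 t = 0"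
  shows "AE t in half_line. f t = 0"
proof -
  have fm: "f \<in> borel_measurable half_line" using f by (rule locint_measurable)
  have ae: "AE t in half_line. t \<le> real n \<longrightarrow> f t = 0" for n :: nat
  proof -
    let ?T = "real n"
    have fi: "integrable half_line (\<lambda>t. indicator {0<..?T} t * f t)"
      using f by (simp add: locint_def set_integrable_def)
    have fiA: "integrable half_line (\<lambda>t. indicator A t * f t)" if "A \<in> sets half_line" "A \<subseteq> {0<..?T}" for A
    proof -
      have "integrable half_line (\<lambda>t. indicator A t *\<^sub>R (indicator {0<..?T} t * f t))"
        using fi that by (intro integrable_mult_indicator)
      moreover have "(\<lambda>t. indicator A t *\<^sub>R (indicator {0<..?T} t * f t)) = (\<lambda>t. indicator A t * f t)"
        using that by (intro ext) (auto simp: indicator_def)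
      ultimately show ?thesis by (simp only:)
    qed
    have zero: "(LINT t|half_line. indicator A t * f t) = 0" if "A \<in> sets half_line" "A \<subseteq> {0<..?T}" for A
      using that
    proof (induction rule: half_line_set_induct)
      case empty then show ?case by simp
    next
      case (interval a)
      then show ?case using z[of a] by (simp add: ig_def set_lebesgue_integral_def)
    next
      case (compl A)
      have "(LINT t|half_line. indicator ({0<..?T} - A) t * f t) 
          = (LINT t|half_line. indicator {0<..?T} t * f t - indicator A t * f t)"
        using compl by (intro Bochner_Integration.integral_cong) (auto split: split_indicator)
      also have "\<dots> = 0" using compl fi fiA z[of ?T] by (simp add: ig_def set_lebesgue_integral_def)
      finally show ?case .
    next
      case (union A)
      have "(LINT t:(\<Union>i. A i)|half_line. f t) = (\<Sum>i. LINT t:A i|half_line. f t)"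
      proof (rule lebesgue_integral_countable_add)
        show "set_integrable half_line (\<Union>i. A i) f"
          unfolding set_integrable_def using fiA[of "\<Union>i. A i"] union by auto
      qed (use union in \<open>auto simp: disjoint_family_on_def\<close>)
      then show ?case using union by (simp add: set_lebesgue_integral_def)
    next
      case (null A B)
      have "(LINT t|half_line. indicator B t * f t) = (LINT t|half_line. indicator A t * f t)"
        using null fm by (intro integral_cong_AE) (auto elim!: eventually_mono split: split_indicator)
      then show ?case using null by simp
    qed
    have part: "AE t in half_line. indicator {t. 0 < \<sigma> * f t \<and> 0 < t \<and> t \<le> ?T} t * f t = 0" if "\<sigma> \<in> {1,-1}" for \<sigma> :: real
    proof -
      define A where "A = {t \<in> space half_line. 0 < \<sigma> * f t} \<inter> {0<..?T}"
      have A: "A \<in> sets half_line" "A \<subseteq> {0<..?T}"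
      proof -
        have "{t \<in> space half_line. 0 < \<sigma> * f t} \<in> sets half_line" using fm by measurable
        then show "A \<in> sets half_line" unfolding A_def by (intro sets.Int) auto
      qed (simp add: A_def)
      have eq: "A = {t. 0 < \<sigma> * f t \<and> 0 < t \<and> t \<le> ?T}" by (auto simp: A_def)
      have "integrable half_line (\<lambda>t. \<sigma> * (indicator A t * f t))" using fiA[OF A] by simp
      moreover have "(LINT t|half_line. \<sigma> * (indicator A t * f t)) = 0" using zero[OF A] by simp
      moreover have "AE t in half_line. 0 \<le> \<sigma> * (indicator A t * f t)"
        by (intro AE_I2) (auto simp: A_def split: split_indicator)
      ultimately have "AE t in half_line. \<sigma> * (indicator A t * f t) = 0"
        using integral_nonneg_eq_0_iff_AE by blast
      then show ?thesis unfolding eq using that by (auto elim!: eventually_mono)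
    qed
    from part[of 1, simplified] part[of "-1", simplified] AE_half_line_pos show ?thesis
    proof eventually_elim
      case (elim t)
      then show ?case by (cases "f t" "0::real" rule: linorder_cases) (auto split: split_indicator_asm)
    qed
  qed
  have "AE t in half_line. \<forall>n::nat. t \<le> real n \<longrightarrow> f t = 0" unfolding AE_all_countable using ae by blast
  then show ?thesis by eventually_elim (use real_arch_simple in blast)
qed

section \<open>Test functions\<close>

text \<open>\<open>bump 1 0\<close> is the standard mollifier exp(-1 / (x (1 - x))) on (0, 1). The
  polynomial and the power are parameters so that the family is closed under differentiation, which
  makes its members smooth.\<close>

definition bump :: "real poly \<Rightarrow> nat \<Rightarrow> real \<Rightarrow> real" where
  "bump P n x = (if 0 < x \<and> x < 1 then poly P x / (x * (1 - x)) ^ n * exp (- 1 / (x * (1 - x))) else 0)"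

text \<open>The exponential decays faster than any power of x (1 - x). Quadratic vanishing at 0 and
  at 1 is what makes the derivative there exist and equal 0.\<close>

lemma bump_bound: "\<exists>K\<ge>0. \<forall>x. \<bar>bump P n x\<bar> \<le> K * x\<^sup>2 \<and> \<bar>bump P n x\<bar> \<le> K * (1 - x)\<^sup>2"
proof -
  have "bounded (poly P ` {0..1})"
    by (intro compact_imp_bounded compact_continuous_image continuous_intros) auto
  then obtain C where C: "\<forall>y\<in>poly P ` {0..1}. norm y \<le> C" unfolding bounded_iff by blast
  then have C0: "C \<ge> 0" by (smt (verit) atLeastAtMost_iff imageI norm_ge_zero)
  \<comment> \<open>Of the m factors gained from the exponential, n cancel the denominator and two
    remain for the quadratic bound.\<close>
  define m where "m = n + 2"
  have b: "\<bar>bump P n x\<bar> \<le> C * real m ^ m * (x * (1 - x))\<^sup>2" for x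
  proof (cases "0 < x \<and> x < 1")
    case True
    define D where "D = x * (1 - x)"
    have D: "D > 0" using True by (simp add: D_def)
    have "(1 / (real m * D)) ^ m \<le> (1 + (1 / D) / real m) ^ m"
      using D by (intro power_mono) (auto simp: m_def field_simps)
    also have "\<dots> \<le> exp (1 / D)" using D by (intro exp_ge_one_plus_x_over_n_power_n) (auto simp: m_def intro: order_trans[of _ 0])
    finally have "1 / (real m * D) ^ m \<le> exp (1 / D)" by (simp only: power_one_over)
    moreover have "0 < 1 / (real m * D) ^ m" using D by (simp add: m_def)
    ultimately have "inverse (exp (1 / D)) \<le> inverse (1 / (real m * D) ^ m)" by (rule le_imp_inverse_le)
    then have "exp (- (1 / D)) \<le> (real m * D) ^ m" by (simp only: exp_minus inverse_divide div_by_1)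
    then have "exp (- 1 / D) / D ^ n \<le> (real m * D) ^ m / D ^ n"
      using D by (intro divide_right_mono) auto
    also have "\<dots> = real m ^ m * D\<^sup>2" using D by (simp add: m_def power_add power_mult_distrib power2_eq_square)
    finally have "\<bar>poly P x\<bar> * (exp (- 1 / D) / D ^ n) \<le> C * (real m ^ m * D\<^sup>2)"
      using C True C0 D by (intro mult_mono) auto
    then show ?thesis using True D by (simp add: bump_def D_def[symmetric] abs_mult abs_divide mult.assoc)
  qed (use C0 in \<open>auto simp: bump_def\<close>)
  define K where "K = C * real m ^ m"
  have K: "K \<ge> 0" using C0 by (simp add: K_def)
  have "\<bar>bump P n x\<bar> \<le> K * x\<^sup>2 \<and> \<bar>bump P n x\<bar> \<le> K * (1 - x)\<^sup>2" for x
  proof (cases "0 < x \<and> x < 1")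
    case True
    have "(x * (1 - x))\<^sup>2 \<le> x\<^sup>2" "(x * (1 - x))\<^sup>2 \<le> (1 - x)\<^sup>2"
      using True by (auto intro!: power_mono simp: mult_left_le mult_left_le_one_le)
    then show ?thesis using b[of x] K unfolding K_def[symmetric] by (meson mult_left_mono order_trans)
  qed (use K in \<open>auto simp: bump_def\<close>)
  then show ?thesis using K by blast
qed

lemma DERIV_zero_of_quadratic_bound:
  fixes f :: "real \<Rightarrow> real"
  assumes "\<And>x. \<bar>f x\<bar> \<le> K * (x - x0)\<^sup>2"
  shows "(f has_real_derivative 0) (at x0)"
  unfolding has_field_derivative_iff
proof (rule Lim_null_comparison)
  have f0: "f x0 = 0" using assms[of x0] by simp
  show "\<forall>\<^sub>F x in at x0. norm ((f x - f x0) / (x - x0)) \<le> K * \<bar>x - x0\<bar>"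
  proof (rule eventually_at_topological[THEN iffD2], intro exI[of _ UNIV] conjI ballI impI)
    fix x assume "x \<noteq> x0"
    then show "norm ((f x - f x0) / (x - x0)) \<le> K * \<bar>x - x0\<bar>"
      using assms[of x] f0 by (simp add: abs_divide divide_le_eq power2_eq_square mult.assoc abs_mult_self_eq flip: abs_mult)
  qed auto
  show "((\<lambda>x. K * \<bar>x - x0\<bar>) \<longlongrightarrow> 0) (at x0)"
    by (rule tendsto_eq_intros refl | simp)+
qed

lemma bump_formula_has_derivative:
  fixes p g :: "real \<Rightarrow> real"
  assumes "(p has_real_derivative p') (at x)" "(g has_real_derivative g') (at x)" "g x = d" "d > 0"
  shows "((\<lambda>x. p x / g x ^ n * exp (- 1 / g x)) has_real_derivative
    ((p' * d ^ n - p x * (of_nat n * d ^ (n - 1) * g')) / (d ^ n * d ^ n) * exp (- 1 / d)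
      + p x / d ^ n * (exp (- 1 / d) * (g' / (d * d))))) (at x)"
proof -
  have gx: "g x > 0" using assms by simp
  have "((\<lambda>x. p x / g x ^ n) has_real_derivative (p' * g x ^ n - p x * (of_nat n * g x ^ (n - 1) * g')) / (g x ^ n * g x ^ n)) (at x)"
    using gx by (auto intro!: derivative_eq_intros assms(1,2) simp: algebra_simps)
  moreover have "((\<lambda>x. exp (- 1 / g x)) has_real_derivative exp (- 1 / g x) * (g' / (g x * g x))) (at x)"
    using gx by (auto intro!: derivative_eq_intros assms(1,2))
  ultimately show ?thesis using DERIV_mult assms(3) by (fastforce simp: algebra_simps)
qed

lemma bump_formula_simp:
  fixes d p p' s E :: real
  assumes d: "d > 0"
  shows "(p' * d ^ n - p * (of_nat n * d ^ (n - 1) * s)) / (d ^ n * d ^ n) * E + p / d ^ n * (E * (s / (d * d)))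
    = (p' * d\<^sup>2 - real n * p * s * d + p * s) / d ^ (n + 2) * E"
proof -
  define Z where "Z = d ^ n"
  have Z: "Z > 0" using d by (simp add: Z_def)
  have *: "real n * d ^ (n - 1) = real n * Z / d" using d by (cases n) (auto simp: Z_def)
  have "(p' * Z - p * (real n * Z / d * s)) / (Z * Z) * E + p / Z * (E * (s / (d * d)))
    = (p' * d\<^sup>2 - real n * p * s * d + p * s) / (Z * d\<^sup>2) * E"
    using Z d by (simp add: field_simps power2_eq_square)
  then show ?thesis unfolding * power_add by (simp add: Z_def)
qed

lemma bump_has_derivative: "\<exists>Q m. \<forall>x. (bump P n has_real_derivative bump Q m x) (at x)"
proof -
  define D :: "real poly" where "D = [:0, 1, -1:]"
  define D' :: "real poly" where "D' = [:1, -2:]"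
  define Q where "Q = pderiv P * D\<^sup>2 - of_nat n * P * D' * D + P * D'"
  have Dx: "poly D x = x * (1 - x)" "poly D' x = 1 - 2 * x" for x by (simp_all add: D_def D'_def algebra_simps)
  have "(bump P n has_real_derivative bump Q (n + 2) x) (at x)" for x
  proof (cases "0 < x \<and> x < 1")
    case True
    define d where "d = x * (1 - x)"
    have d: "d > 0" using True by (simp add: d_def)
    have "((\<lambda>x. poly P x / (x * (1 - x)) ^ n * exp (- 1 / (x * (1 - x)))) has_real_derivative
        ((poly (pderiv P) x * d ^ n - poly P x * (of_nat n * d ^ (n - 1) * (1 - 2 * x))) / (d ^ n * d ^ n) * exp (- 1 / d)
          + poly P x / d ^ n * (exp (- 1 / d) * ((1 - 2 * x) / (d * d))))) (at x)"
      by (rule bump_formula_has_derivative[OF poly_DERIV _ _ d]) (auto intro!: derivative_eq_intros simp: d_def)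
    moreover have "(poly (pderiv P) x * d ^ n - poly P x * (of_nat n * d ^ (n - 1) * (1 - 2 * x))) / (d ^ n * d ^ n) * exp (- 1 / d)
          + poly P x / d ^ n * (exp (- 1 / d) * ((1 - 2 * x) / (d * d))) = bump Q (n + 2) x"
    proof -
      have "poly Q x = poly (pderiv P) x * d\<^sup>2 - real n * poly P x * (1 - 2 * x) * d + poly P x * (1 - 2 * x)"
        by (simp add: Q_def Dx d_def of_nat_poly)
      then have "bump Q (n + 2) x = (poly (pderiv P) x * d\<^sup>2 - real n * poly P x * (1 - 2 * x) * d + poly P x * (1 - 2 * x)) / d ^ (n + 2) * exp (- 1 / d)"
        using True unfolding bump_def d_def[symmetric] by simp
      then show ?thesis unfolding bump_formula_simp[OF d] by simp
    qed
    ultimately have "((\<lambda>x. poly P x / (x * (1 - x)) ^ n * exp (- 1 / (x * (1 - x)))) has_real_derivative bump Q (n + 2) x) (at x)"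
      by simp
    then show ?thesis
      by (rule has_field_derivative_transform_within_open[where S = "{0<..<1}"]) (use True in \<open>auto simp: bump_def\<close>)
  next
    case False
    then consider "x < 0" | "x > 1" | "x = 0" | "x = 1" by linarith
    then show ?thesis
    proof cases
      case 1
      have "((\<lambda>_. 0) has_real_derivative 0) (at x)" by simp
      then have "(bump P n has_real_derivative 0) (at x)"
        by (rule has_field_derivative_transform_within_open[where S = "{..<0}"]) (use 1 in \<open>auto simp: bump_def\<close>)
      then show ?thesis using 1 by (simp add: bump_def)
    next
      case 2
      have "((\<lambda>_. 0) has_real_derivative 0) (at x)" by simp
      then have "(bump P n has_real_derivative 0) (at x)"
        by (rule has_field_derivative_transform_within_open[where S = "{1<..}"]) (use 2 in \<open>auto simp: bump_def\<close>)
      then show ?thesis using 2 by (simp add: bump_def)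
    next
      case 3
      obtain K where "\<forall>x. \<bar>bump P n x\<bar> \<le> K * x\<^sup>2" using bump_bound by blast
      then show ?thesis using DERIV_zero_of_quadratic_bound[of "bump P n" K 0] 3 by (simp add: bump_def)
    next
      case 4
      obtain K where "\<forall>x. \<bar>bump P n x\<bar> \<le> K * (1 - x)\<^sup>2" using bump_bound by blast
      then show ?thesis using DERIV_zero_of_quadratic_bound[of "bump P n" K 1] 4 
        by (simp add: bump_def power2_commute)
    qed
  qed
  then show ?thesis by blast
qed

lemma derivative_closed_imp_smooth:
  fixes F :: "(real \<Rightarrow> real) set"
  assumes F: "\<And>f. f \<in> F \<Longrightarrow> \<exists>g\<in>F. \<forall>x. (f has_real_derivative g x) (at x)" and f: "f \<in> F"
  shows "(deriv ^^ n) f field_differentiable at x"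
proof -
  have "(deriv ^^ n) f \<in> F"
    using f
  proof (induction n arbitrary: f)
    case (Suc n)
    obtain g where g: "g \<in> F" "\<forall>x. (f has_real_derivative g x) (at x)" using F Suc.prems by blast
    then have "deriv f = g" by (auto intro!: DERIV_imp_deriv)
    then show ?case using Suc.IH[OF g(1)] by (simp add: funpow_swap1)
  qed simp
  then show ?thesis using F field_differentiable_def by blast
qed

lemma bump_continuous: "continuous_on S (bump P n)"
proof -
  obtain Q m where "\<And>x. (bump P n has_real_derivative bump Q m x) (at x)" using bump_has_derivative by blast
  then show ?thesis by (intro DERIV_continuous_on) (rule has_field_derivative_at_within)
qed

lemma smooth_step_exists:
  "\<exists>\<Psi> :: real \<Rightarrow> real. (\<forall>x. (\<Psi> has_real_derivative bump 1 0 x) (at x)) \<and> (\<forall>x\<le>0. \<Psi> x = 0) \<and>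
    (\<exists>I>0. (\<forall>x\<ge>1. \<Psi> x = I) \<and> (\<forall>x. 0 \<le> \<Psi> x \<and> \<Psi> x \<le> I))"
proof -
  let ?\<psi> = "bump 1 0"
  note cont = bump_continuous[of _ 1 0]
  \<comment> \<open>The lower limit -1 lies to the left of the support, so that x is an interior
    point of [-1, x + 1] even for x = 0 and the derivative is two-sided.\<close>
  define \<Psi> where "\<Psi> x = integral {-1..x} ?\<psi>" for x
  have zero: "\<Psi> x = 0" if "x \<le> 0" for x
  proof -
    have "\<Psi> x = integral {-1..x} (\<lambda>_. 0 :: real)" unfolding \<Psi>_def
      using that by (intro Henstock_Kurzweil_Integration.integral_cong) (auto simp: bump_def)
    then show ?thesis by simp
  qed
  have der: "(\<Psi> has_real_derivative ?\<psi> x) (at x)" for x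
  proof (cases "x < 0")
    case True
    have "((\<lambda>_. 0) has_real_derivative 0) (at x)" by simp
    then have "(\<Psi> has_real_derivative 0) (at x)"
      by (rule has_field_derivative_transform_within_open[where S = "{..<0}"]) (use True zero in auto)
    then show ?thesis using True by (simp add: bump_def)
  next
    case False
    have "(\<Psi> has_real_derivative ?\<psi> x) (at x within {-1..x+1})"
      unfolding \<Psi>_def[abs_def] using False by (intro integral_has_real_derivative cont) auto
    moreover have "at x within {-1..x+1} = at x" using False by (intro at_within_interior) auto
    ultimately show ?thesis by simp
  qed
  have nn: "0 \<le> ?\<psi> x" for x by (simp add: bump_def)
  have mono: "\<Psi> x \<le> \<Psi> y" if "x \<le> y" for x y
    by (rule DERIV_nonneg_imp_nondecreasing[OF that]) (use der nn in blast)
  have const: "\<Psi> x = \<Psi> 1" if "x \<ge> 1" for x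
  proof (cases "x = 1")
    case False
    then have "1 < x" using that by simp
    then obtain z where "1 < z" "z < x" "\<Psi> x - \<Psi> 1 = (x - 1) * ?\<psi> z"
      using MVT2[of 1 x \<Psi> ?\<psi>] der by blast
    then show ?thesis by (simp add: bump_def)
  qed simp
  obtain z where "0 < z" "z < 1" "\<Psi> 1 - \<Psi> 0 = (1 - 0) * ?\<psi> z"
    using MVT2[of 0 1 \<Psi> ?\<psi>] der zero_less_one by blast
  then have "\<Psi> 1 > 0" using zero[of 0] by (simp add: bump_def)
  moreover have "0 \<le> \<Psi> x \<and> \<Psi> x \<le> \<Psi> 1" for x
    using mono[of "min x 0" x] zero[of "min x 0"] mono[of x "max x 1"] const[of "max x 1"] by auto
  ultimately show ?thesis using der zero const by blast
qed

text \<open>The mean value theorem writes an increment of F as (t - s) f z, and uniform continuity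
  of f compares this with the integral.\<close>

lemma ig_FTC:
  assumes der: "\<And>x. (F has_real_derivative f x) (at x)" and cont: "continuous_on UNIV f" and st: "0 \<le> s" "s \<le> t"
  shows "F t - F s = ig f s t"
proof -
  have lf: "locint f" using cont by (intro locint_continuous) (auto intro: continuous_on_subset)
  have "F T - F 0 = ig f 0 T" if T: "0 \<le> T" for T
  proof (rule increments_imp_integral[OF lf _ T, of "\<lambda>_. 1"])
    fix \<epsilon> :: real assume \<epsilon>: "\<epsilon> > 0"
    have "uniformly_continuous_on {0..T} f"
      by (intro compact_uniformly_continuous continuous_on_subset[OF cont]) auto
    then obtain \<delta> where \<delta>: "\<delta> > 0" 
      and uc: "\<And>s t. s \<in> {0..T} \<Longrightarrow> t \<in> {0..T} \<Longrightarrow> dist s t < \<delta> \<Longrightarrow> dist (f s) (f t) < \<epsilon>"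
      using \<epsilon> unfolding uniformly_continuous_on_def by metis
    have "\<bar>F t - F s - ig f s t\<bar> \<le> \<epsilon> * ig (\<lambda>_. 1) s t" if st: "0 \<le> s" "s \<le> t" "t \<le> T" "t - s < \<delta>" for s t
    proof (cases "s = t")
      case False
      then obtain z where z: "s < z" "z < t" "F t - F s = (t - s) * f z"
        using MVT2[of s t F f] der st by auto
      have "F t - F s - ig f s t = ig (\<lambda>r. f z - f r) s t"
        using st z ig_const[of s t "f z"] ig_diff[OF locint_const lf, of s "f z" t] by (simp add: mult.commute)
      also have "\<bar>\<dots>\<bar> \<le> ig (\<lambda>r. \<bar>f z - f r\<bar>) s t" 
        using st by (intro ig_abs_le locint_diff lf) auto
      also have "\<dots> \<le> ig (\<lambda>r. \<epsilon>) s t"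
      proof (rule ig_mono)
        fix r assume r: "s < r" "r \<le> t"
        then have "\<bar>z - r\<bar> < \<delta>" using z st by linarith
        then show "\<bar>f z - f r\<bar> \<le> \<epsilon>" using uc[of z r] z st r by (simp add: dist_real_def)
      qed (use st in \<open>auto intro!: locint_abs locint_diff lf\<close>)
      finally show ?thesis using st by (simp add: ig_const)
    qed simp
    then show "\<exists>\<delta>>0. \<forall>s t. 0 \<le> s \<longrightarrow> s \<le> t \<longrightarrow> t \<le> T \<longrightarrow> t - s < \<delta> \<longrightarrow>
      \<bar>F t - F s - ig f s t\<bar> \<le> \<epsilon> * ig (\<lambda>_. 1) s t" using \<delta> by blast
  qed auto
  from this[of t] this[of s] show ?thesis using ig_split[OF lf, of 0 s t] st by simp
qed

text \<open>
  A smoothed indicator of (s, t]: its derivative is the difference of approximate identities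
  at s and at t.
\<close>

lemma smooth_indicator_exists:
  assumes st: "0 < s" "s < t" and e: "0 < \<epsilon>"
  shows "\<exists>\<phi> k l. test_function \<phi> \<and> (\<forall>r. deriv \<phi> r = k r - l r) \<and>
    continuous_on UNIV k \<and> continuous_on UNIV l \<and> (\<forall>r. 0 \<le> k r \<and> 0 \<le> l r) \<and>
    (\<forall>r. r \<notin> {s<..s+\<epsilon>} \<longrightarrow> k r = 0) \<and> (\<forall>r. r \<notin> {t<..t+\<epsilon>} \<longrightarrow> l r = 0) \<and>
    ig k s (s+\<epsilon>) = 1 \<and> ig l t (t+\<epsilon>) = 1 \<and> (\<forall>r. \<bar>\<phi> r\<bar> \<le> 1) \<and>
    (\<forall>r. r \<notin> {s<..t+\<epsilon>} \<longrightarrow> \<phi> r = 0) \<and> (\<forall>r. s + \<epsilon> \<le> r \<longrightarrow> r \<le> t \<longrightarrow> \<phi> r = 1)"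
proof -
  obtain \<Psi> :: "real \<Rightarrow> real" and I where d: "\<And>x. (\<Psi> has_real_derivative bump 1 0 x) (at x)" 
    and z: "\<And>x. x \<le> 0 \<Longrightarrow> \<Psi> x = 0" and I: "I > 0" "\<And>x. x \<ge> 1 \<Longrightarrow> \<Psi> x = I" "\<And>x. 0 \<le> \<Psi> x" "\<And>x. \<Psi> x \<le> I"
    using smooth_step_exists by metis
  define \<theta> where "\<theta> u r = \<Psi> ((r - u) / \<epsilon>) / I" for u r
  define \<kappa> where "\<kappa> u r = bump 1 0 ((r - u) / \<epsilon>) / (\<epsilon> * I)" for u r
  define \<phi> where "\<phi> r = \<theta> s r - \<theta> t r" for r
  have affine: "((\<lambda>r. A * f ((r - s) / \<epsilon>) + B * f ((r - t) / \<epsilon>)) has_real_derivative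
      (A / \<epsilon>) * g ((x - s) / \<epsilon>) + (B / \<epsilon>) * g ((x - t) / \<epsilon>)) (at x)"
    if fg: "\<And>x. (f has_real_derivative g x) (at x)" for f g :: "real \<Rightarrow> real" and A B x
  proof -
    have "((\<lambda>r. f ((r - u) / \<epsilon>)) has_real_derivative g ((x - u) / \<epsilon>) * (1 / \<epsilon>)) (at x)" for u
      by (rule DERIV_chain2[OF fg]) (use e in \<open>auto intro!: derivative_eq_intros\<close>)
    then show ?thesis by (auto intro!: derivative_eq_intros simp: mult.commute)
  qed
  have \<theta>d: "(\<theta> u has_real_derivative \<kappa> u x) (at x)" for u x
  proof -
    have "((\<lambda>r. \<Psi> ((r - u) / \<epsilon>)) has_real_derivative bump 1 0 ((x - u) / \<epsilon>) * (1 / \<epsilon>)) (at x)"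
      by (rule DERIV_chain2[OF d]) (use e in \<open>auto intro!: derivative_eq_intros\<close>)
    from DERIV_cdivide[OF this, of I] show ?thesis by (simp add: \<theta>_def[abs_def] \<kappa>_def)
  qed
  have \<phi>d: "deriv \<phi> r = \<kappa> s r - \<kappa> t r" for r
    unfolding \<phi>_def[abs_def] by (rule DERIV_imp_deriv[OF DERIV_diff[OF \<theta>d \<theta>d]])
  have \<kappa>c: "continuous_on UNIV (\<kappa> u)" for u
    unfolding \<kappa>_def[abs_def] using e I
    by (intro continuous_intros continuous_on_compose2[OF bump_continuous[of UNIV]]) auto
  have \<kappa>0: "\<kappa> u r = 0" if "r \<notin> {u<..u+\<epsilon>}" for u r
    using that e by (auto simp: \<kappa>_def bump_def field_simps)
  have \<kappa>nn: "0 \<le> \<kappa> u r" for u r using e I by (simp add: \<kappa>_def bump_def)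
  have \<kappa>1: "ig (\<kappa> u) u (u + \<epsilon>) = 1" if "0 < u" for u
    using ig_FTC[OF \<theta>d \<kappa>c, of u "u + \<epsilon>" u] that e I z[of 0] by (simp add: \<theta>_def)
  have \<theta>01: "0 \<le> \<theta> u r" "\<theta> u r \<le> 1" for u r using I by (auto simp: \<theta>_def)
  have \<theta>0: "\<theta> u r = 0" if "r \<le> u" for u r using that e z by (simp add: \<theta>_def divide_le_0_iff)
  have \<theta>1: "\<theta> u r = 1" if "r \<ge> u + \<epsilon>" for u r using that e I by (simp add: \<theta>_def)
  have "test_function \<phi>"
    unfolding test_function_def
  proof
    \<comment> \<open>A class closed under differentiation that contains phi: the derivative of the
      step is a bump, that of a bump is a bump, and the rescaling only changes the
      coefficients.\<close>
    define F where "F = {(\<lambda>r. A * f ((r - s) / \<epsilon>) + B * f ((r - t) / \<epsilon>)) | A B f. f \<in> insert \<Psi> (range (case_prod bump))}"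
    have "\<phi> = (\<lambda>r. (1 / I) * \<Psi> ((r - s) / \<epsilon>) + (- 1 / I) * \<Psi> ((r - t) / \<epsilon>))"
      by (auto simp: \<phi>_def \<theta>_def)
    then have \<phi>F: "\<phi> \<in> F" unfolding F_def by blast
    have "\<exists>g\<in>F. \<forall>x. (f has_real_derivative g x) (at x)" if "f \<in> F" for f
    proof -
      obtain A B h where f: "f = (\<lambda>r. A * h ((r - s) / \<epsilon>) + B * h ((r - t) / \<epsilon>))" 
        and h: "h \<in> insert \<Psi> (range (case_prod bump))" using \<open>f \<in> F\<close> unfolding F_def by blast
      have "\<exists>h'\<in>range (case_prod bump). \<forall>x. (h has_real_derivative h' x) (at x)"
      proof (cases "h = \<Psi>")
        case True then show ?thesis using d by (intro bexI[of _ "bump 1 0"]) (auto intro: image_eqI[of _ _ "(1, 0)"])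
      next
        case False
        then obtain P n where "h = bump P n" using h by auto
        moreover obtain Q m where "\<forall>x. (bump P n has_real_derivative bump Q m x) (at x)" using bump_has_derivative by blast
        ultimately show ?thesis by (intro bexI[of _ "bump Q m"]) (auto intro: image_eqI[of _ _ "(Q, m)"])
      qed
      then obtain h' where h': "h' \<in> range (case_prod bump)" "\<And>x. (h has_real_derivative h' x) (at x)" by blast
      have "(\<lambda>r. (A / \<epsilon>) * h' ((r - s) / \<epsilon>) + (B / \<epsilon>) * h' ((r - t) / \<epsilon>)) \<in> F"
        unfolding F_def using h'(1) by blast
      moreover have "(f has_real_derivative (A / \<epsilon>) * h' ((x - s) / \<epsilon>) + (B / \<epsilon>) * h' ((x - t) / \<epsilon>)) (at x)" for x
        unfolding f by (rule affine[OF h'(2)])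
      ultimately show ?thesis by (intro bexI) (rule allI)
    qed
    from derivative_closed_imp_smooth[OF this \<phi>F]
    show "\<forall>n x. (deriv ^^ n) \<phi> field_differentiable at x" by blast
    show "\<exists>a b. 0 < a \<and> a < b \<and> (\<forall>x. x \<notin> {a..b} \<longrightarrow> \<phi> x = 0)"
      using st e \<theta>0 \<theta>1 by (intro exI[of _ s] exI[of _ "t + \<epsilon>"]) (auto simp: \<phi>_def not_le)
  qed
  moreover have "\<bar>\<phi> r\<bar> \<le> 1" for r using \<theta>01[of s r] \<theta>01[of t r] unfolding \<phi>_def by linarith
  moreover have "\<phi> r = 0" if "r \<notin> {s<..t+\<epsilon>}" for r
    using that st e \<theta>0[of r s] \<theta>0[of r t] \<theta>1[of s r] \<theta>1[of t r] by (auto simp: \<phi>_def not_le)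
  moreover have "\<phi> r = 1" if "s + \<epsilon> \<le> r" "r \<le> t" for r
    using that \<theta>0 \<theta>1 by (auto simp: \<phi>_def)
  ultimately show ?thesis using \<phi>d \<kappa>c \<kappa>nn \<kappa>0 \<kappa>1 st
    by (intro exI[of _ \<phi>] exI[of _ "\<kappa> s"] exI[of _ "\<kappa> t"]) (auto simp: )
qed


section \<open>Integration by parts against test functions and the du Bois-Reymond lemma\<close>

lemma test_function_derivative:
  assumes "test_function \<phi>"
  shows "(\<phi> has_real_derivative deriv \<phi> x) (at x)" "continuous_on UNIV (deriv \<phi>)" "continuous_on UNIV \<phi>"
proof -
  have d: "(deriv ^^ n) \<phi> field_differentiable at x" for n x using assms by (simp add: test_function_def)
  show *: "(\<phi> has_real_derivative deriv \<phi> x) (at x)" for x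
    using d[of 0 x] by (simp add: field_differentiable_derivI)
  show "continuous_on UNIV (deriv \<phi>)"
    using d[of 1] by (intro continuous_at_imp_continuous_on) (auto intro: field_differentiable_imp_continuous_at)
  show "continuous_on UNIV \<phi>"
    using * by (intro continuous_at_imp_continuous_on) (auto intro: DERIV_isCont)
qed

lemma test_function_support:
  assumes "test_function \<phi>"
  shows "\<exists>a b. 0 < a \<and> a < b \<and> (\<forall>x. x \<le> a \<longrightarrow> \<phi> x = 0 \<and> deriv \<phi> x = 0) \<and> (\<forall>x\<ge>b. \<phi> x = 0 \<and> deriv \<phi> x = 0)"
proof -
  obtain a b where ab: "0 < a" "a < b" "\<And>x. x \<notin> {a..b} \<Longrightarrow> \<phi> x = 0"
    using assms by (auto simp: test_function_def)
  have d: "deriv \<phi> x = 0" if "x \<notin> {a..b}" for x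
  proof -
    have "((\<lambda>_. 0) has_real_derivative 0) (at x)" by simp
    then have "(\<phi> has_real_derivative 0) (at x)"
      by (rule has_field_derivative_transform_within_open[where S = "- {a..b}"]) (use that ab in auto)
    then show ?thesis by (rule DERIV_imp_deriv)
  qed
  \<comment> \<open>Halving a and adding 1 to b puts all points in question strictly outside the
    interval of support, where the derivative vanishes by openness.\<close>
  show ?thesis using ab d by (intro exI[of _ "a / 2"] exI[of _ "b + 1"]) auto
qed

lemma integral_eq_ig:
  assumes "0 \<le> T" "\<And>r. r > T \<Longrightarrow> f r = 0"
  shows "(LINT t|half_line. f t) = ig f 0 T"
  unfolding ig_def set_lebesgue_integral_def using assms
  by (intro Bochner_Integration.integral_cong) (auto split: split_indicator)

lemma integrable_of_locint:
  assumes f: "locint f" and "\<And>r. r > T \<Longrightarrow> f r = 0"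
  shows "integrable half_line f"
proof -
  have "integrable half_line (\<lambda>t. indicator {0<..T} t *\<^sub>R f t)"
    using f by (simp add: locint_def set_integrable_def)
  then show ?thesis
    by (rule Bochner_Integration.integrable_cong[THEN iffD1, rotated 2]) (use assms in \<open>auto split: split_indicator\<close>)
qed

lemma integrable_test_function_mult:
  assumes "test_function \<phi>" "locint G"
  shows "integrable half_line (\<lambda>t. \<phi> t * G t)"
proof -
  obtain b where b: "\<forall>x\<ge>b. \<phi> x = 0" using test_function_support[OF assms(1)] by blast
  have "locint (\<lambda>t. G t * \<phi> t)"
    using test_function_derivative(3)[OF assms(1)] by (intro locint_mult_continuous assms(2)) (auto intro: continuous_on_subset)
  then have "integrable half_line (\<lambda>t. G t * \<phi> t)" by (rule integrable_of_locint[where T = b]) (use b in auto)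
  then show ?thesis by (simp add: mult.commute)
qed

text \<open>h is only the primitive of an integrable function, so the product rule comes from
  increments: phi and h are uniformly continuous on [0, b], and the boundary terms vanish with
  phi.\<close>

lemma integration_by_parts_test_function:
  assumes h: "continuous_on {0..} h" and G: "locint G" and hG: "\<And>t. 0 \<le> t \<Longrightarrow> h t = h 0 + ig G 0 t"
    and \<phi>: "test_function \<phi>"
  shows "(LINT t|half_line. deriv \<phi> t * h t) = - (LINT t|half_line. \<phi> t * G t)"
proof -
  obtain a b where ab: "0 < a" "a < b" "\<forall>x. x \<le> a \<longrightarrow> \<phi> x = 0 \<and> deriv \<phi> x = 0"
    "\<forall>x\<ge>b. \<phi> x = 0 \<and> deriv \<phi> x = 0" using test_function_support[OF \<phi>] by blast
  note d = test_function_derivative[OF \<phi>]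
  have b0: "0 \<le> b" using ab by simp
  have c: "continuous_on {0..} \<phi>" "continuous_on {0..} (deriv \<phi>)" using d by (auto intro: continuous_on_subset)
  have l1: "locint (\<lambda>r. G r * \<phi> r)" by (intro locint_mult_continuous G c)
  have l2: "locint (\<lambda>r. deriv \<phi> r * h r)" by (intro locint_continuous continuous_intros c h)
  have ld: "locint (deriv \<phi>)" by (intro locint_continuous c)
  have lK: "locint (\<lambda>r. G r * \<phi> r + deriv \<phi> r * h r)" by (intro locint_add l1 l2)
  have "\<phi> b * h b - \<phi> 0 * h 0 = ig (\<lambda>r. G r * \<phi> r + deriv \<phi> r * h r) 0 b"
  proof (rule increments_imp_integral[OF lK _ b0, of "\<lambda>r. \<bar>G r\<bar> + \<bar>deriv \<phi> r\<bar>"])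
    show "locint (\<lambda>r. \<bar>G r\<bar> + \<bar>deriv \<phi> r\<bar>)" by (intro locint_add locint_abs G ld)
    fix \<epsilon> :: real assume \<epsilon>: "\<epsilon> > 0"
    have "uniformly_continuous_on {0..b} (\<lambda>r. (\<phi> r, h r))"
      by (intro compact_uniformly_continuous continuous_intros continuous_on_subset[OF c(1)] continuous_on_subset[OF h]) auto
    then obtain \<delta> where \<delta>: "\<delta> > 0" 
      and uc: "\<And>s t. s \<in> {0..b} \<Longrightarrow> t \<in> {0..b} \<Longrightarrow> dist s t < \<delta> \<Longrightarrow> dist (\<phi> s, h s) (\<phi> t, h t) < \<epsilon>"
      using \<epsilon> unfolding uniformly_continuous_on_def by metis
    have uc': "\<bar>\<phi> s - \<phi> t\<bar> \<le> \<epsilon> \<and> \<bar>h s - h t\<bar> \<le> \<epsilon>" if "s \<in> {0..b}" "t \<in> {0..b}" "dist s t < \<delta>" for s t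
      using uc[OF that] dist_fst_le[of "(\<phi> s, h s)" "(\<phi> t, h t)"] dist_snd_le[of "(\<phi> s, h s)" "(\<phi> t, h t)"]
      by (simp add: dist_real_def)
    have "\<bar>\<phi> t * h t - \<phi> s * h s - ig (\<lambda>r. G r * \<phi> r + deriv \<phi> r * h r) s t\<bar> \<le> \<epsilon> * ig (\<lambda>r. \<bar>G r\<bar> + \<bar>deriv \<phi> r\<bar>) s t"
      if st: "0 \<le> s" "s \<le> t" "t \<le> b" "t - s < \<delta>" for s t
    proof -
      have "h t - h s = ig G s t" using hG[of t] hG[of s] ig_split[OF G, of 0 s t] st by simp
      moreover have "\<phi> t - \<phi> s = ig (deriv \<phi>) s t" using ig_FTC[OF d(1,2)] st by simp
      moreover have "\<phi> t * h t - \<phi> s * h s = \<phi> t * (h t - h s) + h s * (\<phi> t - \<phi> s)" by (simp add: algebra_simps)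
      ultimately have "\<phi> t * h t - \<phi> s * h s = ig (\<lambda>r. \<phi> t * G r + h s * deriv \<phi> r) s t"
        using ig_add[OF locint_mult[OF G] locint_mult[OF ld]] st by (simp add: ig_mult)
      then have eq: "\<phi> t * h t - \<phi> s * h s - ig (\<lambda>r. G r * \<phi> r + deriv \<phi> r * h r) s t =
          ig (\<lambda>r. (\<phi> t * G r + h s * deriv \<phi> r) - (G r * \<phi> r + deriv \<phi> r * h r)) s t"
        using ig_diff[OF locint_add[OF locint_mult[OF G] locint_mult[OF ld]] lK] st by simp
      have "\<bar>\<phi> t * h t - \<phi> s * h s - ig (\<lambda>r. G r * \<phi> r + deriv \<phi> r * h r) s t\<bar>
          \<le> ig (\<lambda>r. \<bar>(\<phi> t * G r + h s * deriv \<phi> r) - (G r * \<phi> r + deriv \<phi> r * h r)\<bar>) s t"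
        unfolding eq using st by (intro ig_abs_le locint_diff lK locint_add locint_mult G ld)
      also have "\<dots> \<le> ig (\<lambda>r. \<epsilon> * (\<bar>G r\<bar> + \<bar>deriv \<phi> r\<bar>)) s t"
      proof (rule ig_mono)
        fix r assume r: "s < r" "r \<le> t"
        have "(\<phi> t * G r + h s * deriv \<phi> r) - (G r * \<phi> r + deriv \<phi> r * h r) = (\<phi> t - \<phi> r) * G r + (h s - h r) * deriv \<phi> r"
          by (simp add: algebra_simps)
        also have "\<bar>\<dots>\<bar> \<le> \<bar>\<phi> t - \<phi> r\<bar> * \<bar>G r\<bar> + \<bar>h s - h r\<bar> * \<bar>deriv \<phi> r\<bar>"
          by (simp add: abs_mult[symmetric] abs_triangle_ineq)
        also have "\<dots> \<le> \<epsilon> * \<bar>G r\<bar> + \<epsilon> * \<bar>deriv \<phi> r\<bar>"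
        proof (intro add_mono mult_right_mono)
          show "\<bar>\<phi> t - \<phi> r\<bar> \<le> \<epsilon>" using uc'[of t r] st r by (simp add: dist_real_def)
          show "\<bar>h s - h r\<bar> \<le> \<epsilon>" using uc'[of s r] st r by (simp add: dist_real_def)
        qed auto
        finally show "\<bar>(\<phi> t * G r + h s * deriv \<phi> r) - (G r * \<phi> r + deriv \<phi> r * h r)\<bar> \<le> \<epsilon> * (\<bar>G r\<bar> + \<bar>deriv \<phi> r\<bar>)"
          by (simp add: distrib_left)
      qed (use st in \<open>auto intro!: locint_abs locint_mult locint_diff lK locint_add G ld\<close>)
      finally show ?thesis by (simp add: ig_mult)
    qed
    then show "\<exists>\<delta>>0. \<forall>s t. 0 \<le> s \<longrightarrow> s \<le> t \<longrightarrow> t \<le> b \<longrightarrow> t - s < \<delta> \<longrightarrow>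
      \<bar>\<phi> t * h t - \<phi> s * h s - ig (\<lambda>r. G r * \<phi> r + deriv \<phi> r * h r) s t\<bar> \<le> \<epsilon> * ig (\<lambda>r. \<bar>G r\<bar> + \<bar>deriv \<phi> r\<bar>) s t"
      using \<delta> by blast
  qed
  then have "ig (\<lambda>r. G r * \<phi> r) 0 b + ig (\<lambda>r. deriv \<phi> r * h r) 0 b = 0"
    using ab ig_add[OF l1 l2, of 0 b] by simp
  moreover have "(LINT t|half_line. deriv \<phi> t * h t) = ig (\<lambda>r. deriv \<phi> r * h r) 0 b"
    using ab b0 by (intro integral_eq_ig) auto
  moreover have "(LINT t|half_line. \<phi> t * G t) = ig (\<lambda>r. G r * \<phi> r) 0 b"
    using ab b0 by (subst mult.commute, intro integral_eq_ig) auto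
  ultimately show ?thesis by simp
qed

text \<open>Testing with smoothed indicators of (s, t] and letting their width tend to 0 yields the
  increment of h over [s, t]. Test functions vanish near 0, so the initial time is reached only
  afterwards, by s tending to 0 and the continuity of h there.\<close>

lemma du_Bois_Reymond:
  assumes h: "continuous_on {0..} h" and G: "locint G"
    and eq: "\<And>\<phi>. test_function \<phi> \<Longrightarrow> (LINT t|half_line. deriv \<phi> t * h t) = - (LINT t|half_line. \<phi> t * G t)"
    and t: "0 \<le> t"
  shows "h t = h 0 + ig G 0 t"
proof -
  have pos: "h t - h s = ig G s t" if st: "0 < s" "s < t" for s
  proof -
    define \<epsilon> where "\<epsilon> n = 1 / real (Suc n)" for n
    have \<epsilon>: "\<epsilon> n > 0" "\<epsilon> n \<le> 1" for n by (simp_all add: \<epsilon>_def)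
    have \<epsilon>lim: "\<epsilon> \<longlonglongrightarrow> 0" unfolding \<epsilon>_def using LIMSEQ_inverse_real_of_nat by (simp add: inverse_eq_divide)
    have \<epsilon>small: "\<forall>\<^sub>F n in sequentially. \<epsilon> n < e" if "e > 0" for e using \<epsilon>lim that by (rule order_tendstoD)
    have "\<forall>n. \<exists>\<phi> k l. test_function \<phi> \<and> (\<forall>r. deriv \<phi> r = k r - l r) \<and>
      continuous_on UNIV k \<and> continuous_on UNIV l \<and> (\<forall>r. 0 \<le> k r \<and> 0 \<le> l r) \<and>
      (\<forall>r. r \<notin> {s<..s+\<epsilon> n} \<longrightarrow> k r = 0) \<and> (\<forall>r. r \<notin> {t<..t+\<epsilon> n} \<longrightarrow> l r = 0) \<and>
      ig k s (s+\<epsilon> n) = 1 \<and> ig l t (t+\<epsilon> n) = 1 \<and> (\<forall>r. \<bar>\<phi> r\<bar> \<le> 1) \<and>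
      (\<forall>r. r \<notin> {s<..t+\<epsilon> n} \<longrightarrow> \<phi> r = 0) \<and> (\<forall>r. s + \<epsilon> n \<le> r \<longrightarrow> r \<le> t \<longrightarrow> \<phi> r = 1)"
      using smooth_indicator_exists[OF st \<epsilon>(1)] by blast
    then obtain \<phi> k l where all: "\<And>n. test_function (\<phi> n) \<and> (\<forall>r. deriv (\<phi> n) r = k n r - l n r) \<and>
      continuous_on UNIV (k n) \<and> continuous_on UNIV (l n) \<and> (\<forall>r. 0 \<le> k n r \<and> 0 \<le> l n r) \<and>
      (\<forall>r. r \<notin> {s<..s+\<epsilon> n} \<longrightarrow> k n r = 0) \<and> (\<forall>r. r \<notin> {t<..t+\<epsilon> n} \<longrightarrow> l n r = 0) \<and>
      ig (k n) s (s+\<epsilon> n) = 1 \<and> ig (l n) t (t+\<epsilon> n) = 1 \<and> (\<forall>r. \<bar>(\<phi> n) r\<bar> \<le> 1) \<and>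
      (\<forall>r. r \<notin> {s<..t+\<epsilon> n} \<longrightarrow> (\<phi> n) r = 0) \<and> (\<forall>r. s + \<epsilon> n \<le> r \<longrightarrow> r \<le> t \<longrightarrow> (\<phi> n) r = 1)"
      by metis
    have \<phi>: "\<And>n. test_function (\<phi> n)" "\<And>n r. deriv (\<phi> n) r = k n r - l n r"
      and k: "\<And>n. continuous_on UNIV (k n)" "\<And>n r. 0 \<le> k n r" "\<And>n r. r \<notin> {s<..s+\<epsilon> n} \<Longrightarrow> k n r = 0" "\<And>n. ig (k n) s (s+\<epsilon> n) = 1"
      and l: "\<And>n. continuous_on UNIV (l n)" "\<And>n r. 0 \<le> l n r" "\<And>n r. r \<notin> {t<..t+\<epsilon> n} \<Longrightarrow> l n r = 0" "\<And>n. ig (l n) t (t+\<epsilon> n) = 1"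
      and \<phi>1: "\<And>n r. \<bar>\<phi> n r\<bar> \<le> 1" "\<And>n r. r \<notin> {s<..t+\<epsilon> n} \<Longrightarrow> \<phi> n r = 0" "\<And>n r. s + \<epsilon> n \<le> r \<Longrightarrow> r \<le> t \<Longrightarrow> \<phi> n r = 1"
      using all by auto
    have kh: "integrable half_line (\<lambda>r. k r * h r)" if "continuous_on UNIV k" "\<And>r. r \<notin> {u<..u+e} \<Longrightarrow> k r = 0" for k u e
      using that h by (intro integrable_of_locint[of _ "u + e"] locint_continuous continuous_intros) (auto intro: continuous_on_subset)
    \<comment> \<open>The functions \<open>k n\<close> form a one-sided approximate identity: unit
      mass concentrated just to the right of u.\<close>
    have approx: "(\<lambda>n. LINT r|half_line. k n r * h r) \<longlonglongrightarrow> h u"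
      if u: "0 < u" and k: "\<And>n. continuous_on UNIV (k n)" "\<And>n r. 0 \<le> k n r" "\<And>n r. r \<notin> {u<..u+\<epsilon> n} \<Longrightarrow> k n r = 0" "\<And>n. ig (k n) u (u+\<epsilon> n) = 1"
      for u and k :: "nat \<Rightarrow> real \<Rightarrow> real"
    proof (rule LIMSEQ_I)
      fix e :: real assume e: "e > 0"
      have "isCont h u" using h u by (simp add: continuous_on_interior interior_Ici)
      then obtain d where d: "d > 0" "\<And>r. \<bar>r - u\<bar> < d \<Longrightarrow> \<bar>h r - h u\<bar> < e / 2"
        using e unfolding continuous_at_eps_delta dist_real_def by (metis half_gt_zero)
      obtain N where N: "\<And>n. n \<ge> N \<Longrightarrow> \<epsilon> n < d" using \<epsilon>small[OF d(1)] by (auto simp: eventually_sequentially)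
      have "norm ((LINT r|half_line. k n r * h r) - h u) < e" if n: "n \<ge> N" for n
      proof -
        have kc: "continuous_on {0..} (k n)" using k(1) by (rule continuous_on_subset) auto
        have lk: "locint (\<lambda>r. k n r * h r)" "locint (\<lambda>r. h u * k n r)" "locint (k n)"
          by (auto intro!: locint_continuous continuous_intros kc h)
        have kI: "(LINT r|half_line. k n r * h r) = ig (\<lambda>r. k n r * h r) u (u + \<epsilon> n)"
          unfolding ig_def set_lebesgue_integral_def using k(3)
          by (intro Bochner_Integration.integral_cong) (auto split: split_indicator)
        have lk2: "locint (\<lambda>r. (e / 2) * k n r)" by (intro locint_mult lk)
        have "(LINT r|half_line. k n r * h r) - h u = ig (\<lambda>r. k n r * h r - h u * k n r) u (u + \<epsilon> n)"
          using kI ig_diff[OF lk(1,2)] u k(4)[of n] by (simp add: ig_mult)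
        also have "\<bar>\<dots>\<bar> \<le> ig (\<lambda>r. \<bar>k n r * h r - h u * k n r\<bar>) u (u + \<epsilon> n)"
          using u by (intro ig_abs_le locint_diff lk) auto
        also have "\<dots> \<le> ig (\<lambda>r. (e / 2) * k n r) u (u + \<epsilon> n)"
        proof (rule ig_mono)
          fix r assume r: "u < r" "r \<le> u + \<epsilon> n"
          have "\<bar>k n r * h r - h u * k n r\<bar> = \<bar>h r - h u\<bar> * k n r"
            using k(2)[of n r] by (simp add: abs_mult[symmetric] algebra_simps flip: abs_of_nonneg)
              (metis abs_mult abs_of_nonneg left_diff_distrib mult.commute)
          also have "\<dots> \<le> (e / 2) * k n r" using d(2)[of r] r N[OF n] k(2)[of n r] by (intro mult_right_mono) auto
          finally show "\<bar>k n r * h r - h u * k n r\<bar> \<le> (e / 2) * k n r" .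
        qed (use u lk2 in \<open>auto intro!: locint_abs locint_diff lk\<close>)
        also have "\<dots> < e" using e k(4)[of n] by (simp only: ig_mult)
        finally show ?thesis by simp
      qed
      then show "\<exists>no. \<forall>n\<ge>no. norm ((LINT r|half_line. k n r * h r) - h u) < e" by blast
    qed
    have "(\<lambda>n. LINT r|half_line. deriv (\<phi> n) r * h r) \<longlonglongrightarrow> h s - h t"
    proof -
      have "(LINT r|half_line. deriv (\<phi> n) r * h r) = (LINT r|half_line. k n r * h r) - (LINT r|half_line. l n r * h r)" for n
        unfolding \<phi> left_diff_distrib by (intro Bochner_Integration.integral_diff kh[OF k(1,3)] kh[OF l(1,3)])
      then show ?thesis using approx[OF st(1) k] approx[OF order.strict_trans[OF st] l] by (auto intro: tendsto_diff)
    qed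
    moreover have "(\<lambda>n. LINT r|half_line. \<phi> n r * G r) \<longlonglongrightarrow> ig G s t"
      unfolding ig_def set_lebesgue_integral_def
    proof (rule integral_dominated_convergence[where w = "\<lambda>r. \<bar>indicator {0<..t+1} r *\<^sub>R G r\<bar>"])
      show "integrable half_line (\<lambda>r. \<bar>indicator {0<..t+1} r *\<^sub>R G r\<bar>)"
        using G by (intro integrable_abs) (simp add: locint_def set_integrable_def)
      show "(\<lambda>x. indicat_real {s<..t} x *\<^sub>R G x) \<in> borel_measurable half_line"
        using locint_measurable[OF G] st by simp
      show "(\<lambda>r. \<phi> n r * G r) \<in> borel_measurable half_line" for n
        using integrable_test_function_mult[OF \<phi>(1) G] by (rule borel_measurable_integrable)
      show "AE r in half_line. norm (\<phi> n r * G r) \<le> \<bar>indicator {0<..t+1} r *\<^sub>R G r\<bar>" for n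
      proof (rule AE_I2)
        fix r assume "r \<in> space half_line"
        have "\<bar>\<phi> n r\<bar> \<le> indicator {0<..t+1} r"
          using \<phi>1(1)[of n r] \<phi>1(2)[of r n] st \<epsilon>(2)[of n] by (auto split: split_indicator)
        then show "norm (\<phi> n r * G r) \<le> \<bar>indicator {0<..t+1} r *\<^sub>R G r\<bar>"
          by (simp add: abs_mult mult_right_mono)
      qed
      show "AE r in half_line. (\<lambda>n. \<phi> n r * G r) \<longlonglongrightarrow> indicator {s<..t} r *\<^sub>R G r"
      proof (rule AE_I2)
        fix r :: real
        have "\<forall>\<^sub>F n in sequentially. \<phi> n r = indicator {s<..t} r"
        proof (cases "r \<le> s")
          case True then show ?thesis using \<phi>1(2) by (auto intro!: always_eventually)
        next
          case rs: False
          show ?thesis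
          proof (cases "r \<le> t")
            case True
            have "\<forall>\<^sub>F n in sequentially. \<epsilon> n < r - s" using rs by (intro \<epsilon>small) auto
            then show ?thesis by eventually_elim (use \<phi>1(3) True rs in auto)
          next
            case False
            have "\<forall>\<^sub>F n in sequentially. \<epsilon> n < r - t" using False by (intro \<epsilon>small) auto
            then show ?thesis by eventually_elim (use \<phi>1(2) False rs in auto)
          qed
        qed
        then have "(\<lambda>n. \<phi> n r) \<longlonglongrightarrow> indicator {s<..t} r" by (rule tendsto_eventually)
        then show "(\<lambda>n. \<phi> n r * G r) \<longlonglongrightarrow> indicator {s<..t} r *\<^sub>R G r" by (auto intro: tendsto_mult_right)
      qed
    qed
    ultimately have "h s - h t = - ig G s t"
      unfolding eq[OF \<phi>(1)] using LIMSEQ_unique tendsto_minus by blast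
    then show ?thesis by simp
  qed
  show ?thesis
  proof (cases "t = 0")
    case False
    then have t0: "t > 0" using t by simp
    \<comment> \<open>The offset 2 keeps s n strictly below t, also for n = 0.\<close>
    define s where "s n = t / real (n + 2)" for n
    have s: "0 < s n" "s n < t" for n using t0 by (simp_all add: s_def field_simps add_pos_nonneg)
    have slim: "s \<longlonglongrightarrow> 0"
      unfolding s_def using tendsto_mult_right[OF LIMSEQ_ignore_initial_segment[OF lim_inverse_n, of 2], of t] 
      by (simp add: divide_inverse add.commute mult.commute)
    have "(\<lambda>n. h (s n)) \<longlonglongrightarrow> h 0"
      using h slim by (rule continuous_on_tendsto_compose) (use s in \<open>auto intro!: always_eventually less_imp_le\<close>)
    then have "(\<lambda>n. h t - h (s n)) \<longlonglongrightarrow> h t - h 0" by (intro tendsto_intros)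
    moreover have "(\<lambda>n. ig G (s n) t) \<longlonglongrightarrow> ig G 0 t"
    proof -
      have "(\<lambda>n. ig (\<lambda>r. indicator {s n<..} r * G r) 0 t) \<longlonglongrightarrow> ig G 0 t"
      proof (rule ig_dominated_convergence[where w = "\<lambda>r. \<bar>G r\<bar>"])
        show "AE r in half_line. (\<lambda>n. indicator {s n<..} r * G r) \<longlonglongrightarrow> G r"
        proof (rule AE_I2)
          fix r assume "r \<in> space half_line"
          then have "\<forall>\<^sub>F n in sequentially. s n < r" using order_tendstoD(2)[OF slim, of r] by simp
          then have "\<forall>\<^sub>F n in sequentially. indicator {s n<..} r * G r = G r"
            by eventually_elim auto
          then show "(\<lambda>n. indicator {s n<..} r * G r) \<longlonglongrightarrow> G r" by (rule tendsto_eventually)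
        qed
        show "(\<lambda>r. indicator {s n<..} r * G r) \<in> borel_measurable half_line" for n
        proof -
          have "{s n<..} \<in> sets half_line" using s[of n] by (auto simp: sets_restrict_space_iff)
          then show ?thesis using locint_measurable[OF G] by simp
        qed
      qed (use G in \<open>auto intro!: locint_abs locint_measurable AE_I2 split: split_indicator\<close>)
      moreover have "ig (\<lambda>r. indicator {s n<..} r * G r) 0 t = ig G (s n) t" for n
        unfolding ig_def set_lebesgue_integral_def using s[of n]
        by (intro Bochner_Integration.integral_cong) (auto split: split_indicator)
      ultimately show ?thesis by simp
    qed
    ultimately have "h t - h 0 = ig G 0 t" unfolding pos[OF s] by (rule LIMSEQ_unique)
    then show ?thesis by simp
  qed simp
qed

section \<open>Weak derivatives\<close>

lemma to_dual_apply [simp]: "to_dual j x w = x \<bullet> j w"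
  by (simp add: to_dual_def)

lemma bounded_linear_to_dual: "bounded_linear (to_dual j)"
  unfolding to_dual_def[abs_def]
  by (intro bounded_linear_intros)

lemma norm_to_dual_le: 
  fixes j :: "'v::real_inner \<Rightarrow>\<^sub>L 'y::real_inner"
  shows "norm (to_dual j x) \<le> norm j * norm x"
proof -
  have *: "norm (to_dual j x w) \<le> norm j * norm x * norm w" for w
  proof -
    have "\<bar>x \<bullet> j w\<bar> \<le> norm x * norm (j w)" by (rule Cauchy_Schwarz_ineq2)
    also have "\<dots> \<le> norm x * (norm j * norm w)" by (intro mult_left_mono norm_blinfun) auto
    finally show ?thesis by (simp add: algebra_simps)
  qed
  show ?thesis by (rule norm_blinfun_bound[OF _ *]) simp
qed

lemma bounded_bilinear_to_blinfun:
  fixes b :: "'v::real_normed_vector \<Rightarrow> 'v \<Rightarrow> real"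
  assumes "bounded_bilinear b"
  shows "\<exists>L :: 'v \<Rightarrow>\<^sub>L 'v \<Rightarrow>\<^sub>L real. \<forall>v w. L v w = b v w"
proof -
  interpret b: bounded_bilinear b by fact
  obtain K where K: "\<And>x y. norm (b x y) \<le> norm x * norm y * K" using b.bounded by blast
  define L where "L v = Blinfun (b v)" for v
  have L: "L v w = b v w" for v w
    unfolding L_def by (simp add: bounded_linear_Blinfun_apply b.bounded_linear_right)
  have "bounded_linear L"
  proof (rule bounded_linear_intro)
    show "L (x + y) = L x + L y" for x y by (rule blinfun_eqI) (simp add: L b.add_left blinfun.add_left)
    show "L (r *\<^sub>R x) = r *\<^sub>R L x" for r x by (rule blinfun_eqI) (simp add: L b.scaleR_left blinfun.scaleR_left)
    show "norm (L x) \<le> norm x * \<bar>K\<bar>" for x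
    proof (rule norm_blinfun_bound)
      fix w :: 'v
      have "norm x * norm w * K \<le> norm x * norm w * \<bar>K\<bar>" by (intro mult_left_mono) auto
      with K[of x w] show "norm (L x w) \<le> norm x * \<bar>K\<bar> * norm w" by (simp add: L algebra_simps)
    qed simp
  qed
  then show ?thesis using L by (intro exI[of _ "Blinfun L"]) (simp add: bounded_linear_Blinfun_apply)
qed

lemma locint_blinfun_apply:
  assumes "strongly_measurable half_line g" "locint (\<lambda>t. norm (g t))"
  shows "locint (\<lambda>t. blinfun_apply (g t) w :: real)"
proof (rule locint_bound)
  show "locint (\<lambda>t. norm w * norm (g t))" by (intro locint_mult assms)
  show "(\<lambda>t. g t w) \<in> borel_measurable half_line"
    by (intro strongly_measurable_real strongly_measurable_blinfun_apply assms) simp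
  show "AE t in half_line. \<bar>g t w\<bar> \<le> norm w * norm (g t)"
    using abs_blinfun_le[of "g _" w] by (intro AE_I2) (simp add: mult.commute)
qed

lemma integral_mult_cong_AE:
  fixes f g h :: "real \<Rightarrow> real"
  assumes "f \<in> borel_measurable half_line" "h \<in> borel_measurable half_line" "AE t in half_line. h t = g t"
  shows "(LINT t|half_line. f t * h t) = (LINT t|half_line. f t * g t)"
  using assms half_line_measurable_AE_eq[OF assms(2,3)]
  by (intro integral_cong_AE) (auto elim: eventually_mono)

lemma test_function_measurable:
  assumes "test_function \<phi>"
  shows "\<phi> \<in> borel_measurable half_line" "deriv \<phi> \<in> borel_measurable half_line"
  using test_function_derivative(2,3)[OF assms]
  by (auto intro!: locint_measurable locint_continuous intro: continuous_on_subset)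

text \<open>The bridge between the distributional definition of W_inf and the integrated equation on
  which all estimates work. Continuity of c up to 0 brings in the initial value, which test
  functions do not see.\<close>

lemma has_weak_derivative_iff_integrated:
  fixes j :: "'v::real_inner \<Rightarrow>\<^sub>L 'y::real_inner"
  assumes g: "strongly_measurable half_line g" "locint (\<lambda>t. norm (g t))"
    and c: "continuous_on {0..} c" "AE t in half_line. c t = j (y t)"
  shows "has_weak_derivative j y g \<longleftrightarrow> (\<forall>w t. 0 \<le> t \<longrightarrow> c t \<bullet> j w = c 0 \<bullet> j w + ig (\<lambda>s. g s w) 0 t)"
proof -
  have lg: "locint (\<lambda>s. g s w)" for w by (rule locint_blinfun_apply[OF g])
  have hc: "continuous_on {0..} (\<lambda>t. c t \<bullet> j w)" for w by (intro continuous_intros c)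
  have eq: "(LINT t|half_line. deriv \<phi> t * (c t \<bullet> j w)) = (LINT t|half_line. deriv \<phi> t * to_dual j (j (y t)) w)"
    if "test_function \<phi>" for \<phi> w
    using c(2) by (intro integral_mult_cong_AE test_function_measurable[OF that] locint_measurable locint_continuous hc)
      (auto elim: eventually_mono)
  show ?thesis
  proof
    assume "has_weak_derivative j y g"
    then have "\<And>\<phi> w. test_function \<phi> \<Longrightarrow> (LINT t|half_line. deriv \<phi> t * (c t \<bullet> j w)) = - (LINT t|half_line. \<phi> t * g t w)"
      unfolding has_weak_derivative_def by (simp only: eq)
    then show "\<forall>w t. 0 \<le> t \<longrightarrow> c t \<bullet> j w = c 0 \<bullet> j w + ig (\<lambda>s. g s w) 0 t"
      using du_Bois_Reymond[OF hc lg] by blast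
  next
    assume "\<forall>w t. 0 \<le> t \<longrightarrow> c t \<bullet> j w = c 0 \<bullet> j w + ig (\<lambda>s. g s w) 0 t"
    then have "\<And>\<phi> w. test_function \<phi> \<Longrightarrow> (LINT t|half_line. deriv \<phi> t * (c t \<bullet> j w)) = - (LINT t|half_line. \<phi> t * g t w)"
      using integration_by_parts_test_function[OF hc lg] by blast
    then show "has_weak_derivative j y g" unfolding has_weak_derivative_def by (simp add: eq)
  qed
qed

lemma blinfun_norming_sequence:
  fixes d :: "'v::real_normed_vector \<Rightarrow>\<^sub>L real"
  shows "\<exists>w :: nat \<Rightarrow> 'v. \<forall>n. norm (w n) \<le> 1 \<and> norm d \<le> d (w n) + 1 / real (Suc n)"
proof (rule choice, rule allI)
  fix n
  show "\<exists>w. norm w \<le> 1 \<and> norm d \<le> d w + 1 / real (Suc n)"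
  proof (cases "norm d \<le> 1 / real (Suc n)")
    case True then show ?thesis by (intro exI[of _ 0]) simp
  next
    case False
    define K where "K = norm d - 1 / real (Suc n)"
    have K: "K \<ge> 0" "K < norm d" using False by (simp_all add: K_def)
    have "\<exists>x. \<not> norm (d x) \<le> K * norm x"
      using norm_blinfun_bound[OF K(1), of d] K(2) by (meson not_le)
    then obtain x where x: "K * norm x < \<bar>d x\<bar>" by (auto simp: not_le)
    then have x0: "norm x > 0" by (cases "x = 0") auto
    define w where "w = (sgn (d x) / norm x) *\<^sub>R x"
    have "norm w \<le> 1" using x0 by (simp add: w_def abs_sgn_eq)
    moreover have "d w = \<bar>d x\<bar> / norm x" by (simp add: w_def blinfun.scaleR_right abs_sgn)
    then have "K * norm x \<le> d w * norm x" using x x0 by simp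
    then have "K \<le> d w" using x0 by simp
    ultimately show ?thesis by (intro exI[of _ w]) (simp add: K_def)
  qed
qed

text \<open>
  A strongly measurable function has an essentially separable range, and countably many vectors
  are norming for that range, so the exceptional sets can be united.
\<close>

lemma blinfun_AE_zero:
  fixes g :: "real \<Rightarrow> 'v::real_normed_vector \<Rightarrow>\<^sub>L real"
  assumes g: "strongly_measurable half_line g" and z: "\<And>w. AE t in half_line. g t w = 0"
  shows "AE t in half_line. g t = 0"
proof -
  obtain D where D: "countable D" "AE t in half_line. g t \<in> closure D"
    using strongly_measurable_essentially_separable[OF g] by blast
  obtain w :: "('v \<Rightarrow>\<^sub>L real) \<Rightarrow> nat \<Rightarrow> 'v" where w: "\<And>d n. norm (w d n) \<le> 1 \<and> norm d \<le> d (w d n) + 1 / real (Suc n)"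
    using blinfun_norming_sequence by metis
  have "AE t in half_line. \<forall>d\<in>D. \<forall>n. g t (w d n) = 0"
    using z D(1) by (simp add: AE_ball_countable AE_all_countable)
  with D(2) show ?thesis
  proof eventually_elim
    case (elim t)
    have "norm (g t) \<le> e" if e: "e > 0" for e
    proof -
      have "e / 3 > 0" using e by simp
      then obtain d where d: "d \<in> D" "dist d (g t) < e / 3"
        using elim(1) unfolding closure_approachable by blast
      obtain n where "inverse (real (Suc n)) < e / 3"
        using reals_Archimedean[OF \<open>e / 3 > 0\<close>] by blast
      then have n: "1 / real (Suc n) < e / 3" by (simp only: inverse_eq_divide)
      have "d (w d n) = (d - g t) (w d n)" using elim(2) d(1) by (simp add: blinfun.diff_left)
      also have "\<dots> \<le> norm (d - g t) * norm (w d n)" using abs_blinfun_le by (smt (verit))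
      also have "\<dots> \<le> norm (d - g t) * 1" using w by (intro mult_left_mono) auto
      finally have "norm d \<le> 2 * e / 3" using w[of d n] n d(2) by (simp add: dist_norm)
      moreover have "norm (g t) \<le> norm d + norm (d - g t)" using norm_triangle_ineq4[of d "d - g t"] by simp
      ultimately show ?thesis using d(2) by (simp add: dist_norm)
    qed
    from this[of "norm (g t) / 2"] show ?case by (cases "g t = 0") auto
  qed
qed

text \<open>No continuous representative of y is at hand here; the du Bois-Reymond lemma is applied
  to the zero function, of which the difference of g and h, tested with w, is a weak
  derivative.\<close>

lemma weak_derivative_AE_unique:
  assumes g: "strongly_measurable half_line g" "locint (\<lambda>t. norm (g t))" "has_weak_derivative j y g"
    and h: "strongly_measurable half_line h" "locint (\<lambda>t. norm (h t))" "has_weak_derivative j y h"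
  shows "AE t in half_line. g t = h t"
proof -
  have "AE t in half_line. g t w - h t w = 0" for w
  proof (rule ig_zero_imp_AE_zero)
    have lg: "locint (\<lambda>s. g s w)" "locint (\<lambda>s. h s w)" using locint_blinfun_apply g h by auto
    show l: "locint (\<lambda>t. g t w - h t w)" by (intro locint_diff lg)
    fix t :: real assume t: "0 \<le> t"
    have "(0::real) = 0 + ig (\<lambda>t. g t w - h t w) 0 t"
    proof (rule du_Bois_Reymond[OF _ l _ t, of "\<lambda>_. 0"])
      fix \<phi> assume \<phi>: "test_function \<phi>"
      have "(LINT t|half_line. \<phi> t * (g t w - h t w)) = (LINT t|half_line. \<phi> t * g t w) - (LINT t|half_line. \<phi> t * h t w)"
        unfolding right_diff_distrib
        by (intro Bochner_Integration.integral_diff integrable_test_function_mult lg \<phi>)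
      also have "\<dots> = 0"
      proof -
        have "(LINT t|half_line. deriv \<phi> t * to_dual j (j (y t)) w) = - (LINT t|half_line. \<phi> t * g t w)"
          using g(3) \<phi> unfolding has_weak_derivative_def by blast
        moreover have "(LINT t|half_line. deriv \<phi> t * to_dual j (j (y t)) w) = - (LINT t|half_line. \<phi> t * h t w)"
          using h(3) \<phi> unfolding has_weak_derivative_def by blast
        ultimately show ?thesis by simp
      qed
      finally show "(LINT t|half_line. deriv \<phi> t * 0) = - (LINT t|half_line. \<phi> t * (g t w - h t w))" by simp
    qed simp
    then show "ig (\<lambda>t. g t w - h t w) 0 t = 0" by simp
  qed
  then have "AE t in half_line. g t - h t = 0"
    by (intro blinfun_AE_zero strongly_measurable_diff g h) (simp add: blinfun.diff_left)
  then show ?thesis by eventually_elim simp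
qed

lemma weak_derivative_AE_eq:
  assumes g: "in_L2 g" "has_weak_derivative j y g"
  shows "AE t in half_line. weak_derivative j y t = g t" "in_L2 (weak_derivative j y)" "has_weak_derivative j y (weak_derivative j y)"
proof -
  have "in_L2 (weak_derivative j y) \<and> has_weak_derivative j y (weak_derivative j y)"
    unfolding weak_derivative_def by (rule someI[of _ g]) (use g in blast)
  then show "in_L2 (weak_derivative j y)" "has_weak_derivative j y (weak_derivative j y)"
    "AE t in half_line. weak_derivative j y t = g t"
    using g by (auto intro!: weak_derivative_AE_unique[of _ j y] in_L2_meas locint_norm_L2)
qed

section \<open>A priori estimates for the linear problem\<close>

text \<open>
  In the application, b is the form of the negative of the closed-loop operator A_Pi, and the
  Lyapunov inequality is what remains of the Riccati equation.
\<close>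

locale stable_form =
  fixes j :: "'v::{real_inner,complete_space} \<Rightarrow>\<^sub>L 'y::{real_inner,complete_space}"
    and b :: "'v \<Rightarrow> 'v \<Rightarrow> real" and P :: "'y \<Rightarrow>\<^sub>L 'y" and \<nu> lam :: real
  assumes inj: "inj (blinfun_apply j)" and dense: "closure (range (blinfun_apply j)) = UNIV"
    and b: "bounded_bilinear b" and \<nu>: "\<nu> > 0" and lam: "lam \<ge> 0"
    and coercive: "\<And>v. \<nu> * (norm v)\<^sup>2 - lam * (norm (j v))\<^sup>2 \<le> b v v"
    and P_sym: "\<And>x y. P x \<bullet> y = x \<bullet> P y" and P_nonneg: "\<And>x. 0 \<le> x \<bullet> P x"
    and lyapunov: "\<And>u z. (\<And>w. b u w = - (z \<bullet> j w)) \<Longrightarrow> 2 * (z \<bullet> P (j u)) \<le> - (norm (j u))\<^sup>2"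
begin

sublocale b: bounded_bilinear b by (rule b)

definition L1 :: "(real \<Rightarrow> 'y) \<Rightarrow> bool" where
  "L1 f \<longleftrightarrow> strongly_measurable half_line f \<and> integrable half_line (\<lambda>t. norm (f t))"

definition L1_norm :: "(real \<Rightarrow> 'y) \<Rightarrow> real" where
  "L1_norm f = (LINT t|half_line. norm (f t))"

text \<open>c is the representative of y that is continuous with values in Y.\<close>

definition weak_solution :: "(real \<Rightarrow> 'v) \<Rightarrow> (real \<Rightarrow> 'y) \<Rightarrow> (real \<Rightarrow> 'y) \<Rightarrow> bool" where
  "weak_solution y c f \<longleftrightarrow> in_L2 y \<and> continuous_on {0..} c \<and> (AE t in half_line. c t = j (y t)) \<and> L1 f \<and>
    (\<forall>w t. 0 \<le> t \<longrightarrow> c t \<bullet> j w = c 0 \<bullet> j w + ig (\<lambda>s. - b (y s) w + f s \<bullet> j w) 0 t)"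

text \<open>\<open>J n\<close> is the resolvent of the operator of -b at mu n, and
  \<open>J' n\<close> that of the adjoint problem; mu n j J n are the Yosida approximations of the
  identity. Constructed from the form rather than from a semigroup, they map Y into V.\<close>

lemma resolvents:
  obtains \<mu> :: "nat \<Rightarrow> real" and J J' :: "nat \<Rightarrow> 'y \<Rightarrow>\<^sub>L 'v"
  where "\<And>n. \<mu> n > 0"
    and "\<And>n y w. \<mu> n * (j (J n y) \<bullet> j w) + b (J n y) w = y \<bullet> j w"
    and "\<And>n y w. \<mu> n * (j w \<bullet> j (J' n y)) + b w (J' n y) = y \<bullet> j w"
    and "\<And>n y. norm (\<mu> n *\<^sub>R j (J n y)) \<le> 2 * norm y"
    and "\<And>y. (\<lambda>n. \<mu> n *\<^sub>R j (J n y)) \<longlonglongrightarrow> y"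
proof -
  \<comment> \<open>Half of mu n dominates lam, which gives the bound 2 uniformly in n; the summand
    n drives mu n to infinity.\<close>
  define \<mu> where "\<mu> n = 2 * lam + 1 + real n" for n :: nat
  have \<mu>: "\<mu> n \<ge> 2 * lam + 1" "\<mu> n > 0" for n using lam by (simp_all add: \<mu>_def)
  let ?a = "\<lambda>n v w. \<mu> n * (j v \<bullet> j w) + b v w"
  have bil: "bounded_bilinear (?a n)" for n
    by (intro bounded_bilinear_add bounded_bilinear_scale bounded_bilinear_inner_pullback b)
  have bil': "bounded_bilinear (\<lambda>v w. ?a n w v)" for n
    using bounded_bilinear.flip[OF bil[of n]] .
  have co: "\<nu> * (norm v)\<^sup>2 \<le> ?a n v v" for n v
  proof -
    have "lam * (norm (j v))\<^sup>2 \<le> \<mu> n * (norm (j v))\<^sup>2" using \<mu>(1)[of n] lam by (intro mult_right_mono) auto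
    then show ?thesis using coercive[of v] by (simp add: power2_norm_eq_inner)
  qed
  obtain J where J: "\<And>n y w. ?a n (blinfun_apply (J n) y) w = y \<bullet> j w"
    using lax_milgram_operator[OF bil \<nu> co] by metis
  obtain J' where J': "\<And>n y w. ?a n w (blinfun_apply (J' n) y) = y \<bullet> j w"
    using lax_milgram_operator[OF bil' \<nu> co] by metis
  have bound: "norm (\<mu> n *\<^sub>R j (J n y)) \<le> 2 * norm y" for n y
  proof -
    let ?u = "J n y"
    have "\<mu> n * (norm (j ?u))\<^sup>2 - lam * (norm (j ?u))\<^sup>2 \<le> y \<bullet> j ?u"
      using J[of n y ?u] coercive[of ?u] \<nu> by (smt (verit) power2_norm_eq_inner mult_nonneg_nonneg zero_le_power2)
    moreover have "lam * (norm (j ?u))\<^sup>2 \<le> (\<mu> n / 2) * (norm (j ?u))\<^sup>2" 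
      using \<mu>(1)[of n] by (intro mult_right_mono) auto
    ultimately have "(\<mu> n / 2) * (norm (j ?u))\<^sup>2 \<le> y \<bullet> j ?u" by simp
    also have "\<dots> \<le> norm y * norm (j ?u)" by (rule norm_cauchy_schwarz)
    finally have "(\<mu> n * norm (j ?u)) * norm (j ?u) \<le> (2 * norm y) * norm (j ?u)"
      by (simp add: power2_eq_square algebra_simps)
    then show ?thesis using \<mu>(2)[of n] by (cases "j ?u = 0") auto
  qed
  obtain K where K: "K > 0" "\<And>x y. norm (b x y) \<le> norm x * norm y * K" using b.pos_bounded by blast
  have lim_j: "(\<lambda>n. \<mu> n *\<^sub>R j (J n (j v))) \<longlonglongrightarrow> j v" for v
  proof -
    \<comment> \<open>Bounds mu n |j z|^2 for the error z = mu n J n (j v) - v. The 9 is the square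
      in |j z| at most 3 |j v|; the last term comes from absorbing b v z into the
      coercivity.\<close>
    define C where "C = (lam * 9 * (norm (j v))\<^sup>2 + K\<^sup>2 * (norm v)\<^sup>2 / \<nu>)"
    have le: "(norm (\<mu> n *\<^sub>R j (J n (j v)) - j v))\<^sup>2 \<le> C / \<mu> n" for n
    proof -
      let ?u = "J n (j v)"
      define z where "z = \<mu> n *\<^sub>R ?u - v"
      have jz: "j z = \<mu> n *\<^sub>R j ?u - j v" by (simp add: z_def blinfun.diff_right blinfun.scaleR_right)
      have u: "\<mu> n *\<^sub>R ?u = z + v" by (simp add: z_def)
      have "(\<mu> n *\<^sub>R j ?u - j v) \<bullet> j z = - b ?u z" using J[of n "j v" z] by (simp add: inner_diff_left)
      then have "j z \<bullet> j z = - b ?u z" by (simp only: jz[symmetric])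
      then have "\<mu> n * (norm (j z))\<^sup>2 = - b (\<mu> n *\<^sub>R ?u) z" by (simp add: power2_norm_eq_inner b.scaleR_left)
      also have "\<dots> = - b z z - b v z" unfolding u by (simp add: b.add_left)
      also have "\<dots> \<le> lam * (norm (j z))\<^sup>2 - \<nu> * (norm z)\<^sup>2 + K * norm v * norm z"
        using coercive[of z] K(2)[of v z] by (auto simp: algebra_simps abs_le_iff)
      also have "\<dots> \<le> lam * (norm (j z))\<^sup>2 + K\<^sup>2 * (norm v)\<^sup>2 / \<nu>"
      proof -
        have "0 \<le> (\<nu> * norm z - K * norm v)\<^sup>2 + \<nu> * K * norm v * norm z" using \<nu> K by simp
        then have "\<nu> * (K * norm v * norm z - \<nu> * (norm z)\<^sup>2) \<le> K\<^sup>2 * (norm v)\<^sup>2"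
          by (simp add: power2_eq_square algebra_simps)
        then have "K * norm v * norm z - \<nu> * (norm z)\<^sup>2 \<le> K\<^sup>2 * (norm v)\<^sup>2 / \<nu>" using \<nu> by (simp add: field_simps)
        then show ?thesis by simp
      qed
      also have "\<dots> \<le> C"
      proof -
        have "norm (j z) \<le> 3 * norm (j v)" unfolding jz
          using norm_triangle_ineq4[of "\<mu> n *\<^sub>R j ?u" "j v"] bound[of n "j v"] by simp
        then have "(norm (j z))\<^sup>2 \<le> (3 * norm (j v))\<^sup>2" by (intro power_mono) auto
        from mult_left_mono[OF this lam] show ?thesis unfolding C_def by (simp add: power_mult_distrib)
      qed
      finally show ?thesis using \<mu>(2)[of n] unfolding jz by (simp add: field_simps)
    qed
    have "filterlim \<mu> at_top sequentially" unfolding \<mu>_def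
      by (intro filterlim_tendsto_add_at_top[OF tendsto_const] filterlim_real_sequentially)
    then have lim: "(\<lambda>n. C / \<mu> n) \<longlonglongrightarrow> 0" by (rule tendsto_divide_0[OF tendsto_const filterlim_at_top_imp_at_infinity])
    have "(\<lambda>n. (norm (\<mu> n *\<^sub>R j (J n (j v)) - j v))\<^sup>2) \<longlonglongrightarrow> 0"
      by (rule Lim_null_comparison[OF always_eventually lim]) (use le in simp)
    from tendsto_real_sqrt[OF this] show ?thesis
      by (simp add: tendsto_norm_zero_iff LIM_zero_iff)
  qed
  have lim: "(\<lambda>n. \<mu> n *\<^sub>R j (J n y)) \<longlonglongrightarrow> y" for y
  proof (rule metric_LIMSEQ_I)
    fix e :: real assume e: "e > 0"
    have "y \<in> closure (range (blinfun_apply j))" using dense by simp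
    moreover have "e / 4 > 0" using e by simp
    ultimately have "\<exists>x\<in>range (blinfun_apply j). dist x y < e / 4" unfolding closure_approachable by blast
    then obtain v where v: "norm (j v - y) < e / 4" by (auto simp: dist_norm)
    obtain n0 where n0: "\<And>n. n \<ge> n0 \<Longrightarrow> norm (\<mu> n *\<^sub>R j (J n (j v)) - j v) < e / 4"
      using LIMSEQ_D[OF lim_j, of "e / 4"] e by auto
    have "dist (\<mu> n *\<^sub>R j (J n y)) y < e" if "n \<ge> n0" for n
    proof -
      have eq: "\<mu> n *\<^sub>R j (J n y) - y = \<mu> n *\<^sub>R j (J n (y - j v)) + (\<mu> n *\<^sub>R j (J n (j v)) - j v) + (j v - y)"
        by (simp add: blinfun.diff_right scaleR_diff_right)
      have "norm (\<mu> n *\<^sub>R j (J n y) - y) \<le> norm (\<mu> n *\<^sub>R j (J n (y - j v))) + norm (\<mu> n *\<^sub>R j (J n (j v)) - j v) + norm (j v - y)"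
        unfolding eq by (rule order_trans[OF norm_triangle_ineq add_right_mono[OF norm_triangle_ineq]])
      then show ?thesis using bound[of n "y - j v"] n0[OF that] v by (simp add: dist_norm norm_minus_commute)
    qed
    then show "\<exists>no. \<forall>n\<ge>no. dist (\<mu> n *\<^sub>R j (J n y)) y < e" by blast
  qed
  show ?thesis by (rule that[OF \<mu>(2) J J' bound lim])
qed

lemma weak_solution_dual:
  assumes "weak_solution y c f"
  shows "\<exists>g. strongly_measurable half_line g \<and> locint (\<lambda>t. norm (g t)) \<and>
    (\<forall>t w. blinfun_apply (g t) w = - b (y t) w + f t \<bullet> j w)"
proof -
  obtain L :: "'v \<Rightarrow>\<^sub>L 'v \<Rightarrow>\<^sub>L real" where L: "\<And>v w. L v w = b v w" using bounded_bilinear_to_blinfun[OF b] by blast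
  have y: "in_L2 y" and f: "strongly_measurable half_line f" "integrable half_line (\<lambda>t. norm (f t))"
    using assms by (auto simp: weak_solution_def L1_def)
  let ?g = "\<lambda>t. to_dual j (f t) - L (y t)"
  have m: "strongly_measurable half_line ?g"
    by (intro strongly_measurable_diff strongly_measurable_compose[OF f(1)] strongly_measurable_compose[OF in_L2_meas(1)[OF y]]
        linear_continuous_on bounded_linear_to_dual blinfun.bounded_linear_right)
  have "locint (\<lambda>t. norm (?g t))"
  proof (rule locint_bound)
    show "locint (\<lambda>t. norm j * norm (f t) + norm L * norm (y t))"
      by (intro locint_add locint_mult integrable_imp_locint f locint_norm_L2 y)
    show "(\<lambda>t. norm (?g t)) \<in> borel_measurable half_line" using m by (rule strongly_measurable_norm)
    show "AE t in half_line. \<bar>norm (?g t)\<bar> \<le> norm j * norm (f t) + norm L * norm (y t)"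
    proof (rule AE_I2)
      fix t
      show "\<bar>norm (?g t)\<bar> \<le> norm j * norm (f t) + norm L * norm (y t)"
        using norm_triangle_ineq4[of "to_dual j (f t)" "L (y t)"] norm_to_dual_le[of j "f t"] norm_blinfun[of L "y t"] by simp
    qed
  qed
  then show ?thesis using m by (intro exI[of _ ?g]) (simp add: blinfun.diff_left L)
qed

text \<open>Energy identity plus coercivity. The lam term on the right has the bad sign;
  \<open>weak_solution_lyapunov\<close> controls it without Gronwall's inequality and hence without
  growth in T.\<close>

lemma weak_solution_energy:
  assumes ws: "weak_solution y c f" and T: "0 \<le> T"
  shows "(norm (c T))\<^sup>2 + 2 * \<nu> * ig (\<lambda>s. (norm (y s))\<^sup>2) 0 T
    \<le> (norm (c 0))\<^sup>2 + 2 * lam * ig (\<lambda>s. (norm (c s))\<^sup>2) 0 T + 2 * ig (\<lambda>s. norm (f s) * norm (c s)) 0 T"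
proof -
  obtain g where g: "strongly_measurable half_line g" "locint (\<lambda>t. norm (g t))"
    "\<And>t w. blinfun_apply (g t) w = - b (y t) w + f t \<bullet> j w" using weak_solution_dual[OF ws] by blast
  have y: "in_L2 y" and c: "continuous_on {0..} c" "AE t in half_line. c t = j (y t)" and f: "strongly_measurable half_line f" "integrable half_line (\<lambda>t. norm (f t))"
    using ws unfolding weak_solution_def L1_def by blast+
  have weak: "c t \<bullet> j w = c 0 \<bullet> j w + ig (\<lambda>s. g s w) 0 t" if "0 \<le> t" for w t
    using ws that unfolding weak_solution_def g(3) by blast
  obtain K where K: "K > 0" "\<And>x y. norm (b x y) \<le> norm x * norm y * K" using b.pos_bounded by blast
  have ly: "locint (\<lambda>s. (norm (y s))\<^sup>2)" by (intro integrable_imp_locint in_L2_meas y)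
  have lf: "locint (\<lambda>s. norm (f s) * norm (c s))"
    by (intro locint_mult_continuous integrable_imp_locint f continuous_intros c)
  have lc: "locint (\<lambda>s. (norm (c s))\<^sup>2)" by (intro locint_continuous continuous_intros c)
  have "(norm (c T))\<^sup>2 - (norm (c 0))\<^sup>2 = ig (\<lambda>s. 2 * g s (y s)) 0 T"
  proof (rule energy_identity[OF inj dense c(1) g(1,2) weak in_L2_meas(1)[OF y] c(2) _ _ T])
    show "locint (\<lambda>s. K * (norm (y s))\<^sup>2 + norm (f s) * norm (c s))" by (intro locint_add locint_mult ly lf)
    have "\<bar>g t v\<bar> \<le> K * (norm (y t))\<^sup>2 + norm (f t) * norm (c t)" if "norm v \<le> norm (y t)" "norm (j v) \<le> norm (c t)" for t v
    proof -
      have "\<bar>b (y t) v\<bar> \<le> norm (y t) * norm v * K" using K(2)[of "y t" v] by simp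
      also have "\<dots> \<le> norm (y t) * norm (y t) * K" using that K by (intro mult_right_mono mult_left_mono) auto
      finally have 1: "\<bar>b (y t) v\<bar> \<le> K * (norm (y t))\<^sup>2" by (simp add: power2_eq_square algebra_simps)
      have "\<bar>f t \<bullet> j v\<bar> \<le> norm (f t) * norm (j v)" by (rule Cauchy_Schwarz_ineq2)
      also have "\<dots> \<le> norm (f t) * norm (c t)" using that by (intro mult_left_mono) auto
      finally show ?thesis using 1 unfolding g(3) by linarith
    qed
    then show "AE t in half_line. \<forall>v. norm v \<le> norm (y t) \<longrightarrow> norm (j v) \<le> norm (c t) \<longrightarrow> \<bar>g t v\<bar> \<le> K * (norm (y t))\<^sup>2 + norm (f t) * norm (c t)"
      by simp
  qed
  also have "\<dots> \<le> ig (\<lambda>s. 2 * lam * (norm (c s))\<^sup>2 + 2 * (norm (f s) * norm (c s)) - 2 * \<nu> * (norm (y s))\<^sup>2) 0 T"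
  proof (rule ig_mono_AE)
    have "(\<lambda>s. 2 * g s (y s)) \<in> borel_measurable half_line"
      using strongly_measurable_real[OF strongly_measurable_blinfun_apply[OF g(1) in_L2_meas(1)[OF y]]] by simp
    have "AE s in half_line. \<bar>2 * g s (y s)\<bar> \<le> 2 * K * (norm (y s))\<^sup>2 + 2 * (norm (f s) * norm (c s))"
      using c(2)
    proof eventually_elim
      case (elim s)
      have "\<bar>b (y s) (y s)\<bar> \<le> norm (y s) * norm (y s) * K" using K(2)[of "y s" "y s"] by simp
      moreover have "\<bar>f s \<bullet> j (y s)\<bar> \<le> norm (f s) * norm (c s)" unfolding elim by (rule Cauchy_Schwarz_ineq2)
      ultimately have "\<bar>g s (y s)\<bar> \<le> K * (norm (y s))\<^sup>2 + norm (f s) * norm (c s)"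
        unfolding g(3) power2_eq_square by (simp add: algebra_simps)
      then show ?case by (simp add: abs_mult)
    qed
    then show "locint (\<lambda>s. 2 * g s (y s))"
      by (rule locint_bound[rotated 2]) (intro locint_add locint_mult ly lf, fact)
    show "AE s in half_line. 0 < s \<longrightarrow> s \<le> T \<longrightarrow> 2 * g s (y s) \<le> 2 * lam * (norm (c s))\<^sup>2 + 2 * (norm (f s) * norm (c s)) - 2 * \<nu> * (norm (y s))\<^sup>2"
      using c(2)
    proof eventually_elim
      case (elim s)
      have "f s \<bullet> j (y s) \<le> norm (f s) * norm (c s)" unfolding elim by (rule norm_cauchy_schwarz)
      then show ?case using coercive[of "y s"] unfolding g(3) elim by simp
    qed
  qed (intro locint_add locint_diff locint_mult ly lf lc | simp)+
  also have "\<dots> = 2 * lam * ig (\<lambda>s. (norm (c s))\<^sup>2) 0 T + 2 * ig (\<lambda>s. norm (f s) * norm (c s)) 0 T - 2 * \<nu> * ig (\<lambda>s. (norm (y s))\<^sup>2) 0 T"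
    by (simp add: ig_diff[OF locint_add[OF locint_mult[OF lc] locint_mult[OF lf]] locint_mult[OF ly]] 
        ig_add[OF locint_mult[OF lc] locint_mult[OF lf]] ig_mult)
  finally show ?thesis by simp
qed

text \<open>The Lyapunov inequality asks for a vector u on which the operator of -b has its value in
  Y, which y s need not be. So P is replaced by Q n, the form of P evaluated at mu n J n. It maps Y
  into V, keeps the symmetry, and its derivative along the solution reduces to the inequality at J n
  (c s). As n tends to infinity only the time integral of |c|^2 and the forcing term remain; the
  final value of the form is dropped since P is nonnegative.\<close>

lemma weak_solution_lyapunov:
  assumes ws: "weak_solution y c f" and T: "0 \<le> T"
  shows "ig (\<lambda>s. (norm (c s))\<^sup>2) 0 T \<le> norm P * (norm (c 0))\<^sup>2 + 2 * norm P * ig (\<lambda>s. norm (f s) * norm (c s)) 0 T"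
proof -
  obtain g where g: "strongly_measurable half_line g" "locint (\<lambda>t. norm (g t))"
    "\<And>t w. blinfun_apply (g t) w = - b (y t) w + f t \<bullet> j w" using weak_solution_dual[OF ws] by blast
  have y: "in_L2 y" and c: "continuous_on {0..} c" "AE t in half_line. c t = j (y t)" and f: "strongly_measurable half_line f" "integrable half_line (\<lambda>t. norm (f t))"
    using ws unfolding weak_solution_def L1_def by blast+
  have weak: "c t \<bullet> j w = c 0 \<bullet> j w + ig (\<lambda>s. g s w) 0 t" if "0 \<le> t" for w t
    using ws that unfolding weak_solution_def g(3) by blast
  obtain \<mu> :: "nat \<Rightarrow> real" and J J' :: "nat \<Rightarrow> 'y \<Rightarrow>\<^sub>L 'v" where \<mu>: "\<And>n. \<mu> n > 0"
    and J: "\<And>n y w. \<mu> n * (j (J n y) \<bullet> j w) + b (J n y) w = y \<bullet> j w"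
    and J': "\<And>n y w. \<mu> n * (j w \<bullet> j (J' n y)) + b w (J' n y) = y \<bullet> j w"
    and Jb: "\<And>n y. norm (\<mu> n *\<^sub>R j (J n y)) \<le> 2 * norm y"
    and Jlim: "\<And>y. (\<lambda>n. \<mu> n *\<^sub>R j (J n y)) \<longlonglongrightarrow> y" by (rule resolvents) blast
  define E where "E n y = \<mu> n *\<^sub>R j (J n y)" for n y
  have E_bl: "bounded_linear (E n)" for n unfolding E_def[abs_def]
    by (intro bounded_linear_const_scaleR blinfun.bounded_linear_right bounded_linear_compose[OF blinfun.bounded_linear_right, of _ j])
  define Q where "Q n = (\<mu> n)\<^sup>2 *\<^sub>R (J' n o\<^sub>L P o\<^sub>L j o\<^sub>L J n)" for n
  have J'J: "x \<bullet> j (J' n z) = z \<bullet> j (J n x)" for n x z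
    using J[of n x "J' n z"] J'[of n "J n x" z] by simp
  have Q: "x \<bullet> j (Q n z) = P (E n z) \<bullet> E n x" for n x z
    by (simp add: Q_def E_def blinfun.scaleR_left blinfun.scaleR_right J'J power2_eq_square)
  have Q_sym: "x \<bullet> j (Q n z) = z \<bullet> j (Q n x)" for n x z
    unfolding Q by (subst P_sym) (rule inner_commute)
  have id: "c T \<bullet> j (Q n (c T)) - c 0 \<bullet> j (Q n (c 0)) = ig (\<lambda>s. 2 * g s (Q n (c s))) 0 T" for n
    by (rule quadratic_form_identity[OF c(1) g(1,2) weak Q_sym T])
  have gQ: "2 * g s (Q n (c s)) \<le> - (norm (E n (c s)))\<^sup>2 + 2 * (E n (f s) \<bullet> P (E n (c s)))" if cs: "c s = j (y s)" for n s
  proof -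
    let ?u = "J n (c s)"
    define x where "x = (\<mu> n)\<^sup>2 *\<^sub>R P (j ?u)"
    have Qx: "Q n (c s) = J' n x" by (simp add: Q_def x_def blinfun.scaleR_left blinfun.scaleR_right)
    \<comment> \<open>By the resolvent equation z is the value of the operator of -b at J n (c s),
      so the Lyapunov inequality applies to this pair.\<close>
    define z where "z = \<mu> n *\<^sub>R j ?u - c s"
    have "b ?u w = - (z \<bullet> j w)" for w using J[of n "c s" w] by (simp add: z_def inner_simps)
    then have ly: "2 * (z \<bullet> P (j ?u)) \<le> - (norm (j ?u))\<^sup>2" by (rule lyapunov)
    have "- b (y s) (Q n (c s)) = \<mu> n * (c s \<bullet> j (J' n x)) - x \<bullet> c s"
      using J'[of n "y s" x] by (simp add: Qx cs[symmetric])
    also have "\<dots> = x \<bullet> z" by (simp add: J'J z_def inner_simps)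
    also have "\<dots> = (\<mu> n)\<^sup>2 * (z \<bullet> P (j ?u))" by (simp add: x_def inner_commute)
    finally have "2 * (- b (y s) (Q n (c s))) \<le> (\<mu> n)\<^sup>2 * (- (norm (j ?u))\<^sup>2)"
      using mult_left_mono[OF ly, of "(\<mu> n)\<^sup>2"] by simp
    also have "\<dots> = - (norm (E n (c s)))\<^sup>2" using \<mu>[of n] by (simp add: E_def power_mult_distrib)
    finally show ?thesis unfolding g(3) Q by (simp add: inner_commute)
  qed
  have Em: "strongly_measurable half_line (\<lambda>s. E n (f s))" "continuous_on {0..} (\<lambda>s. E n (c s))" for n
    using E_bl by (auto intro!: strongly_measurable_compose[OF f(1)] linear_continuous_on continuous_on_compose2[OF linear_continuous_on[OF E_bl, of UNIV] c(1)])
  let ?F = "\<lambda>n s. - (norm (E n (c s)))\<^sup>2 + 2 * (E n (f s) \<bullet> P (E n (c s)))"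
  \<comment> \<open>Majorant uniform in n: each factor mu n j J n has norm at most 2, whence 2^2 in
    the first term and 2 times 2 times 2 in the second.\<close>
  let ?w = "\<lambda>s. 4 * (norm (c s))\<^sup>2 + 8 * norm P * (norm (f s) * norm (c s))"
  have lf: "locint (\<lambda>s. norm (f s) * norm (c s))"
    by (intro locint_mult_continuous integrable_imp_locint f continuous_intros c)
  have lc: "locint (\<lambda>s. (norm (c s))\<^sup>2)" by (intro locint_continuous continuous_intros c)
  have lw: "locint ?w" by (intro locint_add locint_mult lf lc)
  have Fb: "\<bar>?F n s\<bar> \<le> ?w s" for n s
  proof -
    have "(norm (E n (c s)))\<^sup>2 \<le> (2 * norm (c s))\<^sup>2" using Jb unfolding E_def by (intro power_mono) auto
    moreover have "\<bar>E n (f s) \<bullet> P (E n (c s))\<bar> \<le> norm (E n (f s)) * (norm P * norm (E n (c s)))"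
      by (intro order_trans[OF Cauchy_Schwarz_ineq2] mult_left_mono norm_blinfun) auto
    moreover have "\<dots> \<le> (2 * norm (f s)) * (norm P * (2 * norm (c s)))"
      using Jb unfolding E_def by (intro mult_mono) auto
    moreover have "(2 * norm (f s)) * (norm P * (2 * norm (c s))) = 4 * (norm P * (norm (f s) * norm (c s)))" by simp
    ultimately have "(norm (E n (c s)))\<^sup>2 \<le> 4 * (norm (c s))\<^sup>2" 
      "\<bar>E n (f s) \<bullet> P (E n (c s))\<bar> \<le> 4 * (norm P * (norm (f s) * norm (c s)))" by (simp_all add: power_mult_distrib)
    moreover have "8 * norm P * (norm (f s) * norm (c s)) = 2 * (4 * (norm P * (norm (f s) * norm (c s))))" by simp
    moreover have "0 \<le> (norm (E n (c s)))\<^sup>2" by simp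
    ultimately show ?thesis by linarith
  qed
  have inner_meas: "(\<lambda>s. p s \<bullet> q s) \<in> borel_measurable half_line" if "strongly_measurable half_line p" "continuous_on {0..} q" for p q :: "real \<Rightarrow> 'y"
    by (intro strongly_measurable_real strongly_measurable_compose2[OF that(1) strongly_measurable_continuous[OF that(2)], of inner] continuous_intros)
  have Fm: "?F n \<in> borel_measurable half_line" for n
  proof -
    have "(\<lambda>s. (norm (E n (c s)))\<^sup>2) \<in> borel_measurable half_line"
      by (intro locint_measurable locint_continuous continuous_intros Em)
    moreover have "(\<lambda>s. E n (f s) \<bullet> P (E n (c s))) \<in> borel_measurable half_line"
      by (intro inner_meas Em continuous_intros)
    ultimately show ?thesis by simp
  qed
  have le: "c T \<bullet> j (Q n (c T)) - c 0 \<bullet> j (Q n (c 0)) \<le> ig (?F n) 0 T" for n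
    unfolding id
  proof (rule ig_mono_AE)
    have Qc: "continuous_on {0..} (\<lambda>s. Q n (c s))" by (intro continuous_intros c)
    have lQ: "locint (\<lambda>s. g s (Q n (c s)))"
    proof (rule locint_bound)
      show "locint (\<lambda>t. norm (g t) * norm (Q n (c t)))" by (intro locint_mult_continuous g continuous_intros c)
      show "AE t in half_line. \<bar>g t (Q n (c t))\<bar> \<le> norm (g t) * norm (Q n (c t))" by (intro AE_I2 abs_blinfun_le)
    qed (intro strongly_measurable_real strongly_measurable_blinfun_apply g strongly_measurable_continuous[OF Qc])
    then show "locint (\<lambda>s. 2 * g s (Q n (c s)))" by (rule locint_mult)
    show "locint (?F n)" by (rule locint_bound[OF lw Fm]) (intro AE_I2 Fb)
    show "AE s in half_line. 0 < s \<longrightarrow> s \<le> T \<longrightarrow> 2 * g s (Q n (c s)) \<le> ?F n s"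
      using c(2) by eventually_elim (use gQ in blast)
  qed simp
  have "(\<lambda>n. ig (?F n) 0 T) \<longlonglongrightarrow> ig (\<lambda>s. - (norm (c s))\<^sup>2 + 2 * (f s \<bullet> P (c s))) 0 T"
  proof (rule ig_dominated_convergence[OF _ Fm lw])
    have "(\<lambda>s. (norm (c s))\<^sup>2) \<in> borel_measurable half_line" by (rule locint_measurable[OF lc])
    moreover have "(\<lambda>s. f s \<bullet> P (c s)) \<in> borel_measurable half_line"
      by (intro inner_meas f continuous_intros c)
    ultimately show "(\<lambda>s. - (norm (c s))\<^sup>2 + 2 * (f s \<bullet> P (c s))) \<in> borel_measurable half_line" by simp
    show "AE r in half_line. (\<lambda>n. ?F n r) \<longlonglongrightarrow> - (norm (c r))\<^sup>2 + 2 * (f r \<bullet> P (c r))"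
      unfolding E_def by (intro AE_I2 tendsto_intros Jlim)
  qed (use Fb in auto)
  moreover have "(\<lambda>n. c T \<bullet> j (Q n (c T)) - c 0 \<bullet> j (Q n (c 0))) \<longlonglongrightarrow> P (c T) \<bullet> c T - P (c 0) \<bullet> c 0"
    unfolding Q E_def by (intro tendsto_intros Jlim)
  ultimately have "P (c T) \<bullet> c T - P (c 0) \<bullet> c 0 \<le> ig (\<lambda>s. - (norm (c s))\<^sup>2 + 2 * (f s \<bullet> P (c s))) 0 T"
    using le by (intro LIMSEQ_le) auto
  also have "\<dots> \<le> ig (\<lambda>s. 2 * norm P * (norm (f s) * norm (c s)) - (norm (c s))\<^sup>2) 0 T"
  proof (rule ig_mono)
    have Pb: "\<bar>f s \<bullet> P (c s)\<bar> \<le> norm P * (norm (f s) * norm (c s))" for s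
    proof -
      have "\<bar>f s \<bullet> P (c s)\<bar> \<le> norm (f s) * (norm P * norm (c s))"
        by (intro order_trans[OF Cauchy_Schwarz_ineq2] mult_left_mono norm_blinfun) auto
      then show ?thesis by (simp add: algebra_simps)
    qed
    then show "- (norm (c s))\<^sup>2 + 2 * (f s \<bullet> P (c s)) \<le> 2 * norm P * (norm (f s) * norm (c s)) - (norm (c s))\<^sup>2" for s
      using Pb[of s] by (simp add: abs_le_iff)
    have "locint (\<lambda>s. f s \<bullet> P (c s))"
    proof (rule locint_bound)
      show "locint (\<lambda>s. norm P * (norm (f s) * norm (c s)))" by (intro locint_mult lf)
      show "(\<lambda>s. f s \<bullet> P (c s)) \<in> borel_measurable half_line" by (intro inner_meas f continuous_intros c)
    qed (intro AE_I2 Pb)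
    then show "locint (\<lambda>s. - (norm (c s))\<^sup>2 + 2 * (f s \<bullet> P (c s)))" by (intro locint_add locint_uminus lc locint_mult)
    show "locint (\<lambda>s. 2 * norm P * (norm (f s) * norm (c s)) - (norm (c s))\<^sup>2)" by (intro locint_diff lc locint_mult lf)
  qed simp
  also have "\<dots> = 2 * norm P * ig (\<lambda>s. norm (f s) * norm (c s)) 0 T - ig (\<lambda>s. (norm (c s))\<^sup>2) 0 T"
    by (simp add: ig_diff[OF locint_mult[OF lf] lc] ig_mult)
  finally have "ig (\<lambda>s. (norm (c s))\<^sup>2) 0 T \<le> P (c 0) \<bullet> c 0 - P (c T) \<bullet> c T + 2 * norm P * ig (\<lambda>s. norm (f s) * norm (c s)) 0 T"
    by simp
  moreover have "0 \<le> P (c T) \<bullet> c T" using P_nonneg[of "c T"] by (simp add: inner_commute)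
  moreover have "P (c 0) \<bullet> c 0 \<le> norm (P (c 0)) * norm (c 0)" by (rule norm_cauchy_schwarz)
  moreover have "\<dots> \<le> (norm P * norm (c 0)) * norm (c 0)" by (intro mult_right_mono norm_blinfun) auto
  ultimately show ?thesis by (simp add: power2_eq_square)
qed

end

section \<open>Integrable forcing, linearity and the global a priori estimate\<close>

context stable_form begin

lemma L1_add: "L1 f \<Longrightarrow> L1 g \<Longrightarrow> L1 (\<lambda>t. f t + g t)"
  unfolding L1_def
proof (elim conjE, intro conjI strongly_measurable_add)
  assume fg: "strongly_measurable half_line f" "integrable half_line (\<lambda>t. norm (f t))"
    "strongly_measurable half_line g" "integrable half_line (\<lambda>t. norm (g t))"
  show "integrable half_line (\<lambda>t. norm (f t + g t))"
  proof (rule Bochner_Integration.integrable_bound)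
    show "integrable half_line (\<lambda>t. norm (f t) + norm (g t))" using fg by simp
    show "(\<lambda>t. norm (f t + g t)) \<in> borel_measurable half_line"
      by (intro strongly_measurable_norm strongly_measurable_add fg)
  qed (auto intro!: AE_I2 norm_triangle_ineq)
qed

lemma L1_scale: "L1 f \<Longrightarrow> L1 (\<lambda>t. r *\<^sub>R f t)"
  unfolding L1_def by (auto intro!: strongly_measurable_scaleR)

lemma L1_diff: "L1 f \<Longrightarrow> L1 g \<Longrightarrow> L1 (\<lambda>t. f t - g t)"
  using L1_add[OF _ L1_scale[of g "-1"], of f] by simp

lemma L1_zero [simp]: "L1 (\<lambda>_. 0)"
  by (simp add: L1_def)

lemma L1_locint: "L1 f \<Longrightarrow> locint (\<lambda>t. f t \<bullet> q)" "L1 f \<Longrightarrow> locint (\<lambda>t. norm (f t))"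
proof -
  assume f: "L1 f"
  then show l: "locint (\<lambda>t. norm (f t))" by (auto simp: L1_def intro: integrable_imp_locint)
  show "locint (\<lambda>t. f t \<bullet> q)"
  proof (rule locint_bound)
    show "locint (\<lambda>t. norm q * norm (f t))" by (intro locint_mult l)
    show "(\<lambda>t. f t \<bullet> q) \<in> borel_measurable half_line"
      using f by (auto simp: L1_def intro!: strongly_measurable_real strongly_measurable_compose[where g = "\<lambda>x. x \<bullet> q"] continuous_intros)
    show "AE t in half_line. \<bar>f t \<bullet> q\<bar> \<le> norm q * norm (f t)"
      using Cauchy_Schwarz_ineq2[of "f _" q] by (intro AE_I2) (simp add: mult.commute)
  qed
qed

lemma L1_norm_nonneg [simp]: "0 \<le> L1_norm f"
  by (simp add: L1_norm_def)

lemma L1_norm_triangle: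
  assumes "L1 f" "L1 g" "L1 h"
  shows "L1_norm (\<lambda>t. f t - h t) \<le> L1_norm (\<lambda>t. f t - g t) + L1_norm (\<lambda>t. g t - h t)"
proof -
  have i: "integrable half_line (\<lambda>t. norm (f t - h t))" "integrable half_line (\<lambda>t. norm (f t - g t))" "integrable half_line (\<lambda>t. norm (g t - h t))"
    using L1_diff assms by (auto simp: L1_def)
  have "L1_norm (\<lambda>t. f t - h t) \<le> (LINT t|half_line. norm (f t - g t) + norm (g t - h t))"
    unfolding L1_norm_def using i
    by (intro integral_mono) (auto intro: order_trans[OF _ norm_triangle_ineq])
  then show ?thesis using i by (simp add: L1_norm_def)
qed

lemma L1_norm_minus_commute: "L1_norm (\<lambda>t. f t - g t) = L1_norm (\<lambda>t. g t - f t)"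
  by (simp add: L1_norm_def norm_minus_commute)

lemma locint_b: "in_L2 y \<Longrightarrow> locint (\<lambda>s. b (y s) w)"
proof -
  assume y: "in_L2 y"
  obtain K where K: "\<And>x y. norm (b x y) \<le> norm x * norm y * K" using b.bounded by blast
  show ?thesis
  proof (rule locint_bound)
    show "locint (\<lambda>t. (norm w * K) * norm (y t))" by (intro locint_mult locint_norm_L2 y)
    show "(\<lambda>s. b (y s) w) \<in> borel_measurable half_line"
      by (intro strongly_measurable_real strongly_measurable_compose[OF in_L2_meas(1)[OF y], of "\<lambda>v. b v w"] 
          linear_continuous_on b.bounded_linear_left)
    show "AE t in half_line. \<bar>b (y t) w\<bar> \<le> (norm w * K) * norm (y t)"
      using K[of "y _" w] by (intro AE_I2) (simp add: algebra_simps)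
  qed
qed

lemma weak_solution_lin:
  assumes "weak_solution y1 c1 f1" "weak_solution y2 c2 f2"
  shows "weak_solution (\<lambda>t. y1 t + r *\<^sub>R y2 t) (\<lambda>t. c1 t + r *\<^sub>R c2 t) (\<lambda>t. f1 t + r *\<^sub>R f2 t)"
  unfolding weak_solution_def
proof (intro conjI allI impI)
  have y: "in_L2 y1" "in_L2 y2" and c: "continuous_on {0..} c1" "continuous_on {0..} c2"
    and ae: "AE t in half_line. c1 t = j (y1 t)" "AE t in half_line. c2 t = j (y2 t)"
    and f: "L1 f1" "L1 f2"
    using assms by (auto simp: weak_solution_def)
  have "in_L2 (\<lambda>t. r *\<^sub>R y2 t)"
    by (rule in_L2_linear(1)[OF bounded_linear_scaleR_right y(2), where K = "\<bar>r\<bar>"]) auto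
  with y(1) show "in_L2 (\<lambda>t. y1 t + r *\<^sub>R y2 t)" by (rule in_L2_add(1))
  show "continuous_on {0..} (\<lambda>t. c1 t + r *\<^sub>R c2 t)" by (intro continuous_intros c)
  show "AE t in half_line. c1 t + r *\<^sub>R c2 t = j (y1 t + r *\<^sub>R y2 t)"
    using ae by eventually_elim (simp add: blinfun.add_right blinfun.scaleR_right)
  show "L1 (\<lambda>t. f1 t + r *\<^sub>R f2 t)" by (intro L1_add L1_scale f)
  fix w and t :: real assume t: "0 \<le> t"
  have l: "locint (\<lambda>s. - b (y1 s) w + f1 s \<bullet> j w)" "locint (\<lambda>s. - b (y2 s) w + f2 s \<bullet> j w)"
    by (intro locint_add locint_uminus locint_b L1_locint y f)+
  have e: "c1 t \<bullet> j w = c1 0 \<bullet> j w + ig (\<lambda>s. - b (y1 s) w + f1 s \<bullet> j w) 0 t"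
    "c2 t \<bullet> j w = c2 0 \<bullet> j w + ig (\<lambda>s. - b (y2 s) w + f2 s \<bullet> j w) 0 t"
    using assms t unfolding weak_solution_def by blast+
  have "c1 t \<bullet> j w + r * (c2 t \<bullet> j w) = c1 0 \<bullet> j w + r * (c2 0 \<bullet> j w) 
      + ig (\<lambda>s. (- b (y1 s) w + f1 s \<bullet> j w) + r * (- b (y2 s) w + f2 s \<bullet> j w)) 0 t"
    unfolding ig_add[OF l(1) locint_mult[OF l(2)] order_refl] ig_mult e
    by (simp only: distrib_left)
  moreover have "(\<lambda>s. (- b (y1 s) w + f1 s \<bullet> j w) + r * (- b (y2 s) w + f2 s \<bullet> j w))
    = (\<lambda>s. - b (y1 s + r *\<^sub>R y2 s) w + (f1 s + r *\<^sub>R f2 s) \<bullet> j w)"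
    by (simp add: b.add_left b.scaleR_left inner_simps algebra_simps)
  ultimately show "(c1 t + r *\<^sub>R c2 t) \<bullet> j w = (c1 0 + r *\<^sub>R c2 0) \<bullet> j w
      + ig (\<lambda>s. - b (y1 s + r *\<^sub>R y2 s) w + (f1 s + r *\<^sub>R f2 s) \<bullet> j w) 0 t"
    by (simp add: inner_simps)
qed

lemma weak_solution_diff:
  assumes "weak_solution y1 c1 f1" "weak_solution y2 c2 f2"
  shows "weak_solution (\<lambda>t. y1 t - y2 t) (\<lambda>t. c1 t - c2 t) (\<lambda>t. f1 t - f2 t)"
  using weak_solution_lin[OF assms, of "-1"] by simp

lemma weak_solution_zero: "weak_solution (\<lambda>_. 0) (\<lambda>_. 0) (\<lambda>_. 0)"
  by (simp add: weak_solution_def b.zero_left)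
    (simp add: ig_def set_lebesgue_integral_def)

lemma weak_solution_cong_AE:
  assumes ws: "weak_solution y c f" and ae: "AE t in half_line. f t = g t"
  shows "weak_solution y c g"
proof -
  have f: "strongly_measurable half_line f" "integrable half_line (\<lambda>t. norm (f t))" and y: "in_L2 y"
    using ws by (auto simp: weak_solution_def L1_def)
  have m: "strongly_measurable half_line g" using f(1) ae by (rule strongly_measurable_AE_eq)
  have "integrable half_line (\<lambda>t. norm (f t)) = integrable half_line (\<lambda>t. norm (g t))"
    by (intro integrable_cong_AE strongly_measurable_norm f m) (use ae in \<open>auto elim: eventually_mono\<close>)
  then have g: "L1 g" using f m by (simp add: L1_def)
  have eq: "ig (\<lambda>s. - b (y s) w + f s \<bullet> j w) 0 t = ig (\<lambda>s. - b (y s) w + g s \<bullet> j w) 0 t" for w t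
    using f g ae by (intro ig_cong_AE locint_measurable locint_add locint_uminus locint_b y L1_locint)
      (auto simp: L1_def elim: eventually_mono)
  show ?thesis using ws g unfolding weak_solution_def eq by blast
qed

text \<open>Inserting the Lyapunov bound into the energy inequality replaces the lam term by the
  factor K0. What remains is a quadratic inequality for the maximum m of |c| on [0, T]; since no
  constant depends on T, it yields bounds on the whole half line.\<close>

lemma a_priori_estimate:
  obtains K where "K > 0"
    "\<And>y c f t. weak_solution y c f \<Longrightarrow> 0 \<le> t \<Longrightarrow> norm (c t) \<le> K * (norm (c 0) + L1_norm f)"
    "\<And>y c f. weak_solution y c f \<Longrightarrow> L2_norm y \<le> K * (norm (c 0) + L1_norm f)"
proof -
  define K0 where "K0 = 1 + 2 * lam * norm P"
  have K0: "K0 \<ge> 1" using lam by (simp add: K0_def)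
  \<comment> \<open>The first summand serves the supremum bound. In the second, 5 = 1 + 4 adds the
    contribution of the initial value and that of the forcing to 2 nu times the squared L2
    norm.\<close>
  define K where "K = 2 * K0 + K0 * sqrt (5 / (2 * \<nu>))"
  have K: "K > 0" "2 * K0 \<le> K" "K0 * sqrt (5 / (2 * \<nu>)) \<le> K"
    using K0 \<nu> by (auto simp: K_def add_pos_nonneg)
  have main: "norm (c T) \<le> 2 * K0 * (norm (c 0) + L1_norm f) \<and>
      ig (\<lambda>s. (norm (y s))\<^sup>2) 0 T \<le> 5 / (2 * \<nu>) * (K0 * (norm (c 0) + L1_norm f))\<^sup>2"
    if ws: "weak_solution y c f" and T: "0 \<le> T" for y c f T
  proof -
    have y: "in_L2 y" and c: "continuous_on {0..} c" and f: "L1 f" using ws by (auto simp: weak_solution_def)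
    have "continuous_on {0..T} (\<lambda>t. norm (c t))" by (intro continuous_intros continuous_on_subset[OF c]) auto
    \<comment> \<open>With the maximum attained, the integral of |f| |c| is at most m times the L1
      norm of f, which is linear in m and can be absorbed.\<close>
    then obtain t0 where t0: "t0 \<in> {0..T}" "\<And>t. t \<in> {0..T} \<Longrightarrow> norm (c t) \<le> norm (c t0)"
      using continuous_attains_sup[of "{0..T}" "\<lambda>t. norm (c t)"] T by auto
    define m where "m = norm (c t0)"
    define m0 where "m0 = norm (c 0)"
    define n1 where "n1 = L1_norm f"
    have nn: "m \<ge> 0" "m0 \<ge> 0" "n1 \<ge> 0" by (simp_all add: m_def m0_def n1_def)
    have fc: "ig (\<lambda>s. norm (f s) * norm (c s)) 0 t \<le> m * n1" if t: "0 \<le> t" "t \<le> T" for t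
    proof -
      have "ig (\<lambda>s. norm (f s) * norm (c s)) 0 t \<le> ig (\<lambda>s. m * norm (f s)) 0 t"
      proof (rule ig_mono)
        show "locint (\<lambda>s. norm (f s) * norm (c s))"
          by (intro locint_mult_continuous L1_locint f continuous_intros c)
        fix r assume "0 < r" "r \<le> t"
        then have "norm (c r) \<le> m" using t0(2)[of r] t unfolding m_def by simp
        from mult_right_mono[OF this norm_ge_zero, of "f r"]
        show "norm (f r) * norm (c r) \<le> m * norm (f r)" by (simp add: mult.commute)
      qed (intro locint_mult L1_locint f | simp)+
      also have "\<dots> \<le> m * n1" unfolding ig_mult n1_def L1_norm_def using f nn
        by (intro mult_left_mono ig_le_integral) (auto simp: L1_def)
      finally show ?thesis .
    qed
    have est: "(norm (c t))\<^sup>2 + 2 * \<nu> * ig (\<lambda>s. (norm (y s))\<^sup>2) 0 t \<le> K0 * m0\<^sup>2 + 2 * K0 * n1 * m" if t: "0 \<le> t" "t \<le> T" for t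
    proof -
      have "2 * lam * ig (\<lambda>s. (norm (c s))\<^sup>2) 0 t \<le> 2 * lam * (norm P * m0\<^sup>2 + 2 * norm P * ig (\<lambda>s. norm (f s) * norm (c s)) 0 t)"
        using weak_solution_lyapunov[OF ws t(1)] lam by (intro mult_left_mono) (auto simp: m0_def)
      also have "\<dots> \<le> 2 * lam * (norm P * m0\<^sup>2 + 2 * norm P * (m * n1))"
        using lam fc[OF t] by (intro mult_left_mono add_left_mono) auto
      finally show ?thesis using weak_solution_energy[OF ws t(1)] fc[OF t] unfolding K0_def m0_def[symmetric]
        by (simp add: algebra_simps)
    qed
    have ynn: "0 \<le> ig (\<lambda>s. (norm (y s))\<^sup>2) 0 t" for t by (intro ig_nonneg) auto
    have mm: "m\<^sup>2 \<le> K0 * m0\<^sup>2 + 2 * K0 * n1 * m"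
      using est[of t0] t0(1) mult_nonneg_nonneg[OF less_imp_le[OF \<nu>] ynn[of t0]] by (simp add: m_def)
    have mK: "m \<le> 2 * K0 * (m0 + n1)"
    proof (rule ccontr)
      assume "\<not> ?thesis"
      then have gt: "2 * K0 * (m0 + n1) < m" by simp
      have "2 * K0 * (m0 + n1) \<ge> m0 + n1" using K0 nn by (intro mult_le_cancel_right1[THEN iffD2]) auto
      then have m0m: "m0 \<le> m" and mpos: "0 < m" using gt nn by auto
      have "2 * K0 * (m0 + n1) * m < m * m" using gt mpos by (intro mult_strict_right_mono)
      moreover have "K0 * m0\<^sup>2 \<le> 2 * K0 * m0 * m"
      proof -
        have "K0 * m0 * m0 \<le> K0 * m0 * m" using m0m K0 nn by (intro mult_left_mono) auto
        moreover have "0 \<le> K0 * m0 * m" using K0 nn by simp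
        ultimately show ?thesis by (simp add: power2_eq_square)
      qed
      ultimately show False using mm by (simp add: power2_eq_square algebra_simps)
    qed
    have "norm (c T) \<le> m" using t0(2)[of T] T unfolding m_def by simp
    moreover have "ig (\<lambda>s. (norm (y s))\<^sup>2) 0 T \<le> 5 / (2 * \<nu>) * (K0 * (m0 + n1))\<^sup>2"
    proof -
      have "2 * \<nu> * ig (\<lambda>s. (norm (y s))\<^sup>2) 0 T \<le> K0 * m0\<^sup>2 + 2 * K0 * n1 * m"
        using est[OF T order_refl] by (smt (verit) zero_le_power2)
      also have "\<dots> \<le> K0 * m0\<^sup>2 + 2 * K0 * n1 * (2 * K0 * (m0 + n1))"
        using mK K0 nn by (intro add_left_mono mult_left_mono) auto
      also have "\<dots> \<le> K0\<^sup>2 * (m0 + n1)\<^sup>2 + 4 * K0\<^sup>2 * (m0 + n1)\<^sup>2"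
      proof (rule add_mono)
        have "K0 * m0\<^sup>2 \<le> K0\<^sup>2 * m0\<^sup>2" using K0 by (intro mult_right_mono) (auto simp: power2_eq_square)
        also have "\<dots> \<le> K0\<^sup>2 * (m0 + n1)\<^sup>2" using nn by (intro mult_left_mono power_mono) auto
        finally show "K0 * m0\<^sup>2 \<le> K0\<^sup>2 * (m0 + n1)\<^sup>2" .
        have "2 * K0 * n1 * (2 * K0 * (m0 + n1)) = 4 * K0\<^sup>2 * (n1 * (m0 + n1))" by (simp add: power2_eq_square)
        also have "\<dots> \<le> 4 * K0\<^sup>2 * ((m0 + n1) * (m0 + n1))" using nn by (intro mult_left_mono mult_right_mono) auto
        finally show "2 * K0 * n1 * (2 * K0 * (m0 + n1)) \<le> 4 * K0\<^sup>2 * (m0 + n1)\<^sup>2" by (simp add: power2_eq_square)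
      qed
      finally show ?thesis using \<nu> unfolding power_mult_distrib by (simp add: field_simps)
    qed
    ultimately show ?thesis using mK by (simp add: m0_def n1_def)
  qed
  show ?thesis
  proof (rule that[OF K(1)])
    fix y c f and t :: real assume ws: "weak_solution y c f" and t: "0 \<le> t"
    have q: "0 \<le> norm (c 0) + L1_norm f" by simp
    from main[OF ws t] mult_right_mono[OF K(2) q]
    show "norm (c t) \<le> K * (norm (c 0) + L1_norm f)" by linarith
  next
    fix y c f assume ws: "weak_solution y c f"
    define q where "q = norm (c 0) + L1_norm f"
    have q: "0 \<le> q" by (simp add: q_def)
    have y: "in_L2 y" using ws by (auto simp: weak_solution_def)
    have "(LINT t|half_line. (norm (y t))\<^sup>2) \<le> 5 / (2 * \<nu>) * (K0 * q)\<^sup>2"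
      using main[OF ws] by (intro LIMSEQ_le_const2[OF ig_tendsto_integral[OF in_L2_meas(3)[OF y]]]) (auto simp: q_def)
    then have "L2_norm y \<le> sqrt (5 / (2 * \<nu>) * (K0 * q)\<^sup>2)" unfolding L2_norm_def by (rule real_sqrt_le_mono)
    also have "\<dots> = (K0 * sqrt (5 / (2 * \<nu>))) * q" unfolding real_sqrt_mult using K0 q by simp
    also have "\<dots> \<le> K * q" using K(3) q by (rule mult_right_mono)
    finally show "L2_norm y \<le> K * (norm (c 0) + L1_norm f)" by (simp add: q_def)
  qed
qed

section \<open>Limits of weak solutions\<close>

lemma ig_norm_le_L2:
  assumes h: "in_L2 h" and t: "0 \<le> t"
  shows "ig (\<lambda>s. norm (h s)) 0 t \<le> sqrt t * L2_norm h"
proof -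
  have ind: "(\<lambda>s. (indicator {0<..t} s :: real)\<^sup>2) = indicator {0<..t}" by (auto split: split_indicator)
  have i: "integrable half_line (indicator {0<..t} :: real \<Rightarrow> real)"
    using emeasure_half_line_Ioc[of 0 t] t by (intro integrable_real_indicator) auto
  have e: "(LINT s|half_line. (indicator {0<..t} s)) = t"
    using ig_const[of 0 t 1] t by (simp add: ig_def set_lebesgue_integral_def)
  have "\<bar>LINT s|half_line. indicator {0<..t} s * norm (h s)\<bar> 
      \<le> sqrt (LINT s|half_line. (indicator {0<..t} s)\<^sup>2) * sqrt (LINT s|half_line. (norm (h s))\<^sup>2)"
    using i by (intro Cauchy_Schwarz_integral in_L2_meas h) (auto simp only: ind intro!: borel_measurable_integrable)
  then show ?thesis unfolding ind e by (simp add: ig_def set_lebesgue_integral_def L2_norm_def abs_le_iff)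
qed

lemma weak_solution_limit:
  assumes ws: "\<And>k::nat. weak_solution (y k) (c k) (f k)"
    and f: "L1 f0" "(\<lambda>k. L1_norm (\<lambda>t. f k t - f0 t)) \<longlonglongrightarrow> 0"
    and y: "in_L2 y0" "(\<lambda>k. L2_norm (\<lambda>t. y k t - y0 t)) \<longlonglongrightarrow> 0"
    and c: "continuous_on {0..} c0" "AE t in half_line. c0 t = j (y0 t)" "\<And>t. 0 \<le> t \<Longrightarrow> (\<lambda>k. c k t) \<longlonglongrightarrow> c0 t"
  shows "weak_solution y0 c0 f0"
  unfolding weak_solution_def
proof (intro conjI allI impI f y c)
  fix w and t :: real assume t: "0 \<le> t"
  have yk: "in_L2 (y k)" and fk: "L1 (f k)" for k using ws[of k] by (auto simp: weak_solution_def)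
  obtain K where K: "K > 0" "\<And>x y. norm (b x y) \<le> norm x * norm y * K" using b.pos_bounded by blast
  let ?I = "\<lambda>y f. ig (\<lambda>s. - b (y s) w + f s \<bullet> j w) 0 t"
  have l: "locint (\<lambda>s. - b (y s) w + f s \<bullet> j w)" if "in_L2 y" "L1 f" for y f
    by (intro locint_add locint_uminus locint_b L1_locint that)
  have le: "norm (?I (y k) (f k) - ?I y0 f0) \<le> K * norm w * (sqrt t * L2_norm (\<lambda>t. y k t - y0 t)) + norm (j w) * L1_norm (\<lambda>t. f k t - f0 t)" for k
  proof -
    have d: "in_L2 (\<lambda>t. y k t - y0 t)" "L1 (\<lambda>t. f k t - f0 t)" by (rule in_L2_diff(1)[OF yk y(1)], rule L1_diff[OF fk f(1)])
    have eq: "?I (y k) (f k) - ?I y0 f0 = ?I (\<lambda>t. y k t - y0 t) (\<lambda>t. f k t - f0 t)"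
      unfolding ig_diff[OF l[OF yk fk] l[OF y(1) f(1)] order_refl, symmetric]
      by (intro ig_cong) (simp add: b.diff_left inner_simps)
    have "\<bar>?I (\<lambda>t. y k t - y0 t) (\<lambda>t. f k t - f0 t)\<bar> \<le> ig (\<lambda>s. \<bar>- b (y k s - y0 s) w + (f k s - f0 s) \<bullet> j w\<bar>) 0 t"
      by (intro ig_abs_le l d) simp
    also have "\<dots> \<le> ig (\<lambda>s. (K * norm w) * norm (y k s - y0 s) + norm (j w) * norm (f k s - f0 s)) 0 t"
    proof (rule ig_mono)
      fix s
      have "\<bar>b (y k s - y0 s) w\<bar> \<le> norm (y k s - y0 s) * norm w * K" using K(2)[of "y k s - y0 s" w] by simp
      moreover have "\<bar>(f k s - f0 s) \<bullet> j w\<bar> \<le> norm (f k s - f0 s) * norm (j w)" by (rule Cauchy_Schwarz_ineq2)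
      ultimately show "\<bar>- b (y k s - y0 s) w + (f k s - f0 s) \<bullet> j w\<bar> \<le> (K * norm w) * norm (y k s - y0 s) + norm (j w) * norm (f k s - f0 s)"
        by (simp add: algebra_simps abs_le_iff)
    qed (intro locint_abs l d locint_add locint_mult locint_norm_L2 L1_locint | simp)+
    also have "\<dots> = (K * norm w) * ig (\<lambda>s. norm (y k s - y0 s)) 0 t + norm (j w) * ig (\<lambda>s. norm (f k s - f0 s)) 0 t"
      using ig_add[OF locint_mult[OF locint_norm_L2[OF d(1)]] locint_mult[OF L1_locint(2)[OF d(2)]] order_refl] by (simp add: ig_mult)
    also have "\<dots> \<le> K * norm w * (sqrt t * L2_norm (\<lambda>t. y k t - y0 t)) + norm (j w) * L1_norm (\<lambda>t. f k t - f0 t)"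
      using K d(2) unfolding L1_norm_def
      by (intro add_mono mult_left_mono ig_norm_le_L2 d t ig_le_integral) (auto simp: L1_def)
    finally show ?thesis unfolding eq by simp
  qed
  have "(\<lambda>k. K * norm w * (sqrt t * L2_norm (\<lambda>t. y k t - y0 t)) + norm (j w) * L1_norm (\<lambda>t. f k t - f0 t)) \<longlonglongrightarrow> K * norm w * (sqrt t * 0) + norm (j w) * 0"
    by (intro tendsto_intros y f)
  then have "(\<lambda>k. ?I (y k) (f k) - ?I y0 f0) \<longlonglongrightarrow> 0"
    by (intro Lim_null_comparison[OF always_eventually[OF allI[OF le]]]) simp
  then have "(\<lambda>k. ?I (y k) (f k)) \<longlonglongrightarrow> ?I y0 f0" by (rule LIM_zero_cancel)
  then have lim: "(\<lambda>k. c k 0 \<bullet> j w + ?I (y k) (f k)) \<longlonglongrightarrow> c0 0 \<bullet> j w + ?I y0 f0" by (intro tendsto_intros c) simp_all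
  have "(\<lambda>k. c k t \<bullet> j w) \<longlonglongrightarrow> c0 t \<bullet> j w" by (intro tendsto_intros c t)
  moreover have "c k t \<bullet> j w = c k 0 \<bullet> j w + ?I (y k) (f k)" for k
    using ws[of k] t unfolding weak_solution_def by blast
  ultimately have "(\<lambda>k. c k 0 \<bullet> j w + ?I (y k) (f k)) \<longlonglongrightarrow> c0 t \<bullet> j w" by (simp only:)
  from LIMSEQ_unique[OF this lim] show "c0 t \<bullet> j w = c0 0 \<bullet> j w + ?I y0 f0" .
qed

lemma geometric_limit:
  fixes x :: "nat \<Rightarrow> 'x::{real_normed_vector,complete_space}"
  assumes C: "\<And>k. norm (x (Suc k) - x k) \<le> C * (1/2)^k"
  shows "\<exists>l. x \<longlonglongrightarrow> l \<and> (\<forall>k. norm (l - x k) \<le> 2 * C * (1/2)^k)"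
proof -
  have C0: "C \<ge> 0" using order_trans[OF norm_ge_zero C[of 0]] by simp
  have tel: "norm (x n - x m) \<le> 2 * C * (1/2)^m - 2 * C * (1/2)^n" if "m \<le> n" for m n
    using that
  proof (induction n rule: dec_induct)
    case (step n)
    have "norm (x (Suc n) - x m) \<le> norm (x (Suc n) - x n) + norm (x n - x m)"
      using norm_triangle_ineq[of "x (Suc n) - x n" "x n - x m"] by simp
    then show ?case using C[of n] step by simp
  qed simp
  have tel': "norm (x n - x m) \<le> 2 * C * (1/2)^m" if "m \<le> n" for m n
    using tel[OF that] mult_nonneg_nonneg[OF C0, of "(1/2)^n"] by simp
  have lim: "(\<lambda>m. 2 * C * (1/2)^m) \<longlonglongrightarrow> 2 * C * 0"
    by (intro tendsto_intros LIMSEQ_power_zero) simp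
  have "Cauchy x"
  proof (rule CauchyI')
    fix e :: real assume "e > 0"
    then obtain M where M: "\<And>m. m \<ge> M \<Longrightarrow> 2 * C * (1/2)^m < e"
      using order_tendstoD(2)[OF lim, of e] by (auto simp: eventually_sequentially)
    have "dist (x m) (x n) < e" if "m \<ge> M" "n > m" for m n
      using tel'[of m n] M[OF that(1)] that(2) by (simp add: dist_norm norm_minus_commute)
    then show "\<exists>M. \<forall>m\<ge>M. \<forall>n>m. dist (x m) (x n) < e" by blast
  qed
  then obtain l where l: "x \<longlonglongrightarrow> l" by (auto simp: Cauchy_convergent_iff convergent_def)
  have "norm (l - x k) \<le> 2 * C * (1/2)^k" for k
  proof (rule LIMSEQ_le_const2)
    show "(\<lambda>n. norm (x n - x k)) \<longlonglongrightarrow> norm (l - x k)" by (intro tendsto_intros l)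
    show "\<exists>N. \<forall>n\<ge>N. norm (x n - x k) \<le> 2 * C * (1/2)^k" using tel' by blast
  qed
  then show ?thesis using l by blast
qed

text \<open>The limits in L2(V) and uniformly in Y belong together: j maps the almost everywhere
  limit in V to the pointwise limit of the c k.\<close>

lemma trajectory_complete:
  assumes y: "\<And>k. in_L2 (y k)" and c: "\<And>k. continuous_on {0..} (c k)" "\<And>k. AE t in half_line. c k t = j (y k t)"
    and dy: "\<And>k. L2_norm (\<lambda>t. y (Suc k) t - y k t) \<le> C * (1/2)^k"
    and dc: "\<And>k t. 0 \<le> t \<Longrightarrow> norm (c (Suc k) t - c k t) \<le> C * (1/2)^k"
  obtains y0 c0 where "in_L2 y0" "continuous_on {0..} c0" "AE t in half_line. c0 t = j (y0 t)"
    "\<And>k. L2_norm (\<lambda>t. y k t - y0 t) \<le> 2 * C * (1/2)^k"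
    "\<And>k t. 0 \<le> t \<Longrightarrow> norm (c k t - c0 t) \<le> 2 * C * (1/2)^k"
    "\<And>t. 0 \<le> t \<Longrightarrow> (\<lambda>k. c k t) \<longlonglongrightarrow> c0 t"
proof -
  obtain y0 where y0: "in_L2 y0" "AE t in half_line. (\<lambda>k. y k t) \<longlonglongrightarrow> y0 t" "\<And>k. L2_norm (\<lambda>t. y0 t - y k t) \<le> 2 * C * (1/2)^k"
    using L2_complete[OF y dy] by blast
  have "\<forall>t. \<exists>l. 0 \<le> t \<longrightarrow> (\<lambda>k. c k t) \<longlonglongrightarrow> l \<and> (\<forall>k. norm (l - c k t) \<le> 2 * C * (1/2)^k)"
    using geometric_limit[of "\<lambda>k. c k _" C] dc by blast
  then obtain c0 where c0: "\<And>t. 0 \<le> t \<Longrightarrow> (\<lambda>k. c k t) \<longlonglongrightarrow> c0 t" "\<And>t k. 0 \<le> t \<Longrightarrow> norm (c0 t - c k t) \<le> 2 * C * (1/2)^k"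
    by metis
  have lim: "(\<lambda>m. 2 * C * (1/2)^m) \<longlonglongrightarrow> 2 * C * 0"
    by (intro tendsto_intros LIMSEQ_power_zero) simp
  have "uniform_limit {0..} c c0 sequentially"
  proof (rule uniform_limitI)
    fix e :: real assume "e > 0"
    then have "\<forall>\<^sub>F n in sequentially. 2 * C * (1/2)^n < e" using order_tendstoD(2)[OF lim, of e] by simp
    then show "\<forall>\<^sub>F n in sequentially. \<forall>t\<in>{0..}. dist (c n t) (c0 t) < e"
    proof eventually_elim
      case (elim n)
      then show ?case using c0(2)[of _ n] by (auto simp: dist_norm norm_minus_commute intro: le_less_trans)
    qed
  qed
  then have cc: "continuous_on {0..} c0"
    by (rule uniform_limit_theorem[rotated]) (use c in auto)
  have "AE t in half_line. \<forall>k. c k t = j (y k t)" using c(2) by (simp add: AE_all_countable)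
  with y0(2) AE_half_line_pos have "AE t in half_line. c0 t = j (y0 t)"
  proof eventually_elim
    case (elim t)
    have "(\<lambda>k. j (y k t)) \<longlonglongrightarrow> j (y0 t)" by (intro tendsto_intros elim)
    moreover have "(\<lambda>k. j (y k t)) \<longlonglongrightarrow> c0 t" using c0(1)[of t] elim by simp
    ultimately show ?case by (metis LIMSEQ_unique)
  qed
  then show ?thesis
    using y0(1,3) cc c0 by (intro that[of y0 c0]) (auto simp: L2_norm_minus_commute[of _ y0] norm_minus_commute)
qed

definition solvable :: "'y \<Rightarrow> (real \<Rightarrow> 'y) \<Rightarrow> bool" where
  "solvable x f \<longleftrightarrow> (\<exists>y c. weak_solution y c f \<and> c 0 = x)"

lemma solvable_L1: "solvable x f \<Longrightarrow> L1 f"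
  by (auto simp: solvable_def weak_solution_def)

lemma solvable_lin: "solvable x f \<Longrightarrow> solvable x' f' \<Longrightarrow> solvable (x + r *\<^sub>R x') (\<lambda>t. f t + r *\<^sub>R f' t)"
  unfolding solvable_def using weak_solution_lin by blast

text \<open>The a priori estimate applied to differences of solutions turns convergence of the data
  into convergence of the solutions, once a selection makes the rate geometric.\<close>

lemma solvable_limit:
  assumes s: "\<And>k::nat. solvable (x k) (f k)" and f: "L1 f0" "(\<lambda>k. L1_norm (\<lambda>t. f k t - f0 t)) \<longlonglongrightarrow> 0" and x: "x \<longlonglongrightarrow> x0"
  shows "solvable x0 f0"
proof -
  obtain K where K: "K > 0" 
    "\<And>y c f t. weak_solution y c f \<Longrightarrow> 0 \<le> t \<Longrightarrow> norm (c t) \<le> K * (norm (c 0) + L1_norm f)"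
    "\<And>y c f. weak_solution y c f \<Longrightarrow> L2_norm y \<le> K * (norm (c 0) + L1_norm f)" by (rule a_priori_estimate) blast
  \<comment> \<open>Indices are picked by accuracy alone; the chosen map r need not be increasing,
    as only the distances to the limits matter.\<close>
  have "\<exists>k. L1_norm (\<lambda>t. f k t - f0 t) < (1/2)^m \<and> norm (x k - x0) < (1/2)^m" for m
  proof -
    have p: "(0::real) < (1/2)^m" by simp
    have "\<forall>\<^sub>F k in sequentially. L1_norm (\<lambda>t. f k t - f0 t) < (1/2)^m" using f(2) p by (rule order_tendstoD)
    moreover have "\<forall>\<^sub>F k in sequentially. norm (x k - x0) < (1/2)^m" using tendstoD[OF x p] by (simp only: dist_norm)
    ultimately have "\<forall>\<^sub>F k in sequentially. L1_norm (\<lambda>t. f k t - f0 t) < (1/2)^m \<and> norm (x k - x0) < (1/2)^m"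
      by (rule eventually_conj)
    then show ?thesis by (auto simp: eventually_sequentially)
  qed
  then obtain r where r: "\<And>m. L1_norm (\<lambda>t. f (r m) t - f0 t) < (1/2)^m" "\<And>m. norm (x (r m) - x0) < (1/2)^m" by metis
  have "\<forall>m. \<exists>y c. weak_solution y c (f (r m)) \<and> c 0 = x (r m)" using s by (auto simp: solvable_def)
  then obtain y c where ws: "\<And>m. weak_solution (y m) (c m) (f (r m))" and c0: "\<And>m. c m 0 = x (r m)" by metis
  have fL: "L1 (f (r m))" and yL: "in_L2 (y m)" and cC: "continuous_on {0..} (c m)" and cy: "AE t in half_line. c m t = j (y m t)" for m
    using ws[of m] by (auto simp: weak_solution_def)
  have d: "norm (x (r (Suc m)) - x (r m)) + L1_norm (\<lambda>t. f (r (Suc m)) t - f (r m) t) \<le> 4 * (1/2)^m" for m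
  proof -
    have "norm (x (r (Suc m)) - x (r m)) \<le> norm (x (r (Suc m)) - x0) + norm (x (r m) - x0)"
      using norm_triangle_ineq4[of "x (r (Suc m)) - x0" "x (r m) - x0"] by simp
    moreover have "L1_norm (\<lambda>t. f (r (Suc m)) t - f (r m) t) \<le> L1_norm (\<lambda>t. f (r (Suc m)) t - f0 t) + L1_norm (\<lambda>t. f (r m) t - f0 t)"
      using L1_norm_triangle[OF fL f(1) fL, of "Suc m" m] L1_norm_minus_commute[of f0 "f (r m)"] by simp
    ultimately show ?thesis using r(1)[of m] r(1)[of "Suc m"] r(2)[of m] r(2)[of "Suc m"]
        zero_less_power[of "1/2 :: real" m] unfolding power_Suc by linarith
  qed
  have d': "K * (norm (x (r (Suc m)) - x (r m)) + L1_norm (\<lambda>t. f (r (Suc m)) t - f (r m) t)) \<le> 4 * K * (1/2)^m" for m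
    using mult_left_mono[OF d[of m] less_imp_le[OF K(1)]] by simp
  note wsd = weak_solution_diff[OF ws ws]
  obtain y0 c0' where lim: "in_L2 y0" "continuous_on {0..} c0'" "AE t in half_line. c0' t = j (y0 t)"
    "\<And>k. L2_norm (\<lambda>t. y k t - y0 t) \<le> 2 * (4 * K) * (1/2)^k" "\<And>k t. 0 \<le> t \<Longrightarrow> norm (c k t - c0' t) \<le> 2 * (4 * K) * (1/2)^k"
    "\<And>t. 0 \<le> t \<Longrightarrow> (\<lambda>k. c k t) \<longlonglongrightarrow> c0' t"
  proof (rule trajectory_complete[OF yL cC cy])
    show "L2_norm (\<lambda>t. y (Suc k) t - y k t) \<le> 4 * K * (1/2)^k" for k
      using K(3)[OF wsd[of "Suc k" k]] d'[of k] unfolding c0 by (rule order_trans)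
    show "norm (c (Suc k) t - c k t) \<le> 4 * K * (1/2)^k" if "0 \<le> t" for k t
      using K(2)[OF wsd[of "Suc k" k] that] d'[of k] unfolding c0 by (rule order_trans)
  qed blast
  have "weak_solution y0 c0' f0"
  proof (rule weak_solution_limit[OF ws f(1) _ lim(1) _ lim(2,3,6)])
    have half: "(\<lambda>m. C * (1/2)^m) \<longlonglongrightarrow> 0" for C :: real
      using tendsto_mult_right_zero[OF LIMSEQ_power_zero[of "1/2 :: real"], of C] by simp
    show "(\<lambda>k. L1_norm (\<lambda>t. f (r k) t - f0 t)) \<longlonglongrightarrow> 0"
      by (rule Lim_null_comparison[OF always_eventually half[of 1]]) (use r in \<open>auto intro: less_imp_le\<close>)
    show "(\<lambda>k. L2_norm (\<lambda>t. y k t - y0 t)) \<longlonglongrightarrow> 0"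
      by (rule Lim_null_comparison[OF always_eventually half[of "2 * (4 * K)"]]) (use lim(4) in auto)
  qed simp_all
  moreover have "c0' 0 = x0"
  proof (rule LIMSEQ_unique[OF lim(6)[of 0]])
    have "(\<lambda>m. x (r m) - x0) \<longlonglongrightarrow> 0"
      by (rule Lim_null_comparison[OF always_eventually LIMSEQ_power_zero[of "1/2 :: real"]]) (use r in \<open>auto intro: less_imp_le\<close>)
    then show "(\<lambda>k. c k 0) \<longlonglongrightarrow> x0" unfolding c0 by (rule LIM_zero_cancel)
  qed simp
  ultimately show ?thesis by (auto simp: solvable_def)
qed

lemma solvable_cong_AE: "solvable x f \<Longrightarrow> AE t in half_line. f t = g t \<Longrightarrow> solvable x g"
  unfolding solvable_def using weak_solution_cong_AE by blast

text \<open>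
  The stationary problem is solved by decreasing the shift from a coercive value to 0; the
  Lyapunov inequality bounds the solution operators uniformly in the shift.
\<close>

lemma stationary_solvable: "\<exists>u. \<forall>w. b u w = - (x \<bullet> j w)"
proof -
  define \<kappa> where "\<kappa> = 2 * norm P + 1"
  have \<kappa>: "\<kappa> > 0" by (simp add: \<kappa>_def add_nonneg_pos)
  define solv where "solv \<mu> \<longleftrightarrow> (\<forall>x. \<exists>u. \<forall>w. \<mu> * (j u \<bullet> j w) + b u w = x \<bullet> j w)" for \<mu>
  \<comment> \<open>A nonnegative shift enters the Lyapunov inequality with the favourable sign
    because P is nonnegative, so kappa does not depend on mu.\<close>
  have bound: "norm (j u) \<le> \<kappa> * norm x" if \<mu>: "\<mu> \<ge> 0" and u: "\<And>w. \<mu> * (j u \<bullet> j w) + b u w = x \<bullet> j w" for \<mu> u x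
  proof -
    have "b u w = - ((\<mu> *\<^sub>R j u - x) \<bullet> j w)" for w using u[of w] by (simp add: inner_simps)
    then have "2 * ((\<mu> *\<^sub>R j u - x) \<bullet> P (j u)) \<le> - (norm (j u))\<^sup>2" by (rule lyapunov)
    then have "(norm (j u))\<^sup>2 \<le> 2 * (x \<bullet> P (j u)) - 2 * \<mu> * (j u \<bullet> P (j u))" by (simp add: inner_simps)
    also have "\<dots> \<le> 2 * (x \<bullet> P (j u))" using \<mu> P_nonneg[of "j u"] by simp
    also have "\<dots> \<le> 2 * (norm x * (norm P * norm (j u)))"
      by (intro mult_left_mono order_trans[OF norm_cauchy_schwarz] norm_blinfun) auto
    also have "\<dots> \<le> (\<kappa> * norm x) * norm (j u)" by (simp add: \<kappa>_def algebra_simps)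
    finally show ?thesis using \<kappa> by (cases "j u = 0") (auto simp: power2_eq_square)
  qed
  \<comment> \<open>Lowering the shift by delta amounts to a fixed point of p |-> j (U (x + delta
    p)) in Y, whose Lipschitz constant is delta times kappa.\<close>
  have step: "solv (\<mu> - \<delta>)" if s: "solv \<mu>" and \<mu>: "\<mu> \<ge> 0" and \<delta>: "0 \<le> \<delta>" "\<delta> * \<kappa> < 1" for \<mu> \<delta>
    unfolding solv_def
  proof
    fix x
    obtain U where U: "\<And>x w. \<mu> * (j (U x) \<bullet> j w) + b (U x) w = x \<bullet> j w" using s unfolding solv_def by metis
    define T where "T y = j (U (x + \<delta> *\<^sub>R y))" for y
    have "dist (T p) (T q) \<le> (\<delta> * \<kappa>) * dist p q" for p q
    proof -
      let ?u = "U (x + \<delta> *\<^sub>R p) - U (x + \<delta> *\<^sub>R q)"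
      have "\<mu> * (j ?u \<bullet> j w) + b ?u w = (\<delta> *\<^sub>R (p - q)) \<bullet> j w" for w
        using U[of "x + \<delta> *\<^sub>R p" w] U[of "x + \<delta> *\<^sub>R q" w]
        by (simp add: blinfun.diff_right b.diff_left inner_simps algebra_simps)
      from bound[OF \<mu> this] show ?thesis using \<delta> by (simp add: T_def dist_norm blinfun.diff_right mult.left_commute mult.assoc)
    qed
    then have "\<exists>!p\<in>UNIV. T p = p"
      using \<delta> \<kappa> by (intro Banach_fix[of UNIV "\<delta> * \<kappa>"]) (auto simp: complete_UNIV)
    then obtain p where p: "j (U (x + \<delta> *\<^sub>R p)) = p" by (auto simp: T_def)
    have "(\<mu> - \<delta>) * (j (U (x + \<delta> *\<^sub>R p)) \<bullet> j w) + b (U (x + \<delta> *\<^sub>R p)) w = x \<bullet> j w" for w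
      using U[of "x + \<delta> *\<^sub>R p" w] unfolding p by (simp add: inner_simps algebra_simps)
    then show "\<exists>u. \<forall>w. (\<mu> - \<delta>) * (j u \<bullet> j w) + b u w = x \<bullet> j w" by blast
  qed
  obtain \<mu>0 where \<mu>0: "\<mu>0 > 0" "solv \<mu>0"
  proof (rule resolvents)
    fix \<mu> :: "nat \<Rightarrow> real" and J J' :: "nat \<Rightarrow> 'y \<Rightarrow>\<^sub>L 'v"
    assume pos: "\<And>n. \<mu> n > 0" and J: "\<And>n y w. \<mu> n * (j (J n y) \<bullet> j w) + b (J n y) w = y \<bullet> j w"
    have "solv (\<mu> 0)" unfolding solv_def
    proof
      fix x show "\<exists>u. \<forall>w. \<mu> 0 * (j u \<bullet> j w) + b u w = x \<bullet> j w" by (rule exI[of _ "J 0 x"]) (use J in blast)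
    qed
    then show thesis by (rule that[OF pos])
  qed
  define \<delta> where "\<delta> = 1 / (2 * \<kappa>)"
  have \<delta>: "\<delta> > 0" "\<delta> * \<kappa> < 1" using \<kappa> by (simp_all add: \<delta>_def)
  have "solv (max 0 (\<mu>0 - real n * \<delta>))" for n
  proof (induction n)
    case 0 then show ?case using \<mu>0 by simp
  next
    case (Suc n)
    define m where "m = max 0 (\<mu>0 - real n * \<delta>)"
    define m' where "m' = max 0 (\<mu>0 - real (Suc n) * \<delta>)"
    have "m' \<le> m" "m - m' \<le> \<delta>" "m \<ge> 0" using \<delta> by (auto simp: m_def m'_def algebra_simps)
    moreover have "(m - m') * \<kappa> < 1" using mult_right_mono[OF \<open>m - m' \<le> \<delta>\<close> less_imp_le[OF \<kappa>]] \<delta> by linarith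
    ultimately have "solv (m - (m - m'))" using Suc by (intro step) (auto simp: m_def)
    then show ?case by (simp add: m'_def)
  qed
  moreover obtain n where "\<mu>0 / \<delta> < real n" using reals_Archimedean2 by blast
  then have "max 0 (\<mu>0 - real n * \<delta>) = 0" using \<delta> by (simp add: field_simps)
  ultimately have "solv 0" by metis
  then obtain u where "\<forall>w. 0 * (j u \<bullet> j w) + b u w = (- x) \<bullet> j w" unfolding solv_def by blast
  then show ?thesis by auto
qed

end

section \<open>Existence for the linear problem\<close>

lemma in_L2_exponential_decay:
  fixes v :: "real \<Rightarrow> 'x::real_normed_vector"
  assumes v: "continuous_on {0..} v" and \<omega>: "\<omega> > 0" and le: "\<And>t. 0 \<le> t \<Longrightarrow> norm (v t) \<le> C * exp (- \<omega> * t)"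
  shows "in_L2 v"
proof -
  have "(\<lambda>x. exp (- (2 * \<omega>) * x)) integrable_on {0..}"
    using has_integral_exp_minus_to_infinity[of "2 * \<omega>" 0] \<omega> by (auto simp: integrable_on_def)
  then have "set_integrable lebesgue {0..} (\<lambda>x. exp (- (2 * \<omega>) * x))"
    by (intro nonnegative_absolutely_integrable_1) auto
  then have "set_integrable lebesgue {0<..} (\<lambda>x. exp (- (2 * \<omega>) * x))"
    by (rule set_integrable_subset) auto
  then have i: "integrable half_line (\<lambda>x. exp (- (2 * \<omega>) * x))"
    by (simp add: integrable_restrict_space set_integrable_def)
  have m: "strongly_measurable half_line v" using v by (rule strongly_measurable_continuous)
  have "integrable half_line (\<lambda>t. (norm (v t))\<^sup>2)"
  proof (rule Bochner_Integration.integrable_bound)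
    show "integrable half_line (\<lambda>x. C\<^sup>2 * exp (- (2 * \<omega>) * x))" using i by simp
    show "(\<lambda>t. (norm (v t))\<^sup>2) \<in> borel_measurable half_line" using strongly_measurable_norm[OF m] by simp
    show "AE t in half_line. norm ((norm (v t))\<^sup>2) \<le> norm (C\<^sup>2 * exp (- (2 * \<omega>) * t))"
      using AE_half_line_pos
    proof eventually_elim
      case (elim t)
      then have "(norm (v t))\<^sup>2 \<le> (C * exp (- \<omega> * t))\<^sup>2" using le[of t] by (intro power_mono) auto
      also have "\<dots> = C\<^sup>2 * exp (- (2 * \<omega>) * t)"
        by (simp add: power_mult_distrib exp_double[symmetric] algebra_simps)
      finally show ?case by simp
    qed
  qed
  then show ?thesis using m by (simp add: in_L2_def)
qed

text \<open>The graph condition identifies the generator of S with the operator of -b, so that its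
  domain is described inside V.\<close>

locale stable_evolution = stable_form j b P \<nu> lam
  for j :: "'v::{real_inner,complete_space} \<Rightarrow>\<^sub>L 'y::{real_inner,complete_space}" and b P \<nu> lam +
  fixes S :: "real \<Rightarrow> 'y \<Rightarrow>\<^sub>L 'y"
  assumes semigroup: "C0_semigroup S" and stable: "exp_stable S"
    and generator: "generator_graph S = {(j u, z) | u z. \<forall>w. b u w = - (z \<bullet> j w)}"
begin

lemma decay: obtains M \<omega> where "M > 0" "\<omega> > 0" "\<And>t x. 0 \<le> t \<Longrightarrow> norm (S t x) \<le> M * exp (- \<omega> * t) * norm x"
proof -
  obtain M \<omega> where M: "\<omega> > 0" "\<And>t. 0 \<le> t \<Longrightarrow> norm (S t) \<le> M * exp (- \<omega> * t)"
    using stable by (auto simp: exp_stable_def)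
  have "norm (S t x) \<le> (\<bar>M\<bar> + 1) * exp (- \<omega> * t) * norm x" if "0 \<le> t" for t x
  proof -
    have "norm (S t x) \<le> norm (S t) * norm x" by (rule norm_blinfun)
    also have "\<dots> \<le> ((\<bar>M\<bar> + 1) * exp (- \<omega> * t)) * norm x"
      using M(2)[OF that] by (intro mult_right_mono) (auto intro: order_trans mult_right_mono)
    finally show ?thesis .
  qed
  then show ?thesis using M(1) by (intro that[of "\<bar>M\<bar> + 1" \<omega>]) auto
qed

lemma S_zero [simp]: "S 0 x = x"
  using semigroup by (simp add: C0_semigroup_def)

lemma S_add: "0 \<le> s \<Longrightarrow> 0 \<le> t \<Longrightarrow> S (s + t) x = S s (S t x)"
  using semigroup by (simp add: C0_semigroup_def)

text \<open>The operators S s are bounded uniformly in s, so the modulus of continuity at 0 serves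
  at every time.\<close>

lemma S_uniformly_continuous:
  assumes e: "e > 0"
  shows "\<exists>\<delta>>0. \<forall>s t. 0 \<le> s \<longrightarrow> s \<le> t \<longrightarrow> t - s < \<delta> \<longrightarrow> norm (S t x - S s x) \<le> e"
proof -
  obtain M \<omega> where M: "M > 0" "\<omega> > 0" "\<And>t x. 0 \<le> t \<Longrightarrow> norm (S t x) \<le> M * exp (- \<omega> * t) * norm x" by (rule decay) blast
  have "((\<lambda>t. S t x) \<longlongrightarrow> x) (at_right 0)" using semigroup by (simp add: C0_semigroup_def)
  moreover have "e / M > 0" using e M by simp
  ultimately have "\<forall>\<^sub>F t in at_right 0. dist (S t x) x < e / M" by (rule tendstoD)
  then obtain \<delta> where \<delta>: "\<delta> > 0" "\<And>t. 0 < t \<Longrightarrow> t < \<delta> \<Longrightarrow> dist (S t x) x < e / M"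
    unfolding eventually_at_right_field by auto
  have "norm (S t x - S s x) \<le> e" if st: "0 \<le> s" "s \<le> t" "t - s < \<delta>" for s t
  proof (cases "s = t")
    case False
    have "S t x - S s x = S s (S (t - s) x - x)" using S_add[of s "t - s" x] st by (simp add: blinfun.diff_right)
    then have "norm (S t x - S s x) \<le> M * exp (- \<omega> * s) * norm (S (t - s) x - x)" using M(3)[OF st(1)] by metis
    also have "\<dots> \<le> (M * 1) * (e / M)"
      using \<delta>(2)[of "t - s"] st False M by (intro mult_mono) (auto simp: dist_norm)
    finally show ?thesis using M by simp
  qed (use e in simp)
  then show ?thesis using \<delta>(1) by blast
qed

lemma S_continuous: "continuous_on {0..} (\<lambda>t. S t x)"
  unfolding continuous_on_iff
proof (intro ballI allI impI)
  fix s e :: real assume s: "s \<in> {0..}" and e: "0 < e"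
  obtain \<delta> where \<delta>: "\<delta> > 0" "\<And>s t. 0 \<le> s \<Longrightarrow> s \<le> t \<Longrightarrow> t - s < \<delta> \<Longrightarrow> norm (S t x - S s x) \<le> e / 2"
    using S_uniformly_continuous[of "e / 2" x] e by auto
  have "dist (S t x) (S s x) < e" if t: "t \<in> {0..}" "dist t s < \<delta>" for t
  proof (cases "s \<le> t")
    case True then show ?thesis using \<delta>(2)[of s t] t s e by (auto simp: dist_norm dist_real_def)
  next
    case False then show ?thesis using \<delta>(2)[of t s] t s e by (auto simp: dist_norm dist_real_def norm_minus_commute)
  qed
  then show "\<exists>d>0. \<forall>t\<in>{0..}. dist t s < d \<longrightarrow> dist (S t x) (S s x) < e" using \<delta>(1) by blast
qed

text \<open>The shifted orbit max 0 (t - beta) is needed to switch off a constant forcing at time beta.\<close>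

lemma shifted_orbit_integral:
  assumes gen: "\<And>w. b u w = - (z \<bullet> j w)" and \<beta>: "0 \<le> \<beta>" and T: "0 \<le> T"
  shows "S (max 0 (T - \<beta>)) (j u) \<bullet> q - j u \<bullet> q = ig (\<lambda>r. indicator {\<beta><..} r * (S (max 0 (r - \<beta>)) z \<bullet> q)) 0 T"
proof -
  obtain M \<omega> where M: "M > 0" "\<omega> > 0" "\<And>t x. 0 \<le> t \<Longrightarrow> norm (S t x) \<le> M * exp (- \<omega> * t) * norm x" by (rule decay) blast
  have Mb: "norm (S t x) \<le> M * norm x" if "0 \<le> t" for t x
  proof -
    have "M * exp (- \<omega> * t) * norm x \<le> M * 1 * norm x" using M that by (intro mult_right_mono mult_left_mono) auto
    then show ?thesis using M(3)[OF that, of x] by simp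
  qed
  have "(j u, z) \<in> generator_graph S" using gen unfolding generator by blast
  then have dS: "((\<lambda>h. (S h (j u) - j u) /\<^sub>R h) \<longlongrightarrow> z) (at_right 0)" by (simp add: generator_graph_def)
  define \<tau> where "\<tau> t = max 0 (t - \<beta>)" for t
  define K where "K r = indicator {\<beta><..} r * (S (\<tau> r) z \<bullet> q)" for r
  have cont: "continuous_on {0..} (\<lambda>r. S (\<tau> r) z \<bullet> q)"
    unfolding \<tau>_def by (intro continuous_intros continuous_on_compose2[OF S_continuous]) auto
  have lK: "locint K"
  proof (rule locint_bound[OF locint_abs[OF locint_continuous[OF cont]]])
    have "{\<beta><..} \<in> sets half_line" using \<beta> by (auto simp: sets_restrict_space_iff)
    then show "K \<in> borel_measurable half_line"
      unfolding K_def[abs_def] using locint_measurable[OF locint_continuous[OF cont]] by simp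
    show "AE t in half_line. \<bar>K t\<bar> \<le> \<bar>S (\<tau> t) z \<bullet> q\<bar>"
      by (intro AE_I2) (auto simp: K_def split: split_indicator)
  qed
  have "S (\<tau> T) (j u) \<bullet> q - S (\<tau> 0) (j u) \<bullet> q = ig K 0 T"
  proof (rule increments_imp_integral[OF lK _ T, of "\<lambda>_. 1"])
    fix \<epsilon> :: real assume \<epsilon>: "\<epsilon> > 0"
    define D where "D = (M + 1) * (norm q + 1)"
    define e where "e = \<epsilon> / D"
    have den: "D > 0" unfolding D_def using M by (intro mult_pos_pos) (auto intro: add_nonneg_pos)
    have e: "e > 0" using \<epsilon> den by (simp add: e_def)
    have e_le: "(M + 1) * e * norm q \<le> \<epsilon>"
    proof -
      have "(M + 1) * e * norm q \<le> (M + 1) * e * (norm q + 1)" using M e by (intro mult_left_mono) auto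
      also have "\<dots> = e * D" by (simp add: D_def)
      also have "\<dots> = \<epsilon>" using den by (simp add: e_def)
      finally show ?thesis .
    qed
    obtain \<delta>1 where \<delta>1: "\<delta>1 > 0" "\<And>s t. 0 \<le> s \<Longrightarrow> s \<le> t \<Longrightarrow> t - s < \<delta>1 \<Longrightarrow> norm (S t z - S s z) \<le> e"
      using S_uniformly_continuous[OF e] by blast
    have "\<forall>\<^sub>F h in at_right 0. dist ((S h (j u) - j u) /\<^sub>R h) z < e" using dS e by (rule tendstoD)
    then obtain \<delta>2 where \<delta>2: "\<delta>2 > 0" "\<And>h. 0 < h \<Longrightarrow> h < \<delta>2 \<Longrightarrow> dist ((S h (j u) - j u) /\<^sub>R h) z < e"
      unfolding eventually_at_right_field by auto
    have inc: "\<bar>S (\<tau> t) (j u) \<bullet> q - S (\<tau> s) (j u) \<bullet> q - ig K s t\<bar> \<le> \<epsilon> * ig (\<lambda>_. 1) s t"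
      if st: "0 \<le> s" "s \<le> t" "t \<le> T" "t - s < min \<delta>1 \<delta>2" for s t
    proof (cases "t \<le> \<beta> \<or> s = t")
      case True
      have "ig K s t = ig (\<lambda>_. 0) s t" if "t \<le> \<beta>" using that by (intro ig_cong) (auto simp: K_def)
      then have "ig K s t = 0" using True st by (auto simp: ig_const)
      moreover have "\<tau> t = \<tau> s" using True st by (auto simp: \<tau>_def)
      ultimately show ?thesis using st \<epsilon> by (simp add: ig_const)
    next
      case False
      \<comment> \<open>Up to time beta the shifted orbit rests, so only the part of (s, t] after
        beta contributes, and it has length h.\<close>
      define s1 where "s1 = max s \<beta>"
      define h where "h = t - s1"
      have s1: "0 \<le> s1" "s \<le> s1" "s1 < t" "\<beta> \<le> s1" using False st \<beta> by (auto simp: s1_def)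
      have h: "0 < h" "h \<le> t - s" "h < \<delta>1" "h < \<delta>2" using s1 st by (auto simp: h_def)
      have \<tau>s: "\<tau> s = s1 - \<beta>" "\<tau> t = \<tau> s + h" "0 \<le> \<tau> s" using s1 by (auto simp: \<tau>_def s1_def h_def)
      have "ig K s s1 = ig (\<lambda>_. 0) s s1" by (intro ig_cong) (auto simp: K_def s1_def)
      then have K1: "ig K s t = ig K s1 t" using ig_split[OF lK, of s s1 t] st s1 by (simp add: ig_const)
      have a: "S (\<tau> t) (j u) - S (\<tau> s) (j u) = S (\<tau> s) (S h (j u) - j u)"
        unfolding \<tau>s(2) using S_add[OF \<tau>s(3), of h] h by (simp add: blinfun.diff_right)
      \<comment> \<open>Remainder of the first-order expansion of the orbit at time 0; applying S
        (tau s) carries it to the present time.\<close>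
      define d where "d = S h (j u) - j u - h *\<^sub>R z"
      have d: "norm d \<le> e * h"
      proof -
        have "d = h *\<^sub>R ((S h (j u) - j u) /\<^sub>R h - z)" using h by (simp add: d_def scaleR_diff_right)
        then have "norm d = h * norm ((S h (j u) - j u) /\<^sub>R h - z)" using h by simp
        also have "\<dots> \<le> h * e" using \<delta>2(2)[of h] h by (intro mult_left_mono) (auto simp: dist_norm)
        finally show ?thesis by (simp add: mult.commute)
      qed
      have b1: "S (\<tau> t) (j u) \<bullet> q - S (\<tau> s) (j u) \<bullet> q = h * (S (\<tau> s) z \<bullet> q) + S (\<tau> s) d \<bullet> q"
      proof -
        have "S h (j u) - j u = h *\<^sub>R z + d" by (simp add: d_def)
        then have "S (\<tau> t) (j u) - S (\<tau> s) (j u) = h *\<^sub>R S (\<tau> s) z + S (\<tau> s) d"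
          unfolding a by (simp add: blinfun.add_right blinfun.scaleR_right)
        then show ?thesis by (metis inner_add_left inner_diff_left inner_scaleR_left)
      qed
      have "\<bar>S (\<tau> s) d \<bullet> q\<bar> \<le> norm (S (\<tau> s) d) * norm q" by (rule Cauchy_Schwarz_ineq2)
      also have "\<dots> \<le> (M * (e * h)) * norm q"
        using Mb[OF \<tau>s(3), of d] d M by (intro mult_right_mono) (auto intro: order_trans mult_left_mono)
      finally have b2: "\<bar>S (\<tau> s) d \<bullet> q\<bar> \<le> M * e * norm q * h" by (simp add: algebra_simps)
      have b3: "\<bar>h * (S (\<tau> s) z \<bullet> q) - ig K s1 t\<bar> \<le> e * norm q * h"
      proof -
        have "h * (S (\<tau> s) z \<bullet> q) - ig K s1 t = ig (\<lambda>r. S (\<tau> s) z \<bullet> q - K r) s1 t"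
          using ig_diff[OF locint_const lK s1(1)] s1 by (simp add: ig_const h_def mult.commute)
        also have "\<bar>\<dots>\<bar> \<le> ig (\<lambda>r. \<bar>S (\<tau> s) z \<bullet> q - K r\<bar>) s1 t"
          using s1 by (intro ig_abs_le locint_diff locint_const lK)
        also have "\<dots> \<le> ig (\<lambda>r. e * norm q) s1 t"
        proof (rule ig_mono)
          fix r assume r: "s1 < r" "r \<le> t"
          have "K r = S (\<tau> r) z \<bullet> q" using r s1 by (simp add: K_def)
          moreover have "\<tau> r - \<tau> s < \<delta>1" "\<tau> s \<le> \<tau> r" using r s1 h unfolding \<tau>s(1) by (auto simp: \<tau>_def h_def)
          then have "norm (S (\<tau> r) z - S (\<tau> s) z) \<le> e" using \<delta>1(2) \<tau>s(3) by blast
          moreover have "\<bar>(S (\<tau> r) z - S (\<tau> s) z) \<bullet> q\<bar> \<le> norm (S (\<tau> r) z - S (\<tau> s) z) * norm q" by (rule Cauchy_Schwarz_ineq2)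
          moreover have "\<dots> \<le> e * norm q" using calculation(2) by (intro mult_right_mono) auto
          ultimately show "\<bar>S (\<tau> s) z \<bullet> q - K r\<bar> \<le> e * norm q" by (simp add: inner_diff_left abs_minus_commute)
        qed (use s1 lK in \<open>auto intro!: locint_abs locint_diff\<close>)
        finally show ?thesis using s1 by (simp add: ig_const h_def)
      qed
      have "\<bar>S (\<tau> t) (j u) \<bullet> q - S (\<tau> s) (j u) \<bullet> q - ig K s t\<bar> \<le> M * e * norm q * h + e * norm q * h"
        unfolding b1 K1 using b2 b3 by linarith
      also have "\<dots> = ((M + 1) * e * norm q) * h" by (simp add: algebra_simps)
      also have "\<dots> \<le> \<epsilon> * (t - s)" using e_le h \<epsilon> by (intro mult_mono) auto
      finally show ?thesis using st by (simp add: ig_const)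
    qed
    show "\<exists>\<delta>>0. \<forall>s t. 0 \<le> s \<longrightarrow> s \<le> t \<longrightarrow> t \<le> T \<longrightarrow> t - s < \<delta> \<longrightarrow>
      \<bar>S (\<tau> t) (j u) \<bullet> q - S (\<tau> s) (j u) \<bullet> q - ig K s t\<bar> \<le> \<epsilon> * ig (\<lambda>_. 1) s t"
      using inc \<delta>1(1) \<delta>2(1) by (intro exI[of _ "min \<delta>1 \<delta>2"]) auto
  qed simp
  then show ?thesis using \<beta> by (simp add: \<tau>_def K_def[abs_def])
qed

text \<open>The semigroup preserves the domain of its generator, so the orbit lifts to V. Coercivity
  bounds V norms by Y norms of the orbit and of its image under the generator, which gives
  continuity and exponential decay in V.\<close>

lemma orbit_exists:
  assumes gen: "\<And>w. b u w = - (z \<bullet> j w)"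
  obtains \<sigma> C \<omega> where "continuous_on {0..} \<sigma>" "\<And>t. 0 \<le> t \<Longrightarrow> j (\<sigma> t) = S t (j u)"
    "\<And>t w. 0 \<le> t \<Longrightarrow> b (\<sigma> t) w = - (S t z \<bullet> j w)" "\<omega> > 0" "C \<ge> 0" "\<And>t. 0 \<le> t \<Longrightarrow> norm (\<sigma> t) \<le> C * exp (- \<omega> * t)"
proof -
  obtain M \<omega> where M: "M > 0" "\<omega> > 0" "\<And>t x. 0 \<le> t \<Longrightarrow> norm (S t x) \<le> M * exp (- \<omega> * t) * norm x" by (rule decay) blast
  have "(j u, z) \<in> generator_graph S" using gen unfolding generator by blast
  then have dS: "((\<lambda>h. (S h (j u) - j u) /\<^sub>R h) \<longlongrightarrow> z) (at_right 0)" by (simp add: generator_graph_def)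
  have ex: "\<exists>v. j v = S t (j u) \<and> (\<forall>w. b v w = - (S t z \<bullet> j w))" if t: "0 \<le> t" for t
  proof -
    have "((\<lambda>h. S t ((S h (j u) - j u) /\<^sub>R h)) \<longlongrightarrow> S t z) (at_right 0)" by (intro tendsto_intros dS)
    moreover have "\<forall>\<^sub>F h in at_right 0. S t ((S h (j u) - j u) /\<^sub>R h) = (S h (S t (j u)) - S t (j u)) /\<^sub>R h"
      using eventually_at_right_less[of "0 :: real"]
    proof eventually_elim
      case (elim h)
      then have "S t (S h (j u)) = S h (S t (j u))"
        using S_add[OF t, of h "j u"] S_add[of h t "j u"] t by (simp add: add.commute)
      then show ?case by (simp add: blinfun.scaleR_right blinfun.diff_right)
    qed
    ultimately have "((\<lambda>h. (S h (S t (j u)) - S t (j u)) /\<^sub>R h) \<longlongrightarrow> S t z) (at_right 0)" by (rule Lim_transform_eventually)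
    then have "(S t (j u), S t z) \<in> generator_graph S" by (simp add: generator_graph_def)
    then show ?thesis unfolding generator by fastforce
  qed
  define \<sigma> where "\<sigma> t = (SOME v. j v = S t (j u) \<and> (\<forall>w. b v w = - (S t z \<bullet> j w)))" for t
  have \<sigma>: "j (\<sigma> t) = S t (j u)" "b (\<sigma> t) w = - (S t z \<bullet> j w)" if "0 \<le> t" for t w
    using someI_ex[OF ex[OF that]] unfolding \<sigma>_def[symmetric] by auto
  \<comment> \<open>Testing the stationary equation with its own solution v; applied below to
    differences and to single values of the orbit.\<close>
  have co: "\<nu> * (norm v)\<^sup>2 \<le> norm x * norm (j v) + lam * (norm (j v))\<^sup>2" if "b v v = - (x \<bullet> j v)" for v x
    using coercive[of v] Cauchy_Schwarz_ineq2[of x "j v"] that by (simp add: abs_le_iff)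
  have cont: "continuous_on {0..} \<sigma>"
    unfolding continuous_on_def
  proof
    fix s :: real assume s: "s \<in> {0..}"
    let ?F = "at s within {0..}"
    have lim: "((\<lambda>t. S t x) \<longlongrightarrow> S s x) ?F" for x using S_continuous[of x] s by (auto simp: continuous_on_def)
    let ?g = "\<lambda>t. (norm (S t z - S s z) * norm (S t (j u) - S s (j u)) + lam * (norm (S t (j u) - S s (j u)))\<^sup>2) / \<nu>"
    have "\<forall>\<^sub>F t in ?F. norm ((norm (\<sigma> t - \<sigma> s))\<^sup>2) \<le> ?g t"
      unfolding eventually_at_filter
    proof (rule always_eventually, intro allI impI)
      fix t :: real assume "t \<noteq> s" "t \<in> {0..}"
      then have "b (\<sigma> t - \<sigma> s) (\<sigma> t - \<sigma> s) = - ((S t z - S s z) \<bullet> j (\<sigma> t - \<sigma> s))"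
        using s \<sigma> by (simp add: b.diff_left inner_diff_left)
      from co[OF this] show "norm ((norm (\<sigma> t - \<sigma> s))\<^sup>2) \<le> ?g t"
        using \<nu> s \<sigma> \<open>t \<in> {0..}\<close> by (simp add: blinfun.diff_right field_simps)
    qed
    moreover have "(?g \<longlongrightarrow> (norm (S s z - S s z) * norm (S s (j u) - S s (j u)) + lam * (norm (S s (j u) - S s (j u)))\<^sup>2) / \<nu>) ?F"
      using \<nu> by (intro tendsto_intros lim) auto
    then have "(?g \<longlongrightarrow> 0) ?F" by simp
    ultimately have "((\<lambda>t. (norm (\<sigma> t - \<sigma> s))\<^sup>2) \<longlongrightarrow> 0) ?F" by (rule Lim_null_comparison)
    from tendsto_real_sqrt[OF this] have "((\<lambda>t. norm (\<sigma> t - \<sigma> s)) \<longlongrightarrow> 0) ?F" by simp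
    then show "(\<sigma> \<longlongrightarrow> \<sigma> s) ?F" by (simp add: tendsto_norm_zero_iff LIM_zero_iff)
  qed
  define C where "C = sqrt ((M\<^sup>2 * (norm z * norm (j u)) + lam * M\<^sup>2 * (norm (j u))\<^sup>2) / \<nu>)"
  have "norm (\<sigma> t) \<le> C * exp (- \<omega> * t)" if t: "0 \<le> t" for t
  proof -
    let ?E = "M * exp (- \<omega> * t)"
    have "\<nu> * (norm (\<sigma> t))\<^sup>2 \<le> norm (S t z) * norm (S t (j u)) + lam * (norm (S t (j u)))\<^sup>2"
      using co[OF \<sigma>(2)[OF t]] \<sigma>(1)[OF t] by simp
    also have "\<dots> \<le> (?E * norm z) * (?E * norm (j u)) + lam * (?E * norm (j u))\<^sup>2"
      using M lam t by (intro add_mono mult_mono mult_left_mono power_mono) auto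
    also have "\<dots> = (M\<^sup>2 * (norm z * norm (j u)) + lam * M\<^sup>2 * (norm (j u))\<^sup>2) * (exp (- \<omega> * t))\<^sup>2"
      by (simp add: power_mult_distrib power2_eq_square algebra_simps)
    finally have "(norm (\<sigma> t))\<^sup>2 \<le> (M\<^sup>2 * (norm z * norm (j u)) + lam * M\<^sup>2 * (norm (j u))\<^sup>2) / \<nu> * (exp (- \<omega> * t))\<^sup>2"
      using \<nu> by (simp add: field_simps)
    then have "norm (\<sigma> t) \<le> sqrt ((M\<^sup>2 * (norm z * norm (j u)) + lam * M\<^sup>2 * (norm (j u))\<^sup>2) / \<nu> * (exp (- \<omega> * t))\<^sup>2)"
      by (rule real_le_rsqrt)
    then show ?thesis unfolding real_sqrt_mult C_def by simp
  qed
  moreover have "C \<ge> 0" unfolding C_def using lam \<nu> by auto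
  ultimately show ?thesis using that[OF cont \<sigma> M(2)] by blast
qed

lemma solvable_generator_domain:
  assumes gen: "\<And>w. b u w = - (z \<bullet> j w)"
  shows "solvable (j u) (\<lambda>_. 0)"
proof -
  obtain \<sigma> C \<omega> where \<sigma>: "continuous_on {0..} \<sigma>" "\<And>t. 0 \<le> t \<Longrightarrow> j (\<sigma> t) = S t (j u)"
    "\<And>t w. 0 \<le> t \<Longrightarrow> b (\<sigma> t) w = - (S t z \<bullet> j w)" "\<omega> > 0" "C \<ge> 0" "\<And>t. 0 \<le> t \<Longrightarrow> norm (\<sigma> t) \<le> C * exp (- \<omega> * t)"
    using orbit_exists[OF gen] by metis
  have "weak_solution \<sigma> (\<lambda>t. S t (j u)) (\<lambda>_. 0)"
    unfolding weak_solution_def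
  proof (intro conjI allI impI)
    show "in_L2 \<sigma>" by (rule in_L2_exponential_decay[OF \<sigma>(1,4,6)])
    show "AE t in half_line. S t (j u) = j (\<sigma> t)" using AE_half_line_pos by eventually_elim (simp add: \<sigma>(2))
    fix w and t :: real assume t: "0 \<le> t"
    have "S t (j u) \<bullet> j w - j u \<bullet> j w = ig (\<lambda>r. indicator {0<..} r * (S (max 0 (r - 0)) z \<bullet> j w)) 0 t"
      using shifted_orbit_integral[OF gen order_refl t, of "j w"] t by simp
    also have "\<dots> = ig (\<lambda>r. - b (\<sigma> r) w + 0 \<bullet> j w) 0 t"
      by (intro ig_cong) (simp add: \<sigma>(3))
    finally show "S t (j u) \<bullet> j w = S 0 (j u) \<bullet> j w + ig (\<lambda>r. - b (\<sigma> r) w + 0 \<bullet> j w) 0 t" by simp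
  qed (auto intro: S_continuous)
  then show ?thesis unfolding solvable_def
    by (intro exI[of _ \<sigma>] exI[of _ "\<lambda>t. S t (j u)"]) simp
qed

section \<open>From constant forcing on an interval to integrable forcing\<close>

lemma L1_indicator:
  assumes "A \<in> sets half_line" "A \<subseteq> {0<..T}"
  shows "L1 (\<lambda>t. indicator A t *\<^sub>R x)"
proof -
  have "emeasure half_line A \<le> emeasure half_line {0<..max 0 T}"
    using assms by (intro emeasure_mono) auto
  also have "\<dots> < \<infinity>" by (simp add: emeasure_half_line_Ioc)
  finally have i: "integrable half_line (indicator A :: real \<Rightarrow> real)"
    using assms by (intro integrable_real_indicator) auto
  have "strongly_measurable half_line (indicator A :: real \<Rightarrow> real)"
    by (intro strongly_measurable_of_real_measurable borel_measurable_indicator assms)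
  then show ?thesis using i unfolding L1_def
    by (auto intro!: strongly_measurable_scaleR)
qed

text \<open>Let u be the stationary state for the constant forcing x. Starting at 0, the solution
  under this forcing is j u - S t (j u); after beta it evolves freely to S (t - beta) (j u) - S t (j
  u). Writing tau for the positive part of t - beta merges both phases into one formula.\<close>

lemma solvable_interval:
  assumes \<beta>: "0 \<le> \<beta>"
  shows "solvable 0 (\<lambda>t. indicator {0<..\<beta>} t *\<^sub>R x)"
proof -
  obtain u where u: "\<And>w. b u w = - ((- x) \<bullet> j w)" using stationary_solvable by metis
  obtain \<sigma> C \<omega> where \<sigma>: "continuous_on {0..} \<sigma>" "\<And>t. 0 \<le> t \<Longrightarrow> j (\<sigma> t) = S t (j u)"
    "\<And>t w. 0 \<le> t \<Longrightarrow> b (\<sigma> t) w = - (S t (- x) \<bullet> j w)" "\<omega> > 0" "C \<ge> 0" "\<And>t. 0 \<le> t \<Longrightarrow> norm (\<sigma> t) \<le> C * exp (- \<omega> * t)"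
    using orbit_exists[OF u] by metis
  define \<tau> where "\<tau> t = max 0 (t - \<beta>)" for t
  have \<tau>0: "0 \<le> \<tau> t" for t by (simp add: \<tau>_def)
  have \<tau>c: "continuous_on {0..} \<tau>" unfolding \<tau>_def[abs_def] by (intro continuous_intros)
  define v where "v t = \<sigma> (\<tau> t) - \<sigma> t" for t
  define c where "c t = S (\<tau> t) (j u) - S t (j u)" for t
  have "weak_solution v c (\<lambda>t. indicator {0<..\<beta>} t *\<^sub>R x)"
    unfolding weak_solution_def
  proof (intro conjI allI impI)
    have vc: "continuous_on {0..} v" unfolding v_def
      by (intro continuous_intros \<sigma>(1) continuous_on_compose2[OF \<sigma>(1) \<tau>c]) (auto simp: \<tau>0)
    have "norm (v t) \<le> (C * exp (\<omega> * \<beta>) + C) * exp (- \<omega> * t)" if t: "0 \<le> t" for t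
    proof -
      have "norm (v t) \<le> norm (\<sigma> (\<tau> t)) + norm (\<sigma> t)" unfolding v_def by (rule norm_triangle_ineq4)
      also have "\<dots> \<le> C * exp (- \<omega> * \<tau> t) + C * exp (- \<omega> * t)" by (intro add_mono \<sigma> \<tau>0 t)
      also have "\<dots> \<le> C * exp (\<omega> * \<beta> + - \<omega> * t) + C * exp (- \<omega> * t)"
      proof -
        have "\<omega> * (t - \<beta>) \<le> \<omega> * \<tau> t" using \<sigma>(4) by (intro mult_left_mono) (auto simp: \<tau>_def)
        then have "- \<omega> * \<tau> t \<le> \<omega> * \<beta> + - \<omega> * t" by (simp add: algebra_simps)
        then show ?thesis using \<sigma>(5) by (intro add_mono mult_left_mono) auto
      qed
      finally show ?thesis by (simp only: exp_add distrib_right mult.assoc)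
    qed
    then show "in_L2 v" by (rule in_L2_exponential_decay[OF vc \<sigma>(4)])
    show "continuous_on {0..} c" unfolding c_def
      by (intro continuous_intros S_continuous continuous_on_compose2[OF S_continuous \<tau>c]) (auto simp: \<tau>0)
    show "AE t in half_line. c t = j (v t)" using AE_half_line_pos
      by eventually_elim (simp add: c_def v_def blinfun.diff_right \<sigma>(2) \<tau>0)
    show "L1 (\<lambda>t. indicator {0<..\<beta>} t *\<^sub>R x)" by (rule L1_indicator[of _ \<beta>]) auto
    fix w and t :: real assume t: "0 \<le> t"
    let ?k = "\<lambda>\<beta> r. indicator {\<beta><..} r * (S (max 0 (r - \<beta>)) (- x) \<bullet> j w)"
    have lk: "locint (?k \<beta>)" if \<beta>: "0 \<le> \<beta>" for \<beta>
    proof -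
      have c: "continuous_on {0..} (\<lambda>r. S (max 0 (r - \<beta>)) (- x) \<bullet> j w)"
        by (intro continuous_intros continuous_on_compose2[OF S_continuous]) auto
      have "{\<beta><..} \<in> sets half_line" using \<beta> by (auto simp: sets_restrict_space_iff)
      then show ?thesis
        by (intro locint_bound[OF locint_abs[OF locint_continuous[OF c]]])
          (auto intro!: borel_measurable_times borel_measurable_indicator locint_measurable[OF locint_continuous[OF c]] AE_I2 split: split_indicator)
    qed
    have "c t \<bullet> j w - c 0 \<bullet> j w = (S (max 0 (t - \<beta>)) (j u) \<bullet> j w - j u \<bullet> j w) - (S (max 0 (t - 0)) (j u) \<bullet> j w - j u \<bullet> j w)"
      using t \<beta> by (simp add: c_def \<tau>_def inner_diff_left)
    also have "\<dots> = ig (?k \<beta>) 0 t - ig (?k 0) 0 t"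
      using shifted_orbit_integral[OF u \<beta> t] shifted_orbit_integral[OF u order_refl t] by (simp only:)
    also have "\<dots> = ig (\<lambda>r. ?k \<beta> r - ?k 0 r) 0 t" by (rule ig_diff[OF lk[OF \<beta>] lk[OF order_refl] order_refl, symmetric])
    also have "\<dots> = ig (\<lambda>r. - b (v r) w + (indicator {0<..\<beta>} r *\<^sub>R x) \<bullet> j w) 0 t"
    proof (rule ig_cong)
      fix r assume r: "0 < r" "r \<le> t"
      have bv: "- b (v r) w = S (\<tau> r) (- x) \<bullet> j w - S r (- x) \<bullet> j w"
        using r \<tau>0 by (simp add: v_def b.diff_left \<sigma>(3))
      show "?k \<beta> r - ?k 0 r = - b (v r) w + (indicator {0<..\<beta>} r *\<^sub>R x) \<bullet> j w"
        unfolding bv using r by (cases "r \<le> \<beta>") (auto simp: \<tau>_def blinfun.minus_right)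
    qed
    finally show "c t \<bullet> j w = c 0 \<bullet> j w + ig (\<lambda>r. - b (v r) w + (indicator {0<..\<beta>} r *\<^sub>R x) \<bullet> j w) 0 t" by simp
  qed
  then show ?thesis unfolding solvable_def using \<beta>
    by (intro exI[of _ v] exI[of _ c]) (simp add: c_def \<tau>_def)
qed

lemma L1_norm_dominated_limit:
  assumes "\<And>k. L1 (f k)" "L1 g" "integrable half_line w" "AE t in half_line. (\<lambda>k. f k t) \<longlonglongrightarrow> g t"
    "\<And>k. AE t in half_line. norm (f k t) \<le> w t"
  shows "(\<lambda>k. L1_norm (\<lambda>t. f k t - g t)) \<longlonglongrightarrow> 0"
proof -
  have "(\<lambda>k. LINT t|half_line. norm (f k t - g t)) \<longlonglongrightarrow> (LINT t|half_line. 0)"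
  proof (rule integral_dominated_convergence[where w = "\<lambda>t. w t + norm (g t)"])
    show "(\<lambda>t. norm (f k t - g t)) \<in> borel_measurable half_line" for k
      using L1_diff[OF assms(1,2), of k] by (auto simp: L1_def)
    show "integrable half_line (\<lambda>t. w t + norm (g t))" using assms by (auto simp: L1_def)
    show "AE t in half_line. (\<lambda>k. norm (f k t - g t)) \<longlonglongrightarrow> 0"
      using assms(4) by eventually_elim (simp add: tendsto_norm_zero_iff LIM_zero_iff)
    show "AE t in half_line. norm (norm (f k t - g t)) \<le> w t + norm (g t)" for k
      using assms(5)[of k] by eventually_elim (auto intro: order_trans[OF norm_triangle_ineq4])
  qed simp
  then show ?thesis by (simp add: L1_norm_def)
qed

text \<open>The closure properties in the set induction are those of solvability: complements and
  finite unions by linearity, countable unions by \<open>solvable_limit\<close>, null sets since the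
  equation ignores them.\<close>

lemma solvable_indicator:
  assumes "A \<in> sets half_line" "A \<subseteq> {0<..T}"
  shows "solvable 0 (\<lambda>t. indicator A t *\<^sub>R x)"
  using assms
proof (induction rule: half_line_set_induct)
  case empty
  then show ?case using solvable_interval[of 0 x] by simp
next
  case (interval a)
  then show ?case by (rule solvable_interval)
next
  case (compl A)
  \<comment> \<open>T may be negative, in which case the interval is empty;
    \<open>solvable_interval\<close> asks for a nonnegative end point.\<close>
  have 1: "solvable 0 (\<lambda>t. indicator {0<..max 0 T} t *\<^sub>R x)" by (rule solvable_interval) simp
  have "solvable (0 + (-1) *\<^sub>R 0) (\<lambda>t. indicator {0<..max 0 T} t *\<^sub>R x + (-1) *\<^sub>R (indicator A t *\<^sub>R x))"
    by (rule solvable_lin[OF 1 compl(1)])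
  moreover have "indicator {0<..max 0 T} t *\<^sub>R x + (-1) *\<^sub>R (indicator A t *\<^sub>R x) = indicator ({0<..T} - A) t *\<^sub>R x" for t
    using compl(3) by (auto split: split_indicator)
  ultimately show ?case by simp
next
  case (union A)
  define B where "B n = (\<Union>i<n. A i)" for n :: nat
  have sB: "solvable 0 (\<lambda>t. indicator (B n) t *\<^sub>R x)" for n
  proof (induction n)
    case 0
    then show ?case using solvable_interval[of 0 x] by (simp add: B_def)
  next
    case (Suc n)
    have "solvable (0 + 1 *\<^sub>R 0) (\<lambda>t. indicator (B n) t *\<^sub>R x + 1 *\<^sub>R (indicator (A n) t *\<^sub>R x))"
      by (rule solvable_lin[OF Suc union(1)])
    moreover have "indicator (B n) t *\<^sub>R x + 1 *\<^sub>R (indicator (A n) t *\<^sub>R x) = indicator (B (Suc n)) t *\<^sub>R x" for t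
    proof -
      have "A i \<inter> A n = {}" if "i < n" for i using union(4) that by (auto simp: disjoint_family_on_def)
      then have "B n \<inter> A n = {}" by (auto simp: B_def)
      moreover have "B (Suc n) = B n \<union> A n" by (auto simp: B_def lessThan_Suc)
      ultimately show ?thesis by (auto split: split_indicator)
    qed
    ultimately show ?case by simp
  qed
  have sets: "(\<Union>i. A i) \<in> sets half_line" "(\<Union>i. A i) \<subseteq> {0<..T}" using union by auto
  show ?case
  proof (rule solvable_limit[OF sB L1_indicator[OF sets]])
    have w: "L1 (\<lambda>t. indicator {0<..max 0 T} t *\<^sub>R x)" by (rule L1_indicator[of _ "max 0 T"]) auto
    show "(\<lambda>k. L1_norm (\<lambda>t. indicator (B k) t *\<^sub>R x - indicator (\<Union>i. A i) t *\<^sub>R x)) \<longlonglongrightarrow> 0"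
    proof (rule L1_norm_dominated_limit[OF solvable_L1[OF sB] L1_indicator[OF sets], where w = "\<lambda>t. norm (indicator {0<..max 0 T} t *\<^sub>R x)"])
      show "integrable half_line (\<lambda>t. norm (indicator {0<..max 0 T} t *\<^sub>R x))" using w by (simp add: L1_def)
      show "AE t in half_line. norm (indicator (B k) t *\<^sub>R x) \<le> norm (indicator {0<..max 0 T} t *\<^sub>R x)" for k
        using union(3) by (intro AE_I2) (force simp: B_def split: split_indicator)
      show "AE t in half_line. (\<lambda>k. indicator (B k) t *\<^sub>R x) \<longlonglongrightarrow> indicator (\<Union>i. A i) t *\<^sub>R x"
        unfolding B_def by (intro AE_I2 tendsto_intros LIMSEQ_indicator_UN)
    qed
  qed simp
next
  case (null A B)
  show ?case by (rule solvable_cong_AE[OF null(1)]) (use null(3) in \<open>auto elim!: eventually_mono split: split_indicator\<close>)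
qed

text \<open>Strong measurability gives simple functions converging almost everywhere, without any
  integrable majorant. Truncating them makes dominated convergence in L1 available and leaves finite
  sums of indicators.\<close>

lemma solvable_L1_forcing:
  assumes f: "L1 f"
  shows "solvable 0 f"
proof -
  have fm: "strongly_measurable half_line f" "integrable half_line (\<lambda>t. norm (f t))" using f by (auto simp: L1_def)
  obtain s where s: "\<And>n::nat. simple_function half_line (s n)" "AE t in half_line. (\<lambda>n. s n t) \<longlonglongrightarrow> f t"
    using fm(1) by (auto simp: strongly_measurable_def)
  have [measurable]: "(\<lambda>t. norm (f t)) \<in> borel_measurable half_line" using fm by auto
  \<comment> \<open>Cut off in time and at twice |f|. Where f is nonzero the cutoff is eventually
    inactive; where f = 0 it forces the value 0.\<close>
  define A where "A k x = {t \<in> space half_line. s k t = x \<and> norm x \<le> 2 * norm (f t)} \<inter> {0<..real k}" for k x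
  have A: "A k x \<in> sets half_line" "A k x \<subseteq> {0<..real k}" for k x
  proof -
    have "{t \<in> space half_line. s k t = x \<and> norm x \<le> 2 * norm (f t)}
      = (s k -` {x} \<inter> space half_line) \<inter> {t \<in> space half_line. norm x \<le> 2 * norm (f t)}" by auto
    moreover have "{t \<in> space half_line. norm x \<le> 2 * norm (f t)} \<in> sets half_line" by measurable
    ultimately show "A k x \<in> sets half_line" unfolding A_def using simple_functionD(2)[OF s(1), of k "{x}"]
      by (intro sets.Int) auto
  qed (auto simp: A_def)
  define g where "g k t = (\<Sum>x\<in>s k ` space half_line. indicator (A k x) t *\<^sub>R x)" for k t
  have fin: "finite (s k ` space half_line)" for k by (rule simple_functionD(1)[OF s(1)])
  have sg: "solvable 0 (g k)" for k
  proof -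
    have "solvable 0 (\<lambda>t. \<Sum>x\<in>X. indicator (A k x) t *\<^sub>R x)" if "finite X" for X
      using that
    proof (induction X)
      case empty then show ?case using solvable_interval[of 0 0] by simp
    next
      case (insert x X)
      have "solvable (0 + 1 *\<^sub>R 0) (\<lambda>t. indicator (A k x) t *\<^sub>R x + 1 *\<^sub>R (\<Sum>x\<in>X. indicator (A k x) t *\<^sub>R x))"
        by (rule solvable_lin[OF solvable_indicator[OF A] insert.IH])
      then show ?case unfolding sum.insert[OF insert.hyps] by (simp only: scaleR_one add_0_left)
    qed
    from this[OF fin] show ?thesis unfolding g_def .
  qed
  have g_eq: "g k t = (if t \<le> real k \<and> norm (s k t) \<le> 2 * norm (f t) then s k t else 0)" if t: "0 < t" for k t
  proof -
    have "g k t = (\<Sum>x\<in>s k ` space half_line. if x = s k t then indicator (A k x) t *\<^sub>R x else 0)"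
      unfolding g_def by (intro sum.cong) (auto simp: A_def)
    also have "\<dots> = indicator (A k (s k t)) t *\<^sub>R s k t" using t by (subst sum.delta[OF fin]) auto
    finally show ?thesis using t by (auto simp: A_def)
  qed
  show ?thesis
  proof (rule solvable_limit[OF sg f])
    show "(\<lambda>k. L1_norm (\<lambda>t. g k t - f t)) \<longlonglongrightarrow> 0"
    proof (rule L1_norm_dominated_limit[OF solvable_L1[OF sg] f, where w = "\<lambda>t. 2 * norm (f t)"])
      show "AE t in half_line. norm (g k t) \<le> 2 * norm (f t)" for k
        using AE_half_line_pos by eventually_elim (simp add: g_eq)
      show "AE t in half_line. (\<lambda>k. g k t) \<longlonglongrightarrow> f t"
        using s(2) AE_half_line_pos
      proof eventually_elim
        case (elim t)
        obtain N where N: "t \<le> real N" using real_arch_simple by blast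
        show ?case
        proof (cases "f t = 0")
          case True
          then have "g k t = f t" for k using elim by (auto simp: g_eq)
          then show ?thesis by simp
        next
          case False
          have "(\<lambda>k. norm (s k t)) \<longlonglongrightarrow> norm (f t)" using elim by (intro tendsto_intros)
          then have "\<forall>\<^sub>F k in sequentially. norm (s k t) < 2 * norm (f t)" using False by (intro order_tendstoD) auto
          moreover have "\<forall>\<^sub>F k in sequentially. t \<le> real k" using N by (intro eventually_sequentiallyI[of N]) auto
          ultimately have "\<forall>\<^sub>F k in sequentially. s k t = g k t"
            by eventually_elim (simp add: g_eq elim)
          with elim(1) show ?thesis by (rule Lim_transform_eventually)
        qed
      qed
    qed (use fm in auto)
  qed simp
qed

text \<open>Superposition of zero initial value with the forcing and zero forcing with the initial
  value; the latter is approximated by Yosida approximations, which lie in the domain of the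
  generator.\<close>

theorem linear_problem_solvable:
  assumes "L1 f"
  shows "solvable x f"
proof -
  have "solvable x (\<lambda>_. 0)"
  proof (rule resolvents)
    fix \<mu> :: "nat \<Rightarrow> real" and J J' :: "nat \<Rightarrow> 'y \<Rightarrow>\<^sub>L 'v"
    assume J: "\<And>n y w. \<mu> n * (j (J n y) \<bullet> j w) + b (J n y) w = y \<bullet> j w"
      and lim: "\<And>y. (\<lambda>n. \<mu> n *\<^sub>R j (J n y)) \<longlonglongrightarrow> y"
    show "solvable x (\<lambda>_. 0)"
    proof (rule solvable_limit[OF _ L1_zero _ lim])
      fix n
      let ?z = "\<mu> n *\<^sub>R (\<mu> n *\<^sub>R j (J n x) - x)"
      have "b (\<mu> n *\<^sub>R J n x) w = - (?z \<bullet> j w)" for w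
        using arg_cong[OF J[of n x w], of "\<lambda>r. \<mu> n * r"] by (simp add: b.scaleR_left inner_diff_left algebra_simps)
      from solvable_generator_domain[OF this] show "solvable (\<mu> n *\<^sub>R j (J n x)) (\<lambda>_. 0)"
        by (simp add: blinfun.scaleR_right)
    qed (simp add: L1_norm_def)
  qed
  from solvable_lin[OF this solvable_L1_forcing[OF assms], of 1] show ?thesis by simp
qed

end

section \<open>Multilinear forms and the feedback law\<close>

lemma multilinear_linear_slot:
  assumes "bounded_multilinear_form k T" "length pre + length post + 1 = k"
  shows "linear (\<lambda>a. T (pre @ a # post))"
proof -
  have "\<forall>zs i. length zs = k \<longrightarrow> i < k \<longrightarrow> linear (\<lambda>x. T (zs[i := x]))"
    using assms(1) unfolding bounded_multilinear_form_def by blast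
  from this[rule_format, of "pre @ 0 # post" "length pre"]
  have "linear (\<lambda>x. T ((pre @ 0 # post)[length pre := x]))"
    using assms(2) by simp
  then show ?thesis by simp
qed

lemma multilinear_bound:
  assumes "bounded_multilinear_form k T"
  obtains M where "M \<ge> 0" "\<And>zs. length zs = k \<Longrightarrow> \<bar>T zs\<bar> \<le> M * prod_list (map norm zs)"
proof -
  obtain M where M: "\<And>zs. length zs = k \<Longrightarrow> \<bar>T zs\<bar> \<le> M * prod_list (map norm zs)"
    using assms unfolding bounded_multilinear_form_def by blast
  have "prod_list (map norm zs) \<ge> 0" for zs :: "'a list" by (rule prod_list_nonneg) auto
  then have "\<bar>T zs\<bar> \<le> \<bar>M\<bar> * prod_list (map norm zs)" if "length zs = k" for zs
    using M[OF that] by (meson abs_ge_self mult_right_mono order_trans)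
  then show ?thesis by (intro that[of "\<bar>M\<bar>"]) auto
qed

text \<open>The slots are exchanged one at a time; each exchange costs one factor x - x' and leaves
  m - 1 slots bounded by R. The leading slot is reserved for a direction h, as in the
  derivative.\<close>

lemma multilinear_telescope:
  fixes x x' :: "'y::real_normed_vector"
  assumes T: "bounded_multilinear_form (Suc m) T"
    and M: "M \<ge> 0" "\<And>zs. length zs = Suc m \<Longrightarrow> \<bar>T zs\<bar> \<le> M * prod_list (map norm zs)"
    and R: "norm x \<le> R" "norm x' \<le> R" and i: "i \<le> m"
  shows "\<bar>T (h # replicate i x @ replicate (m - i) x') - T (h # replicate m x')\<bar>
    \<le> real i * (M * norm h * R ^ (m - 1) * norm (x - x'))"
  using i
proof (induction i)
  case 0
  then show ?case by simp
next
  case (Suc i)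
  define post where "post = replicate (m - Suc i) x'"
  have e1: "h # replicate (Suc i) x @ replicate (m - Suc i) x' = (h # replicate i x) @ x # post"
    by (simp add: post_def replicate_app_Cons_same)
  have "replicate (m - i) x' = x' # post" using Suc.prems by (simp add: post_def Suc_diff_Suc flip: replicate_Suc)
  then have e2: "h # replicate i x @ replicate (m - i) x' = (h # replicate i x) @ x' # post" by simp
  have len: "length (h # replicate i x) + length post + 1 = Suc m" using Suc.prems by (simp add: post_def)
  have "T ((h # replicate i x) @ x # post) - T ((h # replicate i x) @ x' # post) = T ((h # replicate i x) @ (x - x') # post)"
    using linear_diff[OF multilinear_linear_slot[OF T len], of x x'] by simp
  also have "\<bar>\<dots>\<bar> \<le> M * prod_list (map norm ((h # replicate i x) @ (x - x') # post))"
    using len by (intro M) simp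
  also have "prod_list (map norm ((h # replicate i x) @ (x - x') # post)) = norm h * (norm x ^ i * norm x' ^ (m - Suc i)) * norm (x - x')"
    by (simp add: post_def prod_list_replicate)
  also have "\<dots> \<le> norm h * (R ^ i * R ^ (m - Suc i)) * norm (x - x')"
    using R order_trans[OF norm_ge_zero R(1)]
    by (intro mult_right_mono mult_left_mono mult_mono power_mono) auto
  also have "R ^ i * R ^ (m - Suc i) = R ^ (m - 1)" using Suc.prems by (simp flip: power_add)
  finally have "\<bar>T ((h # replicate i x) @ x # post) - T ((h # replicate i x) @ x' # post)\<bar> \<le> M * (norm h * R ^ (m - 1) * norm (x - x'))"
    using M(1) by (simp add: mult_left_mono)
  then show ?case using Suc.IH Suc.prems unfolding e1 e2 by (simp add: algebra_simps abs_le_iff)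
qed

lemma symmetric_form_mset:
  assumes "symmetric_form k T" "length ys = k" "mset xs = mset ys"
  shows "T xs = T ys"
proof -
  obtain \<sigma> where "\<sigma> permutes {..<length ys}" "permute_list \<sigma> ys = xs"
    using assms(3) by (rule mset_eq_permutation)
  then show ?thesis using assms(1,2) unfolding symmetric_form_def by blast
qed

text \<open>The difference of the powers telescopes over positions, and symmetry moves each
  increment h to the front. Replacing the remaining y by x changes each summand by at most a
  multiple of |h|^2.\<close>

lemma multilinear_power_has_derivative:
  fixes T :: "'y::real_normed_vector list \<Rightarrow> real"
  assumes T: "bounded_multilinear_form (Suc m) T" and sym: "symmetric_form (Suc m) T"
  shows "((\<lambda>x. T (replicate (Suc m) x)) has_derivative (\<lambda>h. real (Suc m) * T (h # replicate m x))) (at x)"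
proof -
  obtain M where M: "M \<ge> 0" "\<And>zs. length zs = Suc m \<Longrightarrow> \<bar>T zs\<bar> \<le> M * prod_list (map norm zs)"
    using multilinear_bound[OF T] by blast
  have lin: "linear (\<lambda>h. T (h # replicate m x))" using multilinear_linear_slot[OF T, of "[]" "replicate m x"] by simp
  have "\<bar>T (h # replicate m x)\<bar> \<le> norm h * (M * norm x ^ m)" for h
    using M(2)[of "h # replicate m x"] by (simp add: prod_list_replicate algebra_simps)
  then have bl: "bounded_linear (\<lambda>h. T (h # replicate m x))"
    using lin by (intro bounded_linear_intro[where K = "M * norm x ^ m"]) (auto simp: linear_iff)
  \<comment> \<open>Bounds both x and all y at distance below 1 from x. In C, one factor
    \<open>Suc m\<close> counts the positions and the other comes from the telescope.\<close>
  define R where "R = norm x + 1"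
  define C where "C = real (Suc m) * real (Suc m) * M * R ^ (m - 1)"
  show ?thesis
  proof (rule has_derivativeI_sandwich[where e = 1])
    show "bounded_linear (\<lambda>h. real (Suc m) * T (h # replicate m x))" using bl by (rule bounded_linear_const_mult)
    show "((\<lambda>y. C * norm (y - x)) \<longlongrightarrow> 0) (at x)" by (rule tendsto_eq_intros refl | simp)+
    fix y assume y: "y \<noteq> x" "dist y x < 1"
    define h where "h = y - x"
    have "norm y \<le> norm x + norm (y - x)" using norm_triangle_ineq[of x "y - x"] by simp
    then have R: "norm y \<le> R" "norm x \<le> R" "R \<ge> 0" using y(2) by (auto simp: R_def dist_norm)
    define W where "W i = T (replicate i y @ replicate (Suc m - i) x)" for i
    have diff: "\<bar>(W (Suc i) - W i) - T (h # replicate m x)\<bar> \<le> real (Suc m) * (M * norm h * R ^ (m - 1) * norm h)" if i: "i \<le> m" for i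
    proof -
      have e: "W (Suc i) = T (replicate i y @ y # replicate (m - i) x)" "W i = T (replicate i y @ x # replicate (m - i) x)"
        using i unfolding W_def by (simp_all add: replicate_app_Cons_same Suc_diff_le)
      have "W (Suc i) - W i = T (replicate i y @ h # replicate (m - i) x)"
        unfolding e h_def using linear_diff[OF multilinear_linear_slot[OF T, of "replicate i y" "replicate (m - i) x"], of y x] i by simp
      also have "\<dots> = T (h # replicate i y @ replicate (m - i) x)"
        using i by (intro symmetric_form_mset[OF sym]) auto
      finally have "\<bar>(W (Suc i) - W i) - T (h # replicate m x)\<bar> \<le> real i * (M * norm h * R ^ (m - 1) * norm h)"
        using multilinear_telescope[OF T M R(1,2) i, of h] by (simp add: h_def)
      also have "\<dots> \<le> real (Suc m) * (M * norm h * R ^ (m - 1) * norm h)"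
        using i M R by (intro mult_right_mono) auto
      finally show ?thesis .
    qed
    have "T (replicate (Suc m) y) - T (replicate (Suc m) x) - real (Suc m) * T (h # replicate m x)
      = (\<Sum>i<Suc m. (W (Suc i) - W i) - T (h # replicate m x))"
      unfolding sum_subtractf[of "\<lambda>i. W (Suc i) - W i" "\<lambda>_. T (h # replicate m x)"] sum_lessThan_telescope[of W]
      by (simp add: W_def)
    also have "\<bar>\<dots>\<bar> \<le> (\<Sum>i<Suc m. \<bar>(W (Suc i) - W i) - T (h # replicate m x)\<bar>)" by (rule sum_abs)
    also have "\<dots> \<le> (\<Sum>i<Suc m. real (Suc m) * (M * norm h * R ^ (m - 1) * norm h))"
      by (intro sum_mono diff) simp
    also have "\<dots> = C * norm h * norm h" by (simp add: C_def algebra_simps)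
    finally show "norm (T (replicate (Suc m) y) - T (replicate (Suc m) x) - real (Suc m) * T ((y - x) # replicate m x)) / norm (y - x) \<le> C * norm (y - x)"
      using y(1) by (simp add: h_def divide_le_eq)
  qed simp
qed

text \<open>Derivative of the value polynomial at x in direction h, with k / k! = 1 / (k - 1)!. The
  starting order l is a parameter: 2 gives the whole derivative, 3 omits the part linear in x, which
  A_Pi contains.\<close>

definition value_derivative :: "(nat \<Rightarrow> 'y list \<Rightarrow> real) \<Rightarrow> nat \<Rightarrow> nat \<Rightarrow> 'y \<Rightarrow> 'y \<Rightarrow> real" where
  "value_derivative T l p x h = (\<Sum>k=l..p. (real k / fact k) * T k (h # replicate (k - 1) x))"

context
  fixes T :: "nat \<Rightarrow> 'y::real_inner list \<Rightarrow> real" and p :: nat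
  assumes T: "\<And>k. k \<ge> 2 \<Longrightarrow> bounded_multilinear_form k (T k) \<and> symmetric_form k (T k)"
begin

lemma frechet_derivative_value_poly:
  "frechet_derivative (value_poly T p) (at x) = value_derivative T 2 p x"
proof -
  have "((\<lambda>x. (1 / fact k) * T k (replicate k x)) has_derivative (\<lambda>h. (real k / fact k) * T k (h # replicate (k - 1) x))) (at x)"
    if k: "k \<ge> 2" for k
  proof -
    obtain m where m: "k = Suc m" using k by (cases k) auto
    have "((\<lambda>x. T k (replicate k x)) has_derivative (\<lambda>h. real k * T k (h # replicate (k - 1) x))) (at x)"
      using multilinear_power_has_derivative[of m "T k" x] T[OF k] by (simp add: m)
    from has_derivative_mult_right[OF this, of "1 / fact k"] show ?thesis by simp
  qed
  then have "(value_poly T p has_derivative value_derivative T 2 p x) (at x)"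
    unfolding value_poly_def[abs_def] value_derivative_def[abs_def] by (intro has_derivative_sum) auto
  from frechet_derivative_at[OF this] show ?thesis ..
qed

lemma value_derivative_linear:
  assumes l: "l \<ge> 2"
  shows "linear (value_derivative T l p x)"
  unfolding value_derivative_def[abs_def]
proof (intro linear_compose_sum ballI)
  fix k assume k: "k \<in> {l..p}"
  then have "linear (\<lambda>h. T k ([] @ h # replicate (k - 1) x))"
    using l T[of k] by (intro multilinear_linear_slot) auto
  then show "linear (\<lambda>h. (real k / fact k) * T k (h # replicate (k - 1) x))"
    using linear_compose[OF _ bounded_linear.linear[OF bounded_linear_mult_right[of "real k / fact k"]]]
    by (simp add: o_def)
qed

lemma value_derivative_zero:
  assumes l: "l \<ge> 2"
  shows "value_derivative T l p 0 h = 0"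
  unfolding value_derivative_def
proof (intro sum.neutral ballI)
  fix k assume "k \<in> {l..p}"
  then have k: "k \<ge> 2" using l by simp
  obtain M where M: "\<And>zs. length zs = k \<Longrightarrow> \<bar>T k zs\<bar> \<le> M * prod_list (map norm zs)"
    using multilinear_bound T[OF k] by metis
  have "T k (h # replicate (k - 1) 0) = 0"
    using M[of "h # replicate (k - 1) 0"] k by (simp add: prod_list_replicate power_0_left)
  then show "real k / fact k * T k (h # replicate (k - 1) 0) = 0" by simp
qed

text \<open>From order 3 on at least two slots carry x, so that beside the difference x - x' one
  more factor of the size of x and x' survives. This is the source of the quadratic bound for the
  part in direction B.\<close>

lemma value_derivative_lipschitz:
  "\<exists>C\<ge>0. \<forall>x x' h. norm x \<le> R \<longrightarrow> norm x' \<le> R \<longrightarrow>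
    \<bar>value_derivative T 2 p x h - value_derivative T 2 p x' h\<bar> \<le> C * norm (x - x') * norm h \<and>
    \<bar>value_derivative T 3 p x h - value_derivative T 3 p x' h\<bar> \<le> C * (norm x + norm x') * norm (x - x') * norm h"
proof -
  have "\<forall>k. \<exists>M. 2 \<le> k \<longrightarrow> M \<ge> 0 \<and> (\<forall>zs. length zs = k \<longrightarrow> \<bar>T k zs\<bar> \<le> M * prod_list (map norm zs))"
    using T multilinear_bound by metis
  then obtain M where M: "\<And>k. 2 \<le> k \<Longrightarrow> M k \<ge> 0" "\<And>k zs. 2 \<le> k \<Longrightarrow> length zs = k \<Longrightarrow> \<bar>T k zs\<bar> \<le> M k * prod_list (map norm zs)"
    by metis
  \<comment> \<open>At least 1, so that a single power \<open>Q ^ k\<close> dominates all lower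
    ones.\<close>
  define Q where "Q = \<bar>R\<bar> + 1"
  have Q: "Q \<ge> 1" by (simp add: Q_def)
  define C where "C = (\<Sum>k=2..p. real k / fact k * (real k * M k * Q ^ k))"
  have C0: "C \<ge> 0" unfolding C_def using M(1) Q by (intro sum_nonneg) auto
  have diff: "value_derivative T l p x h - value_derivative T l p x' h
      = (\<Sum>k=l..p. real k / fact k * (T k (h # replicate (k - 1) x) - T k (h # replicate (k - 1) x')))" for l x x' h
    unfolding value_derivative_def sum_subtractf[symmetric] by (simp add: right_diff_distrib)
  have slot: "\<bar>T k (h # replicate (k - 1) x) - T k (h # replicate (k - 1) x')\<bar> \<le> real k * (M k * norm h * r ^ (k - 2) * norm (x - x'))"
    if k: "k \<ge> 2" and r: "norm x \<le> r" "norm x' \<le> r" for k x x' h r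
  proof -
    obtain m where m: "k = Suc m" using k by (cases k) auto
    have r0: "r \<ge> 0" using r(1) norm_ge_zero order_trans by blast
    have "\<bar>T k (h # replicate m x) - T k (h # replicate m x')\<bar> \<le> real m * (M k * norm h * r ^ (m - 1) * norm (x - x'))"
      using multilinear_telescope[of m "T k" "M k" x r x' m h] T[OF k] M[OF k] r by (simp add: m)
    also have "\<dots> \<le> real k * (M k * norm h * r ^ (m - 1) * norm (x - x'))"
      using M(1)[OF k] r0 by (intro mult_right_mono) (auto simp: m)
    finally show ?thesis by (simp add: m numeral_2_eq_2)
  qed
  have A: "\<bar>value_derivative T 2 p x h - value_derivative T 2 p x' h\<bar> \<le> C * norm (x - x') * norm h"
    if x: "norm x \<le> R" "norm x' \<le> R" for x x' h
  proof -
    have "\<bar>value_derivative T 2 p x h - value_derivative T 2 p x' h\<bar>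
        \<le> (\<Sum>k=2..p. \<bar>real k / fact k * (T k (h # replicate (k - 1) x) - T k (h # replicate (k - 1) x'))\<bar>)"
      unfolding diff by (rule sum_abs)
    also have "\<dots> \<le> (\<Sum>k=2..p. real k / fact k * (real k * M k * Q ^ k) * (norm (x - x') * norm h))"
    proof (rule sum_mono)
      fix k assume "k \<in> {2..p}"
      then have k: "k \<ge> 2" by simp
      have q: "norm x \<le> Q" "norm x' \<le> Q" using x by (auto simp: Q_def)
      have "Q ^ (k - 2) \<le> Q ^ k" using Q by (intro power_increasing) auto
      then have "real k * (M k * norm h * Q ^ (k - 2) * norm (x - x')) \<le> real k * (M k * norm h * Q ^ k * norm (x - x'))"
        using M(1)[OF k] by (intro mult_left_mono mult_right_mono) auto
      with slot[OF k q, of h] have s: "\<bar>T k (h # replicate (k - 1) x) - T k (h # replicate (k - 1) x')\<bar> \<le> (real k * M k * Q ^ k) * (norm (x - x') * norm h)"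
        by (simp add: algebra_simps)
      have "\<bar>real k / fact k * (T k (h # replicate (k - 1) x) - T k (h # replicate (k - 1) x'))\<bar>
        = real k / fact k * \<bar>T k (h # replicate (k - 1) x) - T k (h # replicate (k - 1) x')\<bar>" by (simp add: abs_mult)
      also have "\<dots> \<le> real k / fact k * ((real k * M k * Q ^ k) * (norm (x - x') * norm h))"
        using s by (intro mult_left_mono) auto
      finally show "\<bar>real k / fact k * (T k (h # replicate (k - 1) x) - T k (h # replicate (k - 1) x'))\<bar>
        \<le> real k / fact k * (real k * M k * Q ^ k) * (norm (x - x') * norm h)" by (simp only: mult.assoc)
    qed
    also have "\<dots> = C * norm (x - x') * norm h" unfolding C_def sum_distrib_right mult.assoc ..
    finally show ?thesis .
  qed
  have B: "\<bar>value_derivative T 3 p x h - value_derivative T 3 p x' h\<bar> \<le> C * (norm x + norm x') * norm (x - x') * norm h"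
    if x: "norm x \<le> R" "norm x' \<le> R" for x x' h
  proof -
    define r where "r = norm x + norm x'"
    have r: "norm x \<le> r" "norm x' \<le> r" "0 \<le> r" by (auto simp: r_def)
    have r2: "r \<le> 2 * Q" using x by (auto simp: r_def Q_def)
    have "\<bar>value_derivative T 3 p x h - value_derivative T 3 p x' h\<bar>
        \<le> (\<Sum>k=3..p. \<bar>real k / fact k * (T k (h # replicate (k - 1) x) - T k (h # replicate (k - 1) x'))\<bar>)"
      unfolding diff by (rule sum_abs)
    also have "\<dots> \<le> (\<Sum>k=3..p. real k / fact k * (real k * M k * Q ^ k) * (r * norm (x - x') * norm h))"
    proof (rule sum_mono)
      fix k assume "k \<in> {3..p}"
      then have k: "k \<ge> 3" "k \<ge> 2" by auto
      \<comment> \<open>The larger norm is at most r and at most Q: one factor rho is kept as r, the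
        others are absorbed into Q.\<close>
      define \<rho> where "\<rho> = max (norm x) (norm x')"
      have \<rho>: "norm x \<le> \<rho>" "norm x' \<le> \<rho>" "0 \<le> \<rho>" "\<rho> \<le> r" "\<rho> \<le> Q" using x by (auto simp: \<rho>_def r_def Q_def le_max_iff_disj)
      have "\<rho> ^ (k - 2) = \<rho> * \<rho> ^ (k - 3)" using k by (simp add: Suc_diff_le flip: power_Suc) (metis Suc_diff_le diff_Suc_Suc numeral_2_eq_2 numeral_3_eq_3)
      also have "\<dots> \<le> r * Q ^ (k - 3)" using \<rho> r by (intro mult_mono power_mono) auto
      also have "\<dots> \<le> r * Q ^ k" using Q r by (intro mult_left_mono power_increasing) auto
      finally have "real k * (M k * norm h * \<rho> ^ (k - 2) * norm (x - x')) \<le> real k * (M k * norm h * (r * Q ^ k) * norm (x - x'))"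
        using M(1)[OF k(2)] by (intro mult_left_mono mult_right_mono) auto
      with slot[OF k(2) \<rho>(1,2), of h] have s: "\<bar>T k (h # replicate (k - 1) x) - T k (h # replicate (k - 1) x')\<bar> \<le> (real k * M k * Q ^ k) * (r * norm (x - x') * norm h)"
        by (simp add: algebra_simps)
      have "\<bar>real k / fact k * (T k (h # replicate (k - 1) x) - T k (h # replicate (k - 1) x'))\<bar>
        = real k / fact k * \<bar>T k (h # replicate (k - 1) x) - T k (h # replicate (k - 1) x')\<bar>" by (simp add: abs_mult)
      also have "\<dots> \<le> real k / fact k * ((real k * M k * Q ^ k) * (r * norm (x - x') * norm h))"
        using s by (intro mult_left_mono) auto
      finally show "\<bar>real k / fact k * (T k (h # replicate (k - 1) x) - T k (h # replicate (k - 1) x'))\<bar>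
        \<le> real k / fact k * (real k * M k * Q ^ k) * (r * norm (x - x') * norm h)" by (simp only: mult.assoc)
    qed
    also have "\<dots> = (\<Sum>k=3..p. real k / fact k * (real k * M k * Q ^ k)) * (r * norm (x - x') * norm h)"
      unfolding sum_distrib_right ..
    also have "\<dots> \<le> C * (r * norm (x - x') * norm h)"
      unfolding C_def using M(1) Q r by (intro mult_right_mono sum_mono2) auto
    finally show ?thesis by (simp add: r_def mult.assoc)
  qed
  show ?thesis using A B C0 by blast
qed

end

text \<open>
  In the pivot space Y the nonlinearity is quadratic in the V norm, hence integrable in time; in
  the dual of V it is linear in the V norm, hence square integrable. The latter uses the adjoint
  of N.
\<close>

lemma feedback_nonlinearity_estimates:
  fixes j N :: "'v::real_inner \<Rightarrow>\<^sub>L 'y::real_inner" and N' :: "'v \<Rightarrow>\<^sub>L 'y" and P :: "'y \<Rightarrow>\<^sub>L 'y" and B :: 'y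
  assumes T: "\<And>k. k \<ge> 2 \<Longrightarrow> bounded_multilinear_form k (T k) \<and> symmetric_form k (T k)"
    and T2: "\<And>z1 z2. T 2 [z1, z2] = z1 \<bullet> P z2" and p: "p \<ge> 2"
    and \<alpha>: "\<alpha> > 0" and N': "\<And>v w. N v \<bullet> j w = j v \<bullet> N' w"
  defines "F \<equiv> \<lambda>v. feedback j N B \<alpha> T p v *\<^sub>R (N v + B) + ((1 / \<alpha>) * (B \<bullet> P (j v))) *\<^sub>R B"
  shows "F 0 = 0"
    and "\<exists>C\<ge>0. \<forall>v w. norm (j v) \<le> R \<longrightarrow> norm (j w) \<le> R \<longrightarrow>
      norm (F v - F w) \<le> C * ((norm v + norm w) * norm (v - w) + (norm v + norm w)\<^sup>2 * norm (j (v - w))) \<and>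
      norm (to_dual j (F v - F w)) \<le> C * (norm (v - w) + (norm v + norm w) * norm (j (v - w)))"
proof -
  let ?D = "value_derivative T 2 p" and ?E = "value_derivative T 3 p"
  have DE: "?D x h = h \<bullet> P x + ?E x h" for x h
  proof -
    have "{2..p} = insert 2 {3..p}" using p by auto
    then show ?thesis by (simp add: value_derivative_def T2)
  qed
  have D_lin: "linear (?D x)" for x using value_derivative_linear[OF T] by blast
  have D_zero: "?D 0 h = 0" "?E 0 h = 0" for h using value_derivative_zero[OF T] by auto
  define \<beta> where "\<beta> = 1 / \<alpha>"
  have \<beta>: "\<beta> > 0" using \<alpha> by (simp add: \<beta>_def)
  define u where "u v = \<beta> * (?D (j v) (N v) + ?D (j v) B)" for v
  \<comment> \<open>While -u is the feedback, q lacks the second-order term in direction B: adding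
    the rank-one term in F cancels it.\<close>
  define q where "q v = \<beta> * (?D (j v) (N v) + ?E (j v) B)" for v
  have fd: "frechet_derivative (value_poly T p) (at x) = ?D x" for x
    by (rule frechet_derivative_value_poly) (use T in blast)
  have fb: "feedback j N B \<alpha> T p v = - u v" for v
    unfolding feedback_def fd u_def \<beta>_def linear_add[OF D_lin] by simp
  have F: "F v = - (u v *\<^sub>R N v + q v *\<^sub>R B)" for v
  proof -
    have "- u v + \<beta> * (B \<bullet> P (j v)) = - q v" unfolding u_def q_def DE[of _ B] by (simp add: algebra_simps)
    then have "(- u v) *\<^sub>R B + (\<beta> * (B \<bullet> P (j v))) *\<^sub>R B = (- q v) *\<^sub>R B" by (metis scaleR_add_left)
    then show ?thesis unfolding F_def fb \<beta>_def[symmetric] by (simp add: scaleR_add_right algebra_simps)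
  qed
  show "F 0 = 0" unfolding F by (simp add: u_def q_def D_zero)
  obtain C0 where C0: "C0 \<ge> 0" and 
    lip: "\<And>x x' h. norm x \<le> \<bar>R\<bar> \<Longrightarrow> norm x' \<le> \<bar>R\<bar> \<Longrightarrow> \<bar>?D x h - ?D x' h\<bar> \<le> C0 * norm (x - x') * norm h \<and>
      \<bar>?E x h - ?E x' h\<bar> \<le> C0 * (norm x + norm x') * norm (x - x') * norm h"
    using value_derivative_lipschitz[OF T, of "\<bar>R\<bar>" p] by blast
  \<comment> \<open>One constant for all bounds, at least 1 so that its powers are monotone. The
    factor 10 and the exponent 7 below are crude upper bounds for the collected terms.\<close>
  define H where "H = 1 + \<bar>R\<bar> + norm j + norm N + norm N' + norm B + C0 + \<beta>"
  have H: "1 \<le> H" "\<bar>R\<bar> \<le> H" "norm j \<le> H" "norm N \<le> H" "norm N' \<le> H" "norm B \<le> H" "C0 \<le> H" "\<beta> \<le> H" "0 \<le> H"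
    using C0 \<beta> by (simp_all add: H_def)
  have Hp: "H ^ a \<le> H ^ b" if "a \<le> b" for a b using H(1) that by (intro power_increasing)
  have est: "norm (F v - F w) \<le> 10 * H ^ 7 * ((norm v + norm w) * norm (v - w) + (norm v + norm w)\<^sup>2 * norm (j (v - w))) \<and>
      norm (to_dual j (F v - F w)) \<le> 10 * H ^ 7 * (norm (v - w) + (norm v + norm w) * norm (j (v - w)))"
    if v: "norm (j v) \<le> R" and w: "norm (j w) \<le> R" for v w
  proof -
    define d where "d = norm (v - w)"
    define n where "n = norm (j (v - w))"
    define s where "s = norm v + norm w"
    have nn: "0 \<le> d" "0 \<le> n" "0 \<le> s" by (simp_all add: d_def n_def s_def)
    have vR: "norm (j v) \<le> \<bar>R\<bar>" "norm (j w) \<le> \<bar>R\<bar>" using v w by auto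
    have jv: "norm (j v) \<le> H" "norm (j w) \<le> H" using vR H by auto
    have jl: "norm (j x) \<le> H * norm x" "norm (N x) \<le> H * norm x" "norm (N' x) \<le> H * norm x" for x
      using norm_blinfun[of j x] norm_blinfun[of N x] norm_blinfun[of N' x] H(3-5)
      by (meson mult_right_mono norm_ge_zero order_trans)+
    have js: "norm (j v) + norm (j w) \<le> H * s" using jl(1)[of v] jl(1)[of w] by (simp add: s_def algebra_simps)
    have jvs: "norm (j v) \<le> H * s" using js norm_ge_zero[of "j w"] by linarith
    have ws: "norm w \<le> s" "norm v \<le> s" by (auto simp: s_def)
    have nd: "n \<le> H * d" using jl(1) by (simp add: n_def d_def)
    have Dv: "\<bar>?D (j v) h\<bar> \<le> H * norm (j v) * norm h" for h
    proof -
      have "\<bar>?D (j v) h\<bar> \<le> C0 * norm (j v) * norm h" using lip[OF vR(1), of 0 h] by (simp add: D_zero)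
      also have "\<dots> \<le> H * norm (j v) * norm h" using H(7) by (intro mult_right_mono) auto
      finally show ?thesis .
    qed
    have Dd: "\<bar>?D (j v) h - ?D (j w) h\<bar> \<le> H * n * norm h" for h
    proof -
      have "\<bar>?D (j v) h - ?D (j w) h\<bar> \<le> C0 * n * norm h" using lip[OF vR, of h] by (simp add: n_def blinfun.diff_right)
      also have "\<dots> \<le> H * n * norm h" using H(7) nn by (intro mult_right_mono) auto
      finally show ?thesis .
    qed
    have Ed: "\<bar>?E (j v) B - ?E (j w) B\<bar> \<le> H ^ 3 * s * n"
    proof -
      have "\<bar>?E (j v) B - ?E (j w) B\<bar> \<le> C0 * (norm (j v) + norm (j w)) * n * norm B" using lip[OF vR, of B] by (simp add: n_def blinfun.diff_right)
      also have "\<dots> \<le> H * (H * s) * n * H" using H js nn C0 by (intro mult_mono mult_nonneg_nonneg) auto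
      finally show ?thesis by (simp add: power3_eq_cube algebra_simps)
    qed
    have dN: "\<bar>?D (j v) (N v) - ?D (j w) (N w)\<bar> \<le> H\<^sup>2 * norm (j v) * d + H\<^sup>2 * n * s"
    proof -
      have "?D (j v) (N v) - ?D (j w) (N w) = ?D (j v) (N (v - w)) + (?D (j v) (N w) - ?D (j w) (N w))"
        by (simp add: blinfun.diff_right linear_diff[OF D_lin])
      also have "\<bar>\<dots>\<bar> \<le> H * norm (j v) * norm (N (v - w)) + H * n * norm (N w)"
        using Dv[of "N (v - w)"] Dd[of "N w"] by linarith
      also have "\<dots> \<le> H * norm (j v) * (H * d) + H * n * (H * s)"
        using jl(2)[of "v - w"] order_trans[OF jl(2)[of w] mult_left_mono[OF ws(1) H(9)]] H nn
        by (intro add_mono mult_left_mono mult_nonneg_nonneg) (auto simp: d_def)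
      finally show ?thesis by (simp add: power2_eq_square algebra_simps)
    qed
    have u_v: "\<bar>u v\<bar> \<le> 2 * H ^ 4 * s"
    proof -
      have "\<bar>?D (j v) (N v)\<bar> \<le> H * H * (H * s)"
        using Dv[of "N v"] jl(2)[of v] jv(1) ws(2) H nn
        by (intro order_trans[OF Dv] mult_mono mult_nonneg_nonneg order_trans[OF jl(2)] mult_left_mono) auto
      moreover have "\<bar>?D (j v) B\<bar> \<le> H * (H * s) * H"
        using jvs H nn by (intro order_trans[OF Dv] mult_mono mult_nonneg_nonneg) auto
      ultimately have "\<bar>?D (j v) (N v) + ?D (j v) B\<bar> \<le> 2 * H ^ 3 * s" by (simp add: power3_eq_cube algebra_simps)
      then have "\<beta> * \<bar>?D (j v) (N v) + ?D (j v) B\<bar> \<le> H * (2 * H ^ 3 * s)" using H \<beta> by (intro mult_mono) auto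
      moreover have "\<bar>u v\<bar> = \<beta> * \<bar>?D (j v) (N v) + ?D (j v) B\<bar>" using \<beta> by (simp add: u_def abs_mult)
      ultimately show ?thesis by (simp add: eval_nat_numeral)
    qed
    have u_d: "\<bar>u v - u w\<bar> \<le> H ^ 3 * norm (j v) * d + H ^ 3 * n * s + H ^ 3 * n"
    proof -
      have "\<bar>?D (j v) B - ?D (j w) B\<bar> \<le> H * n * H" using H nn by (intro order_trans[OF Dd] mult_left_mono) auto
      then have "\<bar>(?D (j v) (N v) + ?D (j v) B) - (?D (j w) (N w) + ?D (j w) B)\<bar> \<le> H\<^sup>2 * norm (j v) * d + H\<^sup>2 * n * s + H\<^sup>2 * n"
        using dN by (simp add: power2_eq_square algebra_simps)
      then have "\<beta> * \<bar>(?D (j v) (N v) + ?D (j v) B) - (?D (j w) (N w) + ?D (j w) B)\<bar> \<le> H * (H\<^sup>2 * norm (j v) * d + H\<^sup>2 * n * s + H\<^sup>2 * n)"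
        using H \<beta> by (intro mult_mono) auto
      moreover have "u v - u w = \<beta> * ((?D (j v) (N v) + ?D (j v) B) - (?D (j w) (N w) + ?D (j w) B))" by (simp add: u_def algebra_simps)
      then have "\<bar>u v - u w\<bar> = \<beta> * \<bar>(?D (j v) (N v) + ?D (j v) B) - (?D (j w) (N w) + ?D (j w) B)\<bar>" using \<beta> by (simp only: abs_mult abs_of_pos)
      ultimately have "\<bar>u v - u w\<bar> \<le> H * (H\<^sup>2 * norm (j v) * d + H\<^sup>2 * n * s + H\<^sup>2 * n)" by (simp only:)
      then show ?thesis by (simp add: eval_nat_numeral algebra_simps)
    qed
    have q_d: "\<bar>q v - q w\<bar> \<le> H ^ 3 * norm (j v) * d + H ^ 3 * n * s + H ^ 4 * s * n"
    proof -
      have "\<bar>(?D (j v) (N v) + ?E (j v) B) - (?D (j w) (N w) + ?E (j w) B)\<bar> \<le> H\<^sup>2 * norm (j v) * d + H\<^sup>2 * n * s + H ^ 3 * s * n"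
        using dN Ed by linarith
      then have "\<beta> * \<bar>(?D (j v) (N v) + ?E (j v) B) - (?D (j w) (N w) + ?E (j w) B)\<bar> \<le> H * (H\<^sup>2 * norm (j v) * d + H\<^sup>2 * n * s + H ^ 3 * s * n)"
        using H \<beta> by (intro mult_mono) auto
      moreover have "q v - q w = \<beta> * ((?D (j v) (N v) + ?E (j v) B) - (?D (j w) (N w) + ?E (j w) B))" by (simp add: q_def algebra_simps)
      then have "\<bar>q v - q w\<bar> = \<beta> * \<bar>(?D (j v) (N v) + ?E (j v) B) - (?D (j w) (N w) + ?E (j w) B)\<bar>" using \<beta> by (simp only: abs_mult abs_of_pos)
      ultimately have "\<bar>q v - q w\<bar> \<le> H * (H\<^sup>2 * norm (j v) * d + H\<^sup>2 * n * s + H ^ 3 * s * n)" by (simp only:)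
      then show ?thesis by (simp add: eval_nat_numeral algebra_simps)
    qed
    have split: "F v - F w = - (u v *\<^sub>R N (v - w) + (u v - u w) *\<^sub>R N w + (q v - q w) *\<^sub>R B)"
      unfolding F by (simp add: blinfun.diff_right algebra_simps)
    have pw: "H ^ a * x \<le> H ^ 7 * x" if "a \<le> 7" "0 \<le> x" for a x using Hp[OF that(1)] that(2) by (intro mult_right_mono)
    have sd: "0 \<le> s * d" "0 \<le> s * n" "0 \<le> s\<^sup>2 * n" using nn by auto
    have pw5: "H ^ 5 * (s * d) \<le> H ^ 7 * (s * d)" "H ^ 5 * (s * n) \<le> H ^ 7 * (s * n)"
      and pw6: "H ^ 6 * (s * d) \<le> H ^ 7 * (s * d)" "H ^ 6 * (s * n) \<le> H ^ 7 * (s * n)" "H ^ 6 * d \<le> H ^ 7 * d"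
      and pw4: "H ^ 4 * (s\<^sup>2 * n) \<le> H ^ 7 * (s\<^sup>2 * n)"
      and nn7: "0 \<le> H ^ 7 * (s * d)" "0 \<le> H ^ 7 * (s * n)" "0 \<le> H ^ 7 * d" "0 \<le> H ^ 7 * (s\<^sup>2 * n)"
      using sd nn H(9) by (auto intro!: pw simp del: mult_le_cancel_right)
    have Y: "norm (F v - F w) \<le> 10 * H ^ 7 * (s * d + s\<^sup>2 * n)"
    proof -
      have "norm (F v - F w) \<le> \<bar>u v\<bar> * norm (N (v - w)) + \<bar>u v - u w\<bar> * norm (N w) + \<bar>q v - q w\<bar> * norm B"
        unfolding split norm_minus_cancel
        by (rule order_trans[OF norm_triangle_ineq add_mono[OF order_trans[OF norm_triangle_ineq]]]) simp_all
      also have "\<dots> \<le> (2 * H ^ 4 * s) * (H * d) + (H ^ 3 * H * d + H ^ 3 * n * s + H ^ 3 * (H * d)) * (H * s)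
          + (H ^ 3 * (H * s) * d + H ^ 3 * (H * d) * s + H ^ 4 * s * (H * d)) * H"
      proof (intro add_mono mult_mono)
        show "\<bar>u v - u w\<bar> \<le> H ^ 3 * H * d + H ^ 3 * n * s + H ^ 3 * (H * d)"
          using jv nd nn H by (intro order_trans[OF u_d] add_mono mult_right_mono mult_left_mono) auto
        show "\<bar>q v - q w\<bar> \<le> H ^ 3 * (H * s) * d + H ^ 3 * (H * d) * s + H ^ 4 * s * (H * d)"
          using jvs nd nn H by (intro order_trans[OF q_d] add_mono mult_right_mono mult_left_mono) auto
        show "norm (N w) \<le> H * s" using order_trans[OF jl(2)[of w] mult_left_mono[OF ws(1) H(9)]] .
        show "norm (N (v - w)) \<le> H * d" using jl(2)[of "v - w"] by (simp add: d_def)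
      qed (use u_v H nn in auto)
      also have "\<dots> = 2 * (H ^ 5 * (s * d)) + H ^ 5 * (s * d) + H ^ 4 * (s\<^sup>2 * n) + H ^ 5 * (s * d) + 2 * (H ^ 5 * (s * d)) + H ^ 6 * (s * d)"
        by (simp add: eval_nat_numeral algebra_simps)
      also have "\<dots> \<le> 10 * H ^ 7 * (s * d + s\<^sup>2 * n)"
        using pw5(1) pw6(1) pw4 nn7 unfolding distrib_left mult.assoc by linarith
      finally show ?thesis .
    qed
    have dual: "norm (to_dual j (F v - F w)) \<le> 10 * H ^ 7 * (d + s * n)"
    proof (rule norm_blinfun_bound)
      show "0 \<le> 10 * H ^ 7 * (d + s * n)" using H nn by simp
      fix z :: 'v
      \<comment> \<open>The adjoint moves N onto the test vector, so v - w is measured in Y instead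
        of V. One V factor is saved this way.\<close>
      have n1: "\<bar>N (v - w) \<bullet> j z\<bar> \<le> n * (H * norm z)"
        unfolding N' n_def by (intro order_trans[OF Cauchy_Schwarz_ineq2] mult_left_mono jl) auto
      have n2: "\<bar>N w \<bullet> j z\<bar> \<le> H * (H * norm z)"
        unfolding N' by (intro order_trans[OF Cauchy_Schwarz_ineq2] mult_mono jl jv) (use H in auto)
      have n3: "\<bar>B \<bullet> j z\<bar> \<le> H * (H * norm z)"
        by (intro order_trans[OF Cauchy_Schwarz_ineq2] mult_mono jl H) auto
      have "norm (to_dual j (F v - F w) z) = \<bar>u v * (N (v - w) \<bullet> j z) + (u v - u w) * (N w \<bullet> j z) + (q v - q w) * (B \<bullet> j z)\<bar>"
        unfolding to_dual_apply split by (simp add: inner_add_left inner_diff_left abs_minus_commute)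
      also have "\<dots> \<le> \<bar>u v\<bar> * \<bar>N (v - w) \<bullet> j z\<bar> + \<bar>u v - u w\<bar> * \<bar>N w \<bullet> j z\<bar> + \<bar>q v - q w\<bar> * \<bar>B \<bullet> j z\<bar>"
        unfolding abs_mult[symmetric] by linarith
      also have "\<dots> \<le> (2 * H ^ 4 * s) * (n * (H * norm z)) + (H ^ 3 * H * d + H ^ 3 * n * s + H ^ 3 * (H * d)) * (H * (H * norm z))
          + (H ^ 3 * H * d + H ^ 3 * n * s + H ^ 4 * s * n) * (H * (H * norm z))"
      proof (intro add_mono mult_mono)
        show "\<bar>u v - u w\<bar> \<le> H ^ 3 * H * d + H ^ 3 * n * s + H ^ 3 * (H * d)"
          using jv nd nn H by (intro order_trans[OF u_d] add_mono mult_right_mono mult_left_mono) auto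
        show "\<bar>q v - q w\<bar> \<le> H ^ 3 * H * d + H ^ 3 * n * s + H ^ 4 * s * n"
          using jv nn H by (intro order_trans[OF q_d] add_mono mult_right_mono mult_left_mono) auto
      qed (use u_v n1 n2 n3 H nn in auto)
      also have "\<dots> = (2 * (H ^ 5 * (s * n)) + 3 * (H ^ 6 * d) + 2 * (H ^ 5 * (s * n)) + H ^ 6 * (s * n)) * norm z"
        by (simp add: eval_nat_numeral algebra_simps)
      also have "\<dots> \<le> 10 * H ^ 7 * (d + s * n) * norm z"
      proof (rule mult_right_mono)
        show "2 * (H ^ 5 * (s * n)) + 3 * (H ^ 6 * d) + 2 * (H ^ 5 * (s * n)) + H ^ 6 * (s * n) \<le> 10 * H ^ 7 * (d + s * n)"
          using pw5(2) pw6(2,3) nn7 unfolding distrib_left mult.assoc by linarith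
      qed simp
      finally show "norm (to_dual j (F v - F w) z) \<le> 10 * H ^ 7 * (d + s * n) * norm z" .
    qed
    show ?thesis using Y dual by (simp add: d_def n_def s_def)
  qed
  show "\<exists>C\<ge>0. \<forall>v w. norm (j v) \<le> R \<longrightarrow> norm (j w) \<le> R \<longrightarrow>
      norm (F v - F w) \<le> C * ((norm v + norm w) * norm (v - w) + (norm v + norm w)\<^sup>2 * norm (j (v - w))) \<and>
      norm (to_dual j (F v - F w)) \<le> C * (norm (v - w) + (norm v + norm w) * norm (j (v - w)))"
    using est H by (intro exI[of _ "10 * H ^ 7"]) auto
qed

section \<open>The closed-loop system\<close>

lemma integrable_AE_restrict_bound:
  assumes \<kappa>: "locint \<kappa>" and T: "0 \<le> T" and e: "e > 0"
  shows "\<exists>K>0. ig (\<lambda>s. if \<kappa> s \<le> K then 0 else \<kappa> s) 0 T \<le> e"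
proof -
  let ?F = "\<lambda>n s. if \<kappa> s \<le> real n then 0 else \<kappa> s"
  have [measurable]: "\<kappa> \<in> borel_measurable half_line" using \<kappa> by (rule locint_measurable)
  have "(\<lambda>n. ig (?F n) 0 T) \<longlonglongrightarrow> ig (\<lambda>_. 0) 0 T"
  proof (rule ig_dominated_convergence[OF _ _ locint_abs[OF \<kappa>]])
    show "AE r in half_line. (\<lambda>n. ?F n r) \<longlonglongrightarrow> 0"
    proof (rule AE_I2)
      fix r
      obtain N where N: "\<kappa> r \<le> real N" using real_arch_simple by blast
      have "\<forall>\<^sub>F n in sequentially. ?F n r = 0" using N by (intro eventually_sequentiallyI[of N]) auto
      then show "(\<lambda>n. ?F n r) \<longlonglongrightarrow> 0" by (rule tendsto_eventually)
    qed
  qed auto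
  then have "\<forall>\<^sub>F n in sequentially. ig (?F n) 0 T < e" using e T by (intro order_tendstoD) (auto simp: ig_const)
  then obtain N where "\<And>n. n \<ge> N \<Longrightarrow> ig (?F n) 0 T < e" by (auto simp: eventually_sequentially)
  \<comment> \<open>The successor makes K positive.\<close>
  from this[of "Suc N"] show ?thesis by (intro exI[of _ "real (Suc N)"]) auto
qed

text \<open>
  Gronwall's inequality with an integrable weight: the part of the weight exceeding a large
  constant K has small integral, and the bounded part is absorbed by an exponential weight.
\<close>

lemma gronwall_zero:
  fixes \<phi> :: "real \<Rightarrow> real"
  assumes \<phi>: "continuous_on {0..} \<phi>" and \<phi>0: "\<And>t. 0 \<le> t \<Longrightarrow> 0 \<le> \<phi> t" and \<kappa>: "locint \<kappa>" and T: "0 \<le> T"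
    and le: "\<And>t. 0 \<le> t \<Longrightarrow> t \<le> T \<Longrightarrow> \<phi> t \<le> ig (\<lambda>s. \<kappa> s * \<phi> s) 0 t"
  shows "\<phi> T = 0"
proof -
  obtain K where K: "K > 0" "ig (\<lambda>s. if \<kappa> s \<le> K then 0 else \<kappa> s) 0 T \<le> 1 / 4"
    using integrable_AE_restrict_bound[OF \<kappa> T, of "1/4"] by auto
  define \<kappa>' where "\<kappa>' s = (if \<kappa> s \<le> K then 0 else \<kappa> s)" for s
  have [measurable]: "\<kappa> \<in> borel_measurable half_line" using \<kappa> by (rule locint_measurable)
  have "\<kappa>' \<in> borel_measurable half_line" unfolding \<kappa>'_def[abs_def] by measurable
  then have l\<kappa>': "locint \<kappa>'"
    by (rule locint_bound[OF locint_abs[OF \<kappa>]]) (auto simp: \<kappa>'_def)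
  have \<kappa>'0: "\<kappa>' s \<ge> 0" "\<kappa> s \<le> K + \<kappa>' s" for s using K(1) by (auto simp: \<kappa>'_def)
  \<comment> \<open>With L = 4 K the bounded part of the weight contributes m / 4 and the excess at
    most m / 4, so m is at most m / 2.\<close>
  define L where "L = 4 * K"
  have L: "L > 0" using K by (simp add: L_def)
  have "continuous_on {0..T} (\<lambda>t. \<phi> t * exp (- L * t))" by (intro continuous_intros continuous_on_subset[OF \<phi>]) auto
  then obtain t0 where t0: "t0 \<in> {0..T}" "\<And>t. t \<in> {0..T} \<Longrightarrow> \<phi> t * exp (- L * t) \<le> \<phi> t0 * exp (- L * t0)"
    using continuous_attains_sup[of "{0..T}" "\<lambda>t. \<phi> t * exp (- L * t)"] T by auto
  define m where "m = \<phi> t0 * exp (- L * t0)"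
  have m0: "m \<ge> 0" using \<phi>0 t0(1) by (simp add: m_def)
  have \<phi>m: "\<phi> t \<le> m * exp (L * t)" if "t \<in> {0..T}" for t
  proof -
    have "\<phi> t = \<phi> t * exp (- L * t) * exp (L * t)" by (simp add: mult.assoc flip: exp_add)
    also have "\<dots> \<le> m * exp (L * t)" using t0(2)[OF that] unfolding m_def by (intro mult_right_mono) auto
    finally show ?thesis .
  qed
  have lE: "locint (\<lambda>s. exp (L * s))" by (intro locint_continuous continuous_intros)
  have "\<phi> t0 \<le> ig (\<lambda>s. \<kappa> s * \<phi> s) 0 t0" using t0(1) by (intro le) auto
  also have "\<dots> \<le> ig (\<lambda>s. (m * K) * exp (L * s) + (m * exp (L * t0)) * \<kappa>' s) 0 t0"
  proof (rule ig_mono)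
    fix s assume s: "0 < s" "s \<le> t0"
    have p: "\<phi> s \<le> m * exp (L * s)" "0 \<le> \<phi> s" using \<phi>m[of s] \<phi>0[of s] s t0(1) by auto
    have "\<kappa> s * \<phi> s \<le> (K + \<kappa>' s) * \<phi> s" using \<kappa>'0(2) p by (intro mult_right_mono) auto
    also have "\<dots> \<le> (K + \<kappa>' s) * (m * exp (L * s))" using p \<kappa>'0(1)[of s] K by (intro mult_left_mono) auto
    also have "\<dots> \<le> (m * K) * exp (L * s) + (m * exp (L * t0)) * \<kappa>' s"
    proof -
      have "\<kappa>' s * (m * exp (L * s)) \<le> \<kappa>' s * (m * exp (L * t0))"
        using s L m0 \<kappa>'0(1) by (intro mult_left_mono) auto
      then show ?thesis by (simp add: algebra_simps)
    qed
    finally show "\<kappa> s * \<phi> s \<le> (m * K) * exp (L * s) + (m * exp (L * t0)) * \<kappa>' s" .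
  qed (intro locint_mult_continuous \<kappa> \<phi> locint_add locint_mult lE l\<kappa>' | simp)+
  also have "\<dots> = (m * K) * ig (\<lambda>s. exp (L * s)) 0 t0 + (m * exp (L * t0)) * ig \<kappa>' 0 t0"
    using ig_add[OF locint_mult[OF lE] locint_mult[OF l\<kappa>'] order_refl] by (simp add: ig_mult)
  also have "ig (\<lambda>s. exp (L * s)) 0 t0 = exp (L * t0) / L - exp (L * 0) / L"
    using L t0(1) by (intro ig_FTC[symmetric, where F = "\<lambda>s. exp (L * s) / L"]) (auto intro!: derivative_eq_intros continuous_intros)
  also have "(m * K) * (exp (L * t0) / L - exp (L * 0) / L) + (m * exp (L * t0)) * ig \<kappa>' 0 t0
      \<le> (m * K) * (exp (L * t0) / L) + (m * exp (L * t0)) * (1 / 4)"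
  proof (intro add_mono mult_left_mono)
    have "ig \<kappa>' 0 t0 \<le> ig \<kappa>' 0 T" using ig_split[OF l\<kappa>', of 0 t0 T] t0(1) ig_nonneg[of t0 T \<kappa>'] \<kappa>'0(1) by auto
    then show "ig \<kappa>' 0 t0 \<le> 1 / 4" using K(2) unfolding \<kappa>'_def[abs_def] by simp
  qed (use m0 K L in auto)
  also have "\<dots> = (m / 2) * exp (L * t0)" using K by (simp add: L_def field_simps)
  finally have "\<phi> t0 * exp (- L * t0) \<le> (m / 2) * exp (L * t0) * exp (- L * t0)" by (rule mult_right_mono) simp
  also have "\<dots> = m / 2" by (simp add: mult.assoc flip: exp_add)
  finally have "m \<le> m / 2" unfolding m_def[symmetric] .
  then have "m \<le> 0" by simp
  then have "\<phi> T \<le> 0" using \<phi>m[of T] T mult_nonpos_nonneg[of m "exp (L * T)"] by simp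
  then show ?thesis using \<phi>0[OF T] by simp
qed

text \<open>The constant depends on a bound in Y only: trajectories are bounded in Y but merely
  square integrable in V. The first estimate feeds contraction and uniqueness, the second the time
  derivative.\<close>

locale closed_loop = stable_evolution j b P \<nu> lam S
  for j :: "'v::{real_inner,complete_space} \<Rightarrow>\<^sub>L 'y::{real_inner,complete_space}" and b P \<nu> lam S +
  fixes F :: "'v \<Rightarrow> 'y"
  assumes F_zero: "F 0 = 0"
    and F_lipschitz: "\<And>R. \<exists>C\<ge>0. \<forall>v w. norm (j v) \<le> R \<longrightarrow> norm (j w) \<le> R \<longrightarrow>
      norm (F v - F w) \<le> C * ((norm v + norm w) * norm (v - w) + (norm v + norm w)\<^sup>2 * norm (j (v - w))) \<and>
      norm (to_dual j (F v - F w)) \<le> C * (norm (v - w) + (norm v + norm w) * norm (j (v - w)))"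
begin

text \<open>Makes F composed with a strongly measurable trajectory strongly measurable.\<close>

lemma F_continuous: "continuous_on UNIV F"
  unfolding continuous_on_eq_continuous_at[OF open_UNIV]
proof
  fix v :: 'v
  define R where "R = norm j * (norm v + 1)"
  obtain C where C: "C \<ge> 0" "\<And>v w. norm (j v) \<le> R \<Longrightarrow> norm (j w) \<le> R \<Longrightarrow>
      norm (F v - F w) \<le> C * ((norm v + norm w) * norm (v - w) + (norm v + norm w)\<^sup>2 * norm (j (v - w)))"
    using F_lipschitz[of R] by blast
  have "(F \<longlongrightarrow> F v) (at v)"
  proof (rule LIM_zero_cancel, rule Lim_null_comparison)
    have "\<forall>\<^sub>F w in at v. dist w v < 1" unfolding eventually_at by (intro exI[of _ 1]) auto
    then show "\<forall>\<^sub>F w in at v. norm (F w - F v) \<le> C * ((norm w + norm v) * norm (w - v) + (norm w + norm v)\<^sup>2 * norm (j (w - v)))"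
    proof eventually_elim
      case (elim w)
      have "norm w \<le> norm v + 1" using elim norm_triangle_ineq[of v "w - v"] by (simp add: dist_norm)
      then have "norm (j w) \<le> R" "norm (j v) \<le> R"
        unfolding R_def by (auto intro!: order_trans[OF norm_blinfun] mult_left_mono)
      then show ?case by (rule C(2))
    qed
    have "((\<lambda>w. C * ((norm w + norm v) * norm (w - v) + (norm w + norm v)\<^sup>2 * norm (j (w - v)))) \<longlongrightarrow>
      C * ((norm v + norm v) * norm (v - v) + (norm v + norm v)\<^sup>2 * norm (j (v - v)))) (at v)"
      by (intro tendsto_intros)
    then show "((\<lambda>w. C * ((norm w + norm v) * norm (w - v) + (norm w + norm v)\<^sup>2 * norm (j (w - v)))) \<longlongrightarrow> 0) (at v)" by simp
  qed
  then show "isCont F v" by (simp add: isCont_def)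
qed

text \<open>Cauchy-Schwarz in time for the term with the difference in V; in the other term the
  difference is bounded in the supremum norm of Y, and both remaining factors are square
  integrable.\<close>

lemma forcing_L1_estimate:
  assumes C: "\<And>v w. norm (j v) \<le> R \<Longrightarrow> norm (j w) \<le> R \<Longrightarrow>
      norm (F v - F w) \<le> C * ((norm v + norm w) * norm (v - w) + (norm v + norm w)\<^sup>2 * norm (j (v - w)))" and C0: "C \<ge> 0"
    and y: "in_L2 y" and z: "in_L2 z"
    and yR: "AE t in half_line. norm (j (y t)) \<le> R" and zR: "AE t in half_line. norm (j (z t)) \<le> R"
    and d: "AE t in half_line. norm (j (y t - z t)) \<le> d" and d0: "d \<ge> 0"
  shows "L1 (\<lambda>t. F (y t) - F (z t))"
    and "L1_norm (\<lambda>t. F (y t) - F (z t)) \<le>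
      C * ((L2_norm y + L2_norm z) * L2_norm (\<lambda>t. y t - z t) + (L2_norm y + L2_norm z)\<^sup>2 * d)"
proof -
  let ?h = "\<lambda>t. norm (y t) + norm (z t)" and ?k = "\<lambda>t. norm (y t - z t)"
  have h: "in_L2 ?h" "L2_norm ?h \<le> L2_norm y + L2_norm z"
  proof -
    have n: "in_L2 (\<lambda>t. norm (x t))" if "in_L2 x" for x :: "real \<Rightarrow> 'v"
      using that in_L2_meas[OF that] by (simp add: in_L2_def strongly_measurable_of_real_measurable)
    show "in_L2 ?h" "L2_norm ?h \<le> L2_norm y + L2_norm z"
      using in_L2_add[OF n[OF y] n[OF z]] by (simp_all add: L2_norm_norm)
  qed
  have hm: "?h \<in> borel_measurable half_line" using in_L2_meas(2)[OF h(1)] strongly_measurable_real[OF in_L2_meas(1)[OF h(1)]] by simp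
  have hi: "integrable half_line (\<lambda>t. (?h t)\<^sup>2)" using in_L2_meas(3)[OF h(1)] by simp
  note k = in_L2_diff(1)[OF y z]
  have km: "?k \<in> borel_measurable half_line" "integrable half_line (\<lambda>t. (?k t)\<^sup>2)" using in_L2_meas[OF k] by auto
  have m: "strongly_measurable half_line (\<lambda>t. F (y t) - F (z t))"
    by (intro strongly_measurable_diff strongly_measurable_compose[OF _ F_continuous] in_L2_meas y z)
  let ?b = "\<lambda>t. C * (?h t * ?k t + (?h t)\<^sup>2 * d)"
  have hk: "integrable half_line (\<lambda>t. ?h t * ?k t)" by (rule integrable_mult_of_power2[OF hm km(1) hi km(2)])
  have bi: "integrable half_line ?b" using hk hi by simp
  have le: "AE t in half_line. norm (F (y t) - F (z t)) \<le> ?b t"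
    using yR zR d
  proof eventually_elim
    case (elim t)
    have "norm (F (y t) - F (z t)) \<le> C * (?h t * ?k t + (?h t)\<^sup>2 * norm (j (y t - z t)))" using elim by (intro C)
    also have "\<dots> \<le> ?b t" using C0 elim(3) by (intro mult_left_mono add_left_mono) auto
    finally show ?case .
  qed
  have i: "integrable half_line (\<lambda>t. norm (F (y t) - F (z t)))"
    by (rule Bochner_Integration.integrable_bound[OF bi strongly_measurable_norm[OF m]])
      (use le in \<open>auto elim!: eventually_mono\<close>)
  then show "L1 (\<lambda>t. F (y t) - F (z t))" using m by (simp add: L1_def)
  have "L1_norm (\<lambda>t. F (y t) - F (z t)) \<le> (LINT t|half_line. ?b t)"
    unfolding L1_norm_def by (rule integral_mono_AE[OF i bi le])
  also have "\<dots> = C * ((LINT t|half_line. ?h t * ?k t) + (LINT t|half_line. (?h t)\<^sup>2) * d)"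
    using hk hi by simp
  also have "\<dots> \<le> C * ((L2_norm y + L2_norm z) * L2_norm (\<lambda>t. y t - z t) + (L2_norm y + L2_norm z)\<^sup>2 * d)"
  proof (intro mult_left_mono add_mono mult_right_mono C0 d0)
    have "(LINT t|half_line. ?h t * ?k t) \<le> L2_norm ?h * L2_norm (\<lambda>t. y t - z t)"
      using Cauchy_Schwarz_integral[OF hm km(1) hi km(2)] by (simp add: L2_norm_def)
    also have "\<dots> \<le> (L2_norm y + L2_norm z) * L2_norm (\<lambda>t. y t - z t)" by (intro mult_right_mono h) simp
    finally show "(LINT t|half_line. ?h t * ?k t) \<le> (L2_norm y + L2_norm z) * L2_norm (\<lambda>t. y t - z t)" .
    have "(LINT t|half_line. (?h t)\<^sup>2) = (L2_norm ?h)\<^sup>2" by (simp add: L2_norm_power2)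
    also have "\<dots> \<le> (L2_norm y + L2_norm z)\<^sup>2" by (intro power_mono h) simp
    finally show "(LINT t|half_line. (?h t)\<^sup>2) \<le> (L2_norm y + L2_norm z)\<^sup>2" .
  qed
  finally show "L1_norm (\<lambda>t. F (y t) - F (z t)) \<le>
      C * ((L2_norm y + L2_norm z) * L2_norm (\<lambda>t. y t - z t) + (L2_norm y + L2_norm z)\<^sup>2 * d)" .
qed

text \<open>Trajectories of size at most r, measured in the supremum norm of Y and the square norm of V.\<close>

definition small :: "real \<Rightarrow> (real \<Rightarrow> 'v) \<Rightarrow> (real \<Rightarrow> 'y) \<Rightarrow> bool" where
  "small r y c \<longleftrightarrow> in_L2 y \<and> continuous_on {0..} c \<and> (AE t in half_line. c t = j (y t)) \<and>
    (\<forall>t\<ge>0. norm (c t) \<le> r) \<and> L2_norm y \<le> r"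

text \<open>Scaled by the constant K of the linear estimate, F halves distances between small
  trajectories. Comparison with the zero trajectory also gives integrability of F along y.\<close>

lemma small_contraction:
  obtains r K where "0 < r" "0 < K"
    "\<And>y c z e d. small r y c \<Longrightarrow> small r z e \<Longrightarrow> (\<And>t. 0 \<le> t \<Longrightarrow> norm (c t - e t) \<le> d) \<Longrightarrow>
      L2_norm (\<lambda>t. y t - z t) \<le> d \<Longrightarrow> L1 (\<lambda>t. F (y t)) \<and> K * L1_norm (\<lambda>t. F (y t) - F (z t)) \<le> d / 2"
    "\<And>y c f t. weak_solution y c f \<Longrightarrow> 0 \<le> t \<Longrightarrow> norm (c t) \<le> K * norm (c 0) + K * L1_norm f"
    "\<And>y c f. weak_solution y c f \<Longrightarrow> L2_norm y \<le> K * norm (c 0) + K * L1_norm f"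
proof -
  obtain K where K: "K > 0"
    "\<And>y c f t. weak_solution y c f \<Longrightarrow> 0 \<le> t \<Longrightarrow> norm (c t) \<le> K * (norm (c 0) + L1_norm f)"
    "\<And>y c f. weak_solution y c f \<Longrightarrow> L2_norm y \<le> K * (norm (c 0) + L1_norm f)" by (rule a_priori_estimate) blast
  obtain C where C: "C \<ge> 0" "\<And>v w. norm (j v) \<le> 1 \<Longrightarrow> norm (j w) \<le> 1 \<Longrightarrow>
      norm (F v - F w) \<le> C * ((norm v + norm w) * norm (v - w) + (norm v + norm w)\<^sup>2 * norm (j (v - w)))"
    using F_lipschitz[of 1] by blast
  \<comment> \<open>The two terms of the forcing estimate are at most 2 r d and 4 r d, the latter
    because r is at most 1. So K C 6 r must not exceed 1/2; C + 1 avoids dividing by 0.\<close>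
  define r where "r = min 1 (1 / (12 * K * (C + 1)))"
  have r: "0 < r" "r \<le> 1" using K C by (auto simp: r_def)
  have KCr: "K * C * (6 * r) \<le> 1 / 2"
  proof -
    define E where "E = 12 * K * (C + 1)"
    have E: "E > 0" "K * (C + 1) = E / 12" using K C by (simp_all add: E_def add_nonneg_pos)
    have "K * C * (6 * r) \<le> K * (C + 1) * (6 * r)" using K r by (intro mult_right_mono mult_left_mono) auto
    also have "\<dots> \<le> K * (C + 1) * (6 * (1 / E))"
      using K C by (intro mult_left_mono) (auto simp: r_def E_def)
    also have "\<dots> = 1 / 2" unfolding E(2) using E(1) by simp
    finally show ?thesis .
  qed
  have contr: "L1 (\<lambda>t. F (y t) - F (z t)) \<and> K * L1_norm (\<lambda>t. F (y t) - F (z t)) \<le> d / 2"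
    if y: "small r y c" and z: "small r z e" and d: "\<And>t. 0 \<le> t \<Longrightarrow> norm (c t - e t) \<le> d" "L2_norm (\<lambda>t. y t - z t) \<le> d"
    for y c z e d
  proof -
    have d0: "d \<ge> 0" using order_trans[OF L2_norm_nonneg d(2)] .
    have yL: "in_L2 y" "in_L2 z" "L2_norm y \<le> r" "L2_norm z \<le> r" using y z by (auto simp: small_def)
    have ae: "AE t in half_line. norm (j (y t)) \<le> 1" "AE t in half_line. norm (j (z t)) \<le> 1" "AE t in half_line. norm (j (y t - z t)) \<le> d"
    proof -
      have aey: "AE t in half_line. c t = j (y t)" and aez: "AE t in half_line. e t = j (z t)" and b: "\<And>t. 0 \<le> t \<Longrightarrow> norm (c t) \<le> 1" "\<And>t. 0 \<le> t \<Longrightarrow> norm (e t) \<le> 1"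
        using y z r(2) by (auto simp: small_def intro: order_trans)
      from aey aez AE_half_line_pos have "AE t in half_line. norm (j (y t)) \<le> 1 \<and> norm (j (z t)) \<le> 1 \<and> norm (j (y t - z t)) \<le> d"
      proof eventually_elim
        case (elim t)
        then show ?case using b[of t] d(1)[of t] by (simp add: blinfun.diff_right)
      qed
      then show "AE t in half_line. norm (j (y t)) \<le> 1" "AE t in half_line. norm (j (z t)) \<le> 1" "AE t in half_line. norm (j (y t - z t)) \<le> d"
        by (auto elim: eventually_mono)
    qed
    note est = forcing_L1_estimate[OF C(2) C(1) yL(1,2) ae d0]
    have "(L2_norm y + L2_norm z) * L2_norm (\<lambda>t. y t - z t) \<le> (2 * r) * d"
      using yL d r by (intro mult_mono) auto
    moreover have "(L2_norm y + L2_norm z)\<^sup>2 * d \<le> (4 * r) * d"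
    proof (rule mult_right_mono[OF _ d0])
      have "(L2_norm y + L2_norm z)\<^sup>2 \<le> (2 * r)\<^sup>2" using yL by (intro power_mono) auto
      also have "\<dots> \<le> 4 * r" using r by (simp add: power2_eq_square mult_left_le)
      finally show "(L2_norm y + L2_norm z)\<^sup>2 \<le> 4 * r" .
    qed
    ultimately have "(L2_norm y + L2_norm z) * L2_norm (\<lambda>t. y t - z t) + (L2_norm y + L2_norm z)\<^sup>2 * d \<le> (6 * r) * d" by simp
    then have "L1_norm (\<lambda>t. F (y t) - F (z t)) \<le> C * ((6 * r) * d)"
      using est(2) C(1) by (meson mult_left_mono order_trans)
    then have "K * L1_norm (\<lambda>t. F (y t) - F (z t)) \<le> K * (C * ((6 * r) * d))" using K by (intro mult_left_mono) auto
    also have "\<dots> = (K * C * (6 * r)) * d" by simp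
    also have "\<dots> \<le> (1 / 2) * d" by (intro mult_right_mono KCr d0)
    finally show ?thesis using est(1) by simp
  qed
  have z: "small r (\<lambda>_. 0) (\<lambda>_. 0)" using r by (simp add: small_def)
  have L1F: "L1 (\<lambda>t. F (y t))" if "small r y c" for y c
    using contr[OF that z, of r] that by (auto simp: small_def F_zero)
  show ?thesis
    by (rule that[OF r(1) K(1)]) (use contr L1F K(2,3) in \<open>simp_all add: distrib_left\<close>)
qed

text \<open>Picard iteration carried out by hand on pairs of a trajectory and its continuous
  representative. Smallness is preserved because half of the radius r is reserved for the initial
  value and half for the nonlinearity.\<close>

lemma closed_loop_small_solutions:
  obtains \<delta> r K where "0 < \<delta>" "0 < r" "0 < K"
    "\<And>x. norm x \<le> \<delta> \<Longrightarrow> \<exists>y c. small r y c \<and> weak_solution y c (\<lambda>t. F (y t)) \<and> c 0 = x"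
    "\<And>y c z e. small r y c \<Longrightarrow> weak_solution y c (\<lambda>t. F (y t)) \<Longrightarrow> small r z e \<Longrightarrow> weak_solution z e (\<lambda>t. F (z t)) \<Longrightarrow>
      L2_norm (\<lambda>t. y t - z t) \<le> K * norm (c 0 - e 0) \<and> (\<forall>t\<ge>0. norm (c t - e t) \<le> K * norm (c 0 - e 0))"
proof -
  obtain r K where r: "0 < r" and K: "0 < K"
    and contr: "\<And>y c z e d. small r y c \<Longrightarrow> small r z e \<Longrightarrow> (\<And>t. 0 \<le> t \<Longrightarrow> norm (c t - e t) \<le> d) \<Longrightarrow>
      L2_norm (\<lambda>t. y t - z t) \<le> d \<Longrightarrow> L1 (\<lambda>t. F (y t)) \<and> K * L1_norm (\<lambda>t. F (y t) - F (z t)) \<le> d / 2"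
    and sup: "\<And>y c f t. weak_solution y c f \<Longrightarrow> 0 \<le> t \<Longrightarrow> norm (c t) \<le> K * norm (c 0) + K * L1_norm f"
    and L2: "\<And>y c f. weak_solution y c f \<Longrightarrow> L2_norm y \<le> K * norm (c 0) + K * L1_norm f"
    by (rule small_contraction) blast
  \<comment> \<open>The linear estimate turns an initial value of this size into at most r /
    2.\<close>
  define \<delta> where "\<delta> = r / (2 * K)"
  have \<delta>: "\<delta> > 0" "K * \<delta> = r / 2" using r K by (simp_all add: \<delta>_def)
  have zero: "small r (\<lambda>_. 0) (\<lambda>_. 0)" using r by (simp add: small_def)
  have FL1: "L1 (\<lambda>t. F (y t))" and FK: "K * L1_norm (\<lambda>t. F (y t)) \<le> r / 2" if "small r y c" for y c
    using contr[OF that zero, of r] that by (auto simp: small_def F_zero)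
  have step: "\<exists>z e. small r z e \<and> weak_solution z e (\<lambda>t. F (y t)) \<and> e 0 = x" if x: "norm x \<le> \<delta>" and y: "small r y c" for x y c
  proof -
    obtain z e where ws: "weak_solution z e (\<lambda>t. F (y t))" and e0: "e 0 = x"
      using linear_problem_solvable[OF FL1[OF y], of x] by (auto simp: solvable_def)
    have "K * norm (e 0) + K * L1_norm (\<lambda>t. F (y t)) \<le> r"
      using FK[OF y] mult_left_mono[OF x less_imp_le[OF K]] unfolding e0 \<delta>(2) by linarith
    then have "small r z e" using sup[OF ws] L2[OF ws] ws unfolding small_def weak_solution_def by (meson order_trans)
    then show ?thesis using ws e0 by blast
  qed
  have diff: "norm (c t - e t) \<le> K * norm (c 0 - e 0) + K * L1_norm (\<lambda>t. f t - g t)"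
    "L2_norm (\<lambda>t. y t - z t) \<le> K * norm (c 0 - e 0) + K * L1_norm (\<lambda>t. f t - g t)"
    if "weak_solution y c f" "weak_solution z e g" "0 \<le> t" for y c f z e g t
    using sup[OF weak_solution_diff[OF that(1,2)] that(3)] L2[OF weak_solution_diff[OF that(1,2)]] by auto
  have "\<exists>y c. small r y c \<and> weak_solution y c (\<lambda>t. F (y t)) \<and> c 0 = x" if x: "norm x \<le> \<delta>" for x
  proof -
    define Q where "Q a a' \<longleftrightarrow> weak_solution (fst a') (snd a') (\<lambda>t. F (fst a t)) \<and> snd a' 0 = x"
      for a a' :: "(real \<Rightarrow> 'v) \<times> (real \<Rightarrow> 'y)"
    have "\<exists>s. \<forall>n. small r (fst (s n)) (snd (s n)) \<and> Q (s n) (s (Suc n))"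
    proof (rule dependent_nat_choice)
      show "\<exists>a. small r (fst a) (snd a)" using zero by (intro exI[of _ "(\<lambda>_. 0, \<lambda>_. 0)"]) simp
      show "\<exists>a'. small r (fst a') (snd a') \<and> Q a a'" if "small r (fst a) (snd a)" for a n
        using step[OF x that] unfolding Q_def by (metis fst_conv snd_conv)
    qed
    then obtain s where s: "\<And>n. small r (fst (s n)) (snd (s n))" "\<And>n. Q (s n) (s (Suc n))" by metis
    \<comment> \<open>Shifted by one: the starting pair \<open>s 0\<close> need not have the initial
      value x, every later one has.\<close>
    define y where "y n = fst (s (Suc n))" for n
    define c where "c n = snd (s (Suc n))" for n
    have sm: "small r (y n) (c n)" for n using s by (simp add: y_def c_def)
    have ws: "weak_solution (y (Suc n)) (c (Suc n)) (\<lambda>t. F (y n t))" and c0: "c n 0 = x" for n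
      using s(2)[of "Suc n"] s(2)[of n] by (simp_all add: Q_def y_def c_def)
    have "(\<forall>t\<ge>0. norm (c (Suc n) t - c n t) \<le> 2 * r * (1/2)^n) \<and> L2_norm (\<lambda>t. y (Suc n) t - y n t) \<le> 2 * r * (1/2)^n" for n
    proof (induction n)
      case 0
      have "norm (c (Suc 0) t - c 0 t) \<le> 2 * r" if "0 \<le> t" for t
        using norm_triangle_ineq4[of "c (Suc 0) t" "c 0 t"] sm[of 0] sm[of "Suc 0"] that unfolding small_def by force
      moreover have "L2_norm (\<lambda>t. y (Suc 0) t - y 0 t) \<le> 2 * r"
        using in_L2_diff(2)[of "y (Suc 0)" "y 0"] sm[of 0] sm[of "Suc 0"] unfolding small_def by linarith
      ultimately show ?case by simp
    next
      case (Suc n)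
      have "K * L1_norm (\<lambda>t. F (y (Suc n) t) - F (y n t)) \<le> (2 * r * (1/2)^n) / 2"
        using contr[OF sm sm, of "Suc n" n "2 * r * (1/2)^n"] Suc by blast
      then show ?case using diff[OF ws[of "Suc n"] ws[of n]] unfolding c0 by fastforce
    qed
    then have cd: "\<And>n t. 0 \<le> t \<Longrightarrow> norm (c (Suc n) t - c n t) \<le> 2 * r * (1/2)^n"
      and yd: "\<And>n. L2_norm (\<lambda>t. y (Suc n) t - y n t) \<le> 2 * r * (1/2)^n" by blast+
    have sm': "in_L2 (y n)" "continuous_on {0..} (c n)" "AE t in half_line. c n t = j (y n t)" for n
      using sm[of n] by (auto simp: small_def)
    obtain y0 c0' where lim: "in_L2 y0" "continuous_on {0..} c0'" "AE t in half_line. c0' t = j (y0 t)"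
      "\<And>k. L2_norm (\<lambda>t. y k t - y0 t) \<le> 2 * (2 * r) * (1/2)^k" "\<And>k t. 0 \<le> t \<Longrightarrow> norm (c k t - c0' t) \<le> 2 * (2 * r) * (1/2)^k"
      "\<And>t. 0 \<le> t \<Longrightarrow> (\<lambda>k. c k t) \<longlonglongrightarrow> c0' t"
      using trajectory_complete[OF sm' yd cd] by blast
    have half: "(\<lambda>m. C * (1/2)^m) \<longlonglongrightarrow> 0" for C :: real
      using tendsto_mult_right_zero[OF LIMSEQ_power_zero[of "1/2 :: real"], of C] by simp
    have L2lim: "(\<lambda>k. L2_norm (\<lambda>t. y k t - y0 t)) \<longlonglongrightarrow> 0"
      by (rule Lim_null_comparison[OF always_eventually half[of "2 * (2 * r)"]]) (use lim(4) in auto)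
    have sm0: "small r y0 c0'"
      unfolding small_def
    proof (intro conjI allI impI lim)
      fix t :: real assume t: "0 \<le> t"
      have "norm (c k t) \<le> r" for k using sm[of k] t by (simp add: small_def)
      then show "norm (c0' t) \<le> r" by (intro LIMSEQ_le_const2[OF tendsto_norm[OF lim(6)[OF t]]]) auto
    next
      have "L2_norm y0 \<le> r + L2_norm (\<lambda>t. y k t - y0 t)" for k
      proof -
        have "L2_norm (\<lambda>t. y k t - (y k t - y0 t)) \<le> L2_norm (y k) + L2_norm (\<lambda>t. y k t - y0 t)"
          by (intro in_L2_diff sm' lim)
        then show ?thesis using sm[of k] by (simp add: small_def)
      qed
      moreover have "(\<lambda>k. r + L2_norm (\<lambda>t. y k t - y0 t)) \<longlonglongrightarrow> r + 0" by (intro tendsto_intros L2lim)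
      ultimately show "L2_norm y0 \<le> r" using LIMSEQ_le_const[of _ "r + 0" "L2_norm y0"] by auto
    qed
    have "weak_solution y0 c0' (\<lambda>t. F (y0 t))"
    proof (rule weak_solution_limit[OF ws FL1[OF sm0] _ lim(1) _ lim(2,3)])
      show "(\<lambda>k. L2_norm (\<lambda>t. y (Suc k) t - y0 t)) \<longlonglongrightarrow> 0" using L2lim by (rule LIMSEQ_Suc)
      show "(\<lambda>k. c (Suc k) t) \<longlonglongrightarrow> c0' t" if "0 \<le> t" for t using lim(6)[OF that] by (rule LIMSEQ_Suc)
      have "K * L1_norm (\<lambda>t. F (y k t) - F (y0 t)) \<le> (2 * (2 * r) * (1/2)^k) / 2" for k
        using contr[OF sm[of k] sm0, of "2 * (2 * r) * (1/2)^k"] lim(4,5) by blast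
      then have "norm (L1_norm (\<lambda>t. F (y k t) - F (y0 t))) \<le> (2 * r / K) * (1/2)^k" for k
        using K by (simp add: field_simps)
      then show "(\<lambda>k. L1_norm (\<lambda>t. F (y k t) - F (y0 t))) \<longlonglongrightarrow> 0"
        by (intro Lim_null_comparison[OF always_eventually half[of "2 * r / K"]]) blast
    qed
    moreover have "c0' 0 = x" using LIMSEQ_unique[OF lim(6)[of 0]] by (simp add: c0)
    ultimately show ?thesis using sm0 by blast
  qed
  moreover have "L2_norm (\<lambda>t. y t - z t) \<le> (2 * K) * norm (c 0 - e 0) \<and> (\<forall>t\<ge>0. norm (c t - e t) \<le> (2 * K) * norm (c 0 - e 0))"
    if y: "small r y c" "weak_solution y c (\<lambda>t. F (y t))" and z: "small r z e" "weak_solution z e (\<lambda>t. F (z t))" for y c z e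
  proof -
    have yz: "in_L2 y" "in_L2 z" using y z by (auto simp: small_def)
    define n where "n = norm (c 0 - e 0)"
    \<comment> \<open>The larger of the two distances. The linear estimate and the contraction give
      D at most K n + D / 2, hence the Lipschitz constant 2 K; finiteness of D comes from
      smallness.\<close>
    define D where "D = Sup (insert (L2_norm (\<lambda>t. y t - z t)) ((\<lambda>t. norm (c t - e t)) ` {0..}))"
    have bdd: "bdd_above (insert (L2_norm (\<lambda>t. y t - z t)) ((\<lambda>t. norm (c t - e t)) ` {0..}))"
    proof -
      have "norm (c t - e t) \<le> 2 * r" if "0 \<le> t" for t
        using norm_triangle_ineq4[of "c t" "e t"] y(1) z(1) that unfolding small_def by force
      then show ?thesis by (auto intro: bdd_aboveI[of _ "2 * r"])
    qed
    have D: "L2_norm (\<lambda>t. y t - z t) \<le> D" "\<And>t. 0 \<le> t \<Longrightarrow> norm (c t - e t) \<le> D"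
      unfolding D_def by (intro cSup_upper bdd; simp)+
    have h: "K * L1_norm (\<lambda>t. F (y t) - F (z t)) \<le> D / 2" using contr[OF y(1) z(1) D(2) D(1)] by blast
    have "L2_norm (\<lambda>t. y t - z t) \<le> K * n + D / 2"
      using diff(2)[OF y(2) z(2) order_refl] h unfolding n_def by linarith
    moreover have "norm (c t - e t) \<le> K * n + D / 2" if "0 \<le> t" for t
      using diff(1)[OF y(2) z(2) that] h unfolding n_def by linarith
    ultimately have "Sup (insert (L2_norm (\<lambda>t. y t - z t)) ((\<lambda>t. norm (c t - e t)) ` {0..})) \<le> K * n + D / 2"
      by (intro cSup_least) auto
    then have "D \<le> K * n + D / 2" by (simp only: D_def[symmetric])
    then have "D \<le> (2 * K) * n" by simp
    then show ?thesis using D unfolding n_def by (meson order_trans)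
  qed
  ultimately show ?thesis using that[OF \<delta>(1) r, of "2 * K"] K by auto
qed

end

section \<open>Time derivatives, uniqueness and Lipschitz dependence in W_inf\<close>

context closed_loop begin

definition form_map :: "'v \<Rightarrow>\<^sub>L 'v \<Rightarrow>\<^sub>L real" where
  "form_map = (SOME L :: 'v \<Rightarrow>\<^sub>L 'v \<Rightarrow>\<^sub>L real. \<forall>v w. blinfun_apply (blinfun_apply L v) w = b v w)"

lemma form_map_apply: "form_map v w = b v w"
  using someI_ex[OF bounded_bilinear_to_blinfun[OF b]] unfolding form_map_def by blast

text \<open>A_Pi v + F v read as a functional on V, where it makes sense for every v in V.\<close>

definition vector_field :: "'v \<Rightarrow> 'v \<Rightarrow>\<^sub>L real" where
  "vector_field v = to_dual j (F v) - form_map v"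

lemma vector_field_apply: "vector_field v w = F v \<bullet> j w - b v w"
  by (simp add: vector_field_def blinfun.diff_left form_map_apply)

lemma vector_field_zero: "vector_field 0 = 0"
  by (rule blinfun_eqI) (simp add: vector_field_apply F_zero b.zero_left)

lemma vector_field_continuous: "continuous_on UNIV vector_field"
  unfolding vector_field_def[abs_def]
  by (intro continuous_intros continuous_on_compose2[OF linear_continuous_on[OF bounded_linear_to_dual] F_continuous]) auto

text \<open>In the dual of V the nonlinearity is at most linear in V norms; in the product term the
  difference is bounded by d in Y, and the L2 norms of y and z contribute at most 2 r.\<close>

lemma vector_field_L2:
  assumes y: "small r y c" and z: "small r z e" and d: "\<And>t. 0 \<le> t \<Longrightarrow> norm (c t - e t) \<le> d"
    and C0: "C \<ge> 0" and C: "\<And>v w. norm (j v) \<le> r \<Longrightarrow> norm (j w) \<le> r \<Longrightarrow>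
      norm (to_dual j (F v - F w)) \<le> C * (norm (v - w) + (norm v + norm w) * norm (j (v - w)))"
  shows "in_L2 (\<lambda>t. vector_field (y t) - vector_field (z t))"
    and "L2_norm (\<lambda>t. vector_field (y t) - vector_field (z t))
      \<le> (norm form_map + C) * L2_norm (\<lambda>t. y t - z t) + C * d * (2 * r)"
proof -
  have yz: "in_L2 y" "in_L2 z" "L2_norm y \<le> r" "L2_norm z \<le> r"
    and ae: "AE t in half_line. c t = j (y t)" "AE t in half_line. e t = j (z t)"
    and cr: "\<And>t. 0 \<le> t \<Longrightarrow> norm (c t) \<le> r" "\<And>t. 0 \<le> t \<Longrightarrow> norm (e t) \<le> r"
    using y z by (auto simp: small_def)
  have d0: "d \<ge> 0" using order_trans[OF norm_ge_zero d[of 0]] by simp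
  have nL2: "in_L2 (\<lambda>t. norm (x t))" if "in_L2 x" for x :: "real \<Rightarrow> 'v"
    using that in_L2_meas[OF that] by (simp add: in_L2_def strongly_measurable_of_real_measurable)
  have scale: "in_L2 (\<lambda>t. k * x t) \<and> L2_norm (\<lambda>t. k * x t) \<le> k * L2_norm x" if "k \<ge> 0" "in_L2 x" for k and x :: "real \<Rightarrow> real"
    using in_L2_linear[OF bounded_linear_mult_right that(2), of k k] that(1) by (simp add: abs_mult)
  let ?A = "norm form_map + C"
  define g1 where "g1 t = ?A * norm (y t - z t)" for t
  define g2 where "g2 t = C * d * (norm (y t) + norm (z t))" for t
  have g1: "in_L2 g1" "L2_norm g1 \<le> ?A * L2_norm (\<lambda>t. y t - z t)"
    using scale[of ?A "\<lambda>t. norm (y t - z t)", OF _ nL2[OF in_L2_diff(1)[OF yz(1,2)]]] C0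
    unfolding g1_def[abs_def] by (simp_all add: L2_norm_norm)
  have g2: "in_L2 g2" "L2_norm g2 \<le> C * d * (2 * r)"
  proof -
    note n = in_L2_add[OF nL2[OF yz(1)] nL2[OF yz(2)]]
    have "L2_norm (\<lambda>t. norm (y t) + norm (z t)) \<le> 2 * r" using n(2) yz(3,4) by (simp add: L2_norm_norm)
    then have "C * d * L2_norm (\<lambda>t. norm (y t) + norm (z t)) \<le> C * d * (2 * r)" using C0 d0 by (intro mult_left_mono) auto
    moreover have "in_L2 g2" "L2_norm g2 \<le> C * d * L2_norm (\<lambda>t. norm (y t) + norm (z t))"
      using scale[of "C * d", OF _ n(1)] C0 d0 unfolding g2_def[abs_def] by simp_all
    ultimately show "in_L2 g2" "L2_norm g2 \<le> C * d * (2 * r)" by simp_all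
  qed
  note g = in_L2_add[OF g1(1) g2(1)]
  have m: "strongly_measurable half_line (\<lambda>t. vector_field (y t) - vector_field (z t))"
    by (intro strongly_measurable_diff strongly_measurable_compose[OF _ vector_field_continuous] in_L2_meas yz)
  have "AE t in half_line. norm (vector_field (y t) - vector_field (z t)) \<le> norm (g1 t + g2 t)"
    using ae AE_half_line_pos
  proof eventually_elim
    case (elim t)
    have r: "norm (j (y t)) \<le> r" "norm (j (z t)) \<le> r" "norm (j (y t - z t)) \<le> d"
      using elim cr[of t] d[of t] by (simp_all add: blinfun.diff_right)
    have "vector_field (y t) - vector_field (z t) = to_dual j (F (y t) - F (z t)) - form_map (y t - z t)"
      by (rule blinfun_eqI) (simp add: vector_field_apply blinfun.diff_left form_map_apply inner_diff_left b.diff_left)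
    also have "norm \<dots> \<le> norm (to_dual j (F (y t) - F (z t))) + norm (form_map (y t - z t))" by (rule norm_triangle_ineq4)
    also have "\<dots> \<le> C * (norm (y t - z t) + (norm (y t) + norm (z t)) * norm (j (y t - z t))) + norm form_map * norm (y t - z t)"
      by (intro add_mono C r norm_blinfun)
    also have "\<dots> \<le> C * (norm (y t - z t) + (norm (y t) + norm (z t)) * d) + norm form_map * norm (y t - z t)"
      using r(3) C0 by (intro add_mono mult_left_mono) auto
    also have "\<dots> = g1 t + g2 t" by (simp add: g1_def g2_def algebra_simps)
    finally show ?case by simp
  qed
  note * = L2_norm_mono[OF in_L2_meas(3)[OF g(1)] m this]
  show "in_L2 (\<lambda>t. vector_field (y t) - vector_field (z t))" by (fact *(1))
  show "L2_norm (\<lambda>t. vector_field (y t) - vector_field (z t))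
      \<le> (norm form_map + C) * L2_norm (\<lambda>t. y t - z t) + C * d * (2 * r)"
    using *(2) g(2) g1(2) g2(2) by linarith
qed

definition solution :: "'y \<Rightarrow> (real \<Rightarrow> 'v) \<Rightarrow> bool" where
  "solution x y \<longleftrightarrow> in_W_inf j y \<and> (AE t in half_line. weak_derivative j y t = vector_field (y t)) \<and> has_initial_value j y x"

lemma weak_solution_has_weak_derivative:
  assumes ws: "weak_solution y c (\<lambda>t. F (y t))" and L2: "in_L2 (\<lambda>t. vector_field (y t))"
  shows "has_weak_derivative j y (\<lambda>t. vector_field (y t))"
proof (subst has_weak_derivative_iff_integrated[OF in_L2_meas(1)[OF L2] locint_norm_L2[OF L2]])
  show "continuous_on {0..} c" "AE t in half_line. c t = j (y t)" using ws by (auto simp: weak_solution_def)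
  have eq: "vector_field (y s) w = - b (y s) w + F (y s) \<bullet> j w" for s w by (simp add: vector_field_apply)
  then show "\<forall>w t. 0 \<le> t \<longrightarrow> c t \<bullet> j w = c 0 \<bullet> j w + ig (\<lambda>s. vector_field (y s) w) 0 t"
    using ws unfolding eq weak_solution_def by blast
qed

text \<open>Competing solutions may be large, so the contraction says nothing about them. Their
  derivatives lie in L2 with values in the dual of V, so the energy identity applies to the
  difference directly, and its right-hand side is bounded with a weight that is integrable because y
  and z are in L2(V).\<close>

lemma solution_unique:
  assumes y: "solution x y" and z: "solution x z"
  shows "AE t in half_line. z t = y t"
proof -
  have data: "\<exists>c g. in_L2 y \<and> continuous_on {0..} c \<and> (AE t in half_line. c t = j (y t)) \<and> c 0 = x \<and>
      in_L2 g \<and> (AE t in half_line. g t = vector_field (y t)) \<and>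
      (\<forall>w t. 0 \<le> t \<longrightarrow> c t \<bullet> j w = c 0 \<bullet> j w + ig (\<lambda>s. g s w) 0 t)"
    if sy: "solution x y" for y
  proof -
    obtain g where g: "in_L2 g" "has_weak_derivative j y g" and y: "in_L2 y" and ae: "AE t in half_line. weak_derivative j y t = vector_field (y t)"
      using sy unfolding solution_def in_W_inf_def by blast
    obtain c where c: "continuous_on {0..} c" "AE t in half_line. c t = j (y t)" "c 0 = x"
      using sy unfolding solution_def has_initial_value_def by blast
    note wd = weak_derivative_AE_eq[OF g]
    have "\<forall>w t. 0 \<le> t \<longrightarrow> c t \<bullet> j w = c 0 \<bullet> j w + ig (\<lambda>s. weak_derivative j y s w) 0 t"
      using has_weak_derivative_iff_integrated[OF in_L2_meas(1)[OF wd(2)] locint_norm_L2[OF wd(2)] c(1,2)] wd(3) by blast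
    then show ?thesis using y c wd(2) ae by blast
  qed
  obtain c g where y: "in_L2 y" and c: "continuous_on {0..} c" "AE t in half_line. c t = j (y t)" "c 0 = x"
    and g: "in_L2 g" "AE t in half_line. g t = vector_field (y t)"
    and gw: "\<forall>w t. 0 \<le> t \<longrightarrow> c t \<bullet> j w = c 0 \<bullet> j w + ig (\<lambda>s. g s w) 0 t" using data[OF y] by blast
  obtain e h where z: "in_L2 z" and e: "continuous_on {0..} e" "AE t in half_line. e t = j (z t)" "e 0 = x"
    and h: "in_L2 h" "AE t in half_line. h t = vector_field (z t)"
    and hw: "\<forall>w t. 0 \<le> t \<longrightarrow> e t \<bullet> j w = e 0 \<bullet> j w + ig (\<lambda>s. h s w) 0 t" using data[OF z] by blast
  let ?w = "\<lambda>t. y t - z t" and ?q = "\<lambda>t. c t - e t" and ?g = "\<lambda>t. g t - h t"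
  have w: "in_L2 ?w" and gh: "in_L2 ?g" using in_L2_diff(1)[OF y z] in_L2_diff(1)[OF g(1) h(1)] .
  have qc: "continuous_on {0..} ?q" by (intro continuous_intros c e)
  have qw: "AE t in half_line. ?q t = j (?w t)" using c(2) e(2) by eventually_elim (simp add: blinfun.diff_right)
  have lg: "locint (\<lambda>s. g s v)" "locint (\<lambda>s. h s v)" for v
    by (intro locint_blinfun_apply in_L2_meas locint_norm_L2 g h)+
  have weak: "?q t \<bullet> j v = ?q 0 \<bullet> j v + ig (\<lambda>s. ?g s v) 0 t" if "0 \<le> t" for v t
  proof -
    have "c t \<bullet> j v = c 0 \<bullet> j v + ig (\<lambda>s. g s v) 0 t" "e t \<bullet> j v = e 0 \<bullet> j v + ig (\<lambda>s. h s v) 0 t" using gw hw that by blast+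
    then show ?thesis by (simp add: inner_diff_left blinfun.diff_left ig_diff[OF lg order_refl])
  qed
  have lgw: "locint (\<lambda>t. norm (?g t) * norm (?w t))"
    by (intro integrable_imp_locint integrable_mult_of_power2 in_L2_meas gh w)
  have energy: "(norm (?q t))\<^sup>2 = ig (\<lambda>s. 2 * ?g s (?w s)) 0 t" if t: "0 \<le> t" for t
  proof -
    have bd: "AE t in half_line. \<forall>v. norm v \<le> norm (?w t) \<longrightarrow> norm (j v) \<le> norm (?q t) \<longrightarrow> \<bar>?g t v\<bar> \<le> norm (?g t) * norm (?w t)"
      by (intro AE_I2 allI impI order_trans[OF abs_blinfun_le] mult_left_mono) auto
    show ?thesis
      using energy_identity[OF inj dense qc in_L2_meas(1)[OF gh] locint_norm_L2[OF gh] weak in_L2_meas(1)[OF w] qw lgw bd t] c(3) e(3)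
      by simp
  qed
  have eq: "c T = e T" if T: "0 \<le> T" for T
  proof -
    obtain K1 where K1: "\<And>t. 0 \<le> t \<Longrightarrow> t \<le> T \<Longrightarrow> norm (c t) \<le> K1" using continuous_half_line_bounded[OF c(1)] by blast
    obtain K2 where K2: "\<And>t. 0 \<le> t \<Longrightarrow> t \<le> T \<Longrightarrow> norm (e t) \<le> K2" using continuous_half_line_bounded[OF e(1)] by blast
    \<comment> \<open>Fixing T first makes both trajectories bounded in Y, as the local Lipschitz
      estimate requires.\<close>
    define R where "R = max K1 K2"
    obtain C where C: "C \<ge> 0" "\<And>v w. norm (j v) \<le> R \<Longrightarrow> norm (j w) \<le> R \<Longrightarrow>
      norm (F v - F w) \<le> C * ((norm v + norm w) * norm (v - w) + (norm v + norm w)\<^sup>2 * norm (j (v - w)))"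
      using F_lipschitz[of R] by blast
    let ?h = "\<lambda>t. norm (y t) + norm (z t)"
    \<comment> \<open>The coefficient with nu arises from absorbing the term linear in the V norm of
      the difference into 2 nu times its square; 2 C belongs to the term quadratic in the Y norm, 2
      lam to the defect of coercivity.\<close>
    define \<kappa> where "\<kappa> t = 2 * lam + (C\<^sup>2 / (2 * \<nu>) + 2 * C) * (?h t)\<^sup>2" for t
    have l\<kappa>: "locint \<kappa>" unfolding \<kappa>_def[abs_def]
      by (intro locint_add locint_const locint_mult integrable_imp_locint integrable_power2_add in_L2_meas y z)
    have "(norm (?q T))\<^sup>2 = 0"
    proof (rule gronwall_zero[OF _ _ l\<kappa> T])
      show "continuous_on {0..} (\<lambda>t. (norm (?q t))\<^sup>2)" by (intro continuous_intros qc)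
      fix t assume t: "0 \<le> t" "t \<le> T"
      show "(norm (?q t))\<^sup>2 \<le> ig (\<lambda>s. \<kappa> s * (norm (?q s))\<^sup>2) 0 t"
        unfolding energy[OF t(1)]
      proof (rule ig_mono_AE)
        have lgw': "locint (\<lambda>s. ?g s (?w s))"
        proof (rule locint_bound[OF lgw])
          show "(\<lambda>s. ?g s (?w s)) \<in> borel_measurable half_line"
            by (intro strongly_measurable_real strongly_measurable_blinfun_apply in_L2_meas gh w)
        qed (intro AE_I2 abs_blinfun_le)
        then show "locint (\<lambda>s. 2 * ?g s (?w s))" by (rule locint_mult)
        show "locint (\<lambda>s. \<kappa> s * (norm (?q s))\<^sup>2)" by (intro locint_mult_continuous l\<kappa> continuous_intros qc)
        show "AE s in half_line. 0 < s \<longrightarrow> s \<le> t \<longrightarrow> 2 * ?g s (?w s) \<le> \<kappa> s * (norm (?q s))\<^sup>2"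
          using c(2) e(2) g(2) h(2)
        proof eventually_elim
          case (elim s)
          show ?case
          proof (intro impI)
            assume s: "0 < s" "s \<le> t"
            define \<eta> where "\<eta> = norm (?q s)"
            define \<omega> where "\<omega> = norm (?w s)"
            define H where "H = ?h s"
            have nn: "\<eta> \<ge> 0" "\<omega> \<ge> 0" "H \<ge> 0" by (simp_all add: \<eta>_def \<omega>_def H_def)
            have q: "?q s = j (?w s)" using elim by (simp add: blinfun.diff_right)
            have "norm (j (y s)) \<le> R" "norm (j (z s)) \<le> R"
              using K1[of s] K2[of s] s t elim by (auto simp: R_def le_max_iff_disj)
            then have Fd: "norm (F (y s) - F (z s)) \<le> C * (H * \<omega> + H\<^sup>2 * \<eta>)"
              using C(2)[of "y s" "z s"] by (simp add: H_def \<omega>_def \<eta>_def q)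
            have "?g s (?w s) = (F (y s) - F (z s)) \<bullet> ?q s - b (?w s) (?w s)"
              using elim unfolding q by (simp add: blinfun.diff_left vector_field_apply inner_diff_left b.diff_left)
            also have "\<dots> \<le> norm (F (y s) - F (z s)) * \<eta> - (\<nu> * \<omega>\<^sup>2 - lam * \<eta>\<^sup>2)"
              using coercive[of "?w s"] norm_cauchy_schwarz[of "F (y s) - F (z s)" "?q s"] unfolding \<eta>_def \<omega>_def q by linarith
            also have "\<dots> \<le> (C * (H * \<omega> + H\<^sup>2 * \<eta>)) * \<eta> - (\<nu> * \<omega>\<^sup>2 - lam * \<eta>\<^sup>2)"
              using mult_right_mono[OF Fd nn(1)] by simp
            finally have 1: "2 * ?g s (?w s) \<le> 2 * C * H * \<omega> * \<eta> + 2 * C * H\<^sup>2 * \<eta>\<^sup>2 - 2 * \<nu> * \<omega>\<^sup>2 + 2 * lam * \<eta>\<^sup>2"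
              by (simp add: power2_eq_square algebra_simps)
            have 2: "2 * C * H * \<omega> * \<eta> \<le> 2 * \<nu> * \<omega>\<^sup>2 + C\<^sup>2 / (2 * \<nu>) * H\<^sup>2 * \<eta>\<^sup>2"
            proof -
              have "0 \<le> (2 * \<nu> * \<omega> - C * H * \<eta>)\<^sup>2" by simp
              then have "2 * \<nu> * (2 * C * H * \<omega> * \<eta>) \<le> 2 * \<nu> * (2 * \<nu> * \<omega>\<^sup>2) + C\<^sup>2 * H\<^sup>2 * \<eta>\<^sup>2"
                by (simp add: power2_eq_square algebra_simps)
              also have "\<dots> = 2 * \<nu> * (2 * \<nu> * \<omega>\<^sup>2 + C\<^sup>2 / (2 * \<nu>) * H\<^sup>2 * \<eta>\<^sup>2)" using \<nu> by (simp add: field_simps)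
              finally show ?thesis using \<nu> by simp
            qed
            have "\<kappa> s * \<eta>\<^sup>2 = 2 * lam * \<eta>\<^sup>2 + C\<^sup>2 / (2 * \<nu>) * H\<^sup>2 * \<eta>\<^sup>2 + 2 * C * H\<^sup>2 * \<eta>\<^sup>2"
              by (simp add: \<kappa>_def H_def algebra_simps)
            then show "2 * ?g s (?w s) \<le> \<kappa> s * (norm (?q s))\<^sup>2" using 1 2 unfolding \<eta>_def[symmetric] by linarith
          qed
        qed
      qed simp
    qed simp
    then show ?thesis by simp
  qed
  show ?thesis
    using c(2) e(2) AE_half_line_pos
  proof eventually_elim
    case (elim t)
    then have "j (y t) = j (z t)" using eq[of t] by simp
    then show ?case using inj by (simp add: inj_eq)
  qed
qed

theorem closed_loop_well_posed:
  "\<exists>\<delta>>0. \<exists>C>0. \<exists>Y :: 'y \<Rightarrow> real \<Rightarrow> 'v.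
    (\<forall>x. norm x \<le> \<delta> \<longrightarrow> solution x (Y x) \<and> (\<forall>z. solution x z \<longrightarrow> (AE t in half_line. z t = Y x t)) \<and>
      W_inf_norm j (Y x) \<le> C * norm x) \<and>
    (\<forall>x x'. norm x \<le> \<delta> \<longrightarrow> norm x' \<le> \<delta> \<longrightarrow> W_inf_norm j (\<lambda>t. Y x t - Y x' t) \<le> C * norm (x - x'))"
proof -
  obtain \<delta> r K where \<delta>: "0 < \<delta>" and r: "0 < r" and K: "0 < K"
    and ex: "\<And>x. norm x \<le> \<delta> \<Longrightarrow> \<exists>y c. small r y c \<and> weak_solution y c (\<lambda>t. F (y t)) \<and> c 0 = x"
    and lip: "\<And>y c z e. small r y c \<Longrightarrow> weak_solution y c (\<lambda>t. F (y t)) \<Longrightarrow> small r z e \<Longrightarrow> weak_solution z e (\<lambda>t. F (z t)) \<Longrightarrow>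
      L2_norm (\<lambda>t. y t - z t) \<le> K * norm (c 0 - e 0) \<and> (\<forall>t\<ge>0. norm (c t - e t) \<le> K * norm (c 0 - e 0))"
    by (rule closed_loop_small_solutions) blast
  obtain C where C: "C \<ge> 0" "\<And>v w. norm (j v) \<le> r \<Longrightarrow> norm (j w) \<le> r \<Longrightarrow>
      norm (to_dual j (F v - F w)) \<le> C * (norm (v - w) + (norm v + norm w) * norm (j (v - w)))"
    using F_lipschitz[of r] by blast
  define Q where "Q = K + ((norm form_map + C) * K + C * K * (2 * r))"
  have Q: "Q > 0" using K C(1) r by (simp add: Q_def add_pos_nonneg)
  have zero: "small r (\<lambda>_. 0) (\<lambda>_. 0)" using r by (simp add: small_def)
  have zero_ws: "weak_solution (\<lambda>_. 0) (\<lambda>_. 0) (\<lambda>t. F ((\<lambda>_. 0) t))" using weak_solution_zero by (simp add: F_zero)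
  have W: "W_inf_norm j (\<lambda>t. y t - z t) \<le> Q * norm (c 0 - e 0)"
    if y: "small r y c" "weak_solution y c (\<lambda>t. F (y t))" and z: "small r z e" "weak_solution z e (\<lambda>t. F (z t))" for y c z e
  proof -
    define n where "n = norm (c 0 - e 0)"
    have l: "L2_norm (\<lambda>t. y t - z t) \<le> K * n" "\<And>t. 0 \<le> t \<Longrightarrow> norm (c t - e t) \<le> K * n"
      using lip[OF y z] by (auto simp: n_def)
    note v = vector_field_L2[OF y(1) z(1) l(2) C]
    have "has_weak_derivative j (\<lambda>t. y t - z t) (\<lambda>t. vector_field (y t) - vector_field (z t))"
    proof (subst has_weak_derivative_iff_integrated[OF in_L2_meas(1)[OF v(1)] locint_norm_L2[OF v(1)]])
      note d = weak_solution_diff[OF y(2) z(2)]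
      show "continuous_on {0..} (\<lambda>t. c t - e t)" "AE t in half_line. c t - e t = j (y t - z t)"
        using d by (auto simp: weak_solution_def)
      have eq: "(vector_field (y s) - vector_field (z s)) w = - b (y s - z s) w + (F (y s) - F (z s)) \<bullet> j w" for s w
        by (simp add: vector_field_apply blinfun.diff_left inner_diff_left b.diff_left)
      then show "\<forall>w t. 0 \<le> t \<longrightarrow> (c t - e t) \<bullet> j w = (c 0 - e 0) \<bullet> j w + ig (\<lambda>s. (vector_field (y s) - vector_field (z s)) w) 0 t"
        using d unfolding eq weak_solution_def by blast
    qed
    note wd = weak_derivative_AE_eq[OF v(1) this]
    have "L2_norm (weak_derivative j (\<lambda>t. y t - z t)) = L2_norm (\<lambda>t. vector_field (y t) - vector_field (z t))"
      by (rule L2_norm_cong_AE(2)[OF v(1)]) (use wd(1) in \<open>auto elim: eventually_mono\<close>)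
    also have "\<dots> \<le> (norm form_map + C) * (K * n) + C * (K * n) * (2 * r)"
      using v(2) mult_left_mono[OF l(1), of "norm form_map + C"] C(1) by simp
    finally have "L2_norm (\<lambda>t. y t - z t) + L2_norm (weak_derivative j (\<lambda>t. y t - z t)) \<le> Q * n"
      using l(1) by (simp add: Q_def algebra_simps)
    moreover have "W_inf_norm j (\<lambda>t. y t - z t) \<le> L2_norm (\<lambda>t. y t - z t) + L2_norm (weak_derivative j (\<lambda>t. y t - z t))"
      unfolding W_inf_norm_def by (rule sqrt_sum_squares_le_sum) simp_all
    ultimately show ?thesis by (simp add: n_def)
  qed
  have sol: "solution (c 0) y" if y: "small r y c" "weak_solution y c (\<lambda>t. F (y t))" for y c
  proof -
    have b: "norm (c t - 0) \<le> r" if "0 \<le> t" for t using y(1) that by (simp add: small_def)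
    have L2: "in_L2 (\<lambda>t. vector_field (y t))" using vector_field_L2(1)[OF y(1) zero b C] by (simp add: vector_field_zero)
    note wd = weak_solution_has_weak_derivative[OF y(2) L2]
    show ?thesis unfolding solution_def in_W_inf_def has_initial_value_def
      using weak_derivative_AE_eq(1)[OF L2 wd] wd L2 y(2) unfolding weak_solution_def by blast
  qed
  obtain Y c where Yc: "\<And>x. norm x \<le> \<delta> \<Longrightarrow> small r (Y x) (c x) \<and> weak_solution (Y x) (c x) (\<lambda>t. F (Y x t)) \<and> c x 0 = x"
    using ex by metis
  \<comment> \<open>The bound in W_inf is the Lipschitz estimate against the zero solution.\<close>
  have "solution x (Y x)" "W_inf_norm j (Y x) \<le> Q * norm x" if "norm x \<le> \<delta>" for x
    using Yc[OF that] sol[of "Y x" "c x"] W[OF _ _ zero zero_ws, of "Y x" "c x"] by auto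
  moreover have "W_inf_norm j (\<lambda>t. Y x t - Y x' t) \<le> Q * norm (x - x')" if "norm x \<le> \<delta>" "norm x' \<le> \<delta>" for x x'
    using W[of "Y x" "c x" "Y x'" "c x'"] Yc[OF that(1)] Yc[OF that(2)] by simp
  ultimately show ?thesis using \<delta> Q
    by (intro exI[of _ \<delta>] exI[of _ Q] exI[of _ Y] conjI allI impI solution_unique) simp_all
qed

end

section \<open>Realization of the closed-loop operator by its form\<close>

lemma dense_inner_eq:
  fixes j :: "'v::real_normed_vector \<Rightarrow>\<^sub>L 'y::real_inner"
  assumes dense: "closure (range (blinfun_apply j)) = UNIV" and eq: "\<And>w. x \<bullet> j w = y \<bullet> j w"
  shows "x = y"
proof -
  have "x - y \<in> closure (range (blinfun_apply j))" using dense by simp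
  then obtain s where s: "\<And>n. s n \<in> range (blinfun_apply j)" "s \<longlonglongrightarrow> x - y"
    unfolding closure_sequential by blast
  have "(x - y) \<bullet> s n = 0" for n using s(1)[of n] eq by (auto simp: inner_diff_left)
  moreover have "(\<lambda>n. (x - y) \<bullet> s n) \<longlonglongrightarrow> (x - y) \<bullet> (x - y)" by (intro tendsto_intros s)
  ultimately have "(x - y) \<bullet> (x - y) = 0" by (simp add: LIMSEQ_const_iff)
  then show ?thesis by simp
qed

text \<open>Justifies the definite description in \<open>op_A\<close>: existence by the Riesz
  representation in the pulled back norm, uniqueness by density of the range of j.\<close>

lemma op_A_inner:
  fixes j :: "'v::real_inner \<Rightarrow>\<^sub>L 'y::{real_inner,complete_space}"
  assumes dense: "closure (range (blinfun_apply j)) = UNIV" and a: "bounded_bilinear a" and v: "v \<in> op_dom j a"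
  shows "op_A j a v \<bullet> j w = - a v w"
proof -
  interpret a: bounded_bilinear a by fact
  obtain M where M: "\<And>w. \<bar>a v w\<bar> \<le> M * norm (j w)" using v by (auto simp: op_dom_def)
  have "\<exists>f. \<forall>w. f \<bullet> j w = - a v w"
  proof (rule riesz_pullback)
    show "linear (blinfun_apply j)" by (intro bounded_linear.linear blinfun.bounded_linear_right)
    show "linear (\<lambda>w. - a v w)" by (simp add: linear_iff a.add_right a.scaleR_right)
    show "\<bar>- a v w\<bar> \<le> M * norm (j w)" for w using M by simp
  qed
  then have "\<exists>!f. \<forall>w. f \<bullet> j w = - a v w" using dense_inner_eq[OF dense] by metis
  from theI'[OF this] show ?thesis unfolding op_A_def by blast
qed

theorem theorem22:
  fixes j :: "'v::{real_inner,complete_space} \<Rightarrow>\<^sub>L 'y::{real_inner,complete_space}"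
    and a :: "'v \<Rightarrow> 'v \<Rightarrow> real"
    and N :: "'v \<Rightarrow>\<^sub>L 'y"
    and B :: 'y
    and \<nu> lam \<alpha> :: real
    and P :: "'y \<Rightarrow>\<^sub>L 'y"
    and T :: "nat \<Rightarrow> 'y list \<Rightarrow> real"
    and p :: nat
  assumes "gelfand_triple j"
    and "bounded_bilinear a"
    and "\<alpha> > 0"
    and "assumption_A1 j a \<nu> lam"
    and "assumption_A2 j a N"
    and "assumption_A3 j a lam"
    and "assumption_A4 j a B"
    and "stabilizing_riccati_solution j a B \<alpha> P"
    and "value_expansion_forms j a N B \<alpha> P T"
    and "p \<ge> 2"
  shows "\<exists>\<delta>0>0. \<exists>C>0. \<exists>S :: 'y \<Rightarrow> real \<Rightarrow> 'v.
    (\<forall>y0. norm y0 \<le> \<delta>0 \<longrightarrow>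
       closed_loop_solution j a N B (feedback j N B \<alpha> T p) y0 (S y0) \<and>
       (\<forall>z. closed_loop_solution j a N B (feedback j N B \<alpha> T p) y0 z \<longrightarrow>
          (AE t in half_line. z t = S y0 t)) \<and>
       W_inf_norm j (S y0) \<le> C * norm y0) \<and>
    (\<exists>L. \<forall>y0 y1. norm y0 \<le> \<delta>0 \<longrightarrow> norm y1 \<le> \<delta>0 \<longrightarrow>
       W_inf_norm j (\<lambda>t. S y0 t - S y1 t) \<le> L * norm (y0 - y1))"
proof -
  have inj: "inj (blinfun_apply j)" and dense: "closure (range (blinfun_apply j)) = UNIV"
    using assms(1) by (auto simp: gelfand_triple_def)
  interpret a: bounded_bilinear a by fact
  have \<nu>: "\<nu> > 0" and A1: "\<And>v. a v v \<ge> \<nu> * (norm v)\<^sup>2 - lam * (norm (j v))\<^sup>2"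
    using assms(4) by (auto simp: assumption_A1_def)
  obtain N' :: "'v \<Rightarrow>\<^sub>L 'y" where N': "\<And>v w. N v \<bullet> j w = j v \<bullet> N' w"
    using assms(5) by (auto simp: assumption_A2_def)
  have P_sym: "\<And>x y. P x \<bullet> y = x \<bullet> P y" and P_nonneg: "\<And>x. 0 \<le> x \<bullet> P x"
    and riccati: "\<And>z1 z2. z1 \<in> op_dom j a \<Longrightarrow> z2 \<in> op_dom j a \<Longrightarrow>
        op_A j a z1 \<bullet> P (j z2) + P (j z1) \<bullet> op_A j a z2 + j z1 \<bullet> j z2 - (1/\<alpha>) * (B \<bullet> P (j z1)) * (B \<bullet> P (j z2)) = 0"
    and "generates_exp_stable_semigroup (graph_on j (op_dom j a) (op_A_Pi j a B \<alpha> P))"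
    using assms(8) unfolding stabilizing_riccati_solution_def by blast+
  then obtain S where S: "C0_semigroup S" "exp_stable S" "generator_graph S = graph_on j (op_dom j a) (op_A_Pi j a B \<alpha> P)"
    by (auto simp: generates_exp_stable_semigroup_def)
  have T: "\<And>k. k \<ge> 2 \<Longrightarrow> bounded_multilinear_form k (T k) \<and> symmetric_form k (T k)"
    and T2: "\<And>z1 z2. T 2 [z1, z2] = z1 \<bullet> P z2"
    using assms(9) by (auto simp: value_expansion_forms_def)
  \<comment> \<open>The form of -A_Pi: the rank-one feedback term is added to a.\<close>
  define b where "b v w = a v w + (1/\<alpha>) * ((B \<bullet> P (j v)) * (B \<bullet> j w))" for v w
  define F where "F v = feedback j N B \<alpha> T p v *\<^sub>R (N v + B) + ((1 / \<alpha>) * (B \<bullet> P (j v))) *\<^sub>R B" for v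
  \<comment> \<open>The feedback term is bounded in Y, so it only increases the defect of
    coercivity; the absolute value makes the constant nonnegative.\<close>
  define lam' where "lam' = \<bar>lam\<bar> + (1/\<alpha>) * (norm B * norm P * norm B)"
  \<comment> \<open>Characterises the graph of A_Pi through the form. This turns the generator into
    the shape demanded by the locale and gives access to the Riccati equation, which holds on the
    domain only.\<close>
  have b_iff: "(\<forall>w. b u w = - (z \<bullet> j w)) \<longleftrightarrow> u \<in> op_dom j a \<and> z = op_A_Pi j a B \<alpha> P u" for u z
  proof
    let ?f = "z + ((1/\<alpha>) * (B \<bullet> P (j u))) *\<^sub>R B"
    assume b: "\<forall>w. b u w = - (z \<bullet> j w)"
    then have a: "a u w = - (?f \<bullet> j w)" for w by (simp add: b_def inner_add_left algebra_simps eq_diff_eq)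
    have "\<bar>a u w\<bar> \<le> norm ?f * norm (j w)" for w unfolding a by (simp add: Cauchy_Schwarz_ineq2)
    then have u: "u \<in> op_dom j a" by (auto simp: op_dom_def)
    have "op_A j a u = ?f"
      by (rule dense_inner_eq[OF dense]) (simp add: op_A_inner[OF dense assms(2) u] a)
    then show "u \<in> op_dom j a \<and> z = op_A_Pi j a B \<alpha> P u" using u by (simp add: op_A_Pi_def)
  next
    assume "u \<in> op_dom j a \<and> z = op_A_Pi j a B \<alpha> P u"
    then show "\<forall>w. b u w = - (z \<bullet> j w)"
      by (simp add: b_def op_A_Pi_def inner_diff_left op_A_inner[OF dense assms(2)])
  qed
  interpret b: bounded_bilinear b
  proof -
    have "bounded_linear (\<lambda>v. B \<bullet> P (j v))" "bounded_linear (\<lambda>w. B \<bullet> j w)"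
      by (intro bounded_linear_intros)+
    then have "bounded_bilinear (\<lambda>v w. (B \<bullet> P (j v)) * (B \<bullet> j w))"
      by (rule bounded_bilinear.comp[OF bounded_bilinear_mult])
    then show "bounded_bilinear b" unfolding b_def[abs_def]
      by (intro bounded_bilinear_add bounded_bilinear_scale assms)
  qed
  interpret closed_loop j b P \<nu> lam' S F
  proof
    show "inj (blinfun_apply j)" "closure (range (blinfun_apply j)) = UNIV" by fact+
    show "0 < \<nu>" by fact
    show "0 \<le> lam'" unfolding lam'_def using assms(3) by simp
    show "\<nu> * (norm v)\<^sup>2 - lam' * (norm (j v))\<^sup>2 \<le> b v v" for v
    proof -
      have "\<bar>(B \<bullet> P (j v)) * (B \<bullet> j v)\<bar> \<le> (norm B * (norm P * norm (j v))) * (norm B * norm (j v))"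
        unfolding abs_mult
        by (intro mult_mono order_trans[OF Cauchy_Schwarz_ineq2] mult_left_mono norm_blinfun) auto
      then have "(1/\<alpha>) * (- ((B \<bullet> P (j v)) * (B \<bullet> j v))) \<le> (1/\<alpha>) * ((norm B * (norm P * norm (j v))) * (norm B * norm (j v)))"
        using assms(3) by (intro mult_left_mono) auto
      moreover have "lam * (norm (j v))\<^sup>2 \<le> \<bar>lam\<bar> * (norm (j v))\<^sup>2" by (intro mult_right_mono) auto
      ultimately show ?thesis using A1[of v] by (simp add: b_def lam'_def power2_eq_square algebra_simps)
    qed
    show "P x \<bullet> y = x \<bullet> P y" "0 \<le> x \<bullet> P x" for x y by (fact P_sym P_nonneg)+
    show "2 * (z \<bullet> P (j u)) \<le> - (norm (j u))\<^sup>2" if "\<And>w. b u w = - (z \<bullet> j w)" for u z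
    proof -
      have u: "u \<in> op_dom j a" and z: "z = op_A_Pi j a B \<alpha> P u" using b_iff that by blast+
      \<comment> \<open>On the diagonal the Riccati equation reads 2 <A u, P u> = -|u|^2 + beta^2 /
        alpha. Passing from A to A_Pi subtracts 2 beta^2 / alpha, which leaves -|u|^2 - beta^2 /
        alpha.\<close>
      define \<beta> where "\<beta> = B \<bullet> P (j u)"
      have "2 * (op_A j a u \<bullet> P (j u)) + (norm (j u))\<^sup>2 - (1/\<alpha>) * \<beta> * \<beta> = 0"
        using riccati[OF u u] by (simp add: \<beta>_def inner_commute power2_norm_eq_inner)
      moreover have "z \<bullet> P (j u) = op_A j a u \<bullet> P (j u) - (1/\<alpha>) * \<beta> * \<beta>"
        by (simp add: z op_A_Pi_def inner_diff_left \<beta>_def)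
      moreover have "0 \<le> (1/\<alpha>) * \<beta> * \<beta>" using assms(3) by simp
      ultimately show ?thesis by linarith
    qed
    show "C0_semigroup S" "exp_stable S" by fact+
    show "generator_graph S = {(j u, z) |u z. \<forall>w. b u w = - (z \<bullet> j w)}"
      unfolding S(3) graph_on_def b_iff by blast
    show "F 0 = 0" unfolding F_def by (rule feedback_nonlinearity_estimates(1)) (use T T2 assms N' in auto)
    show "\<exists>C\<ge>0. \<forall>v w. norm (j v) \<le> R \<longrightarrow> norm (j w) \<le> R \<longrightarrow>
      norm (F v - F w) \<le> C * ((norm v + norm w) * norm (v - w) + (norm v + norm w)\<^sup>2 * norm (j (v - w))) \<and>
      norm (to_dual j (F v - F w)) \<le> C * (norm (v - w) + (norm v + norm w) * norm (j (v - w)))" for R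
      unfolding F_def by (rule feedback_nonlinearity_estimates(2)) (use T T2 assms N' in auto)
  qed
  \<comment> \<open>The rank-one term added in F cancels the one added in b, so both sides are the
    original right-hand side.\<close>
  have field: "op_A_ext a v + to_dual j (feedback j N B \<alpha> T p v *\<^sub>R (N v + B)) = vector_field v" for v
  proof (rule blinfun_eqI)
    fix w
    have "bounded_linear (\<lambda>w. - a v w)" by (intro bounded_linear_minus a.bounded_linear_right)
    then have "op_A_ext a v w = - a v w" by (simp add: op_A_ext_def bounded_linear_Blinfun_apply)
    then show "(op_A_ext a v + to_dual j (feedback j N B \<alpha> T p v *\<^sub>R (N v + B))) w = vector_field v w"
      by (simp add: vector_field_apply blinfun.add_left F_def b_def inner_add_left)
  qed
  have sol: "closed_loop_solution j a N B (feedback j N B \<alpha> T p) y0 z \<longleftrightarrow> solution y0 z" for y0 z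
    unfolding closed_loop_solution_def solution_def field ..
  show ?thesis unfolding sol using closed_loop_well_posed by blast
qed

end
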